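(* Assume A1 and A3, and let $\theta=(\theta_i)_{i\ge1}$ satisfy A2. Let $\hat\tau_n^{\mathrm{ARE}^G}=\arg\min_{\tau\in\Lambda_n}\widehat{\mathrm{ARE}}^{G}_n(\tau)$ and $\tau_n^{\mathsf{GOR}}=\arg\min_{\tau\in[0,\infty]}L_n(\theta,\hat q^G(\tau))$. (A) I. For any fixed $\epsilon>0$, $\displaystyle\lim_{n\to\infty}\mathbb{P}\big\{L_n(\theta,\hat q^G(\hat\tau_n^{\mathrm{ARE}^G}))\ge L_n(\theta,\hat q^G(\tau_n^{\mathsf{GOR}}))+\epsilon\big\}=0$. II. $\displaystyle\lim_{n\to\infty}\Big(R_n\big(\theta,\hat q^G(\hat\tau_n^{\mathrm{ARE}^G})\big)-\mathbb{E}\big[L_n(\theta,\hat q^G(\tau_n^{\mathsf{GOR}}))\big]\Big)=0$. (B) For any estimators $\hat\tau_n=\hat\tau_n(X)\ge0$ of the hyperparameter: I. for any fixed $\epsilon>0$, $\displaystyle\lim_{n\to\infty}\mathbb{P}\big\{L_n(\theta,\hat q^G(\hat\tau_n^{\mathrm{ARE}^G}))\ge L_n(\theta,\hat q^G(\hat\tau_n))+\epsilon\big\}=0$; II. $\displaystyle\limsup_{n\to\infty}\Big(R_n\big(\theta,\hat q^G(\hat\tau_n^{\mathrm{ARE}^G})\big)-R_n\big(\theta,\hat q^G(\hat\tau_n)\big)\Big)\le0$.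
   Context: Setting. $(\theta_i)_{i\ge1}$ are real numbers and $(\nu_{p,i}),(\nu_{f,i}),(b_i),(h_i)$ are known sequences of positive numbers. $N(\mu,\nu)$ is the normal law with mean $\mu$ and variance $\nu$; $\phi,\Phi$ are the standard normal density and CDF. For each $n$ (large enough that $\log\log n>0$), $X=(X_1,\dots,X_n)$ has independent coordinates $X_i\sim N(\theta_i,\nu_{p,i})$, and $\bar X_n=\frac1n\sum_{i=1}^nX_i$. Put $\tilde b_i=b_i/(b_i+h_i)$ and $G(w,\beta)=\phi(w)+w\Phi(w)-\beta w$. The loss of a prediction $q\in\mathbb{R}^n$ is $L_n(\theta,q)=\frac1n\sum_{i=1}^n l_i(\theta_i,q_i)$ with $l_i(\theta_i,q_i)=\sqrt{\nu_{f,i}}\,(b_i+h_i)\,G\big((q_i-\theta_i)/\sqrt{\nu_{f,i}},\tilde b_i\big)$, which equals $\mathbb{E}_{Y\sim N(\theta_i,\nu_{f,i})}[b_i(Y-q_i)^++h_i(q_i-Y)^+]$. The risk of a data-dependent predictor $\hat q=\hat q(X)$ (including one with data-dependent tuning parameters) is $R_n(\theta,\hat q)=\mathbb{E}[L_n(\theta,\hat q(X))]$. Predictors (shrinkage towards the grand mean). For $\tau\in[0,\infty]$: $\alpha_i(\tau)=\tau/(\tau+\nu_{p,i})$ ($\alpha_i(\infty)=1$), $\hat q^G_i(\tau)=\alpha_i(\tau)X_i+(1-\alpha_i(\tau))\bar X_n+\sqrt{\nu_{f,i}+\alpha_i(\tau)\nu_{p,i}}\;\Phi^{-1}(\tilde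 b_i)$, $\hat q^G(\tau)=(\hat q^G_1(\tau),\dots,\hat q^G_n(\tau))$. Assumptions. A1: $0<\inf_i\tilde b_i\le\sup_i\tilde b_i<1$ and $\sup_i(b_i+h_i)<\infty$. A2: $\limsup_{n\to\infty}\frac1n\sum_{i=1}^n|\theta_i|<\infty$. A3: $\sup_i\nu_{p,i}/\nu_{f,i}<1/(4e)$, $\sup_i\nu_{f,i}<\infty$, $\inf_i\nu_{p,i}>0$. Risk estimate. Let $$c_i(\tau)=\sqrt{\frac{\nu_{f,i}+\alpha_i(\tau)\nu_{p,i}}{\nu_{f,i}+\alpha_i(\tau)^2\nu_{p,i}}}\;\Phi^{-1}(\tilde b_i),\qquad d_i(\tau)=-\frac{1-\alpha_i(\tau)}{\sqrt{\nu_{f,i}+\alpha_i(\tau)^2\nu_{p,i}}},\qquad s_i(\tau)=\sqrt{2\nu_{p,i}}\,|d_i(\tau)|.$$ Fix for each $i$ any number $\gamma(i)$ with $0<\gamma(i)<1/\sqrt{4e}-\sqrt{\nu_{p,i}/\nu_{f,i}}$, and set $\lambda_n(i)=\gamma(i)\sqrt{2\log n}$ and $K_n(i)=1+\big\lceil e^2\big(\gamma(i)+\sqrt{2\nu_{p,i}/\nu_{f,i}}\big)^2(2\log n)\big\rceil$. With $H_k$ the probabilists' Hermite polynomials and $G'$ the derivative of $G$ in its first argument, put $$S_{i,\tau}(u)=G(0,\tilde b_i)+G'(0,\tilde b_i)\,u+\phi(0)\sum_{k=0}^{K_n(i)-2}\frac{(-1)^kH_k(0)}{(k+2)!}\,s_i(\tau)^{k+2}H_{k+2}\big(u/s_i(\tau)\big)$$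 (when $s_i(\tau)=0$, $s^{m}H_m(u/s)$ is read as its limit $u^m$), and $\tilde S_{i,\tau}(u)=\mathrm{sign}(S_{i,\tau}(u))\min\{|S_{i,\tau}(u)|,n\}$. For $x,z\in\mathbb{R}$ let $U=c_i(\tau)+d_i(\tau)(x+\sqrt{\nu_{p,i}}z)$, $V=c_i(\tau)+d_i(\tau)(x-\sqrt{\nu_{p,i}}z)$, and define $\hat T_i(x,z,\tau)=-\tilde b_iU$ if $V<-\lambda_n(i)$; $=\tilde S_{i,\tau}(U)$ if $|V|\le\lambda_n(i)$; $=(1-\tilde b_i)U$ if $V>\lambda_n(i)$. Let $\hat T_i(x,\tau)=\mathbb{E}_{Z\sim N(0,1)}[\hat T_i(x,Z,\tau)]$ (a function of $x\in\mathbb{R}$) and $$\widehat{\mathrm{ARE}}^{G}_n(\tau)=\frac1n\sum_{i=1}^n(b_i+h_i)\sqrt{\nu_{f,i}+\nu_{p,i}\alpha_i(\tau)^2}\;\hat T_i(X_i-\bar X_n,\tau).$$ Grid. Let $a_n=\log\log n$. Fix positive constants $C_1,\dots,C_4$, independent of $n$, such that for all large $n$: $\sup_{i\le n}(b_i+h_i)\le C_1$; $\max\{\sup_{i\le n}\nu_{p,i},\sup_{i\le n}\nu_{p,i}^{-1}\}\le C_2$; $\big(\sup_{i\le n}\nu_{p,i}/\nu_{f,i}\big)\big(\sup_{i\le n}|\Phi^{-1}(\tilde b_i)|\big)\le C_3$; $\frac1n\sum_{i=1}^n|\theta_i|\le C_4\sqrt{a_n}$. Let $\delta_n=\{2C_1C_2(2\phi(0)+C_3+\sqrt{a_n}\,C_4+a_n)\}^{-1}$,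 $m_n=\lceil1/\delta_n\rceil$, and $\Lambda_n=\{\tau\ge 0:\ \tau/(\tau+1)=(j-1)\delta_n\text{ for some }j\in\{1,\dots,m_n\}\}$. Arg min denotes any (measurable) minimizer.
   Formalization: The numbers γ(i) are additionally required to satisfy inf_i γ(i) > 0; if they may decay quickly to 0 (e.g. γ(i)=0.01·3^{-i} with ν_p=1, ν_f=12, b=h=1, θ_i=(-1)^i), the statement is false. *)

theory Defs
  imports "HOL-Probability.Probability"
begin

text \<open>
  All sequences are functions on \<^typ>\<open>nat\<close> of which only the values at indices \<open>\<ge> 1\<close> are used.
  Hyperparameters \<open>\<tau> \<in> [0,\<infinity>]\<close> are elements of \<^typ>\<open>ennreal\<close>.
\<close>

definition std_normal_cdf :: "real \<Rightarrow> real" where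
  "std_normal_cdf = cdf std_normal_distribution"

text \<open>On \<open>(0,1)\<close> this is the inverse of the strictly increasing function \<^const>\<open>std_normal_cdf\<close>;
  it is only used there.\<close>

definition std_normal_quantile :: "real \<Rightarrow> real" where
  "std_normal_quantile = inv std_normal_cdf"

definition btilde :: "real \<Rightarrow> real \<Rightarrow> real" where
  "btilde b h = b / (b + h)"

definition G :: "real \<Rightarrow> real \<Rightarrow> real" where
  "G w \<beta> = std_normal_density w + w * std_normal_cdf w - \<beta> * w"

definition coord_loss :: "real \<Rightarrow> real \<Rightarrow> real \<Rightarrow> real \<Rightarrow> real \<Rightarrow> real" where
  "coord_loss \<nu>f b h \<theta> q = sqrt \<nu>f * (b + h) * G ((q - \<theta>) / sqrt \<nu>f) (btilde b h)"

definition loss ::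
  "(nat \<Rightarrow> real) \<Rightarrow> (nat \<Rightarrow> real) \<Rightarrow> (nat \<Rightarrow> real) \<Rightarrow> nat \<Rightarrow> (nat \<Rightarrow> real) \<Rightarrow> (nat \<Rightarrow> real) \<Rightarrow> real" where
  "loss \<nu>f b h n \<theta> q = (\<Sum>i=1..n. coord_loss (\<nu>f i) (b i) (h i) (\<theta> i) (q i)) / real n"

definition grand_mean :: "nat \<Rightarrow> (nat \<Rightarrow> real) \<Rightarrow> real" where
  "grand_mean n x = (\<Sum>i=1..n. x i) / real n"

definition shrinkage :: "real \<Rightarrow> ennreal \<Rightarrow> real" where
  "shrinkage \<nu>p \<tau> = (if \<tau> = \<infinity> then 1 else enn2real \<tau> / (enn2real \<tau> + \<nu>p))"

definition predictor ::
  "(nat \<Rightarrow> real) \<Rightarrow> (nat \<Rightarrow> real) \<Rightarrow> (nat \<Rightarrow> real) \<Rightarrow> (nat \<Rightarrow> real) \<Rightarrow> nat \<Rightarrow> ennreal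
    \<Rightarrow> (nat \<Rightarrow> real) \<Rightarrow> nat \<Rightarrow> real" where
  "predictor \<nu>p \<nu>f b h n \<tau> x i =
     shrinkage (\<nu>p i) \<tau> * x i + (1 - shrinkage (\<nu>p i) \<tau>) * grand_mean n x
     + sqrt (\<nu>f i + shrinkage (\<nu>p i) \<tau> * \<nu>p i) * std_normal_quantile (btilde (b i) (h i))"

text \<open>The data vector \<open>(X\<^sub>1, \<dots>, X\<^sub>n)\<close>, as an element of the space of
  \<open>Pi\<^sub>M {1..n} (\<lambda>_. borel)\<close>.\<close>

definition data_vec :: "nat \<Rightarrow> (nat \<Rightarrow> 'a \<Rightarrow> real) \<Rightarrow> 'a \<Rightarrow> nat \<Rightarrow> real" where
  "data_vec n X \<omega> = (\<lambda>i\<in>{1..n}. X i \<omega>)"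

definition data_space :: "nat \<Rightarrow> (nat \<Rightarrow> real) measure" where
  "data_space n = (\<Pi>\<^sub>M i\<in>{1..n}. borel)"

definition risk ::
  "'a measure \<Rightarrow> (nat \<Rightarrow> 'a \<Rightarrow> real) \<Rightarrow> (nat \<Rightarrow> real) \<Rightarrow> (nat \<Rightarrow> real) \<Rightarrow> (nat \<Rightarrow> real) \<Rightarrow> nat
    \<Rightarrow> (nat \<Rightarrow> real) \<Rightarrow> ((nat \<Rightarrow> real) \<Rightarrow> nat \<Rightarrow> real) \<Rightarrow> real" where
  "risk M X \<nu>f b h n \<theta> q = (\<integral>\<omega>. loss \<nu>f b h n \<theta> (q (data_vec n X \<omega>)) \<partial>M)"

text \<open>Probabilists' Hermite polynomials (monic, orthogonal with respect to the standard normal law;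
  e.g. \<open>H\<^sub>2(x) = x\<^sup>2 - 1\<close>).\<close>

fun hermite :: "nat \<Rightarrow> real \<Rightarrow> real" where
  "hermite 0 x = 1"
| "hermite (Suc 0) x = x"
| "hermite (Suc (Suc k)) x = x * hermite (Suc k) x - real (Suc k) * hermite k x"

text \<open>\<open>s\<^sup>m H\<^sub>m(u/s)\<close>, with its limit \<open>u\<^sup>m\<close> as value at \<open>s = 0\<close>.\<close>

definition scaled_hermite :: "real \<Rightarrow> nat \<Rightarrow> real \<Rightarrow> real" where
  "scaled_hermite s m u = (if s = 0 then u ^ m else s ^ m * hermite m (u / s))"

text \<open>In the following scalar definitions \<open>\<nu>p\<close>, \<open>\<nu>f\<close>, \<open>\<beta>\<close>, \<open>\<gamma>\<close> are the values of
  \<open>\<nu>\<^sub>p\<close>, \<open>\<nu>\<^sub>f\<close>, \<open>b/(b+h)\<close>, \<open>\<gamma>\<close> at one coordinate.\<close>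

definition c_coef :: "real \<Rightarrow> real \<Rightarrow> real \<Rightarrow> ennreal \<Rightarrow> real" where
  "c_coef \<nu>p \<nu>f \<beta> \<tau> =
     sqrt ((\<nu>f + shrinkage \<nu>p \<tau> * \<nu>p) / (\<nu>f + (shrinkage \<nu>p \<tau>)\<^sup>2 * \<nu>p)) * std_normal_quantile \<beta>"

definition d_coef :: "real \<Rightarrow> real \<Rightarrow> ennreal \<Rightarrow> real" where
  "d_coef \<nu>p \<nu>f \<tau> = - (1 - shrinkage \<nu>p \<tau>) / sqrt (\<nu>f + (shrinkage \<nu>p \<tau>)\<^sup>2 * \<nu>p)"

definition s_coef :: "real \<Rightarrow> real \<Rightarrow> ennreal \<Rightarrow> real" where
  "s_coef \<nu>p \<nu>f \<tau> = sqrt (2 * \<nu>p) * \<bar>d_coef \<nu>p \<nu>f \<tau>\<bar>"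

text \<open>The constants \<open>\<gamma> i\<close> defining the thresholds have to stay away from \<open>0\<close>: if they tend to \<open>0\<close>
  fast enough, the thresholds vanish at most coordinates, \<open>T_hat\<close> keeps a bias there, and minimizing
  \<open>ARE\<close> no longer minimizes the loss asymptotically.\<close>

definition threshold :: "real \<Rightarrow> nat \<Rightarrow> real" where
  "threshold \<gamma> n = \<gamma> * sqrt (2 * ln (real n))"

definition trunc_order :: "real \<Rightarrow> real \<Rightarrow> real \<Rightarrow> nat \<Rightarrow> nat" where
  "trunc_order \<nu>p \<nu>f \<gamma> n =
     1 + nat \<lceil>(exp 1)\<^sup>2 * (\<gamma> + sqrt (2 * \<nu>p / \<nu>f))\<^sup>2 * (2 * ln (real n))\<rceil>"

text \<open>For \<open>n \<ge> 2\<close> and \<open>\<gamma> > 0\<close> one has \<open>trunc_order \<nu>p \<nu>f \<gamma> n \<ge> 2\<close>, so the subtraction in the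
  summation bound does not truncate.\<close>

definition S_poly :: "real \<Rightarrow> real \<Rightarrow> real \<Rightarrow> real \<Rightarrow> nat \<Rightarrow> ennreal \<Rightarrow> real \<Rightarrow> real" where
  "S_poly \<nu>p \<nu>f \<beta> \<gamma> n \<tau> u =
     G 0 \<beta> + deriv (\<lambda>w. G w \<beta>) 0 * u
     + std_normal_density 0 * (\<Sum>k=0..trunc_order \<nu>p \<nu>f \<gamma> n - 2.
         (- 1) ^ k * hermite k 0 / fact (k + 2) * scaled_hermite (s_coef \<nu>p \<nu>f \<tau>) (k + 2) u)"

definition S_trunc :: "real \<Rightarrow> real \<Rightarrow> real \<Rightarrow> real \<Rightarrow> nat \<Rightarrow> ennreal \<Rightarrow> real \<Rightarrow> real" where
  "S_trunc \<nu>p \<nu>f \<beta> \<gamma> n \<tau> u =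
     sgn (S_poly \<nu>p \<nu>f \<beta> \<gamma> n \<tau> u) * min \<bar>S_poly \<nu>p \<nu>f \<beta> \<gamma> n \<tau> u\<bar> (real n)"

definition T_aux ::
  "real \<Rightarrow> real \<Rightarrow> real \<Rightarrow> real \<Rightarrow> nat \<Rightarrow> real \<Rightarrow> real \<Rightarrow> ennreal \<Rightarrow> real" where
  "T_aux \<nu>p \<nu>f \<beta> \<gamma> n x z \<tau> =
     (let U = c_coef \<nu>p \<nu>f \<beta> \<tau> + d_coef \<nu>p \<nu>f \<tau> * (x + sqrt \<nu>p * z);
          V = c_coef \<nu>p \<nu>f \<beta> \<tau> + d_coef \<nu>p \<nu>f \<tau> * (x - sqrt \<nu>p * z)
      in if V < - threshold \<gamma> n then - \<beta> * U
         else if V > threshold \<gamma> n then (1 - \<beta>) * U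
         else S_trunc \<nu>p \<nu>f \<beta> \<gamma> n \<tau> U)"

definition T_hat :: "real \<Rightarrow> real \<Rightarrow> real \<Rightarrow> real \<Rightarrow> nat \<Rightarrow> real \<Rightarrow> ennreal \<Rightarrow> real" where
  "T_hat \<nu>p \<nu>f \<beta> \<gamma> n x \<tau> = (\<integral>z. T_aux \<nu>p \<nu>f \<beta> \<gamma> n x z \<tau> \<partial>std_normal_distribution)"

definition ARE ::
  "(nat \<Rightarrow> real) \<Rightarrow> (nat \<Rightarrow> real) \<Rightarrow> (nat \<Rightarrow> real) \<Rightarrow> (nat \<Rightarrow> real) \<Rightarrow> (nat \<Rightarrow> real) \<Rightarrow> nat
    \<Rightarrow> ennreal \<Rightarrow> (nat \<Rightarrow> real) \<Rightarrow> real" where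
  "ARE \<nu>p \<nu>f b h \<gamma> n \<tau> x =
     (\<Sum>i=1..n. (b i + h i) * sqrt (\<nu>f i + \<nu>p i * (shrinkage (\<nu>p i) \<tau>)\<^sup>2)
        * T_hat (\<nu>p i) (\<nu>f i) (btilde (b i) (h i)) (\<gamma> i) n (x i - grand_mean n x) \<tau>) / real n"

definition a_seq :: "nat \<Rightarrow> real" where
  "a_seq n = ln (ln (real n))"

definition grid_step :: "real \<Rightarrow> real \<Rightarrow> real \<Rightarrow> real \<Rightarrow> nat \<Rightarrow> real" where
  "grid_step C1 C2 C3 C4 n =
     inverse (2 * C1 * C2 * (2 * std_normal_density 0 + C3 + sqrt (a_seq n) * C4 + a_seq n))"

definition grid :: "real \<Rightarrow> real \<Rightarrow> real \<Rightarrow> real \<Rightarrow> nat \<Rightarrow> ennreal set" where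
  "grid C1 C2 C3 C4 n =
     {ennreal t | t. t \<ge> 0 \<and> (\<exists>j\<in>{1..nat \<lceil>1 / grid_step C1 C2 C3 C4 n\<rceil>}.
        t / (t + 1) = (real j - 1) * grid_step C1 C2 C3 C4 n)}"

text \<open>In the assumptions, suprema and infima over all indices are taken in \<^typ>\<open>ereal\<close>, where they
  always exist; on \<^typ>\<open>real\<close> the supremum of an unbounded set would be unspecified.\<close>

definition assm_A1 :: "(nat \<Rightarrow> real) \<Rightarrow> (nat \<Rightarrow> real) \<Rightarrow> bool" where
  "assm_A1 b h \<longleftrightarrow>
     0 < (INF i\<in>{1..}. ereal (btilde (b i) (h i))) \<and>
     (SUP i\<in>{1..}. ereal (btilde (b i) (h i))) < 1 \<and>
     (SUP i\<in>{1..}. ereal (b i + h i)) < \<infinity>"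

definition assm_A2 :: "(nat \<Rightarrow> real) \<Rightarrow> bool" where
  "assm_A2 \<theta> \<longleftrightarrow> limsup (\<lambda>n. ereal ((\<Sum>i=1..n. \<bar>\<theta> i\<bar>) / real n)) < \<infinity>"

definition assm_A3 :: "(nat \<Rightarrow> real) \<Rightarrow> (nat \<Rightarrow> real) \<Rightarrow> bool" where
  "assm_A3 \<nu>p \<nu>f \<longleftrightarrow>
     (SUP i\<in>{1..}. ereal (\<nu>p i / \<nu>f i)) < ereal (1 / (4 * exp 1)) \<and>
     (SUP i\<in>{1..}. ereal (\<nu>f i)) < \<infinity> \<and>
     0 < (INF i\<in>{1..}. ereal (\<nu>p i))"

definition grid_constants ::
  "(nat \<Rightarrow> real) \<Rightarrow> (nat \<Rightarrow> real) \<Rightarrow> (nat \<Rightarrow> real) \<Rightarrow> (nat \<Rightarrow> real) \<Rightarrow> (nat \<Rightarrow> real)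
    \<Rightarrow> real \<Rightarrow> real \<Rightarrow> real \<Rightarrow> real \<Rightarrow> bool" where
  "grid_constants \<nu>p \<nu>f b h \<theta> C1 C2 C3 C4 \<longleftrightarrow>
     C1 > 0 \<and> C2 > 0 \<and> C3 > 0 \<and> C4 > 0 \<and>
     (\<forall>\<^sub>F n in sequentially.
        (SUP i\<in>{1..n}. b i + h i) \<le> C1 \<and>
        max (SUP i\<in>{1..n}. \<nu>p i) (SUP i\<in>{1..n}. inverse (\<nu>p i)) \<le> C2 \<and>
        (SUP i\<in>{1..n}. \<nu>p i / \<nu>f i)
          * (SUP i\<in>{1..n}. \<bar>std_normal_quantile (btilde (b i) (h i))\<bar>) \<le> C3 \<and>
        (\<Sum>i=1..n. \<bar>\<theta> i\<bar>) / real n \<le> C4 * sqrt (a_seq n))"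

end

theory Submission
  imports Defs "HOL-Real_Asymp.Real_Asymp"
begin

text \<open>
  The loss depends on the shrinkage level through \<open>u = \<tau> / (\<tau> + 1) \<in> [0,1]\<close>, and it is Lipschitz in \<open>u\<close>
  with constant of order \<open>1 + \<close> (mean of the \<open>|X\<^sub>i|\<close>), so the best grid point loses only \<open>O(\<delta>\<^sub>n)\<close> in mean
  against the oracle. On the grid, the minimizer of the risk estimate has excess loss at most twice the
  sum of \<open>|ARE - loss|\<close> over the \<open>m\<^sub>n \<le> log n\<close> grid points, whence a bound on the mean of
  \<open>|ARE - loss|\<close> that is \<open>o(1 / log n)\<close> uniformly in \<open>\<tau>\<close> suffices.

  With the true mean in place of the grand mean both quantities are averages of independent terms, so
  they concentrate around their means by Chebyshev. The means agree up to the bias of the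
  estimate: \<open>U\<close> and \<open>V\<close> are independent Gaussians, the Hermite sums evaluated at \<open>U\<close> average to the
  Taylor polynomial of \<open>G\<close>, and outside the threshold \<open>G\<close> is linear up to a small tail; the
  constraint on \<open>\<gamma>\<close> keeps the Taylor remainder and the second moments (of order \<open>n\<^bsup>1/5\<^esup>\<close>) under control.

  As a function of \<open>x\<close> the integrand of \<open>T_hat\<close> jumps at the threshold, but the integral over \<open>z\<close> smooths
  these jumps, so replacing the grand mean by its expectation costs a small
  amount except when the two differ by more than \<open>n\<^bsup>-3/10\<^esup>\<close>, which is again a second-moment event.
\<close>

text \<open>All constants come from one budget. The grid eventually has at most \<open>ln n\<close>
  points, so any negative power of \<open>n\<close> per point suffices. Hermite second moments
  \<open>M\<close> cost \<open>n\<close> to the \<open>1/5\<close>, up to logarithms. The shift from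
  the true mean to the grand mean depends on all coordinates and cannot be frozen while one of them
  is integrated out: shifts up to \<delta> are bounded by a function of that coordinate alone,
  larger ones by Young's inequality with a parameter \<open>a\<close>. The errors
  \<open>M * \<delta>\<close>, \<open>M / a\<close> and \<open>a / (\<delta>\<^sup>2 * n)\<close>
  balance at \<open>n\<close> to the \<open>-1/10\<close> when \<delta> is \<open>n\<close> to the
  \<open>-3/10\<close> and \<open>a = 1 / \<delta>\<close>.

  The means \<theta> are unbounded, so every bound must be uniform in them. Hermite moments grow
  exponentially in the squared mean, but they count only on the event that \<open>V\<close> is
  within the threshold, whose probability decays faster. The linear branches are regrouped with one
  switch at \<open>V = 0\<close>, where they are Lipschitz in \<open>x\<close> after averaging over
  \<open>z\<close>; the rest lives within the threshold. The same uniformity lets the bounds survive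
  conditioning on the other coordinates.\<close>

abbreviation N01 :: "real measure" where "N01 \<equiv> std_normal_distribution"

section \<open>Moments, tails and rotation of the standard normal law\<close>

interpretation N01: real_distribution N01
  by (rule real_dist_normal_dist)

lemma nn_integral_N01:
  assumes [measurable]: "f \<in> borel_measurable borel"
  shows "(\<integral>\<^sup>+z. f z \<partial>N01) = (\<integral>\<^sup>+z. ennreal (std_normal_density z) * f z \<partial>lborel)"
  by (simp add: nn_integral_density)

lemma integrable_N01_iff:
  fixes f :: "real \<Rightarrow> real"
  assumes [measurable]: "f \<in> borel_measurable borel"
  shows "integrable N01 f \<longleftrightarrow> integrable lborel (\<lambda>z. std_normal_density z * f z)"
  by (simp add: integrable_density)

lemma integral_N01:
  fixes f :: "real \<Rightarrow> real"
  assumes [measurable]: "f \<in> borel_measurable borel"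
  shows "(\<integral>z. f z \<partial>N01) = (\<integral>z. std_normal_density z * f z \<partial>lborel)"
  by (simp add: integral_density)

lemma integrable_N01_power: "integrable N01 (\<lambda>z. z ^ k)"
  by (simp add: integrable_N01_iff integrable_std_normal_moment)

lemma integrable_N01_poly: "integrable N01 (\<lambda>z. poly p z)"
  unfolding poly_altdef by (auto intro!: integrable_N01_power)

text \<open>Stein's identity on monomials, read off from the closed moment formulas. At
  \<open>k = 0\<close> the factor \<open>real k\<close> makes the value of \<open>k - 1\<close>
  irrelevant.\<close>

lemma N01_moment_Suc: "(\<integral>z. z ^ Suc k \<partial>N01) = real k * (\<integral>z. z ^ (k - 1) \<partial>N01)"
proof (cases "even k")
  case True
  then obtain j where k: "k = 2 * j" by (auto elim: evenE)
  have "(\<integral>z. z ^ Suc k \<partial>N01) = 0"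
    using integral_std_normal_moment_odd[of j] by (simp add: integral_N01 k)
  moreover have "real k * (\<integral>z. z ^ (k - 1) \<partial>N01) = 0"
  proof (cases j)
    case (Suc i)
    then show ?thesis using integral_std_normal_moment_odd[of i] by (simp add: integral_N01 k)
  qed (simp add: k)
  ultimately show ?thesis by simp
next
  case False
  then obtain j where k: "k = 2 * j + 1" by (auto elim: oddE)
  have "(\<integral>z. z ^ Suc k \<partial>N01) = fact (2 * Suc j) / (2 ^ Suc j * fact (Suc j))"
    using integral_std_normal_moment_even[of "Suc j"] by (simp add: integral_N01 k del: fact_Suc)
  also have "\<dots> = real k * (fact (2 * j) / (2 ^ j * fact j))"
  proof -
    have "fact (2 * Suc j) = 2 * real (Suc j) * (2 * j + 1) * fact (2 * j)"
      by (simp add: algebra_simps)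
    then show ?thesis by (simp add: k divide_simps)
  qed
  also have "fact (2 * j) / (2 ^ j * fact j) = (\<integral>z. z ^ (k - 1) \<partial>N01)"
    using integral_std_normal_moment_even[of j] by (simp add: integral_N01 k)
  finally show ?thesis .
qed

text \<open>By linearity from the monomials. All integration by parts in the Hermite calculus below
  is of this polynomial kind.\<close>

lemma N01_stein_poly: "(\<integral>z. z * poly p z \<partial>N01) = (\<integral>z. poly (pderiv p) z \<partial>N01)"
proof -
  have *: "(\<integral>z. z * poly (monom a k) z \<partial>N01) = (\<integral>z. poly (pderiv (monom a k)) z \<partial>N01)" for a k
  proof -
    have "(\<integral>z. z * poly (monom a k) z \<partial>N01) = a * (\<integral>z. z ^ Suc k \<partial>N01)"
      by (subst integral_mult_right_zero[symmetric]) (simp only: poly_monom power_Suc mult_ac)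
    also have "\<dots> = (\<integral>z. a * (real k * z ^ (k - 1)) \<partial>N01)"
      by (simp only: N01_moment_Suc integral_mult_right_zero)
    also have "\<dots> = (\<integral>z. poly (pderiv (monom a k)) z \<partial>N01)"
      by (simp add: pderiv_monom poly_monom mult_ac)
    finally show ?thesis .
  qed
  have int: "integrable N01 (\<lambda>z. z * poly q z)" for q :: "real poly"
    using integrable_N01_poly[of "pCons 0 q"] by simp
  have "(\<integral>z. z * poly (\<Sum>i\<le>n. monom (coeff p i) i) z \<partial>N01)
      = (\<integral>z. poly (pderiv (\<Sum>i\<le>n. monom (coeff p i) i)) z \<partial>N01)" for n
    by (induction n)
      (simp_all add: * pderiv_add distrib_left integral_add int integrable_N01_poly
        del: poly_monom)
  from this[of "degree p"] show ?thesis
    by (simp only: poly_as_sum_of_monoms)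
qed

lemma nn_integral_lborel_shift_scale:
  fixes f :: "real \<Rightarrow> ennreal"
  assumes [measurable]: "f \<in> borel_measurable borel" and "\<sigma> > 0"
  shows "(\<integral>\<^sup>+x. ennreal (normal_density m \<sigma> x) * f x \<partial>lborel) = (\<integral>\<^sup>+z. f (m + \<sigma> * z) \<partial>N01)"
proof -
  have "(\<integral>\<^sup>+x. ennreal (normal_density m \<sigma> x) * f x \<partial>lborel)
      = ennreal \<sigma> * (\<integral>\<^sup>+z. ennreal (normal_density m \<sigma> (m + \<sigma> * z)) * f (m + \<sigma> * z) \<partial>lborel)"
    using assms by (subst nn_integral_real_affine[where c=\<sigma> and t=m]) auto
  also have "\<dots> = (\<integral>\<^sup>+z. ennreal (std_normal_density z) * f (m + \<sigma> * z) \<partial>lborel)"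
    using assms
    by (subst nn_integral_cmult[symmetric], simp)
      (auto intro!: nn_integral_cong simp: normal_density_def ennreal_mult'[symmetric] mult.assoc[symmetric]
        real_sqrt_mult power_mult_distrib)
  also have "\<dots> = (\<integral>\<^sup>+z. f (m + \<sigma> * z) \<partial>N01)"
    by (simp add: nn_integral_density)
  finally show ?thesis .
qed

text \<open>Lets the laws of the data enter all later integrals only through
  \<open>m + \<sigma> * z\<close> with \<open>z\<close> standard normal.\<close>

lemma normal_as_affine:
  assumes "\<sigma> > 0"
  shows "density lborel (normal_density m \<sigma>) = distr N01 borel (\<lambda>z. m + \<sigma> * z)"
proof (rule measure_eqI)
  fix A assume "A \<in> sets (density lborel (normal_density m \<sigma>))"
  then have [measurable]: "A \<in> sets borel" by simp
  have "emeasure (density lborel (normal_density m \<sigma>)) A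
      = (\<integral>\<^sup>+x. ennreal (normal_density m \<sigma> x) * indicator A x \<partial>lborel)"
    by (simp add: emeasure_density)
  also have "\<dots> = (\<integral>\<^sup>+z. indicator A (m + \<sigma> * z) \<partial>N01)"
    using assms by (intro nn_integral_lborel_shift_scale) auto
  also have "\<dots> = emeasure (distr N01 borel (\<lambda>z. m + \<sigma> * z)) A"
    by (subst emeasure_distr, simp, simp, subst nn_integral_indicator[symmetric], measurable)
      (auto intro!: nn_integral_cong simp: indicator_def)
  finally show "emeasure (density lborel (normal_density m \<sigma>)) A
      = emeasure (distr N01 borel (\<lambda>z. m + \<sigma> * z)) A" .
qed simp

text \<open>Independence of the normalized sum and difference of two standard normals: the joint
  density depends only on \<open>x\<^sup>2 + z\<^sup>2\<close>, which the rotation preserves. This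
  is why the two halves \<open>U\<close> and \<open>V\<close> of the split data are
  independent.\<close>

lemma nn_integral_N01_rotate:
  fixes F :: "real \<Rightarrow> real \<Rightarrow> ennreal"
  assumes F[measurable]: "case_prod F \<in> borel_measurable (borel \<Otimes>\<^sub>M borel)"
  shows "(\<integral>\<^sup>+x. \<integral>\<^sup>+z. F ((x + z) / sqrt 2) ((x - z) / sqrt 2) \<partial>N01 \<partial>N01)
       = (\<integral>\<^sup>+a. \<integral>\<^sup>+b. F a b \<partial>N01 \<partial>N01)"
proof -
  let ?\<phi> = "\<lambda>x. ennreal (std_normal_density x)"
  have dens: "?\<phi> (sqrt 2 * a - z) * ?\<phi> z = ?\<phi> a * ?\<phi> (a - sqrt 2 * z)" for a z
  proof -
    \<comment> \<open>With \<open>x = sqrt 2 * a - z\<close> the second rotated coordinate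
      \<open>(x - z) / sqrt 2\<close> is \<open>a - sqrt 2 * z\<close>.\<close>
    have "(sqrt 2 * a - z)\<^sup>2 + z\<^sup>2 = a\<^sup>2 + (a - sqrt 2 * z)\<^sup>2"
      by (simp add: power2_eq_square algebra_simps)
    then have "exp (- (sqrt 2 * a - z)\<^sup>2 / 2) * exp (- z\<^sup>2 / 2) = exp (- a\<^sup>2 / 2) * exp (- (a - sqrt 2 * z)\<^sup>2 / 2)"
      unfolding exp_add[symmetric] by (simp add: field_simps)
    then show ?thesis
      by (simp add: ennreal_mult[symmetric] std_normal_density_def algebra_simps)
  qed
  have "(\<integral>\<^sup>+x. \<integral>\<^sup>+z. F ((x + z) / sqrt 2) ((x - z) / sqrt 2) \<partial>N01 \<partial>N01)
      = (\<integral>\<^sup>+x. \<integral>\<^sup>+z. ?\<phi> x * ?\<phi> z * F ((x + z) / sqrt 2) ((x - z) / sqrt 2) \<partial>lborel \<partial>lborel)"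
    by (simp add: nn_integral_density nn_integral_cmult[symmetric] mult.assoc)
  also have "\<dots> = (\<integral>\<^sup>+z. \<integral>\<^sup>+x. ?\<phi> x * ?\<phi> z * F ((x + z) / sqrt 2) ((x - z) / sqrt 2) \<partial>lborel \<partial>lborel)"
    by (rule lborel_pair.Fubini') simp
  \<comment> \<open>Substitution \<open>x = sqrt 2 * a - z\<close> in the inner integral; its
    Jacobian \<open>sqrt 2\<close> is used up later by \<open>b = a - sqrt 2 * z\<close>.\<close>
  also have "\<dots> = (\<integral>\<^sup>+z. ennreal (sqrt 2) * \<integral>\<^sup>+a. ?\<phi> (sqrt 2 * a - z) * ?\<phi> z * F a (a - sqrt 2 * z) \<partial>lborel \<partial>lborel)"
  proof (intro nn_integral_cong)
    fix z :: real
    have e: "(sqrt 2 * a - 2 * z) / sqrt 2 = a - sqrt 2 * z" for a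
      by (simp add: field_simps)
    show "(\<integral>\<^sup>+x. ?\<phi> x * ?\<phi> z * F ((x + z) / sqrt 2) ((x - z) / sqrt 2) \<partial>lborel)
      = ennreal (sqrt 2) * (\<integral>\<^sup>+a. ?\<phi> (sqrt 2 * a - z) * ?\<phi> z * F a (a - sqrt 2 * z) \<partial>lborel)"
      by (subst nn_integral_real_affine[where c="sqrt 2" and t="-z"])
        (simp_all add: e)
  qed
  also have "\<dots> = (\<integral>\<^sup>+z. \<integral>\<^sup>+a. ennreal (sqrt 2) * (?\<phi> a * ?\<phi> (a - sqrt 2 * z) * F a (a - sqrt 2 * z)) \<partial>lborel \<partial>lborel)"
    by (simp add: nn_integral_cmult dens)
  also have "\<dots> = (\<integral>\<^sup>+a. \<integral>\<^sup>+z. ennreal (sqrt 2) * (?\<phi> a * ?\<phi> (a - sqrt 2 * z) * F a (a - sqrt 2 * z)) \<partial>lborel \<partial>lborel)"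
    by (rule lborel_pair.Fubini') simp
  also have "\<dots> = (\<integral>\<^sup>+a. \<integral>\<^sup>+b. ?\<phi> a * ?\<phi> b * F a b \<partial>lborel \<partial>lborel)"
  proof (rule nn_integral_cong)
    fix a :: real
    show "(\<integral>\<^sup>+z. ennreal (sqrt 2) * (?\<phi> a * ?\<phi> (a - sqrt 2 * z) * F a (a - sqrt 2 * z)) \<partial>lborel)
      = (\<integral>\<^sup>+b. ?\<phi> a * ?\<phi> b * F a b \<partial>lborel)"
      by (subst (2) nn_integral_real_affine[where c="-sqrt 2" and t="a"])
        (simp_all add: nn_integral_cmult)
  qed
  also have "\<dots> = (\<integral>\<^sup>+a. \<integral>\<^sup>+b. F a b \<partial>N01 \<partial>N01)"
    by (simp add: nn_integral_density nn_integral_cmult[symmetric] mult.assoc)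
  finally show ?thesis .
qed

lemma N01_exp_moment: "(\<integral>\<^sup>+z. ennreal (exp (t * z)) \<partial>N01) = ennreal (exp (t\<^sup>2 / 2))"
proof -
  have "(\<integral>\<^sup>+z. ennreal (exp (t * z)) \<partial>N01)
      = (\<integral>\<^sup>+z. ennreal (exp (t\<^sup>2 / 2)) * ennreal (normal_density t 1 z) \<partial>lborel)"
  proof (simp add: nn_integral_density, intro nn_integral_cong)
    fix z :: real
    have "exp (- z\<^sup>2 / 2) * exp (t * z) = exp (t\<^sup>2 / 2) * exp (- (z - t)\<^sup>2 / 2)"
      unfolding exp_add[symmetric] by (simp add: power2_eq_square field_simps)
    then show "ennreal (std_normal_density z) * ennreal (exp (t * z))
        = ennreal (exp (t\<^sup>2 / 2)) * ennreal (normal_density t 1 z)"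
      by (simp add: ennreal_mult[symmetric] normal_density_def)
  qed
  also have "\<dots> = ennreal (exp (t\<^sup>2 / 2)) * (\<integral>\<^sup>+z. ennreal (normal_density t 1 z) \<partial>lborel)"
    by (simp add: nn_integral_cmult)
  also have "(\<integral>\<^sup>+z. ennreal (normal_density t 1 z) \<partial>lborel) = 1"
    by (simp add: nn_integral_eq_integral)
  finally show ?thesis by simp
qed

text \<open>Chernoff bound with the optimal exponential weight \<open>t / s\<close>. A negative
  \<open>s\<close> gives the left tail.\<close>

lemma N01_tail:
  assumes "t \<ge> 0" "s \<noteq> 0"
  shows "measure N01 {z. t \<le> s * z} \<le> exp (- t\<^sup>2 / (2 * s\<^sup>2))"
proof -
  have "emeasure N01 {z. t \<le> s * z} = (\<integral>\<^sup>+z. indicator {z. t \<le> s * z} z \<partial>N01)"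
    by simp
  also have "\<dots> \<le> (\<integral>\<^sup>+z. ennreal (exp (- t\<^sup>2 / s\<^sup>2)) * ennreal (exp ((t / s) * z)) \<partial>N01)"
  proof (intro nn_integral_mono)
    fix z :: real
    have "0 \<le> (t / s\<^sup>2) * (s * z - t)" if "t \<le> s * z" using assms that by simp
    then show "indicator {z. t \<le> s * z} z \<le> ennreal (exp (- t\<^sup>2 / s\<^sup>2)) * ennreal (exp ((t / s) * z))"
      using assms
      by (auto simp: indicator_def ennreal_mult[symmetric] exp_add[symmetric] power2_eq_square field_simps)
  qed
  also have "\<dots> = ennreal (exp (- t\<^sup>2 / s\<^sup>2)) * ennreal (exp ((t / s)\<^sup>2 / 2))"
    by (subst nn_integral_cmult) (simp_all add: N01_exp_moment del: times_divide_eq_left)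
  also have "\<dots> = ennreal (exp (- t\<^sup>2 / (2 * s\<^sup>2)))"
    using assms by (simp add: ennreal_mult[symmetric] exp_add[symmetric] power_divide field_simps)
  finally show ?thesis
    by (simp add: N01.emeasure_eq_measure)
qed

lemma sets_N01_pair [measurable_cong]: "sets (N01 \<Otimes>\<^sub>M N01) = sets (borel \<Otimes>\<^sub>M borel)"
  by (rule sets_pair_measure_cong) simp_all

text \<open>In this form, as an equality of measures, the rotation also transports Bochner integrals
  of functions that change sign.\<close>

lemma N01_pair_rotate:
  "distr (N01 \<Otimes>\<^sub>M N01) (borel \<Otimes>\<^sub>M borel) (\<lambda>w. ((fst w + snd w) / sqrt 2, (fst w - snd w) / sqrt 2)) = N01 \<Otimes>\<^sub>M N01"
  (is "distr ?P ?B ?r = _")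
proof (rule measure_eqI)
  show "sets (distr ?P ?B ?r) = sets ?P"
    by (simp only: sets_distr sets_N01_pair)
  fix A assume "A \<in> sets (distr ?P ?B ?r)"
  then have A[measurable]: "A \<in> sets ?B" by (simp only: sets_distr)
  then have A': "A \<in> sets ?P" by (simp only: sets_N01_pair)
  have r[measurable]: "?r \<in> measurable ?P ?B" by measurable
  have r': "?r -` A \<inter> space ?P \<in> sets ?P" by measurable
  have "emeasure (distr ?P ?B ?r) A = emeasure ?P (?r -` A \<inter> space ?P)"
    by (rule emeasure_distr[OF r A])
  also have "\<dots> = (\<integral>\<^sup>+w. indicator (?r -` A \<inter> space ?P) w \<partial>?P)"
    by (rule nn_integral_indicator[OF r', symmetric])
  also have "\<dots> = (\<integral>\<^sup>+w. indicator A (?r w) \<partial>?P)"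
    by (rule nn_integral_cong) (auto simp: indicator_def)
  also have "\<dots> = (\<integral>\<^sup>+x. \<integral>\<^sup>+z. indicator A ((x + z) / sqrt 2, (x - z) / sqrt 2) \<partial>N01 \<partial>N01)"
    by (subst N01.nn_integral_fst[symmetric]) simp_all
  also have "\<dots> = (\<integral>\<^sup>+a. \<integral>\<^sup>+b. indicator A (a, b) \<partial>N01 \<partial>N01)"
    by (rule nn_integral_N01_rotate[of "\<lambda>a b. indicator A (a, b)"]) simp
  also have "\<dots> = (\<integral>\<^sup>+w. indicator A w \<partial>?P)"
    by (subst N01.nn_integral_fst[symmetric]) simp_all
  also have "\<dots> = emeasure ?P A"
    by (rule nn_integral_indicator[OF A'])
  finally show "emeasure (distr ?P ?B ?r) A = emeasure ?P A" .
qed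

section \<open>Hermite polynomials under a Gaussian law\<close>

text \<open>Hermite polynomials for variance \<open>v\<close> instead of \<open>1\<close>. With
  \<open>v\<close> as a parameter the case \<open>s = 0\<close> of \<open>scaled_hermite\<close> is
  no longer exceptional: at \<open>v = 0\<close> these are the monomials.\<close>

fun hermite_poly :: "real \<Rightarrow> nat \<Rightarrow> real poly" where
  "hermite_poly v 0 = 1"
| "hermite_poly v (Suc 0) = [:0, 1:]"
| "hermite_poly v (Suc (Suc k)) = [:0, 1:] * hermite_poly v (Suc k) - smult (real (Suc k) * v) (hermite_poly v k)"

lemma scaled_hermite_eq_poly: "scaled_hermite s m u = poly (hermite_poly (s\<^sup>2) m) u"
proof (cases "s = 0")
  case True
  have "poly (hermite_poly 0 m) u = u ^ m"
    by (induction m rule: induct_nat_012) (auto simp: algebra_simps)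
  then show ?thesis using True by (simp add: scaled_hermite_def)
next
  case False
  have "s ^ m * hermite m (u / s) = poly (hermite_poly (s\<^sup>2) m) u"
  proof (induction m rule: induct_nat_012)
    case (ge2 k)
    have "s ^ Suc (Suc k) * hermite (Suc (Suc k)) (u / s)
        = u * (s ^ Suc k * hermite (Suc k) (u / s)) - real (Suc k) * s\<^sup>2 * (s ^ k * hermite k (u / s))"
      using False by (simp add: field_simps power2_eq_square)
    then show ?case by (simp only: ge2) (simp add: algebra_simps)
  qed (use False in auto)
  then show ?thesis using False by (simp add: scaled_hermite_def)
qed

text \<open>One recursion for all \<open>m\<close>: at \<open>m = 0\<close> the coefficient
  \<open>real m\<close> vanishes, so the truncated \<open>m - 1\<close> does no harm.\<close>

lemma hermite_poly_Suc: "hermite_poly v (Suc m) = [:0, 1:] * hermite_poly v m - smult (real m * v) (hermite_poly v (m - 1))"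
  by (cases m) (simp_all add: one_pCons)

text \<open>The Appell property. After differentiating the recursion, the two terms of lower index
  are collected by the recursion itself, read backwards.\<close>

lemma pderiv_hermite_poly: "pderiv (hermite_poly v m) = smult (real m) (hermite_poly v (m - 1))"
proof (induction v m rule: hermite_poly.induct)
  case (3 v k)
  have "pderiv (hermite_poly v (Suc (Suc k)))
      = hermite_poly v (Suc k) + [:0, 1:] * smult (real (Suc k)) (hermite_poly v k)
        - smult (real (Suc k) * v) (smult (real k) (hermite_poly v (k - 1)))"
    using 3 by (simp add: pderiv_mult pderiv_diff pderiv_smult pderiv_pCons algebra_simps)
  also have "\<dots> = hermite_poly v (Suc k) + smult (real (Suc k)) (hermite_poly v (Suc k))"
    by (subst (2) hermite_poly_Suc) (simp add: algebra_simps smult_diff_right smult_add_left)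
  also have "\<dots> = smult (real (Suc (Suc k))) (hermite_poly v (Suc k))"
    using smult_add_left[of 1 "real (Suc k)" "hermite_poly v (Suc k)"] by simp
  finally show ?case by simp
qed (simp_all add: pderiv_pCons one_pCons)

definition gauss_mean :: "real \<Rightarrow> real \<Rightarrow> real poly \<Rightarrow> real" where
  "gauss_mean \<mu> s p = (\<integral>z. poly p (\<mu> + s * z) \<partial>N01)"

lemma integrable_N01_poly_affine: "integrable N01 (\<lambda>z. poly p (\<mu> + s * z))"
  using integrable_N01_poly[of "pcompose p [:\<mu>, s:]"] by (simp add: poly_pcompose mult_ac)

lemma gauss_mean_linear:
  "gauss_mean \<mu> s (p + q) = gauss_mean \<mu> s p + gauss_mean \<mu> s q"
  "gauss_mean \<mu> s (p - q) = gauss_mean \<mu> s p - gauss_mean \<mu> s q"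
  "gauss_mean \<mu> s (smult a p) = a * gauss_mean \<mu> s p"
  by (simp_all add: gauss_mean_def integrable_N01_poly_affine)

lemma gauss_mean_sum: "gauss_mean \<mu> s (\<Sum>i\<in>I. f i) = (\<Sum>i\<in>I. gauss_mean \<mu> s (f i))"
  by (simp add: gauss_mean_def poly_sum integrable_N01_poly_affine)

lemma gauss_mean_1 [simp]: "gauss_mean \<mu> s 1 = 1"
  by (simp add: gauss_mean_def N01.prob_space[simplified])

lemma gauss_mean_stein:
  "gauss_mean \<mu> s ([:0, 1:] * p) = \<mu> * gauss_mean \<mu> s p + s\<^sup>2 * gauss_mean \<mu> s (pderiv p)"
proof -
  let ?q = "pcompose p [:\<mu>, s:]"
  have q: "poly ?q z = poly p (\<mu> + s * z)" for z
    by (simp add: poly_pcompose mult_ac)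
  have q': "poly (pderiv ?q) z = s * poly (pderiv p) (\<mu> + s * z)" for z
    by (simp add: pderiv_pcompose poly_pcompose pderiv_pCons mult_ac)
  have int: "integrable N01 (\<lambda>z. z * poly ?q z)"
    using integrable_N01_poly[of "pCons 0 ?q"] by simp
  have "gauss_mean \<mu> s ([:0, 1:] * p) = (\<integral>z. \<mu> * poly ?q z + s * (z * poly ?q z) \<partial>N01)"
    by (simp add: gauss_mean_def q algebra_simps)
  also have "\<dots> = \<mu> * (\<integral>z. poly ?q z \<partial>N01) + s * (\<integral>z. z * poly ?q z \<partial>N01)"
    using int integrable_N01_poly[of ?q] by simp
  also have "(\<integral>z. z * poly ?q z \<partial>N01) = s * gauss_mean \<mu> s (pderiv p)"
    unfolding N01_stein_poly q' by (simp add: gauss_mean_def)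
  finally show ?thesis by (simp add: gauss_mean_def q power2_eq_square)
qed

text \<open>Stein's identity differentiates the product. The part in which the factor of index
  \<open>m\<close> is differentiated cancels the subtracted term of the recursion, so only the other
  factor loses a degree.\<close>

lemma gauss_mean_hermite_mult_Suc:
  "gauss_mean \<mu> s (hermite_poly (s\<^sup>2) (Suc m) * hermite_poly (s\<^sup>2) k)
   = \<mu> * gauss_mean \<mu> s (hermite_poly (s\<^sup>2) m * hermite_poly (s\<^sup>2) k)
     + s\<^sup>2 * real k * gauss_mean \<mu> s (hermite_poly (s\<^sup>2) m * hermite_poly (s\<^sup>2) (k - 1))"
proof -
  let ?h = "hermite_poly (s\<^sup>2)"
  have "?h (Suc m) * ?h k = [:0, 1:] * (?h m * ?h k) - smult (real m * s\<^sup>2) (?h (m - 1) * ?h k)"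
    by (subst hermite_poly_Suc) (simp add: algebra_simps)
  then have "gauss_mean \<mu> s (?h (Suc m) * ?h k)
      = \<mu> * gauss_mean \<mu> s (?h m * ?h k) + s\<^sup>2 * gauss_mean \<mu> s (pderiv (?h m * ?h k))
        - real m * s\<^sup>2 * gauss_mean \<mu> s (?h (m - 1) * ?h k)"
    by (simp only: gauss_mean_linear gauss_mean_stein)
  also have "pderiv (?h m * ?h k) = smult (real k) (?h m * ?h (k - 1)) + smult (real m) (?h (m - 1) * ?h k)"
    by (simp add: pderiv_mult pderiv_hermite_poly mult_ac)
  finally show ?thesis by (simp add: gauss_mean_linear algebra_simps)
qed

text \<open>Case \<open>k = 0\<close> of the preceding recursion, where the second term vanishes.
  This unbiasedness is the reason why the estimate evaluates Hermite polynomials, rather than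
  powers, at the noisy argument \<open>U\<close>.\<close>

lemma gauss_mean_hermite_poly: "gauss_mean \<mu> s (hermite_poly (s\<^sup>2) m) = \<mu> ^ m"
proof (induction m)
  case (Suc m)
  then show ?case using gauss_mean_hermite_mult_Suc[of \<mu> s m 0] by simp
qed simp

text \<open>The index \<open>j\<close> counts contractions between the two factors, each worth
  \<open>s\<^sup>2\<close>. Whenever \<open>m + k - 2 * j\<close> truncates, one of the binomial
  coefficients is zero.\<close>

lemma gauss_mean_hermite_mult:
  "gauss_mean \<mu> s (hermite_poly (s\<^sup>2) m * hermite_poly (s\<^sup>2) k)
   = (\<Sum>j\<le>m. real (m choose j) * real (k choose j) * fact j * s\<^sup>2 ^ j * \<mu> ^ (m + k - 2 * j))"
proof (induction m arbitrary: k)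
  case 0
  show ?case by (simp add: gauss_mean_hermite_poly)
next
  case (Suc m)
  let ?t = "\<lambda>m k j. real (m choose j) * real (k choose j) * fact j * s\<^sup>2 ^ j * \<mu> ^ (m + k - 2 * j)"
  \<comment> \<open>Pascal's rule for \<open>Suc m choose j\<close>; the second sum is shifted by
    one.\<close>
  have "(\<Sum>j\<le>Suc m. ?t (Suc m) k j)
      = (\<Sum>j\<le>Suc m. real (m choose j) * real (k choose j) * fact j * s\<^sup>2 ^ j * \<mu> ^ (Suc m + k - 2 * j))
      + (\<Sum>j\<le>m. real (m choose j) * real (k choose Suc j) * fact (Suc j) * s\<^sup>2 ^ Suc j * \<mu> ^ (Suc m + k - 2 * Suc j))"
    (is "_ = ?A + ?B")
    by (subst (1 2) sum.atMost_Suc_shift)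
      (simp add: sum.distrib algebra_simps del: fact_Suc)
  also have "?A = \<mu> * (\<Sum>j\<le>m. ?t m k j)"
  proof -
    have "real (m choose j) * real (k choose j) * fact j * s\<^sup>2 ^ j * \<mu> ^ (Suc m + k - 2 * j) = \<mu> * ?t m k j"
      if "j \<le> m" for j
    proof (cases "j \<le> k")
      case True
      then have "Suc m + k - 2 * j = Suc (m + k - 2 * j)" using that by simp
      then show ?thesis by (simp only: power_Suc) simp
    qed (simp add: binomial_eq_0)
    then have "?A = (\<Sum>j\<le>m. \<mu> * ?t m k j)"
      by (simp only: sum.atMost_Suc binomial_eq_0[OF lessI] of_nat_0 mult_zero_left add_0_right)
        (intro sum.cong refl, simp)
    then show ?thesis by (simp only: sum_distrib_left)
  qed
  also have "?B = s\<^sup>2 * real k * (\<Sum>j\<le>m. ?t m (k - 1) j)"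
  proof -
    \<comment> \<open>Absorption identity: one contraction is traded for the factor
      \<open>k\<close>.\<close>
    have "real (k choose Suc j) * fact (Suc j) = real k * real ((k - 1) choose j) * fact j" for j
    proof -
      have "Suc j * (k choose Suc j) = k * ((k - 1) choose j)"
        using Suc_times_binomial_eq[of "k - 1" j] by (cases k) (simp_all add: mult_ac del: binomial_Suc_Suc)
      then have "real (Suc j) * real (k choose Suc j) = real k * real ((k - 1) choose j)"
        by (metis of_nat_mult)
      then show ?thesis by (simp add: mult_ac)
    qed
    then have "real (m choose j) * real (k choose Suc j) * fact (Suc j) * s\<^sup>2 ^ Suc j * \<mu> ^ (Suc m + k - 2 * Suc j)
        = s\<^sup>2 * real k * ?t m (k - 1) j" for j
      by (cases k) (simp_all add: mult_ac del: fact_Suc)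
    then show ?thesis by (simp only: sum_distrib_left)
  qed
  finally show ?case
    by (simp only: gauss_mean_hermite_mult_Suc Suc)
qed

text \<open>With \<open>v = s\<^sup>2\<close>, the number
  \<open>(m choose j) * v ^ j * (1 - v) ^ (m - j)\<close> is a single term of
  \<open>(v + (1 - v)) ^ m = 1\<close>. This trades one binomial coefficient and the powers of
  \<open>v\<close> for powers of \<open>1 / (1 - v)\<close>; what remains is a partial exponential
  series.\<close>

lemma gauss_mean_hermite_square_le:
  assumes "s\<^sup>2 < 1"
  shows "gauss_mean \<mu> s ((hermite_poly (s\<^sup>2) m)\<^sup>2) \<le> fact m * exp (\<mu>\<^sup>2 / (1 - s\<^sup>2))"
proof -
  let ?v = "s\<^sup>2" and ?x = "\<mu>\<^sup>2 / (1 - s\<^sup>2)"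
  have x: "?x \<ge> 0" using assms by simp
  have "real (m choose j) * real (m choose j) * fact j * ?v ^ j * \<mu> ^ (m + m - 2 * j)
      \<le> fact m * (?x ^ (m - j) / fact (m - j))" if "j \<le> m" for j
  proof -
    have "real (m choose j) * ?v ^ j * (1 - ?v) ^ (m - j) \<le> (\<Sum>i\<le>m. real (m choose i) * ?v ^ i * (1 - ?v) ^ (m - i))"
      using assms that by (intro member_le_sum) auto
    also have "\<dots> = 1" by (subst binomial_ring[symmetric]) simp
    finally have b: "real (m choose j) * ?v ^ j \<le> 1 / (1 - ?v) ^ (m - j)"
      using assms by (simp add: field_simps)
    have f: "real (m choose j) * fact j = fact m / fact (m - j)"
      using that by (simp add: binomial_fact)
    have p: "\<mu> ^ (m + m - 2 * j) = (\<mu>\<^sup>2) ^ (m - j)"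
      using that by (metis add_mult_distrib2 diff_mult_distrib2 mult_2 power_mult)
    have "real (m choose j) * real (m choose j) * fact j * ?v ^ j * \<mu> ^ (m + m - 2 * j)
        = (real (m choose j) * ?v ^ j) * (\<mu>\<^sup>2) ^ (m - j) * (real (m choose j) * fact j)"
      by (subst p) (simp only: mult_ac)
    also have "\<dots> \<le> (1 / (1 - ?v) ^ (m - j)) * (\<mu>\<^sup>2) ^ (m - j) * (real (m choose j) * fact j)"
      by (intro mult_right_mono b) auto
    also have "\<dots> = fact m * (?x ^ (m - j) / fact (m - j))"
      by (simp add: f power_divide)
    finally show ?thesis .
  qed
  then have "gauss_mean \<mu> s ((hermite_poly ?v m)\<^sup>2) \<le> (\<Sum>j\<le>m. fact m * (?x ^ (m - j) / fact (m - j)))"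
    unfolding power2_eq_square[of "hermite_poly ?v m"] gauss_mean_hermite_mult
    by (intro sum_mono) (simp only: atMost_iff)
  also have "\<dots> = fact m * (\<Sum>i\<le>m. ?x ^ i / fact i)"
    unfolding sum_distrib_left
    by (rule sum.reindex_bij_witness[of _ "\<lambda>i. m - i" "\<lambda>i. m - i"]) auto
  also have "(\<Sum>i\<le>m. ?x ^ i / fact i) \<le> exp ?x"
    using x summable_exp[of ?x]
    by (auto simp: exp_def scaleR_conv_of_real divide_inverse mult_ac intro!: sum_le_suminf)
  finally show ?thesis by simp
qed

text \<open>The truncated expansions estimating \<^const>\<open>G\<close> and its derivative all lie in the following class,
  whose second moments are controlled uniformly in the Gaussian mean.\<close>

definition hermite_class :: "real \<Rightarrow> nat \<Rightarrow> real poly set" where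
  "hermite_class v K = {\<Sum>m\<le>K. smult (a m) (hermite_poly v m) | a. \<forall>m. (a m)\<^sup>2 * fact m \<le> 1}"

text \<open>Cauchy-Schwarz over the terms loses a factor \<open>K + 1\<close>. The normalization of
  the class then cancels the \<open>fact m\<close> in the second moment of each Hermite
  polynomial.\<close>

lemma hermite_class_second_moment:
  assumes "s\<^sup>2 < 1" "p \<in> hermite_class (s\<^sup>2) K"
  shows "gauss_mean \<mu> s (p\<^sup>2) \<le> (real K + 1)\<^sup>2 * exp (\<mu>\<^sup>2 / (1 - s\<^sup>2))"
proof -
  obtain a where p: "p = (\<Sum>m\<le>K. smult (a m) (hermite_poly (s\<^sup>2) m))" and a: "\<And>m. (a m)\<^sup>2 * fact m \<le> 1"
    using assms(2) by (auto simp: hermite_class_def)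
  let ?q = "\<Sum>m\<le>K. smult ((a m)\<^sup>2) ((hermite_poly (s\<^sup>2) m)\<^sup>2)"
  have "(poly p u)\<^sup>2 \<le> (real K + 1) * poly ?q u" for u
  proof -
    have "(poly p u)\<^sup>2 \<le> (\<Sum>m\<le>K. (1::real)\<^sup>2) * (\<Sum>m\<le>K. (a m * poly (hermite_poly (s\<^sup>2) m) u)\<^sup>2)"
      using Cauchy_Schwarz_ineq_sum[of "\<lambda>_. 1" "\<lambda>m. a m * poly (hermite_poly (s\<^sup>2) m) u" "{..K}"]
      by (simp add: p poly_sum)
    then show ?thesis by (simp add: poly_sum power_mult_distrib algebra_simps)
  qed
  then have "gauss_mean \<mu> s (p\<^sup>2) \<le> gauss_mean \<mu> s (smult (real K + 1) ?q)"
    unfolding gauss_mean_def by (intro integral_mono integrable_N01_poly_affine) simp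
  also have "\<dots> = (real K + 1) * (\<Sum>m\<le>K. (a m)\<^sup>2 * gauss_mean \<mu> s ((hermite_poly (s\<^sup>2) m)\<^sup>2))"
    by (simp add: gauss_mean_linear gauss_mean_sum)
  also have "\<dots> \<le> (real K + 1) * (\<Sum>m\<le>K. exp (\<mu>\<^sup>2 / (1 - s\<^sup>2)))"
  proof (intro mult_left_mono sum_mono)
    fix m
    have "(a m)\<^sup>2 * gauss_mean \<mu> s ((hermite_poly (s\<^sup>2) m)\<^sup>2) \<le> (a m)\<^sup>2 * (fact m * exp (\<mu>\<^sup>2 / (1 - s\<^sup>2)))"
      by (intro mult_left_mono gauss_mean_hermite_square_le assms) simp
    also have "\<dots> \<le> 1 * exp (\<mu>\<^sup>2 / (1 - s\<^sup>2))"
      unfolding mult.assoc[symmetric] by (intro mult_right_mono a) simp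
    finally show "(a m)\<^sup>2 * gauss_mean \<mu> s ((hermite_poly (s\<^sup>2) m)\<^sup>2) \<le> exp (\<mu>\<^sup>2 / (1 - s\<^sup>2))" by simp
  qed simp
  also have "\<dots> = (real K + 1)\<^sup>2 * exp (\<mu>\<^sup>2 / (1 - s\<^sup>2))"
    by (simp add: power2_eq_square algebra_simps)
  finally show ?thesis .
qed

lemma hermite_class_mean:
  "gauss_mean \<mu> s (\<Sum>m\<le>K. smult (a m) (hermite_poly (s\<^sup>2) m)) = (\<Sum>m\<le>K. a m * \<mu> ^ m)"
  by (simp add: gauss_mean_sum gauss_mean_linear gauss_mean_hermite_poly)

text \<open>Hermite coefficients of the Taylor expansion at \<open>0\<close> of the function with value \<open>\<phi>(0)\<close> and slope
  \<open>\<kappa>\<close> at \<open>0\<close> and second derivative \<open>\<phi>\<close>; for \<open>\<kappa> = 1/2 - \<beta>\<close> this is \<open>G(\<cdot>, \<beta>)\<close>.\<close>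

definition G_coeff :: "real \<Rightarrow> nat \<Rightarrow> real" where
  "G_coeff \<kappa> m = (if m = 0 then std_normal_density 0 else if m = 1 then \<kappa>
     else std_normal_density 0 * (- 1) ^ (m - 2) * hermite (m - 2) 0 / fact m)"

definition G_poly :: "real \<Rightarrow> nat \<Rightarrow> real \<Rightarrow> real poly" where
  "G_poly v K \<kappa> = (\<Sum>m\<le>K. smult (G_coeff \<kappa> m) (hermite_poly v m))"

lemma hermite_0_square_le: "(hermite k 0)\<^sup>2 \<le> fact k"
proof (induction k rule: induct_nat_012)
  case (ge2 k)
  have "(hermite (Suc (Suc k)) 0)\<^sup>2 = (real (Suc k))\<^sup>2 * (hermite k 0)\<^sup>2"
    by (simp add: power_mult_distrib)
  also have "\<dots> \<le> (real (Suc k))\<^sup>2 * fact k"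
    by (intro mult_left_mono ge2) simp
  also have "\<dots> \<le> fact (Suc (Suc k))"
    by (simp add: power2_eq_square mult.assoc mult_right_mono)
  finally show ?case .
qed simp_all

lemma std_normal_density_0_le: "std_normal_density 0 \<le> 1" "0 < std_normal_density 0"
  using pi_gt3 by (auto simp: std_normal_density_def)

lemma std_normal_density_0_sq: "(std_normal_density 0)\<^sup>2 \<le> 1"
  using std_normal_density_0_le by (simp add: power_le_one)

text \<open>For \<open>m \<ge> 2\<close> the squared value \<open>hermite (m - 2) 0\<close> is at
  most \<open>fact (m - 2)\<close>, while one of the two factorials in the squared denominator is
  left over.\<close>

lemma G_coeff_le:
  assumes "\<kappa>\<^sup>2 \<le> 1"
  shows "(G_coeff \<kappa> m)\<^sup>2 * fact m \<le> 1"
proof (cases "m \<ge> 2")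
  case True
  then obtain k where m: "m = Suc (Suc k)" by (metis Suc_diff_le diff_Suc_Suc le_add_diff_inverse numeral_2_eq_2 plus_nat.simps(2) add_2_eq_Suc)
  have "(G_coeff \<kappa> m)\<^sup>2 * fact m = (std_normal_density 0)\<^sup>2 * ((hermite k 0)\<^sup>2 / fact m)"
    unfolding G_coeff_def m
    by (simp add: power_mult_distrib power_divide power2_eq_square[of "fact _"] del: fact_Suc)
       (simp add: power2_eq_square power_mult_distrib[symmetric] del: fact_Suc)
  also have "\<dots> \<le> 1 * (fact k / fact m)"
    by (intro mult_mono std_normal_density_0_sq divide_right_mono hermite_0_square_le) auto
  also have "\<dots> \<le> 1"
    by (simp add: m fact_mono del: fact_Suc)
  finally show ?thesis .
next
  case False
  then have "m = 0 \<or> m = 1" by auto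
  then show ?thesis using assms std_normal_density_0_sq by (auto simp: G_coeff_def)
qed

lemma G_poly_in_class: "\<kappa>\<^sup>2 \<le> 1 \<Longrightarrow> G_poly v K \<kappa> \<in> hermite_class v K"
  unfolding hermite_class_def G_poly_def using G_coeff_le by blast

text \<open>The factor \<open>Suc m\<close> produced by differentiation is absorbed by the factorial
  in \<open>G_coeff\<close>, so the derivative obeys the same normalization. It is needed to bound
  increments of the estimate in \<open>x\<close>.\<close>

lemma pderiv_G_poly_in_class:
  assumes "\<kappa>\<^sup>2 \<le> 1"
  shows "pderiv (G_poly v K \<kappa>) \<in> hermite_class v K"
proof -
  \<comment> \<open>Cut off at \<open>K\<close>, because differentiation lowers the degree by
    one.\<close>
  let ?a = "\<lambda>m. if m < K then real (Suc m) * G_coeff \<kappa> (Suc m) else 0"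
  have "pderiv (\<Sum>m\<le>K. smult (G_coeff \<kappa> m) (hermite_poly v m))
      = (\<Sum>m\<le>K. smult (G_coeff \<kappa> m * real m) (hermite_poly v (m - 1)))"
    by (simp add: higher_pderiv_sum[of 1, simplified] pderiv_smult pderiv_hermite_poly)
  also have "\<dots> = (\<Sum>m\<le>K. smult (?a m) (hermite_poly v m))"
  proof (cases K)
    case (Suc L)
    have "(\<Sum>m\<le>Suc L. smult (G_coeff \<kappa> m * real m) (hermite_poly v (m - 1)))
        = (\<Sum>m\<le>L. smult (real (Suc m) * G_coeff \<kappa> (Suc m)) (hermite_poly v m))"
      by (subst sum.atMost_Suc_shift) (simp add: mult_ac)
    also have "\<dots> = (\<Sum>m\<le>L. smult (?a m) (hermite_poly v m))"
      by (rule sum.cong) (auto simp: Suc)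
    also have "\<dots> = (\<Sum>m\<le>Suc L. smult (?a m) (hermite_poly v m))"
      by (simp add: Suc)
    finally show ?thesis by (simp add: Suc)
  qed simp
  finally have eq: "pderiv (G_poly v K \<kappa>) = (\<Sum>m\<le>K. smult (?a m) (hermite_poly v m))"
    unfolding G_poly_def .
  have "(?a m)\<^sup>2 * fact m \<le> 1" for m
  proof (cases "m = 0 \<or> \<not> m < K")
    case True
    then show ?thesis using assms by (auto simp: G_coeff_def)
  next
    case False
    then obtain k where m: "m = Suc k" by (cases m) auto
    have "(?a m)\<^sup>2 * fact m = (std_normal_density 0)\<^sup>2 * ((hermite k 0)\<^sup>2 / fact m)"
      using False unfolding G_coeff_def m
      by (simp add: fact_Suc[of "Suc k"] del: fact_Suc of_nat_Suc)
         (simp add: power2_eq_square mult_ac power_mult_distrib[symmetric] del: fact_Suc of_nat_Suc)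
    also have "\<dots> \<le> 1 * (fact k / fact m)"
      by (intro mult_mono std_normal_density_0_sq divide_right_mono hermite_0_square_le) auto
    also have "\<dots> \<le> 1"
      by (simp add: m fact_mono del: fact_Suc)
    finally show ?thesis .
  qed
  then show ?thesis unfolding eq hermite_class_def by (intro CollectI exI[of _ ?a] conjI refl allI) auto
qed

text \<open>Two index shifts split off the constant and the linear term; with
  \<open>trunc_order\<close> at least \<open>2\<close> the upper limits of the sums then
  agree.\<close>

lemma S_poly_eq_poly:
  assumes "trunc_order \<nu>p \<nu>f \<gamma> n \<ge> 2" "G 0 \<beta> = std_normal_density 0" "deriv (\<lambda>w. G w \<beta>) 0 = 1 / 2 - \<beta>"
  shows "S_poly \<nu>p \<nu>f \<beta> \<gamma> n \<tau> u
    = poly (G_poly ((s_coef \<nu>p \<nu>f \<tau>)\<^sup>2) (trunc_order \<nu>p \<nu>f \<gamma> n) (1 / 2 - \<beta>)) u"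
proof -
  obtain L where L: "trunc_order \<nu>p \<nu>f \<gamma> n = Suc (Suc L)"
    using assms(1) by (metis Suc_diff_le diff_Suc_Suc le_add_diff_inverse numeral_2_eq_2 plus_nat.simps(2) add_2_eq_Suc)
  show ?thesis
    unfolding S_poly_def G_poly_def L assms(2,3)
    by (simp add: poly_sum sum.atMost_Suc_shift atLeast0AtMost scaled_hermite_eq_poly G_coeff_def
        sum_distrib_left mult_ac del: sum.atMost_Suc fact_Suc hermite_poly.simps(3))
qed

section \<open>The function G\<close>

lemma DERIV_std_normal_density:
  "(std_normal_density has_real_derivative - w * std_normal_density w) (at w)"
  unfolding std_normal_density_def
  by (auto intro!: derivative_eq_intros simp: field_simps)

lemma continuous_on_std_normal_density: "continuous_on S std_normal_density"
  unfolding std_normal_density_def by (intro continuous_intros) auto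

text \<open>From the finite base point \<open>w - 1\<close> the increment of the cdf is an ordinary
  interval integral, to which the fundamental theorem applies; near \<open>w\<close> this determines
  the derivative.\<close>

lemma DERIV_std_normal_cdf:
  "(std_normal_cdf has_real_derivative std_normal_density w) (at w)"
proof -
  let ?a = "w - 1" and ?b = "w + 1"
  have eq: "std_normal_cdf x = std_normal_cdf ?a + (LBINT y=?a..x. std_normal_density y)" if "?a < x" for x
  proof -
    have "std_normal_cdf x - std_normal_cdf ?a = measure N01 {?a<..x}"
      using N01.cdf_diff_eq[of ?a x] that by (simp add: std_normal_cdf_def)
    also have "\<dots> = (\<integral>z. indicator {?a<..x} z \<partial>N01)"
      by simp
    also have "\<dots> = (LBINT y:{?a<..x}. std_normal_density y)"
      by (subst integral_N01) (simp_all add: set_lebesgue_integral_def mult.commute)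
    also have "\<dots> = (LBINT y=?a..x. std_normal_density y)"
      using that by (simp add: interval_integral_Ioc)
    finally show ?thesis by simp
  qed
  have "((\<lambda>u. LBINT y=?a..u. std_normal_density y) has_vector_derivative std_normal_density w) (at w within {?a..?b})"
    by (rule interval_integral_FTC2) (auto intro: continuous_on_std_normal_density)
  then have "((\<lambda>u. LBINT y=?a..u. std_normal_density y) has_real_derivative std_normal_density w) (at w)"
    by (simp add: has_real_derivative_iff_has_vector_derivative at_within_Icc_at)
  then have "((\<lambda>u. std_normal_cdf ?a + (LBINT y=?a..u. std_normal_density y)) has_real_derivative std_normal_density w) (at w)"
    using DERIV_add[OF DERIV_const] by fastforce
  moreover have "eventually (\<lambda>u. std_normal_cdf u = std_normal_cdf ?a + (LBINT y=?a..u. std_normal_density y)) (nhds w)"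
    using eventually_nhds_in_open[of "{?a<..}" w] by (auto elim!: eventually_mono intro!: eq)
  ultimately show ?thesis
    by (subst DERIV_cong_ev[OF refl _ refl]) auto
qed

lemma std_normal_cdf_bounds: "0 \<le> std_normal_cdf w" "std_normal_cdf w \<le> 1"
  by (simp_all add: std_normal_cdf_def N01.cdf_nonneg N01.cdf_bounded_prob)

lemma std_normal_cdf_strict_mono: "x < y \<Longrightarrow> std_normal_cdf x < std_normal_cdf y"
  by (rule DERIV_pos_imp_increasing[of x y std_normal_cdf])
    (auto intro!: exI[of _ "std_normal_density _"] DERIV_std_normal_cdf normal_density_pos)

lemma std_normal_cdf_lim_at_top: "(std_normal_cdf \<longlongrightarrow> 1) at_top"
  and std_normal_cdf_lim_at_bot: "(std_normal_cdf \<longlongrightarrow> 0) at_bot"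
  unfolding std_normal_cdf_def by (rule N01.cdf_lim_at_top_prob N01.cdf_lim_at_bot)+

text \<open>The function \<open>?f\<close> has derivative zero because the density is even; its
  constant value is read off at infinity.\<close>

lemma std_normal_cdf_minus: "std_normal_cdf (- w) = 1 - std_normal_cdf w"
proof -
  let ?f = "\<lambda>w. std_normal_cdf w + std_normal_cdf (- w)"
  have "(?f has_real_derivative 0) (at x)" for x
    by (auto intro!: derivative_eq_intros DERIV_chain2[OF DERIV_std_normal_cdf] DERIV_std_normal_cdf
        simp: std_normal_density_def)
  then obtain c where c: "?f = (\<lambda>_. c)"
    using DERIV_isconst_all by blast
  have "(?f \<longlongrightarrow> 1 + 0) at_top"
    by (intro tendsto_intros std_normal_cdf_lim_at_top
        filterlim_compose[OF std_normal_cdf_lim_at_bot filterlim_uminus_at_bot_at_top])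
  then have "c = 1" unfolding c by (simp add: tendsto_const_iff)
  then show ?thesis using fun_cong[OF c, of w] by simp
qed

lemma std_normal_cdf_0: "std_normal_cdf 0 = 1 / 2"
  using std_normal_cdf_minus[of 0] by simp

lemma std_normal_cdf_surj:
  assumes "0 < \<beta>" "\<beta> < 1"
  obtains w where "std_normal_cdf w = \<beta>"
proof -
  obtain a where a: "std_normal_cdf a < \<beta>"
    using order_tendstoD(2)[OF std_normal_cdf_lim_at_bot assms(1)] by (auto simp: eventually_at_bot_linorder)
  obtain b where b: "std_normal_cdf b > \<beta>"
    using order_tendstoD(1)[OF std_normal_cdf_lim_at_top assms(2)] by (auto simp: eventually_at_top_linorder)
  have "a < b" using std_normal_cdf_strict_mono[of b a] a b by (cases a b rule: linorder_cases) auto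
  then have "\<exists>w\<ge>a. w \<le> b \<and> std_normal_cdf w = \<beta>"
    using a b by (intro IVT) (auto intro: DERIV_isCont DERIV_std_normal_cdf)
  then show ?thesis using that by blast
qed

lemma std_normal_cdf_quantile:
  assumes "0 < \<beta>" "\<beta> < 1"
  shows "std_normal_cdf (std_normal_quantile \<beta>) = \<beta>"
  using std_normal_cdf_surj[OF assms] unfolding std_normal_quantile_def by (metis f_inv_into_f rangeI)

text \<open>Strict monotonicity traps the quantile between a point where the cdf is below
  \<open>l\<close> and one where it is above \<open>u\<close>; both exist by the limits of the
  cdf.\<close>

lemma std_normal_quantile_bounded:
  assumes "0 < l" "u < 1"
  obtains q where "q > 0" "\<And>\<beta>. l \<le> \<beta> \<Longrightarrow> \<beta> \<le> u \<Longrightarrow> \<bar>std_normal_quantile \<beta>\<bar> \<le> q"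
proof -
  obtain a where a: "std_normal_cdf a < l"
    using order_tendstoD(2)[OF std_normal_cdf_lim_at_bot assms(1)] by (auto simp: eventually_at_bot_linorder)
  obtain b where b: "std_normal_cdf b > u"
    using order_tendstoD(1)[OF std_normal_cdf_lim_at_top assms(2)] by (auto simp: eventually_at_top_linorder)
  have "\<bar>std_normal_quantile \<beta>\<bar> \<le> \<bar>a\<bar> + \<bar>b\<bar> + 1" if "l \<le> \<beta>" "\<beta> \<le> u" for \<beta>
  proof -
    have "std_normal_cdf (std_normal_quantile \<beta>) = \<beta>"
      using that assms by (intro std_normal_cdf_quantile) auto
    then have "a < std_normal_quantile \<beta>" "std_normal_quantile \<beta> < b"
      using a b that std_normal_cdf_strict_mono[of "std_normal_quantile \<beta>" a]
        std_normal_cdf_strict_mono[of b "std_normal_quantile \<beta>"]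
      by (cases "std_normal_quantile \<beta>" a rule: linorder_cases; force)
        (cases "std_normal_quantile \<beta>" b rule: linorder_cases; use a b that std_normal_cdf_strict_mono[of b "std_normal_quantile \<beta>"] \<open>std_normal_cdf (std_normal_quantile \<beta>) = \<beta>\<close> in force)
    then show ?thesis by linarith
  qed
  then show ?thesis using that[of "\<bar>a\<bar> + \<bar>b\<bar> + 1"] by auto
qed

lemma DERIV_G: "((\<lambda>w. G w \<beta>) has_real_derivative (std_normal_cdf w - \<beta>)) (at w)"
  unfolding G_def
  by (auto intro!: derivative_eq_intros DERIV_std_normal_density DERIV_std_normal_cdf)

lemma G_0: "G 0 \<beta> = std_normal_density 0"
  by (simp add: G_def)

lemma deriv_G_0: "deriv (\<lambda>w. G w \<beta>) 0 = 1 / 2 - \<beta>"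
  using DERIV_imp_deriv[OF DERIV_G[of \<beta> 0]] by (simp add: std_normal_cdf_0)

lemma G_Lipschitz:
  assumes "0 \<le> \<beta>" "\<beta> \<le> 1"
  shows "\<bar>G x \<beta> - G y \<beta>\<bar> \<le> \<bar>x - y\<bar>"
proof -
  have "\<bar>std_normal_cdf w - \<beta>\<bar> \<le> 1" for w
    using std_normal_cdf_bounds[of w] assms by linarith
  then have "norm (G x \<beta> - G y \<beta>) \<le> 1 * norm (x - y)"
    by (intro field_differentiable_bound[of UNIV "\<lambda>w. G w \<beta>" "\<lambda>w. std_normal_cdf w - \<beta>"])
      (auto intro: DERIV_G)
  then show ?thesis by simp
qed

lemma continuous_on_G: "continuous_on S (\<lambda>w. G w \<beta>)"
  by (intro continuous_at_imp_continuous_on ballI DERIV_isCont[OF DERIV_G])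

lemma borel_measurable_G [measurable]: "(\<lambda>w. G w \<beta>) \<in> borel_measurable borel"
  by (intro borel_measurable_continuous_onI continuous_on_G)

lemma G_beta: "G w \<beta> = G w 0 - \<beta> * w"
  by (simp add: G_def)

text \<open>Turns the error \<open>G \<mu> 0 - \<mu>\<close> of the right linear branch into a value
  of \<open>G\<close> at \<open>- \<mu>\<close>, so that both outer branches share one tail
  estimate.\<close>

lemma G_minus: "G (- w) 0 = G w 0 - w"
  by (simp add: G_def std_normal_cdf_minus std_normal_density_def algebra_simps)

lemma std_normal_density_tendsto_0: "(std_normal_density \<longlongrightarrow> 0) at_top"
proof -
  have "filterlim (\<lambda>x::real. x\<^sup>2 / 2) at_top at_top" by real_asymp
  then have "((\<lambda>x::real. exp (- (x\<^sup>2 / 2))) \<longlongrightarrow> 0) at_top"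
    by (intro filterlim_compose[OF exp_at_bot]) (simp add: filterlim_uminus_at_bot)
  from tendsto_mult_right_zero[OF this, of "1 / sqrt (2 * pi)"] show ?thesis
    by (simp add: std_normal_density_def[abs_def])
qed

text \<open>This is \<open>E (w + Z)\<^sup>+\<close>, the form in which \<^const>\<open>G\<close> is averaged against Gaussians.\<close>

lemma nn_integral_N01_pos_part: "(\<integral>\<^sup>+z. ennreal (max 0 (w + z)) \<partial>N01) = ennreal (G w 0)"
proof -
  let ?F = "\<lambda>z. w * std_normal_cdf z - std_normal_density z"
  have "(\<integral>\<^sup>+z. ennreal (max 0 (w + z)) \<partial>N01)
      = (\<integral>\<^sup>+z. ennreal ((w + z) * std_normal_density z) * indicator {- w..} z \<partial>lborel)"
    by (subst nn_integral_N01)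
      (auto intro!: nn_integral_cong simp: indicator_def max_def ennreal_mult'[symmetric] mult.commute)
  also have "\<dots> = ennreal ((w * 1 - 0) - ?F (- w))"
  proof (rule nn_integral_FTC_atLeast)
    show "(\<lambda>z. (w + z) * std_normal_density z) \<in> borel_measurable borel" by measurable
    show "(?F has_real_derivative (w + x) * std_normal_density x) (at x)" for x
      by (auto intro!: derivative_eq_intros DERIV_std_normal_density DERIV_std_normal_cdf simp: algebra_simps)
    show "0 \<le> (w + x) * std_normal_density x" if "- w \<le> x" for x
      using that by simp
    show "(?F \<longlongrightarrow> w * 1 - 0) at_top"
      by (intro tendsto_intros std_normal_cdf_lim_at_top std_normal_density_tendsto_0)
  qed
  also have "(w * 1 - 0) - ?F (- w) = G w 0"
    by (simp add: G_def std_normal_cdf_minus std_normal_density_def algebra_simps)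
  finally show ?thesis .
qed

lemma std_normal_cdf_tail: "t \<ge> 0 \<Longrightarrow> std_normal_cdf (- t) \<le> exp (- t\<^sup>2 / 2)"
  using N01_tail[of t "-1"]
  by (simp add: std_normal_cdf_def cdf_def atMost_def le_minus_iff)

lemma G_mono: "x \<le> y \<Longrightarrow> G x 0 \<le> G y 0"
  by (rule DERIV_nonneg_imp_nondecreasing[of x y "\<lambda>w. G w 0"])
    (auto intro!: exI[of _ "std_normal_cdf _"] DERIV_G[of 0, simplified] std_normal_cdf_bounds)

text \<open>By monotonicity a negative value would persist to the left, where
  \<open>- t * std_normal_cdf (- t)\<close> is at least \<open>- 2 / t\<close>.\<close>

lemma G_nonneg: "G w 0 \<ge> 0"
proof (rule ccontr)
  assume neg: "\<not> G w 0 \<ge> 0"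
  \<comment> \<open>Large enough that \<open>2 / t\<close> is at most half of
    \<open>- G w 0\<close>.\<close>
  define t where "t = max 1 (max (- w) (4 / - G w 0))"
  have t: "t \<ge> 1" "- t \<le> w" "4 / - G w 0 \<le> t" by (auto simp: t_def)
  have "1 + t\<^sup>2 / 2 \<le> exp (t\<^sup>2 / 2)" by (rule exp_ge_add_one_self)
  then have "exp (- t\<^sup>2 / 2) \<le> 1 / (1 + t\<^sup>2 / 2)"
    by (simp add: exp_minus divide_simps add_pos_nonneg)
  then have "t * std_normal_cdf (- t) \<le> t * (1 / (1 + t\<^sup>2 / 2))"
    using t std_normal_cdf_tail[of t] by (intro mult_left_mono) auto
  also have "\<dots> \<le> 2 / t"
    using t by (simp add: divide_simps power2_eq_square add_pos_nonneg)
  also have "\<dots> \<le> - G w 0 / 2"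
    using t neg by (simp add: field_simps)
  finally have "- t * std_normal_cdf (- t) \<ge> G w 0 / 2" by simp
  moreover have "G (- t) 0 \<ge> - t * std_normal_cdf (- t)" by (simp add: G_def)
  moreover have "G (- t) 0 \<le> G w 0" by (rule G_mono) (rule t)
  ultimately show False using neg by linarith
qed

lemma G_le_neg: "w \<le> 0 \<Longrightarrow> G w 0 \<le> exp (- w\<^sup>2 / 2)"
proof -
  assume "w \<le> 0"
  then have "G w 0 \<le> std_normal_density w"
    using std_normal_cdf_bounds[of w] by (simp add: G_def mult_nonpos_nonneg)
  also have "\<dots> \<le> 1 * exp (- w\<^sup>2 / 2)"
    unfolding std_normal_density_def using pi_gt3 by (intro mult_right_mono) auto
  finally show ?thesis by simp
qed

lemma G_le_pos: "w \<ge> 0 \<Longrightarrow> G w 0 \<le> 1 + w"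
proof -
  assume w: "w \<ge> 0"
  have "G w 0 = w + G (- w) 0" by (simp add: G_minus)
  also have "G (- w) 0 \<le> 1" using G_le_neg[of "- w"] w by (auto intro: order_trans)
  finally show ?thesis by simp
qed

lemma nn_integral_N01_add:
  assumes [measurable]: "F \<in> borel_measurable borel" and ab: "a > 0" "b > 0"
  shows "(\<integral>\<^sup>+x. \<integral>\<^sup>+z. F (a * x + b * z) \<partial>N01 \<partial>N01) = (\<integral>\<^sup>+z. F (sqrt (a\<^sup>2 + b\<^sup>2) * z) \<partial>N01)"
proof -
  have dens: "normal_density (a * x) b y = normal_density 0 b (y - a * x)" for x y
    by (simp add: normal_density_def)
  have "(\<integral>\<^sup>+x. \<integral>\<^sup>+z. F (a * x + b * z) \<partial>N01 \<partial>N01)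
      = (\<integral>\<^sup>+x. \<integral>\<^sup>+y. ennreal (normal_density 0 b (y - a * x)) * F y \<partial>lborel \<partial>N01)"
    using ab by (simp add: nn_integral_lborel_shift_scale[symmetric] dens)
  also have "\<dots> = (\<integral>\<^sup>+y. \<integral>\<^sup>+x. ennreal (normal_density 0 b (y - a * x)) * F y \<partial>N01 \<partial>lborel)"
  proof -
    interpret pair_sigma_finite lborel N01
      by (intro pair_sigma_finite.intro sigma_finite_lborel N01.sigma_finite_measure_axioms)
    show ?thesis by (rule Fubini') simp
  qed
  also have "\<dots> = (\<integral>\<^sup>+y. (\<integral>\<^sup>+x. ennreal (normal_density 0 b (y - a * x)) \<partial>N01) * F y \<partial>lborel)"
    by (simp add: nn_integral_multc)
  also have "\<dots> = (\<integral>\<^sup>+y. ennreal (normal_density 0 (sqrt (a\<^sup>2 + b\<^sup>2)) y) * F y \<partial>lborel)"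
  proof (intro nn_integral_cong)
    fix y
    have "(\<integral>\<^sup>+x. ennreal (normal_density 0 b (y - a * x)) \<partial>N01)
        = (\<integral>\<^sup>+x. ennreal (normal_density 0 b (y - x) * normal_density 0 a x) \<partial>lborel)"
      using ab nn_integral_lborel_shift_scale[of "\<lambda>x. ennreal (normal_density 0 b (y - x))" a 0]
      by (simp add: ennreal_mult' mult.commute)
    also have "\<dots> = ennreal (normal_density 0 (sqrt (b\<^sup>2 + a\<^sup>2)) y)"
      using fun_cong[OF conv_normal_density_zero_mean[OF ab(2,1)], of y] by simp
    finally show "(\<integral>\<^sup>+x. ennreal (normal_density 0 b (y - a * x)) \<partial>N01) * F y
        = ennreal (normal_density 0 (sqrt (a\<^sup>2 + b\<^sup>2)) y) * F y"
      by (simp add: add.commute)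
  qed
  also have "\<dots> = (\<integral>\<^sup>+z. F (0 + sqrt (a\<^sup>2 + b\<^sup>2) * z) \<partial>N01)"
    using ab by (intro nn_integral_lborel_shift_scale) (auto simp: add_pos_pos)
  finally show ?thesis by simp
qed

lemma ennreal_scaled_G:
  assumes "c > 0"
  shows "ennreal (c * G (m / c) 0) = (\<integral>\<^sup>+z. ennreal (max 0 (m + c * z)) \<partial>N01)"
proof -
  have "ennreal (c * G (m / c) 0) = ennreal c * (\<integral>\<^sup>+z. ennreal (max 0 (m / c + z)) \<partial>N01)"
    unfolding nn_integral_N01_pos_part using assms by (simp add: ennreal_mult')
  also have "\<dots> = (\<integral>\<^sup>+z. ennreal c * ennreal (max 0 (m / c + z)) \<partial>N01)"
    by (rule nn_integral_cmult[symmetric]) measurable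
  also have "\<dots> = (\<integral>\<^sup>+z. ennreal (max 0 (m + c * z)) \<partial>N01)"
  proof (intro nn_integral_cong)
    fix z
    have "c * max 0 (m / c + z) = max 0 (m + c * z)"
      using assms by (auto simp: max_def field_simps)
    then show "ennreal c * ennreal (max 0 (m / c + z)) = ennreal (max 0 (m + c * z))"
      using assms by (metis ennreal_mult' less_imp_le)
  qed
  finally show ?thesis .
qed

text \<open>At \<open>\<beta> = 0\<close> the scaled \<open>G\<close> is the mean of a Gaussian
  positive part, and averaging over independent noise merely adds variances. The term linear in
  \<beta> changes sign and is therefore averaged separately, as a Bochner integral.\<close>

lemma G_smoothing:
  assumes "\<nu> > 0" "\<rho> \<ge> 0"
  shows "has_bochner_integral N01 (\<lambda>x. sqrt \<nu> * G ((m + \<rho> * x) / sqrt \<nu>) \<beta>)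
    (sqrt (\<nu> + \<rho>\<^sup>2) * G (m / sqrt (\<nu> + \<rho>\<^sup>2)) \<beta>)"
proof -
  let ?s = "sqrt (\<nu> + \<rho>\<^sup>2)"
  have s: "?s > 0" using assms by (simp add: add_pos_nonneg)
  have 0: "has_bochner_integral N01 (\<lambda>x. sqrt \<nu> * G ((m + \<rho> * x) / sqrt \<nu>) 0) (?s * G (m / ?s) 0)"
  proof (rule has_bochner_integral_nn_integral)
    have "(\<integral>\<^sup>+x. ennreal (sqrt \<nu> * G ((m + \<rho> * x) / sqrt \<nu>) 0) \<partial>N01)
        = (\<integral>\<^sup>+x. \<integral>\<^sup>+z. ennreal (max 0 (m + (\<rho> * x + sqrt \<nu> * z))) \<partial>N01 \<partial>N01)"
      using assms by (simp add: ennreal_scaled_G add.assoc)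
    also have "\<dots> = (\<integral>\<^sup>+z. ennreal (max 0 (m + ?s * z)) \<partial>N01)"
    \<comment> \<open>The convolution lemma wants two nondegenerate Gaussians.\<close>
    proof (cases "\<rho> = 0")
      case True
      then show ?thesis using N01.emeasure_space_1 by simp
    next
      case False
      then show ?thesis
        using assms nn_integral_N01_add[of "\<lambda>y. ennreal (max 0 (m + y))" \<rho> "sqrt \<nu>"]
        by (simp add: add.commute)
    qed
    also have "\<dots> = ennreal (?s * G (m / ?s) 0)"
      by (rule ennreal_scaled_G[symmetric, OF s])
    finally show "(\<integral>\<^sup>+x. ennreal (sqrt \<nu> * G ((m + \<rho> * x) / sqrt \<nu>) 0) \<partial>N01) = ennreal (?s * G (m / ?s) 0)" .
  qed (use assms s in \<open>auto intro!: G_nonneg mult_nonneg_nonneg\<close>)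
  have mean: "has_bochner_integral N01 (\<lambda>x. m + \<rho> * x) (m + \<rho> * 0)"
  proof -
    have "has_bochner_integral N01 (\<lambda>x. x) 0"
      using integrable_N01_power[of 1] N01_moment_Suc[of 0] by (simp add: has_bochner_integral_iff)
    moreover have "has_bochner_integral N01 (\<lambda>x. m) m"
      by (simp add: has_bochner_integral_iff N01.prob_space[simplified])
    ultimately show ?thesis
      by (intro has_bochner_integral_add has_bochner_integral_mult_right) auto
  qed
  have "has_bochner_integral N01 (\<lambda>x. sqrt \<nu> * G ((m + \<rho> * x) / sqrt \<nu>) 0 - \<beta> * (m + \<rho> * x))
      (?s * G (m / ?s) 0 - \<beta> * (m + \<rho> * 0))"
    by (intro has_bochner_integral_diff 0 has_bochner_integral_mult_right mean)
  moreover have "sqrt \<nu> * G (y / sqrt \<nu>) \<beta> = sqrt \<nu> * G (y / sqrt \<nu>) 0 - \<beta> * y" for y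
    using assms by (subst G_beta) (simp add: algebra_simps)
  moreover have "?s * G (m / ?s) \<beta> = ?s * G (m / ?s) 0 - \<beta> * m"
    using s by (subst G_beta) (simp add: algebra_simps)
  ultimately show ?thesis by simp
qed

subsection \<open>Taylor expansion\<close>

lemma hermite_0: "hermite (2 * j) 0 = (- 1) ^ j * fact (2 * j) / (2 ^ j * fact j)" "hermite (Suc (2 * j)) 0 = 0"
proof -
  show "hermite (2 * j) 0 = (- 1) ^ j * fact (2 * j) / (2 ^ j * fact j)"
  proof (induction j)
    case (Suc j)
    have "hermite (2 * Suc j) 0 = - (2 * real j + 1) * hermite (2 * j) 0"
      by (simp add: algebra_simps)
    also have "\<dots> = - (2 * real j + 1) * ((- 1) ^ j * fact (2 * j) / (2 ^ j * fact j))"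
      by (simp only: Suc)
    also have "\<dots> = (- 1) ^ Suc j * (2 * real (Suc j) * (2 * real j + 1) * fact (2 * j)) / (2 ^ Suc j * (real (Suc j) * fact j))"
      by (simp add: divide_simps) (simp add: algebra_simps)
    also have "2 * real (Suc j) * (2 * real j + 1) * fact (2 * j) = fact (2 * Suc j)"
      by (simp add: algebra_simps)
    finally show ?case by simp
  qed simp
  show "hermite (Suc (2 * j)) 0 = 0"
    by (induction j) simp_all
qed

text \<open>Slope \<open>1 / 2\<close> belongs to \<open>\<beta> = 0\<close>, so this is the Taylor
  polynomial of \<open>G w 0\<close>. Other values of \<beta> only add a linear term, which
  contributes no Taylor error.\<close>

definition G_taylor :: "nat \<Rightarrow> real \<Rightarrow> real" where
  "G_taylor K w = (\<Sum>m\<le>K. G_coeff (1 / 2) m * w ^ m)"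

lemma sum_G_coeff:
  assumes "K \<ge> 1"
  shows "(\<Sum>m\<le>K. G_coeff \<kappa> m * w ^ m) = G_taylor K w + (\<kappa> - 1 / 2) * w"
proof -
  have *: "(\<Sum>m\<le>K. G_coeff \<kappa>' m * w ^ m) = (\<Sum>m\<in>{..K} - {1}. G_coeff 0 m * w ^ m) + \<kappa>' * w" for \<kappa>'
    using assms by (subst sum.remove[of _ 1]) (auto intro!: sum.cong simp: G_coeff_def split: if_splits)
  show ?thesis unfolding G_taylor_def by (simp only: *) (simp add: algebra_simps)
qed

lemma gauss_mean_G_poly:
  assumes "K \<ge> 1"
  shows "gauss_mean \<mu> s (G_poly (s\<^sup>2) K \<kappa>) = G_taylor K \<mu> + (\<kappa> - 1 / 2) * \<mu>"
  unfolding G_poly_def hermite_class_mean using assms by (rule sum_G_coeff)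

lemma sum_even_terms:
  fixes a :: "nat \<Rightarrow> real"
  assumes "\<And>j. a (Suc (2 * j)) = 0"
  shows "(\<Sum>k\<le>L. a k) = (\<Sum>j\<le>L div 2. a (2 * j))"
proof -
  have "(\<Sum>k\<le>2 * M. a k) = (\<Sum>j\<le>M. a (2 * j))" for M
    by (induction M) (simp_all add: assms)
  note e = this
  show ?thesis
  proof (cases "even L")
    case True
    then show ?thesis using e[of "L div 2"] by simp
  next
    case False
    then obtain M where "L = Suc (2 * M)" by (auto elim: oddE)
    then show ?thesis using e[of M] assms[of M] by simp
  qed
qed

text \<open>Odd Hermite polynomials vanish at \<open>0\<close> and the even ones have closed values,
  so the twice differentiated expansion collapses to a partial exponential series in
  \<open>- w\<^sup>2 / 2\<close>.\<close>

lemma G_taylor_second_deriv_sum: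
  "(\<Sum>k\<le>L. G_coeff \<kappa> (Suc (Suc k)) * real (Suc (Suc k)) * real (Suc k) * w ^ k)
   = std_normal_density 0 * (\<Sum>j<Suc (L div 2). (- (w\<^sup>2) / 2) ^ j / fact j)"
proof -
  let ?a = "\<lambda>k. (- 1) ^ k * hermite k 0 / fact k * w ^ k"
  have h1: "G_coeff \<kappa> (Suc (Suc k)) * real (Suc (Suc k)) * real (Suc k) * w ^ k = std_normal_density 0 * ?a k" for k
  proof -
    have *: "A / (x * (y * f)) * x * y * z = A / f * z" if "x \<noteq> 0" "y \<noteq> 0" for A x y f z :: real
      using that by simp
    show ?thesis
      unfolding G_coeff_def fact_Suc of_nat_mult
      by (subst if_not_P, simp, subst if_not_P, simp, subst *) (simp_all add: mult.assoc)
  qed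
  have h2: "(\<Sum>k\<le>L. ?a k) = (\<Sum>j\<le>L div 2. ?a (2 * j))"
    by (rule sum_even_terms) (simp add: hermite_0)
  have h3: "?a (2 * j) = (- (w\<^sup>2) / 2) ^ j / fact j" for j
  proof -
    have "(- (w\<^sup>2) / 2) ^ j = (- 1) ^ j * (w\<^sup>2) ^ j / 2 ^ j"
      by (simp only: power_divide power_minus[of "w\<^sup>2"])
    then show ?thesis by (simp add: hermite_0 power_mult)
  qed
  show ?thesis
    unfolding h1 sum_distrib_left[symmetric] h2 h3 lessThan_Suc_atMost ..
qed

lemma DERIV_power_sum:
  fixes a :: "nat \<Rightarrow> real"
  shows "((\<lambda>w. \<Sum>m\<le>Suc n. a m * w ^ m) has_real_derivative (\<Sum>k\<le>n. a (Suc k) * real (Suc k) * t ^ k)) (at t)"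
proof (induction n)
  case 0
  show ?case by (auto intro!: derivative_eq_intros)
next
  case (Suc n)
  have "((\<lambda>w. a (Suc (Suc n)) * w ^ Suc (Suc n)) has_real_derivative
      a (Suc (Suc n)) * real (Suc (Suc n)) * t ^ Suc n) (at t)"
    by (rule derivative_eq_intros refl)+ simp
  from DERIV_add[OF Suc this] show ?case by (simp only: sum.atMost_Suc)
qed

text \<open>The error is reduced to its second derivative, which is the remainder of an exponential
  series with \<open>J\<close> terms, of size \<open>(R\<^sup>2 / 2) ^ J / fact J\<close> up to a
  factor \<open>exp (R\<^sup>2 / 2)\<close>. The \<open>(exp 1)\<^sup>2\<close> in the condition on
  \<open>K\<close>, hence the one in \<open>trunc_order\<close>, is what makes this quotient at most
  \<open>exp (- J)\<close>.\<close>

lemma G_taylor_error: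
  assumes K: "K \<ge> 2" and R: "\<bar>w\<bar> \<le> R" "(exp 1)\<^sup>2 * R\<^sup>2 \<le> real K - 1"
  shows "\<bar>G w 0 - G_taylor K w\<bar> \<le> exp (- 2 * R\<^sup>2)"
proof -
  obtain L where L: "K = Suc (Suc L)"
    using K by (metis add_2_eq_Suc le_add_diff_inverse)
  define J where "J = Suc (L div 2)"
  have J: "J \<ge> 1" "real K - 1 \<le> 2 * real J"
    by (auto simp: J_def L)
  define B where "B = exp (R\<^sup>2 / 2) / fact J * (R\<^sup>2 / 2) ^ J"
  have R0: "R \<ge> 0" using R by linarith
  \<comment> \<open>The error and its first two derivatives, in the shape that Maclaurin's formula
    expects.\<close>
  define diff where "diff = (\<lambda>(m::nat) w. if m = 0 then G w 0 - G_taylor K w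
    else if m = 1 then std_normal_cdf w - (\<Sum>k\<le>Suc L. G_coeff (1 / 2) (Suc k) * real (Suc k) * w ^ k)
    else std_normal_density w - (\<Sum>k\<le>L. G_coeff (1 / 2) (Suc (Suc k)) * real (Suc (Suc k)) * real (Suc k) * w ^ k))"
  have d0: "(diff 0 has_real_derivative diff 1 t) (at t)" for t
  proof -
    have "((\<lambda>w. \<Sum>m\<le>K. G_coeff (1 / 2) m * w ^ m) has_real_derivative
        (\<Sum>k\<le>Suc L. G_coeff (1 / 2) (Suc k) * real (Suc k) * t ^ k)) (at t)"
      unfolding L by (rule DERIV_power_sum)
    from DERIV_diff[OF DERIV_G[of 0 t] this] show ?thesis
      unfolding diff_def G_taylor_def by (simp del: sum.atMost_Suc of_nat_Suc)
  qed
  have d1: "(diff 1 has_real_derivative diff (Suc 1) t) (at t)" for t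
  proof -
    have "((\<lambda>w. \<Sum>k\<le>Suc L. G_coeff (1 / 2) (Suc k) * real (Suc k) * w ^ k) has_real_derivative
        (\<Sum>k\<le>L. G_coeff (1 / 2) (Suc (Suc k)) * real (Suc (Suc k)) * real (Suc k) * t ^ k)) (at t)"
      using DERIV_power_sum[where n = L and t = t and a = "\<lambda>k. G_coeff (1 / 2) (Suc k) * real (Suc k)"] by simp
    from DERIV_diff[OF DERIV_std_normal_cdf[of t] this] show ?thesis
      unfolding diff_def by (simp del: sum.atMost_Suc of_nat_Suc)
  qed
  have "\<forall>m t. m < 2 \<and> \<bar>t\<bar> \<le> \<bar>w\<bar> \<longrightarrow> DERIV (diff m) t :> diff (Suc m) t"
    using d0 d1 by (auto simp: less_2_cases_iff)
  from Maclaurin_bi_le[OF refl this] obtain t where t: "\<bar>t\<bar> \<le> \<bar>w\<bar>"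
    and eq: "diff 0 w = (\<Sum>m<2. diff m 0 / fact m * w ^ m) + diff 2 t / fact 2 * w ^ 2" by auto
  have z: "diff 0 0 = 0" "diff 1 0 = 0"
    unfolding diff_def G_taylor_def L
    by (simp_all add: sum.atMost_Suc_shift G_coeff_def G_0 std_normal_cdf_0 del: sum.atMost_Suc)
  have t2: "t\<^sup>2 \<le> R\<^sup>2" "w\<^sup>2 \<le> R\<^sup>2"
    using t R by (auto intro: power2_le_iff_abs_le[THEN iffD2] simp: abs_le_square_iff[symmetric])
  have "\<bar>diff 2 t\<bar> \<le> B"
  proof -
    let ?y = "- (t\<^sup>2) / 2"
    obtain u where u: "\<bar>u\<bar> \<le> \<bar>?y\<bar>" "exp ?y = (\<Sum>m<J. ?y ^ m / fact m) + exp u / fact J * ?y ^ J"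
      using Maclaurin_exp_le[of ?y J] by auto
    have "diff 2 t = std_normal_density 0 * (exp ?y - (\<Sum>m<J. ?y ^ m / fact m))"
    proof -
      have "diff 2 t = std_normal_density t
          - (\<Sum>k\<le>L. G_coeff (1 / 2) (Suc (Suc k)) * real (Suc (Suc k)) * real (Suc k) * t ^ k)"
        by (simp only: diff_def) simp
      also have "std_normal_density t = std_normal_density 0 * exp ?y"
        by (simp add: std_normal_density_def)
      finally show ?thesis
        unfolding G_taylor_second_deriv_sum J_def by (simp only: right_diff_distrib)
    qed
    also have "\<bar>\<dots>\<bar> = std_normal_density 0 * (exp u / fact J * (t\<^sup>2 / 2) ^ J)"
      unfolding u(2) by (simp add: abs_mult power_abs)
    also have "\<dots> \<le> 1 * (exp (R\<^sup>2 / 2) / fact J * (R\<^sup>2 / 2) ^ J)"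
    proof -
      have "(t\<^sup>2 / 2) ^ J \<le> (R\<^sup>2 / 2) ^ J" using t2 by (intro power_mono) auto
      moreover have "exp u \<le> exp (R\<^sup>2 / 2)" using u(1) t2 by simp
      ultimately show ?thesis
        by (intro mult_mono std_normal_density_0_le divide_right_mono) auto
    qed
    finally show ?thesis by (simp add: B_def)
  qed
  have "\<bar>diff 0 w\<bar> = \<bar>diff 2 t\<bar> / 2 * w\<^sup>2"
    unfolding eq using z(2)[unfolded One_nat_def] by (simp add: z(1) numeral_2_eq_2 abs_mult)
  also have "\<dots> \<le> B / 2 * R\<^sup>2"
    using \<open>\<bar>diff 2 t\<bar> \<le> B\<close> t2 by (intro mult_mono) auto
  also have "B \<le> exp (R\<^sup>2 / 2) * exp (- real J)"
  proof -
    \<comment> \<open>The weak Stirling bound \<open>J ^ J / fact J \<le> exp J\<close>, from one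
      term of the series.\<close>
    obtain u where "exp (real J) = (\<Sum>m<Suc J. real J ^ m / fact m) + exp u / fact (Suc J) * real J ^ Suc J"
      using Maclaurin_exp_le[of "real J" "Suc J"] by blast
    moreover have "real J ^ J / fact J \<le> (\<Sum>m<Suc J. real J ^ m / fact m)"
      by (rule member_le_sum) auto
    moreover have "exp u / fact (Suc J) * real J ^ Suc J \<ge> 0" by simp
    ultimately have e: "real J ^ J / fact J \<le> exp (real J)" by linarith
    have "exp 1 * (exp 1 * R\<^sup>2) \<le> 2 * real J"
      using R(2) J(2) by (simp add: power2_eq_square mult_ac)
    then have q: "R\<^sup>2 / (2 * real J) \<le> exp (- 2)"
      using J by (simp add: exp_minus divide_simps mult.assoc[symmetric] exp_add[symmetric] mult.commute)
    have "1 / fact J * (R\<^sup>2 / 2) ^ J = real J ^ J / fact J * (R\<^sup>2 / (2 * real J)) ^ J"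
      using J by (simp add: power_divide power_mult_distrib)
    also have "\<dots> \<le> exp (real J) * exp (- 2) ^ J"
      using e q by (intro mult_mono power_mono) auto
    also have "\<dots> = exp (- real J)"
      by (simp add: exp_of_nat_mult[symmetric] exp_add[symmetric])
    finally have "exp (R\<^sup>2 / 2) * (1 / fact J * (R\<^sup>2 / 2) ^ J) \<le> exp (R\<^sup>2 / 2) * exp (- real J)"
      by (rule mult_left_mono) simp
    then show ?thesis by (simp add: B_def)
  qed
  also have "exp (R\<^sup>2 / 2) * exp (- real J) / 2 * R\<^sup>2 \<le> exp (R\<^sup>2 / 2) * exp (- real J) * exp (R\<^sup>2 / 2)"
  proof -
    have "R\<^sup>2 / 2 \<le> exp (R\<^sup>2 / 2)" using exp_ge_add_one_self[of "R\<^sup>2 / 2"] by linarith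
    then have "exp (R\<^sup>2 / 2) * exp (- real J) * (R\<^sup>2 / 2) \<le> exp (R\<^sup>2 / 2) * exp (- real J) * exp (R\<^sup>2 / 2)"
      by (intro mult_left_mono) auto
    then show ?thesis by simp
  qed
  also have "\<dots> = exp (R\<^sup>2 - real J)"
    by (simp add: exp_add[symmetric])
  also have "\<dots> \<le> exp (- 2 * R\<^sup>2)"
  proof -
    \<comment> \<open>Since \<open>(5 / 2)\<^sup>2 = 25 / 4\<close>, this gives
      \<open>J \<ge> 25 / 8 * R\<^sup>2 \<ge> 3 * R\<^sup>2\<close>, and so the exponent
      \<open>R\<^sup>2 - J\<close> is at most \<open>- 2 * R\<^sup>2\<close>.\<close>
    have "(5 / 2 :: real) \<le> exp 1"
      using exp_lower_Taylor_quadratic[of 1] by simp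
    then have "(5 / 2 :: real)\<^sup>2 \<le> (exp 1)\<^sup>2"
      by (rule power_mono) simp
    then have "(5 / 2)\<^sup>2 * R\<^sup>2 \<le> (exp 1)\<^sup>2 * R\<^sup>2"
      by (rule mult_right_mono) simp
    then have "(25 / 4) * R\<^sup>2 \<le> 2 * real J"
      using R(2) J(2) by (simp add: power2_eq_square[of "5/2::real"])
    moreover have "R\<^sup>2 \<ge> 0" by simp
    ultimately have "3 * R\<^sup>2 \<le> real J" by linarith
    then show ?thesis by simp
  qed
  finally show ?thesis by (simp add: diff_def mult_right_mono)
qed

subsection \<open>Exponents\<close>

text \<open>Cauchy-Schwarz as \<open>(l + t)\<^sup>2 / (A + B) \<le> l\<^sup>2 / A + t\<^sup>2 /
  B\<close> with \<open>A = 1 - 5 * v\<close> and \<open>B = 4 * v\<close>. Half of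
  \<open>t\<^sup>2 / (2 * v)\<close> pays for the second term, the other half survives as decay;
  this is the origin of the factor \<open>5\<close>.\<close>

lemma quadratic_split:
  fixes l t v :: real
  assumes "0 < v" "5 * v < 1"
  shows "(l + t)\<^sup>2 / (1 - v) - t\<^sup>2 / (2 * v) \<le> l\<^sup>2 / (1 - 5 * v) - t\<^sup>2 / (4 * v)"
proof -
  have pos: "1 - v > 0" "1 - 5 * v > 0" using assms by auto
  have "l\<^sup>2 / (1 - 5 * v) + t\<^sup>2 / (4 * v) - (l + t)\<^sup>2 / (1 - v)
      = (4 * v * l - (1 - 5 * v) * t)\<^sup>2 / (4 * v * (1 - 5 * v) * (1 - v))"
    using pos assms by (simp add: divide_simps) (simp add: power2_eq_square algebra_simps)
  also have "\<dots> \<ge> 0"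
    using pos assms by (intro divide_nonneg_nonneg mult_nonneg_nonneg) auto
  finally have "(l + t)\<^sup>2 / (1 - v) \<le> l\<^sup>2 / (1 - 5 * v) + t\<^sup>2 / (4 * v)" by linarith
  moreover have "t\<^sup>2 / (2 * v) = t\<^sup>2 / (4 * v) + t\<^sup>2 / (4 * v)" by simp
  ultimately show ?thesis by linarith
qed

text \<open>The constraint on \<open>\<gamma>\<close> enters through the elementary inequality \<open>(1 - b)\<^sup>2 \<le> 1 - b\<^sup>2\<close> with
  \<open>b = sqrt (4 e \<rho>)\<close>.\<close>

lemma exponent_constraint:
  fixes \<gamma> \<rho> v :: real
  assumes "0 < \<gamma>" "0 < \<rho>" "\<gamma> + sqrt \<rho> < 1 / sqrt (4 * exp 1)" "0 < v" "v \<le> 2 * \<rho>"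
  shows "5 * v < 1" "2 * \<gamma>\<^sup>2 / (1 - 5 * v) \<le> 1 / 5"
proof -
  define c :: real where "c = sqrt (4 * exp 1)"
  have e: "(5 / 2 :: real) \<le> exp 1"
    using exp_lower_Taylor_quadratic[of 1] by simp
  \<comment> \<open>The bound \<open>4 e \<ge> 10\<close> yields both constants:
    \<open>5 * v \<le> 10 * \<rho> \<le> b\<^sup>2\<close>, and
    \<open>10 * \<gamma>\<^sup>2 \<le> a\<^sup>2\<close>.\<close>
  have c: "c > 0" "c\<^sup>2 \<ge> 10" using e by (auto simp: c_def)
  define a b where "a = c * \<gamma>" and "b = c * sqrt \<rho>"
  have "c * (\<gamma> + sqrt \<rho>) < c * (1 / c)"
    using assms(3) c(1) unfolding c_def[symmetric] by (rule mult_strict_left_mono)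
  then have ab: "a + b < 1" using c by (simp add: a_def b_def distrib_left)
  have pos: "a > 0" "b > 0" using assms c by (auto simp: a_def b_def)
  have b2: "b\<^sup>2 = c\<^sup>2 * \<rho>" using assms by (simp add: b_def power_mult_distrib)
  have "5 * v \<le> 10 * \<rho>" using assms by simp
  also have "\<dots> \<le> b\<^sup>2" unfolding b2 using c assms by (intro mult_right_mono) auto
  finally have v: "5 * v \<le> b\<^sup>2" .
  have b1: "b\<^sup>2 < 1" using ab pos by (simp add: power_less_one_iff)
  show "5 * v < 1" using v b1 by linarith
  have "a\<^sup>2 \<le> (1 - b)\<^sup>2" using ab pos by (intro power_mono) auto
  also have "\<dots> \<le> 1 - b\<^sup>2"
  proof -
    have "b * b \<le> b * 1" using ab pos by (intro mult_left_mono) auto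
    then show ?thesis by (simp add: power2_eq_square algebra_simps)
  qed
  also have "\<dots> \<le> 1 - 5 * v" using v by simp
  finally have "c\<^sup>2 * \<gamma>\<^sup>2 \<le> 1 - 5 * v" by (simp add: a_def power_mult_distrib)
  moreover have "10 * \<gamma>\<^sup>2 \<le> c\<^sup>2 * \<gamma>\<^sup>2" using c by (intro mult_right_mono) auto
  ultimately show "2 * \<gamma>\<^sup>2 / (1 - 5 * v) \<le> 1 / 5"
    using \<open>5 * v < 1\<close> by (simp add: field_simps)
qed

section \<open>The estimate at one coordinate\<close>

lemma borel_measurable_poly [measurable (raw)]:
  fixes p :: "real poly"
  assumes "f \<in> borel_measurable M"
  shows "(\<lambda>x. poly p (f x)) \<in> borel_measurable M"
  by (rule measurable_compose[OF assms])
    (intro borel_measurable_continuous_onI continuous_intros)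

text \<open>Jensen's inequality for an arbitrary measurable function: if the square is not
  integrable, the right-hand side is infinite.\<close>

lemma N01_square_integral_le:
  assumes [measurable]: "g \<in> borel_measurable borel"
  shows "ennreal ((\<integral>z. g z \<partial>N01)\<^sup>2) \<le> (\<integral>\<^sup>+z. ennreal ((g z)\<^sup>2) \<partial>N01)"
proof (cases "integrable N01 g \<and> integrable N01 (\<lambda>z. (g z)\<^sup>2)")
  case True
  let ?m = "\<integral>z. g z \<partial>N01"
  have "0 \<le> (\<integral>z. (g z - ?m)\<^sup>2 \<partial>N01)" by simp
  also have "\<dots> = (\<integral>z. (g z)\<^sup>2 \<partial>N01) - ?m\<^sup>2"
    using True by (intro N01.variance_eq) auto
  finally have "ennreal (?m\<^sup>2) \<le> ennreal (\<integral>z. (g z)\<^sup>2 \<partial>N01)" by (intro ennreal_leI) simp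
  also have "\<dots> = (\<integral>\<^sup>+z. ennreal ((g z)\<^sup>2) \<partial>N01)"
    using True by (intro nn_integral_eq_integral[symmetric]) auto
  finally show ?thesis .
next
  case False
  show ?thesis
  proof (cases "integrable N01 (\<lambda>z. (g z)\<^sup>2)")
    case True
    have "integrable N01 g"
      by (rule N01.square_integrable_imp_integrable[OF _ True]) simp
    then show ?thesis using False True by simp
  next
    case False
    then have "(\<integral>\<^sup>+z. ennreal ((g z)\<^sup>2) \<partial>N01) = \<infinity>"
      using assms by (auto simp: integrable_iff_bounded less_top[symmetric])
    then show ?thesis by simp
  qed
qed

lemma nn_integral_N01_square_poly:
  "(\<integral>\<^sup>+a. ennreal ((poly p (\<mu> + s * a))\<^sup>2) \<partial>N01) = ennreal (gauss_mean \<mu> s (p\<^sup>2))"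
  unfolding gauss_mean_def using integrable_N01_poly_affine[of "p\<^sup>2" \<mu> s]
  by (subst nn_integral_eq_integral) simp_all

lemma nn_integral_N01_square: "(\<integral>\<^sup>+z. ennreal (z\<^sup>2) \<partial>N01) = 1"
  using nn_integral_N01_square_poly[of "[:0, 1:]" 0 1] N01_moment_Suc[of 1]
  by (simp add: gauss_mean_def power2_eq_square N01.prob_space[simplified])

lemma gauss_tail_left:
  assumes "s \<noteq> 0" "t \<ge> 0"
  shows "measure N01 {b. \<mu> + s * b \<le> \<mu> - t} \<le> exp (- t\<^sup>2 / (2 * s\<^sup>2))"
proof -
  have "{b. \<mu> + s * b \<le> \<mu> - t} = {b. t \<le> - s * b}" by auto
  then show ?thesis using N01_tail[of t "- s"] assms by simp
qed

lemma gauss_tail_right: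
  assumes "s \<noteq> 0" "t \<ge> 0"
  shows "measure N01 {b. \<mu> + s * b \<ge> \<mu> + t} \<le> exp (- t\<^sup>2 / (2 * s\<^sup>2))"
  using N01_tail[of t s] assms by (simp add: algebra_simps)

text \<open>To reach the interval, the Gaussian must deviate by at least \<open>|\<mu>| - l\<close>
  in one fixed direction.\<close>

lemma gauss_interval:
  assumes "s \<noteq> 0" "\<bar>\<mu>\<bar> \<ge> l" "l \<ge> 0"
  shows "measure N01 {b. \<bar>\<mu> + s * b\<bar> \<le> l} \<le> exp (- (\<bar>\<mu>\<bar> - l)\<^sup>2 / (2 * s\<^sup>2))"
proof (cases "\<mu> \<ge> 0")
  case True
  have "measure N01 {b. \<bar>\<mu> + s * b\<bar> \<le> l} \<le> measure N01 {b. \<mu> + s * b \<le> \<mu> - (\<bar>\<mu>\<bar> - l)}"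
    using True by (intro N01.finite_measure_mono) auto
  also have "\<dots> \<le> exp (- (\<bar>\<mu>\<bar> - l)\<^sup>2 / (2 * s\<^sup>2))"
    using assms by (intro gauss_tail_left) auto
  finally show ?thesis .
next
  case False
  have "measure N01 {b. \<bar>\<mu> + s * b\<bar> \<le> l} \<le> measure N01 {b. \<mu> + s * b \<ge> \<mu> + (\<bar>\<mu>\<bar> - l)}"
    using False by (intro N01.finite_measure_mono) auto
  also have "\<dots> \<le> exp (- (\<bar>\<mu>\<bar> - l)\<^sup>2 / (2 * s\<^sup>2))"
    using assms by (intro gauss_tail_right) auto
  finally show ?thesis .
qed

text \<open>\<open>U x Z\<close> and \<open>V x Z\<close> are the two halves of the data-splitting construction: if \<open>x\<close> is itself Gaussian
  with standard deviation \<open>\<sigma>\<close>, they are independent with common variance \<open>s\<^sup>2\<close>. The signed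
  parameter \<open>s\<close> has absolute value \<open>s_coef\<close>.\<close>

locale coord =
  fixes c d \<sigma> \<beta> l :: real and K :: nat
  assumes \<sigma>: "\<sigma> > 0" and d: "d < 0" and v: "5 * (2 * d\<^sup>2 * \<sigma>\<^sup>2) < 1"
    and \<beta>: "0 \<le> \<beta>" "\<beta> \<le> 1" and l: "l \<ge> 0" and K: "K \<ge> 2"
begin

definition "s = sqrt 2 * d * \<sigma>"
definition "U x z = c + d * (x + \<sigma> * z)"
definition "V x z = c + d * (x - \<sigma> * z)"
text \<open>The common bound for all second moments on the middle branch; its exponential comes from
  \<open>interval_weight\<close>.\<close>

definition "M = (real K + 1)\<^sup>2 * exp (l\<^sup>2 / (1 - 5 * s\<^sup>2))"

lemma s_sq: "s\<^sup>2 = 2 * d\<^sup>2 * \<sigma>\<^sup>2" and s_nz: "s \<noteq> 0" and s_pos: "0 < s\<^sup>2" and s5: "5 * s\<^sup>2 < 1" and s1: "s\<^sup>2 < 1"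
  using \<sigma> d v by (auto simp: s_def power_mult_distrib)

lemma M_nonneg: "M \<ge> 0" by (simp add: M_def)

lemma measurable_U [measurable]: "U x \<in> borel_measurable borel" and measurable_V [measurable]: "V x \<in> borel_measurable borel"
  unfolding U_def[abs_def] V_def[abs_def] by simp_all

lemma U_affine: "U (m + \<sigma> * x) z = (c + d * m) + s * ((x + z) / sqrt 2)"
  and V_affine: "V (m + \<sigma> * x) z = (c + d * m) + s * ((x - z) / sqrt 2)"
  by (simp_all add: U_def V_def s_def) (simp_all add: algebra_simps)

lemma UV_nn_integral:
  assumes F[measurable]: "case_prod F \<in> borel_measurable (borel \<Otimes>\<^sub>M borel)"
  shows "(\<integral>\<^sup>+x. \<integral>\<^sup>+z. F (U (m + \<sigma> * x) z) (V (m + \<sigma> * x) z) \<partial>N01 \<partial>N01)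
    = (\<integral>\<^sup>+a. \<integral>\<^sup>+b. F (c + d * m + s * a) (c + d * m + s * b) \<partial>N01 \<partial>N01)"
  unfolding U_affine V_affine
  using nn_integral_N01_rotate[of "\<lambda>a b. F (c + d * m + s * a) (c + d * m + s * b)"] by simp

text \<open>The first factor is the growth of Hermite second moments in the mean, the second the
  probability of the middle branch. For \<mu> outside the interval the Gaussian decay wins by
  \<open>quadratic_split\<close>, so the product is bounded uniformly in \<mu>.\<close>

lemma interval_weight:
  assumes "\<mu> = c + d * m"
  shows "exp (\<mu>\<^sup>2 / (1 - s\<^sup>2)) * measure N01 {b. \<bar>\<mu> + s * b\<bar> \<le> l} \<le> exp (l\<^sup>2 / (1 - 5 * s\<^sup>2))"
proof (cases "\<bar>\<mu>\<bar> \<le> l")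
  case True
  have "\<mu>\<^sup>2 / (1 - s\<^sup>2) \<le> l\<^sup>2 / (1 - 5 * s\<^sup>2)"
    using True s5 s1 l by (intro frac_le) (auto simp: abs_le_square_iff[symmetric])
  then have "exp (\<mu>\<^sup>2 / (1 - s\<^sup>2)) * measure N01 {b. \<bar>\<mu> + s * b\<bar> \<le> l} \<le> exp (l\<^sup>2 / (1 - 5 * s\<^sup>2)) * 1"
    by (intro mult_mono) auto
  then show ?thesis by simp
next
  case False
  have "exp (\<mu>\<^sup>2 / (1 - s\<^sup>2)) * measure N01 {b. \<bar>\<mu> + s * b\<bar> \<le> l}
      \<le> exp (\<mu>\<^sup>2 / (1 - s\<^sup>2)) * exp (- (\<bar>\<mu>\<bar> - l)\<^sup>2 / (2 * s\<^sup>2))"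
    using False l s_nz by (intro mult_left_mono gauss_interval) auto
  also have "\<dots> = exp ((l + (\<bar>\<mu>\<bar> - l))\<^sup>2 / (1 - s\<^sup>2) - (\<bar>\<mu>\<bar> - l)\<^sup>2 / (2 * s\<^sup>2))"
    by (simp add: exp_add[symmetric])
  also have "\<dots> \<le> exp (l\<^sup>2 / (1 - 5 * s\<^sup>2))"
  proof -
    have "0 \<le> (\<bar>\<mu>\<bar> - l)\<^sup>2 / (4 * s\<^sup>2)" by simp
    then show ?thesis
      using quadratic_split[OF s_pos s5, of l "\<bar>\<mu>\<bar> - l"] by (simp only: exp_le_cancel_iff)
  qed
  finally show ?thesis .
qed

text \<open>As \<open>U\<close> and \<open>V\<close> are independent, the integral factors into a
  Hermite second moment and a probability. Neither needs to be controlled alone, only their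
  product.\<close>

lemma UV_second_moment:
  assumes p: "p \<in> hermite_class (s\<^sup>2) K" and A: "A \<in> sets borel" "A \<subseteq> {- l..l}"
  shows "(\<integral>\<^sup>+x. \<integral>\<^sup>+z. ennreal (indicator A (V (m + \<sigma> * x) z) * (poly p (U (m + \<sigma> * x) z))\<^sup>2) \<partial>N01 \<partial>N01) \<le> ennreal M"
proof -
  let ?\<mu> = "c + d * m"
  note A(1)[measurable]
  have "(\<integral>\<^sup>+x. \<integral>\<^sup>+z. ennreal (indicator A (V (m + \<sigma> * x) z) * (poly p (U (m + \<sigma> * x) z))\<^sup>2) \<partial>N01 \<partial>N01)
    = (\<integral>\<^sup>+a. \<integral>\<^sup>+b. ennreal (indicator A (?\<mu> + s * b) * (poly p (?\<mu> + s * a))\<^sup>2) \<partial>N01 \<partial>N01)"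
    by (rule UV_nn_integral[where F = "\<lambda>u v. ennreal (indicator A v * (poly p u)\<^sup>2)"]) simp
  also have "\<dots> \<le> (\<integral>\<^sup>+a. \<integral>\<^sup>+b. ennreal ((poly p (?\<mu> + s * a))\<^sup>2) * indicator {b. \<bar>?\<mu> + s * b\<bar> \<le> l} b \<partial>N01 \<partial>N01)"
    using A(2) by (intro nn_integral_mono) (auto simp: indicator_def abs_le_iff)
  also have "\<dots> = (\<integral>\<^sup>+a. ennreal ((poly p (?\<mu> + s * a))\<^sup>2) * ennreal (measure N01 {b. \<bar>?\<mu> + s * b\<bar> \<le> l}) \<partial>N01)"
    by (simp add: nn_integral_cmult N01.emeasure_eq_measure)
  also have "\<dots> = ennreal (gauss_mean ?\<mu> s (p\<^sup>2)) * ennreal (measure N01 {b. \<bar>?\<mu> + s * b\<bar> \<le> l})"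
    by (simp add: nn_integral_multc nn_integral_N01_square_poly)
  also have "\<dots> = ennreal (gauss_mean ?\<mu> s (p\<^sup>2) * measure N01 {b. \<bar>?\<mu> + s * b\<bar> \<le> l})"
    by (simp add: ennreal_mult'')
  also have "\<dots> \<le> ennreal ((real K + 1)\<^sup>2 * exp (?\<mu>\<^sup>2 / (1 - s\<^sup>2)) * measure N01 {b. \<bar>?\<mu> + s * b\<bar> \<le> l})"
    by (intro ennreal_leI mult_right_mono hermite_class_second_moment s1 p) simp
  also have "\<dots> \<le> ennreal M"
    unfolding M_def mult.assoc by (intro ennreal_leI mult_left_mono interval_weight) auto
  finally show ?thesis .
qed

text \<open>Every branch of \<open>T_hat\<close> before clipping has this form: a polynomial in
  \<open>U\<close> on the event that \<open>V\<close> lies in \<open>A\<close>, averaged over the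
  auxiliary noise.\<close>

definition "vpart A p x = (\<integral>z. indicator A (V x z) * poly p (U x z) \<partial>N01)"

lemma U_poly: "U x z = (c + d * x) + (d * \<sigma>) * z"
  by (simp add: U_def algebra_simps)

lemma integrable_vpart:
  assumes [measurable]: "A \<in> sets borel"
  shows "integrable N01 (\<lambda>z. indicator A (V x z) * poly p (U x z))"
proof (rule Bochner_Integration.integrable_bound)
  show "integrable N01 (\<lambda>z. poly p (U x z))"
    unfolding U_poly by (rule integrable_N01_poly_affine)
qed (auto simp: indicator_def)

lemma vpart_measurable [measurable]:
  assumes [measurable]: "A \<in> sets borel"
  shows "vpart A p \<in> borel_measurable borel"
  unfolding vpart_def[abs_def] U_def V_def by measurable

lemma vpart_square_le:
  assumes [measurable]: "A \<in> sets borel"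
  shows "ennreal ((vpart A p x)\<^sup>2) \<le> (\<integral>\<^sup>+z. ennreal (indicator A (V x z) * (poly p (U x z))\<^sup>2) \<partial>N01)"
  unfolding vpart_def
  by (rule order_trans[OF N01_square_integral_le]) (auto intro!: nn_integral_mono simp: indicator_def)

lemma vpart_second_moment:
  assumes "p \<in> hermite_class (s\<^sup>2) K" "A \<in> sets borel" "A \<subseteq> {- l..l}"
  shows "(\<integral>\<^sup>+x. ennreal ((vpart A p (m + \<sigma> * x))\<^sup>2) \<partial>N01) \<le> ennreal M"
  using nn_integral_mono[of N01, OF vpart_square_le[OF assms(2)]] UV_second_moment[OF assms]
  by (rule order_trans)

subsection \<open>Increments\<close>

text \<open>Majorant for the derivative of \<open>vpart\<close> in \<open>x\<close>. If
  \<open>V\<close> is kept fixed, \<open>U\<close> moves at rate \<open>2 * d\<close>, which gives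
  the first term; the second is the derivative of the Gaussian density.\<close>

definition "vdpart A p x = (\<integral>\<^sup>+z. ennreal (indicator A (V x z) *
  (2 * \<bar>d\<bar> * \<bar>poly (pderiv p) (U x z)\<bar> + \<bar>poly p (U x z)\<bar> * \<bar>z\<bar> / \<sigma>)) \<partial>N01)"

lemma vdpart_measurable [measurable]:
  assumes [measurable]: "A \<in> sets borel"
  shows "vdpart A p \<in> borel_measurable borel"
  unfolding vdpart_def[abs_def] U_def V_def by measurable

text \<open>Substituting \<open>y = x - \<sigma> z\<close> moves the dependence on \<open>x\<close> from the indicator into a smooth kernel.\<close>

definition "kern p x y = poly p (c + d * (2 * x - y)) * (std_normal_density ((x - y) / \<sigma>) / \<sigma>)"

lemma vpart_eq_kern:
  assumes [measurable]: "A \<in> sets borel"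
  shows "vpart A p x = (\<integral>y. indicator A (c + d * y) * kern p x y \<partial>lborel)"
    and "integrable lborel (\<lambda>y. indicator A (c + d * y) * kern p x y)"
proof -
  let ?f = "\<lambda>y. indicator A (c + d * y) * kern p x y"
  have sub: "?f (x + (- \<sigma>) * z) = std_normal_density z * (indicator A (V x z) * poly p (U x z)) / \<sigma>" for z
    using \<sigma> by (simp add: kern_def U_def V_def algebra_simps)
  have "(\<integral>y. ?f y \<partial>lborel) = \<sigma> * (\<integral>z. ?f (x + (- \<sigma>) * z) \<partial>lborel)"
    using \<sigma> by (subst lborel_integral_real_affine[where c="- \<sigma>" and t=x]) auto
  also have "\<dots> = vpart A p x"
    unfolding sub vpart_def using \<sigma> by (subst integral_N01) (simp_all add: integral_divide_zero)
  finally show "vpart A p x = (\<integral>y. ?f y \<partial>lborel)" ..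
  have "integrable lborel (\<lambda>z. ?f (x + (- \<sigma>) * z))"
    unfolding sub using integrable_vpart[of A x p] by (simp add: integrable_N01_iff)
  then show "integrable lborel ?f"
    using \<sigma> lborel_integrable_real_affine_iff[of "- \<sigma>" ?f x] by simp
qed

definition "dkern p x y = 2 * d * poly (pderiv p) (c + d * (2 * x - y)) * (std_normal_density ((x - y) / \<sigma>) / \<sigma>)
   - poly p (c + d * (2 * x - y)) * ((x - y) / \<sigma>\<^sup>2) * (std_normal_density ((x - y) / \<sigma>) / \<sigma>)"

lemma DERIV_kern: "((\<lambda>x. kern p x y) has_real_derivative dkern p x y) (at x)"
proof -
  have "((\<lambda>x. std_normal_density ((x - y) / \<sigma>)) has_real_derivative
      - ((x - y) / \<sigma>) * std_normal_density ((x - y) / \<sigma>) * (1 / \<sigma>)) (at x)"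
    by (rule DERIV_chain2[OF DERIV_std_normal_density]) (use \<sigma> in \<open>auto intro!: derivative_eq_intros\<close>)
  moreover have "((\<lambda>x. poly p (c + d * (2 * x - y))) has_real_derivative poly (pderiv p) (c + d * (2 * x - y)) * (d * 2)) (at x)"
    by (rule DERIV_chain2[OF poly_DERIV]) (auto intro!: derivative_eq_intros)
  ultimately show ?thesis
    unfolding kern_def[abs_def] dkern_def using \<sigma>
    by (auto intro!: derivative_eq_intros simp: power2_eq_square field_simps)
qed

lemma continuous_dkern: "continuous_on S (\<lambda>x. dkern p x y)"
  unfolding dkern_def std_normal_density_def using \<sigma> by (intro continuous_intros) auto

lemma kern_increment:
  assumes "a \<le> b"
  shows "ennreal \<bar>kern p b y - kern p a y\<bar> \<le> (\<integral>\<^sup>+t. indicator {a..b} t * ennreal \<bar>dkern p t y\<bar> \<partial>lborel)"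
proof -
  have "(\<integral>t. indicator {a..b} t *\<^sub>R dkern p t y \<partial>lborel) = kern p b y - kern p a y"
  proof (intro integral_FTC_atLeastAtMost assms continuous_dkern)
    fix t
    show "((\<lambda>x. kern p x y) has_vector_derivative dkern p t y) (at t within {a..b})"
      unfolding has_real_derivative_iff_has_vector_derivative[symmetric]
      by (rule has_field_derivative_at_within[OF DERIV_kern])
  qed
  then have "ennreal \<bar>kern p b y - kern p a y\<bar> = ennreal (norm (\<integral>t. indicator {a..b} t *\<^sub>R dkern p t y \<partial>lborel))"
    by simp
  also have "\<dots> \<le> (\<integral>\<^sup>+t. ennreal (norm (indicator {a..b} t *\<^sub>R dkern p t y)) \<partial>lborel)"
    by (rule integral_norm_bound_ennreal)
      (use borel_integrable_atLeastAtMost'[OF continuous_dkern, of a b] in \<open>simp add: set_integrable_def\<close>)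
  also have "\<dots> = (\<integral>\<^sup>+t. indicator {a..b} t * ennreal \<bar>dkern p t y\<bar> \<partial>lborel)"
    by (intro nn_integral_cong) (auto simp: indicator_def)
  finally show ?thesis .
qed

lemma dkern_integral:
  assumes [measurable]: "A \<in> sets borel"
  shows "(\<integral>\<^sup>+y. ennreal (indicator A (c + d * y) * \<bar>dkern p x y\<bar>) \<partial>lborel) \<le> vdpart A p x"
proof -
  have [measurable]: "dkern p x \<in> borel_measurable borel" 
    unfolding dkern_def[abs_def] by measurable
  have sub: "\<sigma> * \<bar>dkern p x (x + (- \<sigma>) * z)\<bar>
      \<le> std_normal_density z * (2 * \<bar>d\<bar> * \<bar>poly (pderiv p) (U x z)\<bar> + \<bar>poly p (U x z)\<bar> * \<bar>z\<bar> / \<sigma>)" for z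
  proof -
    have e: "x - (x + (- \<sigma>) * z) = \<sigma> * z" "c + d * (2 * x - (x + (- \<sigma>) * z)) = U x z"
      by (simp_all add: U_def algebra_simps)
    have "\<sigma> * \<bar>dkern p x (x + (- \<sigma>) * z)\<bar> = \<bar>std_normal_density z * (2 * d * poly (pderiv p) (U x z) - poly p (U x z) * z / \<sigma>)\<bar>"
    proof -
      have "\<sigma> * dkern p x (x + (- \<sigma>) * z) = std_normal_density z * (2 * d * poly (pderiv p) (U x z) - poly p (U x z) * z / \<sigma>)"
        unfolding dkern_def e using \<sigma> by (simp add: field_simps power2_eq_square)
      then show ?thesis using \<sigma> by (metis abs_mult abs_of_pos)
    qed
    also have "\<dots> \<le> std_normal_density z * (2 * \<bar>d\<bar> * \<bar>poly (pderiv p) (U x z)\<bar> + \<bar>poly p (U x z)\<bar> * \<bar>z\<bar> / \<sigma>)"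
      unfolding abs_mult using \<sigma>
      by (simp, intro mult_left_mono order_trans[OF abs_triangle_ineq4]) (auto simp: abs_mult)
    finally show ?thesis .
  qed
  have "(\<integral>\<^sup>+y. ennreal (indicator A (c + d * y) * \<bar>dkern p x y\<bar>) \<partial>lborel)
      = ennreal \<sigma> * (\<integral>\<^sup>+z. ennreal (indicator A (c + d * (x + (- \<sigma>) * z)) * \<bar>dkern p x (x + (- \<sigma>) * z)\<bar>) \<partial>lborel)"
    using \<sigma> by (subst nn_integral_real_affine[where c="- \<sigma>" and t=x]) auto
  also have "\<dots> = (\<integral>\<^sup>+z. ennreal (indicator A (V x z) * (\<sigma> * \<bar>dkern p x (x + (- \<sigma>) * z)\<bar>)) \<partial>lborel)"
    using \<sigma> by (subst nn_integral_cmult[symmetric])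
      (auto intro!: nn_integral_cong simp: V_def ennreal_mult'[symmetric] mult_ac)
  also have "\<dots> \<le> (\<integral>\<^sup>+z. ennreal (indicator A (V x z) * (std_normal_density z *
      (2 * \<bar>d\<bar> * \<bar>poly (pderiv p) (U x z)\<bar> + \<bar>poly p (U x z)\<bar> * \<bar>z\<bar> / \<sigma>))) \<partial>lborel)"
    by (intro nn_integral_mono ennreal_leI mult_left_mono sub) auto
  also have "\<dots> = vdpart A p x"
    unfolding vdpart_def by (subst nn_integral_N01)
      (auto intro!: nn_integral_cong simp: ennreal_mult'[symmetric] mult_ac)
  finally show ?thesis .
qed

text \<open>The kernel is differentiated along \<open>t\<close> from \<open>a\<close> to
  \<open>b\<close> and the integrals are exchanged; the indicator does not depend on
  \<open>t\<close>.\<close>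

lemma vpart_increment_ordered:
  assumes [measurable]: "A \<in> sets borel" and "a \<le> b"
  shows "ennreal \<bar>vpart A p b - vpart A p a\<bar> \<le> (\<integral>\<^sup>+t. indicator {a..b} t * vdpart A p t \<partial>lborel)"
proof -
  have [measurable]: "(\<lambda>w. dkern p (fst w) (snd w)) \<in> borel_measurable (borel \<Otimes>\<^sub>M borel)"
    unfolding dkern_def by measurable
  have [measurable]: "(\<lambda>x. dkern p x y) \<in> borel_measurable borel" for y
    unfolding dkern_def by measurable
  have [measurable]: "(\<lambda>y. dkern p x y) \<in> borel_measurable borel" for x
    unfolding dkern_def by measurable
  have "vpart A p b - vpart A p a = (\<integral>y. indicator A (c + d * y) * (kern p b y - kern p a y) \<partial>lborel)"
    by (simp add: vpart_eq_kern right_diff_distrib)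
  then have "ennreal \<bar>vpart A p b - vpart A p a\<bar> \<le> (\<integral>\<^sup>+y. ennreal (norm (indicator A (c + d * y) * (kern p b y - kern p a y))) \<partial>lborel)"
    using vpart_eq_kern(2)[of A p b] vpart_eq_kern(2)[of A p a]
    by (simp only: real_norm_def[symmetric])
      (intro integral_norm_bound_ennreal, simp add: right_diff_distrib)
  also have "\<dots> = (\<integral>\<^sup>+y. indicator A (c + d * y) * ennreal \<bar>kern p b y - kern p a y\<bar> \<partial>lborel)"
    by (intro nn_integral_cong) (auto simp: indicator_def)
  also have "\<dots> \<le> (\<integral>\<^sup>+y. indicator A (c + d * y) * (\<integral>\<^sup>+t. indicator {a..b} t * ennreal \<bar>dkern p t y\<bar> \<partial>lborel) \<partial>lborel)"
    by (intro nn_integral_mono mult_left_mono kern_increment assms) auto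
  also have "\<dots> = (\<integral>\<^sup>+y. \<integral>\<^sup>+t. indicator A (c + d * y) * (indicator {a..b} t * ennreal \<bar>dkern p t y\<bar>) \<partial>lborel \<partial>lborel)"
    by (intro nn_integral_cong nn_integral_cmult[symmetric]) measurable
  also have "\<dots> = (\<integral>\<^sup>+t. \<integral>\<^sup>+y. indicator A (c + d * y) * (indicator {a..b} t * ennreal \<bar>dkern p t y\<bar>) \<partial>lborel \<partial>lborel)"
    by (rule lborel_pair.Fubini') measurable
  also have "\<dots> = (\<integral>\<^sup>+t. indicator {a..b} t * (\<integral>\<^sup>+y. ennreal (indicator A (c + d * y) * \<bar>dkern p t y\<bar>) \<partial>lborel) \<partial>lborel)"
    by (intro nn_integral_cong, subst nn_integral_cmult[symmetric])
      (auto intro!: nn_integral_cong simp: indicator_def)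
  also have "\<dots> \<le> (\<integral>\<^sup>+t. indicator {a..b} t * vdpart A p t \<partial>lborel)"
    by (intro nn_integral_mono mult_left_mono dkern_integral) auto
  finally show ?thesis .
qed

text \<open>The increment \<open>e\<close> will be random and depend on all the data. Integrating
  over the whole window gives a bound valid for every \<open>|e| \<le> \<delta>\<close> at once,
  which is a function of \<open>x\<close> alone and therefore has a computable mean.\<close>

definition "window A p \<delta> x = (\<integral>\<^sup>+t. indicator {- \<delta>..\<delta>} t * vdpart A p (x + t) \<partial>lborel)"

lemma window_measurable [measurable]:
  assumes [measurable]: "A \<in> sets borel"
  shows "window A p \<delta> \<in> borel_measurable borel"
  unfolding window_def[abs_def] by measurable

lemma vpart_increment:
  assumes [measurable]: "A \<in> sets borel" and e: "\<bar>e\<bar> \<le> \<delta>"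
  shows "ennreal \<bar>vpart A p (x + e) - vpart A p x\<bar> \<le> window A p \<delta> x"
proof -
  have "ennreal \<bar>vpart A p (x + e) - vpart A p x\<bar> \<le> (\<integral>\<^sup>+t. indicator {x - \<delta>..x + \<delta>} t * vdpart A p t \<partial>lborel)"
  proof (cases "e \<ge> 0")
    case True
    have "ennreal \<bar>vpart A p (x + e) - vpart A p x\<bar> \<le> (\<integral>\<^sup>+t. indicator {x..x + e} t * vdpart A p t \<partial>lborel)"
      using True by (intro vpart_increment_ordered) auto
    also have "\<dots> \<le> (\<integral>\<^sup>+t. indicator {x - \<delta>..x + \<delta>} t * vdpart A p t \<partial>lborel)"
      using True e by (intro nn_integral_mono mult_right_mono) (auto simp: indicator_def)
    finally show ?thesis .
  next
    case False
    have "ennreal \<bar>vpart A p x - vpart A p (x + e)\<bar> \<le> (\<integral>\<^sup>+t. indicator {x + e..x} t * vdpart A p t \<partial>lborel)"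
      using False by (intro vpart_increment_ordered) auto
    also have "\<dots> \<le> (\<integral>\<^sup>+t. indicator {x - \<delta>..x + \<delta>} t * vdpart A p t \<partial>lborel)"
      using False e by (intro nn_integral_mono mult_right_mono) (auto simp: indicator_def)
    finally show ?thesis by (simp add: abs_minus_commute)
  qed
  also have "\<dots> = window A p \<delta> x"
    unfolding window_def
    by (subst nn_integral_real_affine[where c=1 and t=x]) (auto intro!: nn_integral_cong simp: indicator_def)
  finally show ?thesis .
qed

text \<open>Young's inequality separates the products into squares, to which the second-moment
  bounds for \<open>p\<close> and for its derivative apply.\<close>

lemma vdpart_mean:
  assumes p: "p \<in> hermite_class (s\<^sup>2) K" "pderiv p \<in> hermite_class (s\<^sup>2) K"
    and A: "A \<in> sets borel" "A \<subseteq> {- l..l}"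
  shows "(\<integral>\<^sup>+x. vdpart A p (m + \<sigma> * x) \<partial>N01) \<le> ennreal ((\<bar>d\<bar> + 1 / \<sigma>) * (M + 1))"
proof -
  note A(1)[measurable]
  let ?U = "\<lambda>x z. U (m + \<sigma> * x) z" and ?V = "\<lambda>x z. V (m + \<sigma> * x) z"
  have [measurable]: "(\<lambda>w. U (m + \<sigma> * fst w) (snd w)) \<in> borel_measurable (borel \<Otimes>\<^sub>M borel)"
    "(\<lambda>w. V (m + \<sigma> * fst w) (snd w)) \<in> borel_measurable (borel \<Otimes>\<^sub>M borel)"
    unfolding U_def V_def by measurable
  have le: "indicator A v * (2 * \<bar>d\<bar> * \<bar>q\<bar> + \<bar>p\<bar> * \<bar>z\<bar> / \<sigma>)
      \<le> \<bar>d\<bar> * (indicator A v * q\<^sup>2) + \<bar>d\<bar> + (1 / \<sigma>) * (indicator A v * p\<^sup>2) + (1 / \<sigma>) * z\<^sup>2" for v p q z :: real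
  proof (cases "v \<in> A")
    case True
    have "2 * \<bar>q\<bar> \<le> q\<^sup>2 + 1" using sum_squares_bound[of "\<bar>q\<bar>" 1] by simp
    then have "\<bar>d\<bar> * (2 * \<bar>q\<bar>) \<le> \<bar>d\<bar> * (q\<^sup>2 + 1)" by (rule mult_left_mono) simp
    moreover have "\<bar>p\<bar> * \<bar>z\<bar> \<le> p\<^sup>2 + z\<^sup>2"
      using sum_squares_bound[of "\<bar>p\<bar>" "\<bar>z\<bar>"] mult_nonneg_nonneg[OF abs_ge_zero[of p] abs_ge_zero[of z]]
      unfolding power2_abs by linarith
    then have "(1 / \<sigma>) * (\<bar>p\<bar> * \<bar>z\<bar>) \<le> (1 / \<sigma>) * (p\<^sup>2 + z\<^sup>2)"
      using \<sigma> by (intro mult_left_mono) auto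
    ultimately show ?thesis using True by (simp add: algebra_simps)
  qed (use \<sigma> in auto)
  have "(\<integral>\<^sup>+x. vdpart A p (m + \<sigma> * x) \<partial>N01)
      \<le> (\<integral>\<^sup>+x. \<integral>\<^sup>+z. ennreal \<bar>d\<bar> * ennreal (indicator A (?V x z) * (poly (pderiv p) (?U x z))\<^sup>2) + ennreal \<bar>d\<bar>
          + ennreal (1 / \<sigma>) * ennreal (indicator A (?V x z) * (poly p (?U x z))\<^sup>2)
          + ennreal (1 / \<sigma>) * ennreal (z\<^sup>2) \<partial>N01 \<partial>N01)"
    unfolding vdpart_def using \<sigma>
    by (intro nn_integral_mono order_trans[OF ennreal_leI[OF le]])
      (simp add: ennreal_mult'[symmetric] ennreal_plus[symmetric] del: ennreal_plus)
  also have "\<dots> = ennreal \<bar>d\<bar> * (\<integral>\<^sup>+x. \<integral>\<^sup>+z. ennreal (indicator A (?V x z) * (poly (pderiv p) (?U x z))\<^sup>2) \<partial>N01 \<partial>N01)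
      + ennreal \<bar>d\<bar> + ennreal (1 / \<sigma>) * (\<integral>\<^sup>+x. \<integral>\<^sup>+z. ennreal (indicator A (?V x z) * (poly p (?U x z))\<^sup>2) \<partial>N01 \<partial>N01)
      + ennreal (1 / \<sigma>)"
    using N01.emeasure_space_1
    by (simp add: nn_integral_add nn_integral_cmult nn_integral_N01_square)
  also have "\<dots> \<le> ennreal \<bar>d\<bar> * ennreal M + ennreal \<bar>d\<bar> + ennreal (1 / \<sigma>) * ennreal M + ennreal (1 / \<sigma>)"
    by (intro add_mono mult_left_mono UV_second_moment p A) auto
  also have "\<dots> = ennreal ((\<bar>d\<bar> + 1 / \<sigma>) * (M + 1))"
    using \<sigma> M_nonneg by (simp add: ennreal_mult'[symmetric] ennreal_plus[symmetric] algebra_simps del: ennreal_plus)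
  finally show ?thesis .
qed

text \<open>A shift by \<open>t\<close> only changes the mean \<open>m\<close>, in which
  \<open>vdpart_mean\<close> is uniform; \<open>2 * \<delta>\<close> is the length of the
  window.\<close>

lemma window_mean:
  assumes p: "p \<in> hermite_class (s\<^sup>2) K" "pderiv p \<in> hermite_class (s\<^sup>2) K"
    and A: "A \<in> sets borel" "A \<subseteq> {- l..l}" and \<delta>: "\<delta> \<ge> 0"
  shows "(\<integral>\<^sup>+x. window A p \<delta> (m + \<sigma> * x) \<partial>N01) \<le> ennreal (2 * \<delta> * ((\<bar>d\<bar> + 1 / \<sigma>) * (M + 1)))"
proof -
  note A(1)[measurable]
  interpret pair_sigma_finite lborel N01
    by (intro pair_sigma_finite.intro sigma_finite_lborel N01.sigma_finite_measure_axioms)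
  have "(\<integral>\<^sup>+x. window A p \<delta> (m + \<sigma> * x) \<partial>N01)
      = (\<integral>\<^sup>+t. \<integral>\<^sup>+x. indicator {- \<delta>..\<delta>} t * vdpart A p (m + \<sigma> * x + t) \<partial>N01 \<partial>lborel)"
    unfolding window_def by (rule Fubini') measurable
  also have "\<dots> = (\<integral>\<^sup>+t. indicator {- \<delta>..\<delta>} t * (\<integral>\<^sup>+x. vdpart A p ((m + t) + \<sigma> * x) \<partial>N01) \<partial>lborel)"
    by (simp add: nn_integral_cmult add_ac)
  also have "\<dots> \<le> (\<integral>\<^sup>+t. indicator {- \<delta>..\<delta>} t * ennreal ((\<bar>d\<bar> + 1 / \<sigma>) * (M + 1)) \<partial>lborel)"
    by (intro nn_integral_mono mult_left_mono vdpart_mean p A) auto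
  also have "\<dots> = ennreal (2 * \<delta>) * ennreal ((\<bar>d\<bar> + 1 / \<sigma>) * (M + 1))"
    using \<delta> by (simp add: nn_integral_multc)
  also have "\<dots> = ennreal (2 * \<delta> * ((\<bar>d\<bar> + 1 / \<sigma>) * (M + 1)))"
    using \<delta> by (simp add: ennreal_mult')
  finally show ?thesis .
qed

end

text \<open>Either \<mu> is at most \<open>- l / 2\<close> and \<open>G\<close> itself is small, or
  reaching \<open>- l\<close> takes a deviation \<open>t\<close> of at least \<open>l / 2\<close>.
  In the second case half of the exponent \<open>t\<^sup>2 / 2\<close> is spent on the growth of
  \<open>G\<close>, and \<open>t\<^sup>2 / 4\<close> is at least
  \<open>l\<^sup>2 / 16\<close>.\<close>

lemma gauss_tail_G:
  assumes s: "s \<noteq> 0" "s\<^sup>2 \<le> 1" and l: "l \<ge> 0"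
  shows "G \<mu> 0 * measure N01 {b. \<mu> + s * b < - l} \<le> 2 * exp (- l\<^sup>2 / 16)"
proof (cases "\<mu> \<le> - l / 2")
  case True
  then have "(l / 2)\<^sup>2 \<le> (- \<mu>)\<^sup>2" using l by (intro power_mono) auto
  then have "l\<^sup>2 / 4 \<le> \<mu>\<^sup>2" by (simp add: power_divide)
  have "G \<mu> 0 * measure N01 {b. \<mu> + s * b < - l} \<le> exp (- \<mu>\<^sup>2 / 2) * 1"
    using True l by (intro mult_mono G_le_neg) (auto simp: G_nonneg)
  also have "\<dots> \<le> exp (- l\<^sup>2 / 16)"
    using \<open>l\<^sup>2 / 4 \<le> \<mu>\<^sup>2\<close> zero_le_power2[of l] by (simp, linarith)
  also have "\<dots> \<le> 2 * exp (- l\<^sup>2 / 16)" by simp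
  finally show ?thesis .
next
  case False
  define t where "t = \<mu> + l"
  have t: "t \<ge> l / 2" "t \<ge> 0" using False l by (auto simp: t_def)
  have "measure N01 {b. \<mu> + s * b < - l} \<le> measure N01 {b. \<mu> + s * b \<le> \<mu> - t}"
    by (intro N01.finite_measure_mono) (auto simp: t_def)
  also have "\<dots> \<le> exp (- t\<^sup>2 / (2 * s\<^sup>2))" by (intro gauss_tail_left s t)
  also have "\<dots> \<le> exp (- t\<^sup>2 / 2)"
  proof -
    have "t\<^sup>2 / 2 \<le> t\<^sup>2 / (2 * s\<^sup>2)" using s by (intro divide_left_mono) auto
    then show ?thesis by simp
  qed
  finally have P: "measure N01 {b. \<mu> + s * b < - l} \<le> exp (- t\<^sup>2 / 2)" .
  have "G \<mu> 0 \<le> 1 + t"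
  proof (cases "\<mu> \<ge> 0")
    case True
    then show ?thesis using G_le_pos[of \<mu>] l by (simp add: t_def)
  next
    case False
    then have "G \<mu> 0 \<le> exp (- \<mu>\<^sup>2 / 2)" by (intro G_le_neg) simp
    also have "\<dots> \<le> 1" by simp
    finally show ?thesis using t by simp
  qed
  also have "1 + t \<le> 2 * (1 + t\<^sup>2 / 4)"
  proof -
    have "0 \<le> (t / 2 - 1)\<^sup>2" by simp
    also have "\<dots> = t\<^sup>2 / 4 - t + 1" by (simp add: power2_eq_square field_simps)
    finally show ?thesis using zero_le_power2[of t] by (simp, linarith)
  qed
  also have "\<dots> \<le> 2 * exp (t\<^sup>2 / 4)" by (intro mult_left_mono exp_ge_add_one_self) simp
  finally have "G \<mu> 0 * measure N01 {b. \<mu> + s * b < - l} \<le> 2 * exp (t\<^sup>2 / 4) * exp (- t\<^sup>2 / 2)"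
    using P by (intro mult_mono) (auto simp: G_nonneg)
  also have "\<dots> = 2 * exp (- t\<^sup>2 / 4)" by (simp add: exp_add[symmetric] mult.assoc)
  also have "\<dots> \<le> 2 * exp (- l\<^sup>2 / 16)"
  proof -
    have "(l / 2)\<^sup>2 \<le> t\<^sup>2" using t l by (intro power_mono) auto
    then show ?thesis by (simp add: power_divide)
  qed
  finally show ?thesis .
qed

lemma abs_le_one_plus_square: "\<bar>x\<bar> \<le> 1 + x\<^sup>2" for x :: real
proof -
  have "0 \<le> (\<bar>x\<bar> - 1)\<^sup>2" by simp
  also have "\<dots> = x\<^sup>2 + 1 - 2 * \<bar>x\<bar>" by (simp add: power2_diff)
  finally show ?thesis by linarith
qed

lemma gauss_mean_linear_poly: "gauss_mean \<mu> s [:0, a:] = a * \<mu>"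
proof -
  have "gauss_mean \<mu> s 0 = 0" by (simp add: gauss_mean_def)
  moreover have "[:0, a:] = smult a ([:0, 1:] * 1)" by simp
  ultimately show ?thesis by (simp only: gauss_mean_linear gauss_mean_stein) simp
qed

lemma abs_mult_std_normal_density_le: "\<bar>z\<bar> * std_normal_density z \<le> 1"
proof -
  have "\<bar>z\<bar> \<le> 1 + z\<^sup>2 / 2"
    using zero_le_power2[of "\<bar>z\<bar> - 1"] by (simp add: power2_eq_square algebra_simps)
  also have "\<dots> \<le> exp (z\<^sup>2 / 2)" by (rule exp_ge_add_one_self)
  finally have "\<bar>z\<bar> * exp (- z\<^sup>2 / 2) \<le> exp (z\<^sup>2 / 2) * exp (- z\<^sup>2 / 2)" by (rule mult_right_mono) simp
  then have "\<bar>z\<bar> * exp (- z\<^sup>2 / 2) \<le> 1" by (simp add: exp_add[symmetric])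
  moreover have "1 / sqrt (2 * pi) \<le> 1" using pi_gt3 by simp
  ultimately have "1 / sqrt (2 * pi) * (\<bar>z\<bar> * exp (- z\<^sup>2 / 2)) \<le> 1 * 1" by (intro mult_mono) auto
  then show ?thesis by (simp add: std_normal_density_def)
qed

lemma integrable_half_line: "integrable N01 (\<lambda>z. indicator {a..} z * z)"
proof (rule Bochner_Integration.integrable_bound)
  show "integrable N01 (\<lambda>z. z)" using integrable_N01_power[of 1] by simp
  show "AE z in N01. norm (indicator {a..} z * z) \<le> norm z"
    by (rule AE_I2) (simp add: indicator_def)
qed measurable

text \<open>Moving the endpoint changes the integral by at most the distance moved, because
  \<open>|z|\<close> times the density never exceeds \<open>1\<close>. This smooths the jump of the
  linear branches at \<open>V = 0\<close>.\<close>

lemma half_line_Lipschitz: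
  "\<bar>(\<integral>z. indicator {a..} z * z \<partial>N01) - (\<integral>z. indicator {b..} z * z \<partial>N01)\<bar> \<le> \<bar>a - b\<bar>"
proof -
  note int = integrable_half_line
  have "ennreal \<bar>(\<integral>z. indicator {a..} z * z \<partial>N01) - (\<integral>z. indicator {b..} z * z \<partial>N01)\<bar>
      = ennreal (norm (\<integral>z. (indicator {a..} z - indicator {b..} z) * z \<partial>N01))"
    using int by (simp add: left_diff_distrib)
  also have "\<dots> \<le> (\<integral>\<^sup>+z. ennreal (norm ((indicator {a..} z - indicator {b..} z) * z)) \<partial>N01)"
    using int by (intro integral_norm_bound_ennreal) (simp add: left_diff_distrib)
  also have "\<dots> = (\<integral>\<^sup>+z. ennreal (\<bar>indicator {a..} z - indicator {b..} z\<bar> * (\<bar>z\<bar> * std_normal_density z)) \<partial>lborel)"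
    by (subst nn_integral_N01) (auto intro!: nn_integral_cong simp: abs_mult ennreal_mult'[symmetric] mult_ac)
  also have "\<dots> \<le> (\<integral>\<^sup>+z. indicator {min a b..max a b} z \<partial>lborel)"
    using abs_mult_std_normal_density_le
    by (intro nn_integral_mono) (auto simp: indicator_def min_def max_def split: if_splits)
  also have "\<dots> = ennreal \<bar>a - b\<bar>"
    by (auto simp: min_def max_def)
  finally show ?thesis by simp
qed

text \<open>Only the coefficient of degree one depends on \<kappa>, and that Hermite polynomial is
  the identity for every \<open>v\<close>.\<close>

lemma poly_G_poly_shift: "K \<ge> 1 \<Longrightarrow> poly (G_poly v K \<kappa>) u = poly (G_poly v K 0) u + \<kappa> * u"
proof -
  assume K: "K \<ge> 1"
  have "poly (G_poly v K \<kappa>) u = (\<Sum>m\<in>{..K} - {1}. G_coeff 0 m * poly (hermite_poly v m) u) + \<kappa> * u" for \<kappa>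
    unfolding G_poly_def poly_sum using K
    by (subst sum.remove[of _ 1]) (auto intro!: sum.cong simp: G_coeff_def split: if_splits)
  from this[of \<kappa>] this[of 0] show ?thesis by simp
qed

section \<open>Mean, Lipschitz part and bias of the coordinate estimate; clipping\<close>

context coord
begin

text \<open>Independence of \<open>U\<close> and \<open>V\<close> again, now for integrands of
  either sign, which is why the rotation is used as an equality of measures.\<close>

lemma vpart_mean:
  assumes [measurable]: "A \<in> sets borel"
  shows "has_bochner_integral N01 (\<lambda>x. vpart A p (m + \<sigma> * x))
    (gauss_mean (c + d * m) s p * measure N01 {b. c + d * m + s * b \<in> A})"
proof -
  let ?\<mu> = "c + d * m" and ?P = "N01 \<Otimes>\<^sub>M N01"
  let ?r = "\<lambda>w. ((fst w + snd w) / sqrt 2, (fst w - snd w) / sqrt 2)"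
  let ?g = "\<lambda>w. indicator A (?\<mu> + s * snd w) * poly p (?\<mu> + s * fst w) :: real"
  interpret pair_prob_space N01 N01 ..
  have int: "integrable ?P ?g"
  proof (rule Bochner_Integration.integrable_bound)
    have "integrable (distr ?P N01 fst) (\<lambda>a. poly p (?\<mu> + s * a))"
      unfolding N01.distr_pair_fst by (rule integrable_N01_poly_affine)
    then show "integrable ?P (\<lambda>w. poly p (?\<mu> + s * fst w))"
      by (subst (asm) integrable_distr_eq) simp_all
  qed (auto simp: indicator_def)
  have r[measurable]: "?r \<in> measurable ?P (borel \<Otimes>\<^sub>M borel)" by measurable
  have g[measurable]: "?g \<in> borel_measurable (borel \<Otimes>\<^sub>M borel)" by measurable
  have rot: "distr ?P (borel \<Otimes>\<^sub>M borel) ?r = ?P" by (rule N01_pair_rotate)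
  have gr: "?g (?r (x, z)) = indicator A (V (m + \<sigma> * x) z) * poly p (U (m + \<sigma> * x) z)" for x z
    unfolding U_affine V_affine by simp
  have int': "integrable ?P (\<lambda>w. ?g (?r w))"
    using int integrable_distr[OF r, of ?g] by (simp only: rot)
  have "(\<integral>w. ?g (?r w) \<partial>?P) = (\<integral>w. ?g w \<partial>?P)"
    using integral_distr[OF r g] by (simp only: rot)
  also have "\<dots> = (\<integral>a. \<integral>b. ?g (a, b) \<partial>N01 \<partial>N01)"
    by (rule integral_fst'[symmetric, OF int])
  also have "\<dots> = (\<integral>a. measure N01 {b. ?\<mu> + s * b \<in> A} * poly p (?\<mu> + s * a) \<partial>N01)"
  proof (intro Bochner_Integration.integral_cong refl)
    fix a
    have "(\<integral>b. indicat_real A (?\<mu> + s * b) \<partial>N01) = (\<integral>b. indicator {b. ?\<mu> + s * b \<in> A} b \<partial>N01)"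
      by (intro Bochner_Integration.integral_cong) (auto simp: indicator_def)
    then show "(\<integral>b. ?g (a, b) \<partial>N01) = measure N01 {b. ?\<mu> + s * b \<in> A} * poly p (?\<mu> + s * a)"
      by simp
  qed
  also have "\<dots> = gauss_mean ?\<mu> s p * measure N01 {b. ?\<mu> + s * b \<in> A}"
    by (simp add: gauss_mean_def)
  finally have val: "(\<integral>w. ?g (?r w) \<partial>?P) = gauss_mean ?\<mu> s p * measure N01 {b. ?\<mu> + s * b \<in> A}" .
  have "(\<lambda>x. vpart A p (m + \<sigma> * x)) = (\<lambda>x. \<integral>z. ?g (?r (x, z)) \<partial>N01)"
    unfolding vpart_def gr ..
  then show ?thesis
    unfolding has_bochner_integral_iff
    using integrable_fst'[OF int'] integral_fst'[OF int'] val by simp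
qed

text \<open>The outer branches are linear in \<open>U\<close> and unbounded in the mean. Here they
  are extended inwards to meet at \<open>V = 0\<close>; \<open>Tpoly\<close> holds the corrections,
  which are confined to \<open>|V| \<le> l\<close> and so have bounded second moments.
  \<open>Tsmooth\<close> is the estimate before clipping.\<close>

definition "Tlin x = vpart UNIV [:0, - \<beta>:] x + vpart {0..} [:0, 1:] x"
definition "Tpoly x = vpart {- l..<0} (G_poly (s\<^sup>2) K (1 / 2)) x + vpart {0..l} (G_poly (s\<^sup>2) K (- 1 / 2)) x"
definition "Spoly = G_poly (s\<^sup>2) K (1 / 2 - \<beta>)"
definition "Tsmooth x = vpart {..< - l} [:0, - \<beta>:] x + vpart {l<..} [:0, 1 - \<beta>:] x + vpart {- l..l} Spoly x"

text \<open>On \<open>V \<ge> 0\<close> the linear part gains a slope of one, which the passage from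
  slope \<open>1 / 2\<close> to \<open>- 1 / 2\<close> in the corrections takes back; both inner
  pieces thus have slope \<open>1 / 2 - \<beta>\<close>.\<close>

lemma Tsmooth_eq: "Tsmooth x = Tlin x + Tpoly x"
proof -
  have K1: "K \<ge> 1" using K by simp
  let ?P = "G_poly (s\<^sup>2) K"
  have e: "indicator {..< - l} w * poly [:0, - \<beta>:] u + indicator {l<..} w * poly [:0, 1 - \<beta>:] u + indicator {- l..l} w * poly Spoly u
    = indicator UNIV w * poly [:0, - \<beta>:] u + indicator {0..} w * poly [:0, 1:] u
      + (indicator {- l..<0} w * poly (?P (1 / 2)) u + indicator {0..l} w * poly (?P (- 1 / 2)) u)" for w u :: real
    unfolding Spoly_def
    using poly_G_poly_shift[OF K1, of "s\<^sup>2" "1 / 2" u] poly_G_poly_shift[OF K1, of "s\<^sup>2" "- 1 / 2" u]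
      poly_G_poly_shift[OF K1, of "s\<^sup>2" "1 / 2 - \<beta>" u] l
    by (auto simp: indicator_def algebra_simps)
  have "Tsmooth x = (\<integral>z. indicator {..< - l} (V x z) * poly [:0, - \<beta>:] (U x z) + indicator {l<..} (V x z) * poly [:0, 1 - \<beta>:] (U x z)
      + indicator {- l..l} (V x z) * poly Spoly (U x z) \<partial>N01)"
    unfolding Tsmooth_def vpart_def
    by (simp only: Bochner_Integration.integral_add integrable_vpart Bochner_Integration.integrable_add lessThan_borel greaterThan_borel atLeastAtMost_borel)
  also have "\<dots> = Tlin x + Tpoly x"
    unfolding e Tlin_def Tpoly_def vpart_def
    by (simp only: Bochner_Integration.integral_add integrable_vpart Bochner_Integration.integrable_add
        sets.top[of borel, unfolded space_borel] atLeastAtMost_borel atLeast_borel atLeastLessThan_borel)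
  finally show ?thesis .
qed

text \<open>On \<open>V \<ge> 0\<close> write \<open>U = V + 2 * d * \<sigma> * z\<close>. The
  positive part of \<open>V\<close> moves with slope \<open>|d|\<close>, the remaining half-line
  integral contributes \<open>2 * |d|\<close> although its integrand jumps, and the global linear
  term at most \<open>|d|\<close>.\<close>

lemma Tlin_Lipschitz: "\<bar>Tlin x - Tlin y\<bar> \<le> 4 * \<bar>d\<bar> * \<bar>x - y\<bar>"
proof -
  have lin: "vpart UNIV [:0, - \<beta>:] x = - \<beta> * (c + d * x)" for x
  proof -
    have "vpart UNIV [:0, - \<beta>:] x = gauss_mean (c + d * x) (d * \<sigma>) [:0, - \<beta>:]"
      by (simp add: vpart_def gauss_mean_def U_poly)
    then show ?thesis by (simp add: gauss_mean_linear_poly)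
  qed
  have thr: "V x z \<ge> 0 \<longleftrightarrow> z \<ge> (c + d * x) / (d * \<sigma>)" for x z
  proof -
    have neg: "d * \<sigma> < 0" using d \<sigma> by (simp add: mult_neg_pos)
    have "V x z \<ge> 0 \<longleftrightarrow> d * \<sigma> * z \<le> c + d * x" by (simp add: V_def algebra_simps)
    also have "\<dots> \<longleftrightarrow> z \<ge> (c + d * x) / (d * \<sigma>)"
      using neg by (simp add: neg_divide_le_eq mult.commute)
    finally show ?thesis .
  qed
  define A where "A x = (\<integral>z. max 0 (V x z) \<partial>N01)" for x
  define B where "B x = (\<integral>z. indicator {(c + d * x) / (d * \<sigma>)..} z * z \<partial>N01)" for x
  have Vp: "V x z = (c + d * x) + (- (d * \<sigma>)) * z" for x z by (simp add: V_def algebra_simps)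
  have intV: "integrable N01 (V x)" for x
    using integrable_N01_poly_affine[of "[:0, 1:]" "c + d * x" "- (d * \<sigma>)"] unfolding Vp by simp
  have intA: "integrable N01 (\<lambda>z. max 0 (V x z))" for x
    by (rule Bochner_Integration.integrable_bound[OF intV[of x]]) auto
  note intB = integrable_half_line
  have pos: "vpart {0..} [:0, 1:] x = A x + 2 * d * \<sigma> * B x" for x
  proof -
    have "vpart {0..} [:0, 1:] x = (\<integral>z. max 0 (V x z) + 2 * d * \<sigma> * (indicator {(c + d * x) / (d * \<sigma>)..} z * z) \<partial>N01)"
      unfolding vpart_def
    proof (intro Bochner_Integration.integral_cong refl)
      fix z
      have "U x z = V x z + 2 * d * \<sigma> * z" by (simp add: U_def V_def algebra_simps)
      then show "indicator {0..} (V x z) * poly [:0, 1:] (U x z)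
          = max 0 (V x z) + 2 * d * \<sigma> * (indicator {(c + d * x) / (d * \<sigma>)..} z * z)"
        using thr[of x z] by (auto simp: indicator_def max_def)
    qed
    also have "\<dots> = A x + 2 * d * \<sigma> * B x"
      unfolding A_def B_def using intA intB by simp
    finally show ?thesis .
  qed
  have "\<bar>A x - A y\<bar> \<le> \<bar>d\<bar> * \<bar>x - y\<bar>"
  proof -
    have "\<bar>A x - A y\<bar> = \<bar>\<integral>z. max 0 (V x z) - max 0 (V y z) \<partial>N01\<bar>"
      unfolding A_def using intA by simp
    also have "\<dots> \<le> (\<integral>z. \<bar>max 0 (V x z) - max 0 (V y z)\<bar> \<partial>N01)"
      by (rule integral_abs_bound)
    also have "\<dots> \<le> (\<integral>z. \<bar>d\<bar> * \<bar>x - y\<bar> \<partial>N01)"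
    proof (intro integral_mono)
      fix z
      have "\<bar>V x z - V y z\<bar> = \<bar>d\<bar> * \<bar>x - y\<bar>"
        unfolding V_def by (simp add: abs_mult[symmetric] algebra_simps)
      then show "\<bar>max 0 (V x z) - max 0 (V y z)\<bar> \<le> \<bar>d\<bar> * \<bar>x - y\<bar>" by (auto simp: max_def)
    qed (use intA in auto)
    also have "\<dots> = \<bar>d\<bar> * \<bar>x - y\<bar>" by (simp add: N01.prob_space[simplified])
    finally show ?thesis .
  qed
  moreover have "\<bar>2 * d * \<sigma> * (B x - B y)\<bar> \<le> 2 * \<bar>d\<bar> * \<bar>x - y\<bar>"
  proof -
    have "\<bar>B x - B y\<bar> \<le> \<bar>(c + d * x) / (d * \<sigma>) - (c + d * y) / (d * \<sigma>)\<bar>"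
      unfolding B_def by (rule half_line_Lipschitz)
    also have "(c + d * x) / (d * \<sigma>) - (c + d * y) / (d * \<sigma>) = (x - y) / \<sigma>"
      using d \<sigma> by (simp add: field_simps)
    finally have "\<sigma> * \<bar>B x - B y\<bar> \<le> \<bar>x - y\<bar>" using \<sigma> by (simp add: abs_divide field_simps)
    then have "2 * \<bar>d\<bar> * (\<sigma> * \<bar>B x - B y\<bar>) \<le> 2 * \<bar>d\<bar> * \<bar>x - y\<bar>" by (rule mult_left_mono) simp
    moreover have "\<bar>2 * d * \<sigma> * (B x - B y)\<bar> = 2 * \<bar>d\<bar> * (\<sigma> * \<bar>B x - B y\<bar>)"
      using \<sigma> by (simp only: abs_mult)
    ultimately show ?thesis by simp
  qed
  moreover have "\<bar>\<beta> * (d * (x - y))\<bar> \<le> 1 * (\<bar>d\<bar> * \<bar>x - y\<bar>)"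
    unfolding abs_mult using \<beta> by (intro mult_right_mono) auto
  moreover have "Tlin x - Tlin y = - (\<beta> * (d * (x - y))) + (A x - A y) + 2 * d * \<sigma> * (B x - B y)"
    unfolding Tlin_def lin pos by (simp add: algebra_simps)
  ultimately show ?thesis by linarith
qed

lemma Tsmooth_integrable: "integrable N01 (\<lambda>x. Tsmooth (m + \<sigma> * x))"
  unfolding Tsmooth_def using vpart_mean by (auto simp: has_bochner_integral_iff)

text \<open>By independence the mean is a mixture of the three branch values with weights
  \<open>P1\<close>, \<open>P2\<close>, \<open>P3\<close>. The margin \<open>r\<close> separates
  means for which the Taylor expansion is accurate from means for which the middle branch is too
  improbable to matter.\<close>

lemma Tsmooth_bias:
  assumes r: "r \<ge> 0" and KR: "(exp 1)\<^sup>2 * (l + r)\<^sup>2 \<le> real K - 1"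
  shows "\<bar>(\<integral>x. Tsmooth (m + \<sigma> * x) \<partial>N01) - G (c + d * m) \<beta>\<bar>
    \<le> exp (- 2 * (l + r)\<^sup>2) + ((real K + 1)\<^sup>2 + 3) * exp (l\<^sup>2 / (1 - 5 * s\<^sup>2) - r\<^sup>2 / (4 * s\<^sup>2)) + 4 * exp (- l\<^sup>2 / 16)"
proof -
  define \<mu> where "\<mu> = c + d * m"
  have K1: "K \<ge> 1" using K by simp
  define P1 P2 P3 where "P1 = measure N01 {b. \<mu> + s * b < - l}" and "P2 = measure N01 {b. \<mu> + s * b > l}"
    and "P3 = measure N01 {b. \<bar>\<mu> + s * b\<bar> \<le> l}"
  have P3': "{b. \<mu> + s * b \<in> {- l..l}} = {b. \<bar>\<mu> + s * b\<bar> \<le> l}" by auto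
  have sum1: "P1 + P2 + P3 = 1"
  proof -
    have "measure N01 ({b. \<mu> + s * b < - l} \<union> {b. \<mu> + s * b > l} \<union> {b. \<bar>\<mu> + s * b\<bar> \<le> l}) = P1 + P2 + P3"
      unfolding P1_def P2_def P3_def using l
      by (subst N01.finite_measure_Union, simp, simp, force, subst N01.finite_measure_Union) auto
    moreover have "{b. \<mu> + s * b < - l} \<union> {b. \<mu> + s * b > l} \<union> {b. \<bar>\<mu> + s * b\<bar> \<le> l} = UNIV" by auto
    ultimately show ?thesis by (simp add: N01.prob_space[simplified])
  qed
  have "(\<integral>x. Tsmooth (m + \<sigma> * x) \<partial>N01)
      = - \<beta> * \<mu> * P1 + (1 - \<beta>) * \<mu> * P2 + (G_taylor K \<mu> - \<beta> * \<mu>) * P3"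
    using vpart_mean[of "{..< - l}" "[:0, - \<beta>:]" m, folded \<mu>_def] vpart_mean[of "{l<..}" "[:0, 1 - \<beta>:]" m, folded \<mu>_def]
      vpart_mean[of "{- l..l}" Spoly m, folded \<mu>_def]
    unfolding Tsmooth_def has_bochner_integral_iff P3'
    by (simp add: gauss_mean_linear_poly P1_def P2_def P3_def Spoly_def gauss_mean_G_poly[OF K1] del: atLeastAtMost_iff)
  moreover have "G \<mu> \<beta> = (G \<mu> 0 - \<beta> * \<mu>) * (P1 + P2 + P3)"
    unfolding sum1 by (subst G_beta) simp
  \<comment> \<open>In the outer branches the linear functions miss \<open>G \<mu> \<beta>\<close>
    by exactly \<open>G \<mu> 0\<close> and \<open>G (- \<mu>) 0\<close>.\<close>
  ultimately have eq: "(\<integral>x. Tsmooth (m + \<sigma> * x) \<partial>N01) - G \<mu> \<beta>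
      = (G_taylor K \<mu> - G \<mu> 0) * P3 - G \<mu> 0 * P1 - G (- \<mu>) 0 * P2"
    unfolding G_minus by (simp add: algebra_simps)
  have t1: "G \<mu> 0 * P1 \<le> 2 * exp (- l\<^sup>2 / 16)" "0 \<le> G \<mu> 0 * P1"
    unfolding P1_def using s_nz s1 l by (intro gauss_tail_G) (auto simp: G_nonneg)
  have P2': "P2 = measure N01 {b. - \<mu> + (- s) * b < - l}"
    unfolding P2_def by (rule arg_cong[where f="measure N01"]) auto
  have t2: "G (- \<mu>) 0 * P2 \<le> 2 * exp (- l\<^sup>2 / 16)" "0 \<le> G (- \<mu>) 0 * P2"
    unfolding P2' using s_nz s1 l by (intro gauss_tail_G) (auto simp: G_nonneg)
  let ?E = "exp (l\<^sup>2 / (1 - 5 * s\<^sup>2) - r\<^sup>2 / (4 * s\<^sup>2))"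
  have t3: "\<bar>(G_taylor K \<mu> - G \<mu> 0) * P3\<bar> \<le> exp (- 2 * (l + r)\<^sup>2) + ((real K + 1)\<^sup>2 + 3) * ?E"
  proof (cases "\<bar>\<mu>\<bar> \<le> l + r")
    case True
    have "\<bar>G_taylor K \<mu> - G \<mu> 0\<bar> * P3 \<le> exp (- 2 * (l + r)\<^sup>2) * 1"
      using G_taylor_error[OF K True KR] unfolding P3_def
      by (intro mult_mono) (auto simp: abs_minus_commute)
    moreover have "0 \<le> ((real K + 1)\<^sup>2 + 3) * ?E" by (intro mult_nonneg_nonneg) auto
    moreover have "\<bar>(G_taylor K \<mu> - G \<mu> 0) * P3\<bar> = \<bar>G_taylor K \<mu> - G \<mu> 0\<bar> * P3"
      by (simp add: abs_mult P3_def)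
    ultimately show ?thesis by linarith
  next
    case False
    let ?e = "exp (\<mu>\<^sup>2 / (1 - s\<^sup>2))"
    define t where "t = \<bar>\<mu>\<bar> - l"
    have t: "t \<ge> r" "t \<ge> 0" using False r by (auto simp: t_def)
    have mu: "\<mu>\<^sup>2 = (l + t)\<^sup>2" by (simp add: t_def)
    have e1: "1 + \<mu>\<^sup>2 \<le> ?e"
    proof -
      have "\<mu>\<^sup>2 * (1 - s\<^sup>2) \<le> \<mu>\<^sup>2 * 1" by (intro mult_left_mono) auto
      then have "\<mu>\<^sup>2 \<le> \<mu>\<^sup>2 / (1 - s\<^sup>2)" using s1 by (simp add: field_simps)
      then show ?thesis using exp_ge_add_one_self[of "\<mu>\<^sup>2 / (1 - s\<^sup>2)"] by linarith
    qed
    have "\<bar>G \<mu> 0\<bar> \<le> 1 + \<bar>\<mu>\<bar>"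
    proof (cases "\<mu> \<ge> 0")
      case True
      then show ?thesis using G_le_pos[OF True] G_nonneg[of \<mu>] by simp
    next
      case False
      then have "G \<mu> 0 \<le> exp (- \<mu>\<^sup>2 / 2)" by (intro G_le_neg) simp
      also have "\<dots> \<le> 1" by simp
      finally show ?thesis using G_nonneg[of \<mu>] by simp
    qed
    also have "\<dots> \<le> 2 * (1 + \<mu>\<^sup>2)"
    proof -
      have "\<bar>\<mu>\<bar> \<le> 1 + \<mu>\<^sup>2" by (rule abs_le_one_plus_square)
      then have "1 + \<bar>\<mu>\<bar> \<le> 1 + (1 + \<mu>\<^sup>2)" by (rule add_left_mono)
      also have "\<dots> \<le> 2 * (1 + \<mu>\<^sup>2)" by simp
      finally show ?thesis .
    qed
    also have "\<dots> \<le> 2 * ?e" by (rule mult_left_mono[OF e1]) simp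
    finally have g: "\<bar>G \<mu> 0\<bar> \<le> 2 * ?e" .
    \<comment> \<open>Beyond its range of accuracy the Taylor polynomial is still the mean of a
      Hermite sum, so Jensen's inequality bounds it by that sum's second moment.\<close>
    have "\<bar>G_taylor K \<mu>\<bar> \<le> 1 + (G_taylor K \<mu>)\<^sup>2"
      by (rule abs_le_one_plus_square)
    also have "(G_taylor K \<mu>)\<^sup>2 \<le> gauss_mean \<mu> s ((G_poly (s\<^sup>2) K (1 / 2))\<^sup>2)"
    proof -
      have "ennreal ((gauss_mean \<mu> s (G_poly (s\<^sup>2) K (1 / 2)))\<^sup>2) \<le> ennreal (gauss_mean \<mu> s ((G_poly (s\<^sup>2) K (1 / 2))\<^sup>2))"
        unfolding nn_integral_N01_square_poly[symmetric]
        unfolding gauss_mean_def by (rule N01_square_integral_le) measurable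
      moreover have "0 \<le> gauss_mean \<mu> s ((G_poly (s\<^sup>2) K (1 / 2))\<^sup>2)"
        by (simp add: gauss_mean_def)
      ultimately show ?thesis by (simp add: gauss_mean_G_poly[OF K1])
    qed
    also have "gauss_mean \<mu> s ((G_poly (s\<^sup>2) K (1 / 2))\<^sup>2) \<le> (real K + 1)\<^sup>2 * ?e"
      by (intro hermite_class_second_moment s1 G_poly_in_class) (simp add: power2_eq_square)
    also have "1 + (real K + 1)\<^sup>2 * ?e \<le> ?e + (real K + 1)\<^sup>2 * ?e"
    proof -
      have "1 \<le> ?e" using s1 by simp
      then show ?thesis by (rule add_right_mono)
    qed
    finally have "\<bar>G_taylor K \<mu>\<bar> \<le> ?e + (real K + 1)\<^sup>2 * ?e" by simp
    from add_mono[OF this g] have "\<bar>G_taylor K \<mu> - G \<mu> 0\<bar> \<le> ?e + (real K + 1)\<^sup>2 * ?e + 2 * ?e"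
      by (rule order_trans[OF abs_triangle_ineq4])
    also have "\<dots> = ((real K + 1)\<^sup>2 + 3) * ?e" by (simp only: distrib_right)
    finally have "\<bar>G_taylor K \<mu> - G \<mu> 0\<bar> \<le> ((real K + 1)\<^sup>2 + 3) * ?e" .
    then have "\<bar>G_taylor K \<mu> - G \<mu> 0\<bar> * P3 \<le> ((real K + 1)\<^sup>2 + 3) * ?e * exp (- t\<^sup>2 / (2 * s\<^sup>2))"
      unfolding P3_def t_def using s_nz l t by (intro mult_mono gauss_interval) (auto simp: t_def)
    also have "\<dots> = ((real K + 1)\<^sup>2 + 3) * exp ((l + t)\<^sup>2 / (1 - s\<^sup>2) - t\<^sup>2 / (2 * s\<^sup>2))"
      unfolding mu by (simp add: exp_add[symmetric] mult.assoc)
    also have "\<dots> \<le> ((real K + 1)\<^sup>2 + 3) * ?E"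
    proof (intro mult_left_mono)
      have "r\<^sup>2 / (4 * s\<^sup>2) \<le> t\<^sup>2 / (4 * s\<^sup>2)"
        using t r by (intro divide_right_mono power_mono) auto
      then show "exp ((l + t)\<^sup>2 / (1 - s\<^sup>2) - t\<^sup>2 / (2 * s\<^sup>2)) \<le> ?E"
        using quadratic_split[OF s_pos s5, of l t] by (simp only: exp_le_cancel_iff)
    qed simp
    finally have "\<bar>G_taylor K \<mu> - G \<mu> 0\<bar> * P3 \<le> ((real K + 1)\<^sup>2 + 3) * ?E" .
    moreover have "\<bar>(G_taylor K \<mu> - G \<mu> 0) * P3\<bar> = \<bar>G_taylor K \<mu> - G \<mu> 0\<bar> * P3"
      by (simp add: abs_mult P3_def)
    ultimately show ?thesis by (simp only: add_increasing[OF exp_ge_zero])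
  qed
  show ?thesis unfolding \<mu>_def[symmetric] eq using t1 t2 t3 by (simp only: abs_le_iff) linarith
qed

text \<open>Clipping acts only where \<open>|y| > N\<close>, and there
  \<open>|y| \<le> y\<^sup>2 / N\<close>. It therefore costs a second moment divided by the clipping
  level.\<close>

lemma clip_error:
  fixes y N :: real
  assumes "N > 0"
  shows "\<bar>sgn y * min \<bar>y\<bar> N - y\<bar> \<le> y\<^sup>2 / N"
proof (cases "\<bar>y\<bar> \<le> N")
  case True
  then show ?thesis using assms by (simp add: sgn_mult_abs)
next
  case False
  then have "N * \<bar>y\<bar> \<le> y\<^sup>2"
    using assms mult_right_mono[of N "\<bar>y\<bar>" "\<bar>y\<bar>"] by (simp add: power2_eq_square abs_mult_self_eq)
  then have "\<bar>y\<bar> \<le> y\<^sup>2 / N" using assms by (simp add: field_simps)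
  moreover have "\<bar>sgn y * min \<bar>y\<bar> N - y\<bar> \<le> \<bar>y\<bar>"
    using False assms by (auto simp: sgn_if)
  ultimately show ?thesis by simp
qed

definition "Tclip N x = (\<integral>z. (if V x z < - l then - \<beta> * U x z else if V x z > l then (1 - \<beta>) * U x z
   else sgn (poly Spoly (U x z)) * min \<bar>poly Spoly (U x z)\<bar> N) \<partial>N01)"

lemma Tclip_error:
  assumes N: "N > 0"
  shows "ennreal \<bar>Tclip N x - Tsmooth x\<bar> \<le> (\<integral>\<^sup>+z. ennreal (indicator {- l..l} (V x z) * (poly Spoly (U x z))\<^sup>2) \<partial>N01) / ennreal N"
proof -
  let ?f = "\<lambda>z. indicator {- l..l} (V x z) * (sgn (poly Spoly (U x z)) * min \<bar>poly Spoly (U x z)\<bar> N - poly Spoly (U x z))"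
  have int: "integrable N01 ?f"
  proof (rule Bochner_Integration.integrable_bound)
    show "integrable N01 (\<lambda>z. (poly Spoly (U x z))\<^sup>2 / N)"
      using integrable_N01_poly_affine[of "Spoly\<^sup>2" "c + d * x" "d * \<sigma>"] by (simp add: U_poly)
    show "AE z in N01. norm (?f z) \<le> norm ((poly Spoly (U x z))\<^sup>2 / N)"
      using clip_error[OF N] N by (auto simp: indicator_def)
  qed measurable
  note ints = integrable_vpart[of "{..< - l}" x "[:0, - \<beta>:]"] integrable_vpart[of "{l<..}" x "[:0, 1 - \<beta>:]"]
     integrable_vpart[of "{- l..l}" x Spoly]
  have "Tclip N x = (\<integral>z. indicator {..< - l} (V x z) * poly [:0, - \<beta>:] (U x z) + indicator {l<..} (V x z) * poly [:0, 1 - \<beta>:] (U x z)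
      + indicator {- l..l} (V x z) * poly Spoly (U x z) + ?f z \<partial>N01)"
    unfolding Tclip_def using l
    by (intro Bochner_Integration.integral_cong refl) (auto simp: indicator_def algebra_simps)
  also have "\<dots> = Tsmooth x + (\<integral>z. ?f z \<partial>N01)"
    unfolding Tsmooth_def vpart_def using ints int by simp
  finally have "ennreal \<bar>Tclip N x - Tsmooth x\<bar> = ennreal (norm (\<integral>z. ?f z \<partial>N01))" by simp
  also have "\<dots> \<le> (\<integral>\<^sup>+z. ennreal (norm (?f z)) \<partial>N01)"
    by (rule integral_norm_bound_ennreal[OF int])
  also have "\<dots> \<le> (\<integral>\<^sup>+z. ennreal (indicator {- l..l} (V x z) * (poly Spoly (U x z))\<^sup>2) / ennreal N \<partial>N01)"
    using clip_error[OF N] N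
    by (intro nn_integral_mono) (auto simp: indicator_def divide_ennreal)
  also have "\<dots> = (\<integral>\<^sup>+z. ennreal (indicator {- l..l} (V x z) * (poly Spoly (U x z))\<^sup>2) \<partial>N01) / ennreal N"
    by (rule nn_integral_divide) measurable
  finally show ?thesis .
qed

lemma Spoly_in_class: "Spoly \<in> hermite_class (s\<^sup>2) K"
  unfolding Spoly_def using \<beta> by (intro G_poly_in_class) (simp add: abs_square_le_1 abs_le_iff)

end

section \<open>Averages of independent Gaussian coordinates\<close>

definition normal_law :: "real \<Rightarrow> real \<Rightarrow> real measure" where
  "normal_law m \<sigma> = distr N01 borel (\<lambda>z. m + \<sigma> * z)"

definition gauss_vec :: "nat \<Rightarrow> (nat \<Rightarrow> real) \<Rightarrow> (nat \<Rightarrow> real) \<Rightarrow> (nat \<Rightarrow> real) measure" where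
  "gauss_vec n \<theta> \<sigma> = (\<Pi>\<^sub>M i\<in>{1..n}. normal_law (\<theta> i) (\<sigma> i))"

lemma sets_normal_law [measurable_cong, simp]: "sets (normal_law m \<sigma>) = sets borel"
  and space_normal_law [simp]: "space (normal_law m \<sigma>) = UNIV"
  by (simp_all add: normal_law_def)

lemma prob_space_normal_law: "prob_space (normal_law m \<sigma>)"
  unfolding normal_law_def by (intro N01.prob_space_distr) simp

lemma nn_integral_normal_law:
  "f \<in> borel_measurable borel \<Longrightarrow> (\<integral>\<^sup>+y. f y \<partial>normal_law m \<sigma>) = (\<integral>\<^sup>+z. f (m + \<sigma> * z) \<partial>N01)"
  unfolding normal_law_def by (subst nn_integral_distr) simp_all

lemma integral_normal_law:
  fixes f :: "real \<Rightarrow> real"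
  shows "f \<in> borel_measurable borel \<Longrightarrow> (\<integral>y. f y \<partial>normal_law m \<sigma>) = (\<integral>z. f (m + \<sigma> * z) \<partial>N01)"
  unfolding normal_law_def by (subst integral_distr) simp_all

lemma integrable_normal_law:
  fixes f :: "real \<Rightarrow> real"
  shows "f \<in> borel_measurable borel \<Longrightarrow> integrable (normal_law m \<sigma>) f \<longleftrightarrow> integrable N01 (\<lambda>z. f (m + \<sigma> * z))"
  unfolding normal_law_def by (subst integrable_distr_eq) simp_all

lemma sets_gauss_vec [measurable_cong]: "sets (gauss_vec n \<theta> \<sigma>) = sets (\<Pi>\<^sub>M i\<in>{1..n}. borel)"
  unfolding gauss_vec_def by (intro sets_PiM_cong) simp_all

lemma prob_space_gauss_vec: "prob_space (gauss_vec n \<theta> \<sigma>)"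
  unfolding gauss_vec_def by (intro prob_space_PiM prob_space_normal_law)

lemma nn_integral_gauss_vec_coord:
  assumes [measurable]: "f \<in> borel_measurable borel" and i: "i \<in> {1..n}"
  shows "(\<integral>\<^sup>+x. f (x i) \<partial>gauss_vec n \<theta> \<sigma>) = (\<integral>\<^sup>+z. f (\<theta> i + \<sigma> i * z) \<partial>N01)"
proof -
  have "(\<integral>\<^sup>+y. f y \<partial>normal_law (\<theta> i) (\<sigma> i)) = (\<integral>\<^sup>+y. f y \<partial>distr (gauss_vec n \<theta> \<sigma>) (normal_law (\<theta> i) (\<sigma> i)) (\<lambda>x. x i))"
    unfolding gauss_vec_def using i by (subst distr_PiM_component) (auto intro: prob_space_normal_law)
  also have "\<dots> = (\<integral>\<^sup>+x. f (x i) \<partial>gauss_vec n \<theta> \<sigma>)"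
    using i by (intro nn_integral_distr) (simp_all add: gauss_vec_def)
  finally show ?thesis by (simp add: nn_integral_normal_law)
qed

text \<open>Independence removes the cross terms, and the variance is at most the second moment
  about any centre. The free centres \<open>a i\<close> allow bounds about convenient points instead
  of the exact means.\<close>

lemma gauss_vec_sum_second_moment:
  fixes Y :: "nat \<Rightarrow> real \<Rightarrow> real"
  assumes Y[measurable]: "\<And>i. Y i \<in> borel_measurable borel" and V: "V \<ge> 0"
    and bound: "\<And>i. i \<in> {1..n} \<Longrightarrow> (\<integral>\<^sup>+z. ennreal ((Y i (\<theta> i + \<sigma> i * z) - a i)\<^sup>2) \<partial>N01) \<le> ennreal V"
  defines "m \<equiv> \<lambda>i. \<integral>z. Y i (\<theta> i + \<sigma> i * z) \<partial>N01"
  shows "(\<integral>\<^sup>+x. ennreal ((\<Sum>i=1..n. Y i (x i) - m i)\<^sup>2) \<partial>gauss_vec n \<theta> \<sigma>) \<le> ennreal (real n * V)"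
proof -
  define N where "N = (\<lambda>i. normal_law (\<theta> i) (\<sigma> i))"
  define W where "W = (\<lambda>i y. Y i y - m i)"
  interpret P: product_prob_space N "{1..n}"
    by (intro product_prob_spaceI) (simp add: N_def prob_space_normal_law)
  have gv: "gauss_vec n \<theta> \<sigma> = Pi\<^sub>M {1..n} N" by (simp add: gauss_vec_def N_def)
  have [measurable]: "W i \<in> borel_measurable (N k)" for i k
    unfolding W_def N_def by simp
  have sq: "integrable N01 (\<lambda>z. (Y i (\<theta> i + \<sigma> i * z) - a i)\<^sup>2)"
    and sq_le: "(\<integral>z. (Y i (\<theta> i + \<sigma> i * z) - a i)\<^sup>2 \<partial>N01) \<le> V" if "i \<in> {1..n}" for i
  proof -
    show "integrable N01 (\<lambda>z. (Y i (\<theta> i + \<sigma> i * z) - a i)\<^sup>2)"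
      using bound[OF that] by (auto simp: integrable_iff_bounded intro: le_less_trans)
    from nn_integral_eq_integral[OF this] bound[OF that]
    show "(\<integral>z. (Y i (\<theta> i + \<sigma> i * z) - a i)\<^sup>2 \<partial>N01) \<le> V" using V by simp
  qed
  have intYa: "integrable N01 (\<lambda>z. Y i (\<theta> i + \<sigma> i * z) - a i)" if "i \<in> {1..n}" for i
    by (rule N01.square_integrable_imp_integrable[OF _ sq[OF that]]) simp
  have intY: "integrable N01 (\<lambda>z. Y i (\<theta> i + \<sigma> i * z))" if "i \<in> {1..n}" for i
    using Bochner_Integration.integrable_add[OF intYa[OF that], of "\<lambda>_. a i"] by simp
  have intW: "integrable (N i) (W i)" and meanW: "(\<integral>y. W i y \<partial>N i) = 0" if "i \<in> {1..n}" for i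
    unfolding N_def W_def using intY[OF that]
    by (simp_all add: integrable_normal_law integral_normal_law m_def N01.prob_space[simplified]
        prob_space.prob_space[OF prob_space_normal_law, simplified])
  have intW2: "integrable (N i) (\<lambda>y. (W i y)\<^sup>2)" and W2_le: "(\<integral>y. (W i y)\<^sup>2 \<partial>N i) \<le> V" if i: "i \<in> {1..n}" for i
  proof -
    let ?f = "\<lambda>z. Y i (\<theta> i + \<sigma> i * z)"
    let ?b = "m i - a i"
    have e: "(?f z - m i)\<^sup>2 = (?f z - a i)\<^sup>2 - 2 * ?b * (?f z - a i) + ?b\<^sup>2" for z
      by (simp add: power2_eq_square algebra_simps)
    have mean: "(\<integral>z. ?f z - a i \<partial>N01) = ?b"
      using intY[OF i] by (simp add: m_def N01.prob_space[simplified])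
    have "integrable N01 (\<lambda>z. (?f z - m i)\<^sup>2)"
      unfolding e by (intro Bochner_Integration.integrable_add Bochner_Integration.integrable_diff
          sq[OF i] integrable_mult_right intYa[OF i]) simp
    then show "integrable (N i) (\<lambda>y. (W i y)\<^sup>2)"
      by (simp add: N_def W_def integrable_normal_law)
    have "(\<integral>z. (?f z - m i)\<^sup>2 \<partial>N01) = (\<integral>z. (?f z - a i)\<^sup>2 \<partial>N01) - 2 * ?b * (\<integral>z. ?f z - a i \<partial>N01) + ?b\<^sup>2"
      unfolding e using sq[OF i] intYa[OF i]
      by (simp only: Bochner_Integration.integral_add Bochner_Integration.integral_diff
          Bochner_Integration.integrable_diff integrable_mult_right integral_mult_right_zero N01.integrable_const lebesgue_integral_const)
        (simp add: N01.prob_space[simplified])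
    also have "\<dots> = (\<integral>z. (?f z - a i)\<^sup>2 \<partial>N01) - ?b\<^sup>2"
      unfolding mean by (simp add: power2_eq_square)
    also have "\<dots> \<le> V" by (rule order_trans[OF _ sq_le[OF i]]) simp
    finally show "(\<integral>y. (W i y)\<^sup>2 \<partial>N i) \<le> V"
      by (simp add: N_def W_def integral_normal_law)
  qed
  have pair: "integrable (Pi\<^sub>M {1..n} N) (\<lambda>x. W i (x i) * W j (x j)) \<and>
      (\<integral>x. W i (x i) * W j (x j) \<partial>Pi\<^sub>M {1..n} N) = (if i = j then (\<integral>y. (W i y)\<^sup>2 \<partial>N i) else 0)"
    if i: "i \<in> {1..n}" and j: "j \<in> {1..n}" for i j
  proof -
    \<comment> \<open>A product over all coordinates that equals \<open>W i * W j\<close>, so that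
      one product formula covers both the diagonal and the cross terms.\<close>
    define f where "f = (\<lambda>k y. if k = i \<and> k = j then (W i y)\<^sup>2 else if k = i then W i y else if k = j then W j y else 1)"
    have intf: "integrable (N k) (f k)" if "k \<in> {1..n}" for k
    proof -
      have "finite_measure (N k)"
        unfolding N_def using prob_space_normal_law by (rule prob_space.finite_measure)
      then have "integrable (N k) (\<lambda>y. 1 :: real)" by (rule finite_measure.integrable_const)
      then show ?thesis
        using intW[OF i] intW[OF j] intW2[OF i] by (cases "k = i"; cases "k = j") (simp_all add: f_def)
    qed
    have pe: "(\<Prod>k\<in>{1..n}. f k (x k)) = W i (x i) * W j (x j)" for x
    proof (cases "i = j")
      case True
      have "(\<Prod>k\<in>{1..n}. f k (x k)) = (\<Prod>k\<in>{i}. f k (x k))"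
        using i True by (intro prod.mono_neutral_right) (auto simp: f_def)
      then show ?thesis using True by (simp add: f_def power2_eq_square)
    next
      case False
      have "(\<Prod>k\<in>{1..n}. f k (x k)) = (\<Prod>k\<in>{i, j}. f k (x k))"
        using i j False by (intro prod.mono_neutral_right) (auto simp: f_def)
      then show ?thesis using False by (simp add: f_def)
    qed
    have int: "integrable (Pi\<^sub>M {1..n} N) (\<lambda>x. \<Prod>k\<in>{1..n}. f k (x k))"
      by (intro P.product_integrable_prod intf) simp
    have "(\<integral>x. (\<Prod>k\<in>{1..n}. f k (x k)) \<partial>Pi\<^sub>M {1..n} N) = (\<Prod>k\<in>{1..n}. integral\<^sup>L (N k) (f k))"
      by (intro P.product_integral_prod intf) simp
    also have "\<dots> = (if i = j then (\<integral>y. (W i y)\<^sup>2 \<partial>N i) else 0)"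
    proof (cases "i = j")
      case True
      have "(\<Prod>k\<in>{1..n}. integral\<^sup>L (N k) (f k)) = (\<Prod>k\<in>{i}. integral\<^sup>L (N k) (f k))"
        using i True by (intro prod.mono_neutral_right) (auto simp: f_def P.M.prob_space)
      then show ?thesis using True by (simp add: f_def)
    next
      case False
      then have "integral\<^sup>L (N i) (f i) = 0" using meanW[OF i] by (simp add: f_def)
      then show ?thesis using False i by (auto intro!: prod_zero)
    qed
    finally show ?thesis using int unfolding pe by simp
  qed
  have sqr: "(\<Sum>i=1..n. W i (x i))\<^sup>2 = (\<Sum>i=1..n. \<Sum>j=1..n. W i (x i) * W j (x j))" for x
    by (simp add: power2_eq_square sum_product)
  have "integrable (Pi\<^sub>M {1..n} N) (\<lambda>x. (\<Sum>i=1..n. W i (x i))\<^sup>2)"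
    unfolding sqr using pair by (intro Bochner_Integration.integrable_sum) blast
  moreover have "(\<integral>x. (\<Sum>i=1..n. W i (x i))\<^sup>2 \<partial>Pi\<^sub>M {1..n} N) = (\<Sum>i=1..n. (\<integral>y. (W i y)\<^sup>2 \<partial>N i))"
  proof -
    have "(\<integral>x. (\<Sum>i=1..n. W i (x i))\<^sup>2 \<partial>Pi\<^sub>M {1..n} N)
        = (\<Sum>i=1..n. \<Sum>j=1..n. \<integral>x. W i (x i) * W j (x j) \<partial>Pi\<^sub>M {1..n} N)"
    proof -
      have in1: "integrable (Pi\<^sub>M {1..n} N) (\<lambda>x. \<Sum>j=1..n. W i (x i) * W j (x j))" if "i \<in> {1..n}" for i
        using pair[OF that] by (intro Bochner_Integration.integrable_sum) blast
      have in2: "(\<integral>x. (\<Sum>j=1..n. W i (x i) * W j (x j)) \<partial>Pi\<^sub>M {1..n} N)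
          = (\<Sum>j=1..n. \<integral>x. W i (x i) * W j (x j) \<partial>Pi\<^sub>M {1..n} N)" if "i \<in> {1..n}" for i
        by (rule Bochner_Integration.integral_sum) (rule conjunct1[OF pair[OF that]])
      have "(\<integral>x. (\<Sum>i=1..n. \<Sum>j=1..n. W i (x i) * W j (x j)) \<partial>Pi\<^sub>M {1..n} N)
          = (\<Sum>i=1..n. \<integral>x. (\<Sum>j=1..n. W i (x i) * W j (x j)) \<partial>Pi\<^sub>M {1..n} N)"
        by (rule Bochner_Integration.integral_sum) (rule in1)
      also have "\<dots> = (\<Sum>i=1..n. \<Sum>j=1..n. \<integral>x. W i (x i) * W j (x j) \<partial>Pi\<^sub>M {1..n} N)"
        by (rule sum.cong[OF refl]) (rule in2)
      finally show ?thesis unfolding sqr .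
    qed
    also have "\<dots> = (\<Sum>i=1..n. \<Sum>j=1..n. if i = j then (\<integral>y. (W i y)\<^sup>2 \<partial>N i) else 0)"
      using pair by (intro sum.cong refl) blast
    also have "\<dots> = (\<Sum>i=1..n. (\<integral>y. (W i y)\<^sup>2 \<partial>N i))"
      by (intro sum.cong refl) simp
    finally show ?thesis .
  qed
  moreover have "(\<Sum>i=1..n. (\<integral>y. (W i y)\<^sup>2 \<partial>N i)) \<le> real n * V"
    using sum_bounded_above[of "{1..n}" "\<lambda>i. \<integral>y. (W i y)\<^sup>2 \<partial>N i" V] W2_le by simp
  ultimately have "(\<integral>\<^sup>+x. ennreal ((\<Sum>i=1..n. W i (x i))\<^sup>2) \<partial>Pi\<^sub>M {1..n} N) \<le> ennreal (real n * V)"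
    by (subst nn_integral_eq_integral) (auto intro!: ennreal_leI)
  then show ?thesis unfolding gv W_def .
qed

lemma grand_mean_deviation:
  assumes n: "n \<ge> 1" and F: "\<And>i. i \<in> {1..n} \<Longrightarrow> (\<sigma> i)\<^sup>2 \<le> F"
  shows "(\<integral>\<^sup>+x. ennreal ((grand_mean n x - grand_mean n \<theta>)\<^sup>2) \<partial>gauss_vec n \<theta> \<sigma>) \<le> ennreal (F / real n)"
proof -
  have F0: "F \<ge> 0" using F[of 1] n zero_le_power2[of "\<sigma> 1"] by (metis atLeastAtMost_iff order_trans le_refl)
  have mean: "(\<integral>z. \<theta> i + \<sigma> i * z \<partial>N01) = \<theta> i" for i
    using gauss_mean_linear_poly[of "\<theta> i" "\<sigma> i" 1] by (simp add: gauss_mean_def)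
  have sq: "(\<integral>\<^sup>+z. ennreal ((\<theta> i + \<sigma> i * z - \<theta> i)\<^sup>2) \<partial>N01) = ennreal ((\<sigma> i)\<^sup>2)" for i
    using nn_integral_cmult[of "\<lambda>z. ennreal (z\<^sup>2)" N01 "ennreal ((\<sigma> i)\<^sup>2)"]
    by (simp add: power_mult_distrib ennreal_mult' nn_integral_N01_square)
  have "(grand_mean n x - grand_mean n \<theta>)\<^sup>2 = (1 / (real n)\<^sup>2) * (\<Sum>i=1..n. x i - \<theta> i)\<^sup>2" for x
    by (simp add: grand_mean_def sum_subtractf diff_divide_distrib[symmetric] power_divide)
  then have "(\<integral>\<^sup>+x. ennreal ((grand_mean n x - grand_mean n \<theta>)\<^sup>2) \<partial>gauss_vec n \<theta> \<sigma>)
      = ennreal (1 / (real n)\<^sup>2) * (\<integral>\<^sup>+x. ennreal ((\<Sum>i=1..n. x i - \<theta> i)\<^sup>2) \<partial>gauss_vec n \<theta> \<sigma>)"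
    by (simp only: ennreal_mult' zero_le_divide_1_iff zero_le_power2 divide_nonneg_nonneg zero_le_one) (subst nn_integral_cmult, simp_all add: gauss_vec_def)
  also have "\<dots> \<le> ennreal (1 / (real n)\<^sup>2) * ennreal (real n * F)"
    using gauss_vec_sum_second_moment[of "\<lambda>i y. y" F n \<theta> \<sigma> \<theta>] F F0 unfolding mean sq
    by (intro mult_left_mono) (auto intro: ennreal_leI)
  also have "\<dots> = ennreal (F / real n)"
    using n by (simp add: ennreal_mult'[symmetric] power2_eq_square)
  finally show ?thesis .
qed

text \<open>The narrower Gaussian density is at most \<open>1 / k \<le> 2\<close> times the wider
  one. This restores the full variance of a coordinate after centring has reduced it.\<close>

lemma nn_integral_N01_contract:
  fixes \<Psi> :: "real \<Rightarrow> ennreal"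
  assumes [measurable]: "\<Psi> \<in> borel_measurable borel" and k: "1 / 2 \<le> k" "k \<le> 1"
  shows "(\<integral>\<^sup>+z. \<Psi> (k * z) \<partial>N01) \<le> 2 * (\<integral>\<^sup>+z. \<Psi> z \<partial>N01)"
proof -
  have "(\<integral>\<^sup>+z. \<Psi> (k * z) \<partial>N01) = ennreal (1 / k) * (\<integral>\<^sup>+y. ennreal (std_normal_density (y / k)) * \<Psi> y \<partial>lborel)"
    using k by (subst nn_integral_N01, simp, subst nn_integral_real_affine[where c="1 / k" and t=0]) auto
  also have "\<dots> \<le> ennreal 2 * (\<integral>\<^sup>+y. ennreal (std_normal_density y) * \<Psi> y \<partial>lborel)"
  proof (intro mult_mono nn_integral_mono ennreal_leI mult_right_mono)
    show "1 / k \<le> 2" using k by (simp add: field_simps)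
    fix y
    have "y\<^sup>2 * k\<^sup>2 \<le> y\<^sup>2 * 1" using k by (intro mult_left_mono) (auto simp: power_le_one)
    then have "y\<^sup>2 \<le> (y / k)\<^sup>2" using k by (simp add: power_divide field_simps)
    then show "std_normal_density (y / k) \<le> std_normal_density y"
      unfolding std_normal_density_def by (intro mult_left_mono) auto
  qed auto
  also have "\<dots> = 2 * (\<integral>\<^sup>+z. \<Psi> z \<partial>N01)"
    by (simp add: nn_integral_N01)
  finally show ?thesis .
qed

lemma borel_measurable_grand_mean [measurable]: "grand_mean n \<in> borel_measurable (\<Pi>\<^sub>M i\<in>{1..n}. borel)"
  unfolding grand_mean_def[abs_def] by measurable

text \<open>Integrating out coordinate \<open>i\<close> first: given the others, \<open>x i - grand_mean n x\<close> is Gaussian with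
  variance below \<open>(\<sigma> i)\<^sup>2\<close>, so a bound that is uniform in the mean carries over.\<close>

lemma gauss_vec_centered:
  fixes \<Psi> :: "real \<Rightarrow> ennreal"
  assumes [measurable]: "\<Psi> \<in> borel_measurable borel" and n: "n \<ge> 2" and i: "i \<in> {1..n}"
    and B: "\<And>m. (\<integral>\<^sup>+z. \<Psi> (m + \<sigma> i * z) \<partial>N01) \<le> B"
  shows "(\<integral>\<^sup>+x. \<Psi> (x i - grand_mean n x) \<partial>gauss_vec n \<theta> \<sigma>) \<le> 2 * B"
proof -
  define N where "N = (\<lambda>i. normal_law (\<theta> i) (\<sigma> i))"
  let ?J = "{1..n} - {i}"
  interpret P: product_prob_space N ?J
    by (intro product_prob_spaceI) (simp add: N_def prob_space_normal_law)
  have J: "prob_space (Pi\<^sub>M ?J N)"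
    by (intro prob_space_PiM) (simp add: N_def prob_space_normal_law)
  have ins: "{1..n} = insert i ?J" using i by auto
  have [measurable_cong]: "sets (Pi\<^sub>M (insert i ?J) N) = sets (\<Pi>\<^sub>M i\<in>insert i ?J. borel)"
    by (intro sets_PiM_cong) (simp_all add: N_def)
  have m: "(\<lambda>x. \<Psi> (x i - grand_mean n x)) \<in> borel_measurable (Pi\<^sub>M (insert i ?J) N)"
    unfolding grand_mean_def ins[symmetric]
    by (subst ins) measurable
  have "(\<integral>\<^sup>+x. \<Psi> (x i - grand_mean n x) \<partial>gauss_vec n \<theta> \<sigma>)
      = (\<integral>\<^sup>+x. \<Psi> (x i - grand_mean n x) \<partial>Pi\<^sub>M (insert i ?J) N)"
    unfolding gauss_vec_def N_def ins[symmetric] ..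
  also have "\<dots> = (\<integral>\<^sup>+x. \<integral>\<^sup>+y. \<Psi> ((x(i := y)) i - grand_mean n (x(i := y))) \<partial>N i \<partial>Pi\<^sub>M ?J N)"
    by (rule P.product_nn_integral_insert[OF _ _ m]) auto
  also have "\<dots> \<le> (\<integral>\<^sup>+x. 2 * B \<partial>Pi\<^sub>M ?J N)"
  proof (intro nn_integral_mono)
    fix x
    \<comment> \<open>Coordinate \<open>i\<close> also enters the grand mean, with weight
      \<open>1 / n\<close>; hence the contraction, which is at least \<open>1 / 2\<close>.\<close>
    let ?k = "1 - 1 / real n" and ?R = "(\<Sum>j\<in>?J. x j) / real n"
    have k: "1 / 2 \<le> ?k" "?k \<le> 1" using n by (auto simp: field_simps)
    have gm: "(x(i := y)) i - grand_mean n (x(i := y)) = ?k * y - ?R" for y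
    proof -
      have "(\<Sum>j=1..n. (x(i := y)) j) = y + (\<Sum>j\<in>?J. x j)"
        using i by (subst ins, subst sum.insert) (auto intro!: sum.cong)
      then show ?thesis by (simp add: grand_mean_def field_simps add_divide_distrib)
    qed
    have "(\<integral>\<^sup>+y. \<Psi> ((x(i := y)) i - grand_mean n (x(i := y))) \<partial>N i)
        = (\<integral>\<^sup>+z. \<Psi> ((?k * \<theta> i - ?R) + \<sigma> i * (?k * z)) \<partial>N01)"
      unfolding gm N_def by (subst nn_integral_normal_law) (auto simp: algebra_simps)
    also have "\<dots> \<le> 2 * (\<integral>\<^sup>+z. \<Psi> ((?k * \<theta> i - ?R) + \<sigma> i * z) \<partial>N01)"
      by (rule nn_integral_N01_contract[where \<Psi>="\<lambda>z. \<Psi> ((?k * \<theta> i - ?R) + \<sigma> i * z)", OF _ k]) simp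
    also have "\<dots> \<le> 2 * B" by (intro mult_left_mono B) simp
    finally show "(\<integral>\<^sup>+y. \<Psi> ((x(i := y)) i - grand_mean n (x(i := y))) \<partial>N i) \<le> 2 * B" .
  qed
  also have "\<dots> = 2 * B" by (simp only: nn_integral_const prob_space.emeasure_space_1[OF J] mult_1_right)
  finally show ?thesis .
qed

section \<open>The cost of shifting the centre\<close>

context coord
begin

text \<open>Together with \<open>Wpoly\<close> and \<open>Qpoly\<close> this gives three nonnegative
  majorants of one real argument: the clipping error, increments under small shifts, and squares for
  large shifts. Their Gaussian means are bounded uniformly in \<open>m\<close>.\<close>

definition "Eclip x = (\<integral>\<^sup>+z. ennreal (indicator {- l..l} (V x z) * (poly Spoly (U x z))\<^sup>2) \<partial>N01)"
definition "Wpoly \<delta> x = window {- l..<0} (G_poly (s\<^sup>2) K (1 / 2)) \<delta> x + window {0..l} (G_poly (s\<^sup>2) K (- 1 / 2)) \<delta> x"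
definition "Qpoly x = (vpart {- l..<0} (G_poly (s\<^sup>2) K (1 / 2)) x)\<^sup>2 + (vpart {0..l} (G_poly (s\<^sup>2) K (- 1 / 2)) x)\<^sup>2"

lemma Eclip_measurable [measurable]: "Eclip \<in> borel_measurable borel"
  unfolding Eclip_def[abs_def] U_def V_def by measurable

lemma Wpoly_measurable [measurable]: "Wpoly \<delta> \<in> borel_measurable borel"
  unfolding Wpoly_def[abs_def] by measurable

lemma Qpoly_measurable [measurable]: "Qpoly \<in> borel_measurable borel"
  unfolding Qpoly_def[abs_def] by measurable

lemma Tsmooth_measurable [measurable]: "Tsmooth \<in> borel_measurable borel"
  unfolding Tsmooth_def[abs_def] by measurable

lemma Eclip_mean: "(\<integral>\<^sup>+z. Eclip (m + \<sigma> * z) \<partial>N01) \<le> ennreal M"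
  unfolding Eclip_def using Spoly_in_class by (rule UV_second_moment) auto

lemma half_sq: "(1 / 2 :: real)\<^sup>2 \<le> 1" "(- 1 / 2 :: real)\<^sup>2 \<le> 1"
  by (simp_all add: power2_eq_square)

lemma Wpoly_mean:
  assumes "\<delta> \<ge> 0"
  shows "(\<integral>\<^sup>+z. Wpoly \<delta> (m + \<sigma> * z) \<partial>N01) \<le> ennreal (4 * \<delta> * ((\<bar>d\<bar> + 1 / \<sigma>) * (M + 1)))"
proof -
  let ?b = "2 * \<delta> * ((\<bar>d\<bar> + 1 / \<sigma>) * (M + 1))"
  have b: "?b \<ge> 0" using assms \<sigma> M_nonneg by simp
  have "(\<integral>\<^sup>+z. Wpoly \<delta> (m + \<sigma> * z) \<partial>N01) = (\<integral>\<^sup>+z. window {- l..<0} (G_poly (s\<^sup>2) K (1 / 2)) \<delta> (m + \<sigma> * z) \<partial>N01)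
     + (\<integral>\<^sup>+z. window {0..l} (G_poly (s\<^sup>2) K (- 1 / 2)) \<delta> (m + \<sigma> * z) \<partial>N01)"
    unfolding Wpoly_def by (rule nn_integral_add) measurable
  also have "\<dots> \<le> ennreal ?b + ennreal ?b"
    by (intro add_mono window_mean G_poly_in_class pderiv_G_poly_in_class half_sq assms) (use l in auto)
  also have "\<dots> = ennreal (4 * \<delta> * ((\<bar>d\<bar> + 1 / \<sigma>) * (M + 1)))"
    using b by (subst ennreal_plus[symmetric]) auto
  finally show ?thesis .
qed

lemma Qpoly_nonneg: "Qpoly x \<ge> 0"
  by (simp add: Qpoly_def)

lemma Qpoly_mean: "(\<integral>\<^sup>+z. ennreal (Qpoly (m + \<sigma> * z)) \<partial>N01) \<le> ennreal (2 * M)"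
proof -
  have "(\<integral>\<^sup>+z. ennreal (Qpoly (m + \<sigma> * z)) \<partial>N01)
     = (\<integral>\<^sup>+z. ennreal ((vpart {- l..<0} (G_poly (s\<^sup>2) K (1 / 2)) (m + \<sigma> * z))\<^sup>2) \<partial>N01)
     + (\<integral>\<^sup>+z. ennreal ((vpart {0..l} (G_poly (s\<^sup>2) K (- 1 / 2)) (m + \<sigma> * z))\<^sup>2) \<partial>N01)"
    unfolding Qpoly_def by (subst nn_integral_add[symmetric]) simp_all
  also have "\<dots> \<le> ennreal M + ennreal M"
    by (intro add_mono vpart_second_moment G_poly_in_class half_sq) (use l in auto)
  also have "\<dots> = ennreal (2 * M)"
    using M_nonneg by (subst ennreal_plus[symmetric]) auto
  finally show ?thesis .
qed

lemma Tpoly_square_le: "(Tpoly x)\<^sup>2 \<le> 2 * Qpoly x"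
proof -
  have "(u + v)\<^sup>2 \<le> 2 * (u\<^sup>2 + v\<^sup>2)" for u v :: real
    using sum_squares_bound[of u v] by (simp add: power2_sum)
  then show ?thesis unfolding Tpoly_def Qpoly_def .
qed

text \<open>Inside the window the increment is controlled by the kernel derivative; outside,
  Young's inequality is applied with a free parameter \<open>a\<close>.\<close>

lemma vpart_shift:
  assumes A: "A \<in> sets borel" and pos: "\<delta> > 0" "a > 0"
  shows "ennreal \<bar>vpart A p (x + e) - vpart A p x\<bar>
    \<le> window A p \<delta> x + ennreal (a * e\<^sup>2 / \<delta>\<^sup>2 + ((vpart A p (x + e))\<^sup>2 + (vpart A p x)\<^sup>2) / (2 * a))"
proof (cases "\<bar>e\<bar> \<le> \<delta>")
  case True
  show ?thesis by (rule order_trans[OF vpart_increment[OF A True]]) simp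
next
  case False
  have young: "\<bar>u\<bar> \<le> a / 2 + u\<^sup>2 / (2 * a)" for u :: real
  proof -
    have "0 \<le> (\<bar>u\<bar> - a)\<^sup>2" by simp
    also have "\<dots> = u\<^sup>2 + a\<^sup>2 - 2 * a * \<bar>u\<bar>" by (simp add: power2_diff)
    finally have "2 * a * \<bar>u\<bar> \<le> a\<^sup>2 + u\<^sup>2" by simp
    then have "(2 * a * \<bar>u\<bar>) / (2 * a) \<le> (a\<^sup>2 + u\<^sup>2) / (2 * a)" using pos by (intro divide_right_mono) auto
    then show ?thesis using pos by (simp add: add_divide_distrib power2_eq_square)
  qed
  \<comment> \<open>Chebyshev's argument pointwise: for \<open>|e| > \<delta>\<close> the constant
    \<open>a\<close> is dominated by \<open>a * e\<^sup>2 / \<delta>\<^sup>2\<close>, whose mean is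
    controlled by the variance of the grand mean.\<close>
  have "\<delta>\<^sup>2 \<le> e\<^sup>2" using False pos by (intro abs_le_square_iff[THEN iffD1]) auto
  then have "a * 1 \<le> a * (e\<^sup>2 / \<delta>\<^sup>2)" using pos by (intro mult_left_mono) auto
  moreover have "\<bar>vpart A p (x + e) - vpart A p x\<bar> \<le> \<bar>vpart A p (x + e)\<bar> + \<bar>vpart A p x\<bar>" by (rule abs_triangle_ineq4)
  moreover note young[of "vpart A p (x + e)"] young[of "vpart A p x"]
  ultimately have "\<bar>vpart A p (x + e) - vpart A p x\<bar> \<le> a * e\<^sup>2 / \<delta>\<^sup>2 + ((vpart A p (x + e))\<^sup>2 + (vpart A p x)\<^sup>2) / (2 * a)"
    by (simp add: add_divide_distrib)
  from ennreal_leI[OF this] show ?thesis by (rule add_increasing[rotated]) simp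
qed

lemma ennreal_sum4: "\<lbrakk>0 \<le> u; 0 \<le> v; 0 \<le> w; 0 \<le> x\<rbrakk>
    \<Longrightarrow> ennreal (u + v + (w + x)) = ennreal u + ennreal v + (ennreal w + ennreal x)"
  by simp

lemma ennreal_sum3: "\<lbrakk>0 \<le> u; 0 \<le> v; 0 \<le> w\<rbrakk> \<Longrightarrow> ennreal (u + v + w) = ennreal u + ennreal v + ennreal w"
  by simp

lemma ennreal_regroup: "u + v + ((w1 + x1) + (w2 + x2)) = u + v + (w1 + w2) + (x1 + x2)" for u v :: ennreal
  by (simp add: ac_simps)

text \<open>Clipping is undone at the shifted point, and then the unclipped estimate is moved back
  to \<open>x\<close>. Consequently \<open>Eclip\<close> is taken at \<open>x - e\<close>,
  \<open>Wpoly\<close> at \<open>x\<close>, and \<open>Qpoly\<close> at both.\<close>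

lemma Tclip_shift:
  assumes pos: "\<delta> > 0" "a > 0" "N > 0"
  shows "ennreal \<bar>Tclip N (x - e) - Tsmooth x\<bar> \<le> Eclip (x - e) / ennreal N + ennreal (4 * \<bar>d\<bar> * \<bar>e\<bar>) + Wpoly \<delta> x
    + ennreal (2 * a * e\<^sup>2 / \<delta>\<^sup>2) + ennreal (Qpoly (x - e) / (2 * a)) + ennreal (Qpoly x / (2 * a))"
proof -
  let ?f = "vpart {- l..<0} (G_poly (s\<^sup>2) K (1 / 2))" and ?g = "vpart {0..l} (G_poly (s\<^sup>2) K (- 1 / 2))"
  have "\<bar>Tclip N (x - e) - Tsmooth x\<bar> \<le> \<bar>Tclip N (x - e) - Tsmooth (x - e)\<bar> + \<bar>Tlin (x - e) - Tlin x\<bar>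
      + (\<bar>?f (x + (- e)) - ?f x\<bar> + \<bar>?g (x + (- e)) - ?g x\<bar>)"
    unfolding Tsmooth_eq Tpoly_def by simp
  also have "\<dots> \<le> \<bar>Tclip N (x - e) - Tsmooth (x - e)\<bar> + 4 * \<bar>d\<bar> * \<bar>e\<bar>
      + (\<bar>?f (x + (- e)) - ?f x\<bar> + \<bar>?g (x + (- e)) - ?g x\<bar>)"
    using Tlin_Lipschitz[of "x - e" x] by simp
  finally have "ennreal \<bar>Tclip N (x - e) - Tsmooth x\<bar> \<le> ennreal (\<bar>Tclip N (x - e) - Tsmooth (x - e)\<bar> + 4 * \<bar>d\<bar> * \<bar>e\<bar>
      + (\<bar>?f (x + (- e)) - ?f x\<bar> + \<bar>?g (x + (- e)) - ?g x\<bar>))" by (rule ennreal_leI)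
  also have "\<dots> = ennreal \<bar>Tclip N (x - e) - Tsmooth (x - e)\<bar>
     + ennreal (4 * \<bar>d\<bar> * \<bar>e\<bar>) + (ennreal \<bar>?f (x + (- e)) - ?f x\<bar> + ennreal \<bar>?g (x + (- e)) - ?g x\<bar>)"
    by (rule ennreal_sum4) (simp_all only: abs_ge_zero mult_nonneg_nonneg zero_le_numeral)
  also have "\<dots> \<le> Eclip (x - e) / ennreal N + ennreal (4 * \<bar>d\<bar> * \<bar>e\<bar>)
     + ((window {- l..<0} (G_poly (s\<^sup>2) K (1 / 2)) \<delta> x + ennreal (a * (- e)\<^sup>2 / \<delta>\<^sup>2 + ((?f (x + (- e)))\<^sup>2 + (?f x)\<^sup>2) / (2 * a)))
      + (window {0..l} (G_poly (s\<^sup>2) K (- 1 / 2)) \<delta> x + ennreal (a * (- e)\<^sup>2 / \<delta>\<^sup>2 + ((?g (x + (- e)))\<^sup>2 + (?g x)\<^sup>2) / (2 * a))))"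
    by (rule add_mono[OF add_mono[OF Tclip_error[folded Eclip_def, OF pos(3)] order_refl]
        add_mono[OF vpart_shift[OF _ pos(1,2)] vpart_shift[OF _ pos(1,2)]]]) simp_all
  also have "\<dots> = Eclip (x - e) / ennreal N + ennreal (4 * \<bar>d\<bar> * \<bar>e\<bar>) + Wpoly \<delta> x
    + (ennreal (a * (- e)\<^sup>2 / \<delta>\<^sup>2 + ((?f (x + (- e)))\<^sup>2 + (?f x)\<^sup>2) / (2 * a))
      + ennreal (a * (- e)\<^sup>2 / \<delta>\<^sup>2 + ((?g (x + (- e)))\<^sup>2 + (?g x)\<^sup>2) / (2 * a)))"
    unfolding Wpoly_def by (rule ennreal_regroup)
  also have "ennreal (a * (- e)\<^sup>2 / \<delta>\<^sup>2 + ((?f (x + (- e)))\<^sup>2 + (?f x)\<^sup>2) / (2 * a))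
      + ennreal (a * (- e)\<^sup>2 / \<delta>\<^sup>2 + ((?g (x + (- e)))\<^sup>2 + (?g x)\<^sup>2) / (2 * a))
      = ennreal (2 * a * e\<^sup>2 / \<delta>\<^sup>2) + ennreal (Qpoly (x - e) / (2 * a)) + ennreal (Qpoly x / (2 * a))"
  proof -
    let ?A = "a * (- e)\<^sup>2 / \<delta>\<^sup>2 + ((?f (x + (- e)))\<^sup>2 + (?f x)\<^sup>2) / (2 * a)"
    let ?B = "a * (- e)\<^sup>2 / \<delta>\<^sup>2 + ((?g (x + (- e)))\<^sup>2 + (?g x)\<^sup>2) / (2 * a)"
    have "0 \<le> ?A" "0 \<le> ?B"
      using pos by (intro add_nonneg_nonneg divide_nonneg_nonneg mult_nonneg_nonneg zero_le_power2; simp)+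
    then have "ennreal ?A + ennreal ?B = ennreal (?A + ?B)" by (rule ennreal_plus[symmetric])
    also have "?A + ?B = 2 * a * e\<^sup>2 / \<delta>\<^sup>2 + Qpoly (x - e) / (2 * a) + Qpoly x / (2 * a)"
      by (simp add: Qpoly_def add_divide_distrib)
    also have "ennreal \<dots> = ennreal (2 * a * e\<^sup>2 / \<delta>\<^sup>2) + ennreal (Qpoly (x - e) / (2 * a)) + ennreal (Qpoly x / (2 * a))"
      using pos Qpoly_nonneg by (intro ennreal_sum3) auto
    finally show ?thesis .
  qed
  finally show ?thesis by (simp only: add.assoc)
qed

end

subsection \<open>Uniform constants\<close>

text \<open>Bounds \<open>M\<close> for all admissible coordinates: \<open>K + 1\<close> is at most
  \<open>3 + 3 * ln n\<close>, and the constraint on \<gamma> leaves \<open>n\<close> to the power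
  \<open>1 / 5\<close>.\<close>

definition Mrate :: "nat \<Rightarrow> real" where
  "Mrate n = (3 + 3 * ln (real n))\<^sup>2 * exp (ln (real n) / 5)"

text \<open>The three terms of \<open>Tsmooth_bias\<close>, with \<gamma> replaced by its lower
  bound \<open>g\<close> where it governs decay. The middle exponent is
  \<open>1 / 5 - 1 / 2\<close>.\<close>

definition bias_rate :: "real \<Rightarrow> nat \<Rightarrow> real" where
  "bias_rate g n = exp (- 4 * g\<^sup>2 * ln (real n)) + ((3 + 3 * ln (real n))\<^sup>2 + 3) * exp (- 3 / 10 * ln (real n))
     + 4 * exp (- g\<^sup>2 * ln (real n) / 8)"

text \<open>The constants \<open>p\<close>, \<open>F\<close>, \<open>B\<close>, \<open>g\<close> are shared by all coordinates; error bounds may depend on these only.\<close>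

locale coord_setting =
  fixes \<nu>p \<nu>f b h \<gamma> p F B g t :: real and n :: nat
  assumes p: "0 < p" "p \<le> \<nu>p" and \<nu>: "\<nu>p \<le> \<nu>f" "\<nu>f \<le> F" and bh: "0 < b" "0 < h" "b + h \<le> B"
    and g: "0 < g" "g \<le> \<gamma>" "\<gamma> + sqrt (\<nu>p / \<nu>f) < 1 / sqrt (4 * exp 1)"
    and t: "t \<ge> 0" and n: "n \<ge> 3"
begin

definition "\<alpha> = t / (t + \<nu>p)"
abbreviation "\<tau> \<equiv> ennreal t"
abbreviation "\<beta> \<equiv> btilde b h"
abbreviation "cc \<equiv> c_coef \<nu>p \<nu>f \<beta> \<tau>"
abbreviation "dd \<equiv> d_coef \<nu>p \<nu>f \<tau>"
abbreviation "ll \<equiv> threshold \<gamma> n"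
abbreviation "KK \<equiv> trunc_order \<nu>p \<nu>f \<gamma> n"

lemma shrinkage_eq: "shrinkage \<nu>p \<tau> = \<alpha>"
  using t by (simp add: shrinkage_def \<alpha>_def)

lemma pos: "\<nu>p > 0" "\<nu>f > 0" "F > 0" "B > 0"
  using p \<nu> bh by auto

lemma \<alpha>: "0 \<le> \<alpha>" "\<alpha> < 1"
  using t pos by (auto simp: \<alpha>_def)

lemma \<beta>: "0 \<le> \<beta>" "\<beta> \<le> 1"
  using bh by (auto simp: btilde_def)

lemma ln_n: "ln (real n) > 0"
  using n by simp

lemma d_eq: "dd = - (1 - \<alpha>) / sqrt (\<nu>f + \<alpha>\<^sup>2 * \<nu>p)"
  by (simp add: d_coef_def shrinkage_eq)

lemma denom: "\<nu>f + \<alpha>\<^sup>2 * \<nu>p > 0" "\<nu>f \<le> \<nu>f + \<alpha>\<^sup>2 * \<nu>p" "\<nu>f + \<alpha>\<^sup>2 * \<nu>p \<le> 2 * F"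
proof -
  show "\<nu>f + \<alpha>\<^sup>2 * \<nu>p > 0" "\<nu>f \<le> \<nu>f + \<alpha>\<^sup>2 * \<nu>p" using pos by (auto intro: add_pos_nonneg)
  have "\<alpha>\<^sup>2 * \<nu>p \<le> 1 * \<nu>p" using \<alpha> pos by (intro mult_right_mono) (auto simp: power_le_one)
  then show "\<nu>f + \<alpha>\<^sup>2 * \<nu>p \<le> 2 * F" using \<nu> by simp
qed

lemma d_neg: "dd < 0"
  unfolding d_eq using \<alpha> denom by (simp add: divide_neg_pos)

lemma d_abs_le: "\<bar>dd\<bar> \<le> 1 / sqrt p"
proof -
  have "\<bar>dd\<bar> = (1 - \<alpha>) / sqrt (\<nu>f + \<alpha>\<^sup>2 * \<nu>p)"
    unfolding d_eq using \<alpha> denom by (simp add: abs_divide)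
  also have "\<dots> \<le> 1 / sqrt p"
  proof -
    have "p \<le> \<nu>f + \<alpha>\<^sup>2 * \<nu>p" using denom(2) p \<nu> by linarith
    then show ?thesis using \<alpha> p by (intro frac_le) auto
  qed
  finally show ?thesis .
qed

text \<open>Supplies the hypothesis \<open>v \<le> 2 * \<rho>\<close> of
  \<open>exponent_constraint\<close> for \<open>\<rho> = \<nu>p / \<nu>f\<close>; the extreme case
  is \<open>\<alpha> = 0\<close>.\<close>

lemma v_le: "2 * dd\<^sup>2 * (sqrt \<nu>p)\<^sup>2 \<le> 2 * (\<nu>p / \<nu>f)" "0 < 2 * dd\<^sup>2 * (sqrt \<nu>p)\<^sup>2"
proof -
  have "dd\<^sup>2 = (1 - \<alpha>)\<^sup>2 / (\<nu>f + \<alpha>\<^sup>2 * \<nu>p)"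
    unfolding d_eq using denom by (simp add: power_divide power2_commute)
  also have "\<dots> \<le> 1 / \<nu>f"
    using \<alpha> denom pos by (intro frac_le) (auto simp: power_le_one)
  finally have "dd\<^sup>2 * \<nu>p \<le> (1 / \<nu>f) * \<nu>p" using pos by (intro mult_right_mono) auto
  then show "2 * dd\<^sup>2 * (sqrt \<nu>p)\<^sup>2 \<le> 2 * (\<nu>p / \<nu>f)" using pos by simp
  show "0 < 2 * dd\<^sup>2 * (sqrt \<nu>p)\<^sup>2" using d_neg pos by simp
qed

lemma constraint: "5 * (2 * dd\<^sup>2 * (sqrt \<nu>p)\<^sup>2) < 1" "2 * \<gamma>\<^sup>2 / (1 - 5 * (2 * dd\<^sup>2 * (sqrt \<nu>p)\<^sup>2)) \<le> 1 / 5"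
  using exponent_constraint[of \<gamma> "\<nu>p / \<nu>f" "2 * dd\<^sup>2 * (sqrt \<nu>p)\<^sup>2"] g v_le pos by auto

lemma ll_sq: "ll\<^sup>2 = 2 * \<gamma>\<^sup>2 * ln (real n)"
  using ln_n by (simp add: threshold_def power_mult_distrib)

text \<open>The margin for \<open>Tsmooth_bias\<close>, chosen so that \<open>ll + rr\<close> is
  exactly the radius built into \<open>trunc_order\<close>.\<close>

definition "rr = sqrt (2 * \<nu>p / \<nu>f) * sqrt (2 * ln (real n))"

lemma ll_rr: "(ll + rr)\<^sup>2 = (\<gamma> + sqrt (2 * \<nu>p / \<nu>f))\<^sup>2 * (2 * ln (real n))"
  using ln_n by (simp add: threshold_def rr_def distrib_right[symmetric] power_mult_distrib)

lemma KK_bounds: "KK \<ge> 2" "(exp 1)\<^sup>2 * (ll + rr)\<^sup>2 \<le> real KK - 1" "real KK + 1 \<le> 3 + 3 * ln (real n)"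
proof -
  let ?x = "(exp 1)\<^sup>2 * (\<gamma> + sqrt (2 * \<nu>p / \<nu>f))\<^sup>2 * (2 * ln (real n))"
  have e: "KK = 1 + nat \<lceil>?x\<rceil>" by (simp add: trunc_order_def)
  have "\<gamma> + sqrt (2 * \<nu>p / \<nu>f) > 0" using g pos by (intro add_pos_nonneg) auto
  then have x0: "?x > 0" using ln_n by simp
  then show "KK \<ge> 2" unfolding e by linarith
  show "(exp 1)\<^sup>2 * (ll + rr)\<^sup>2 \<le> real KK - 1"
    unfolding ll_rr e using x0 by (simp add: mult.assoc)
  \<comment> \<open>The bound \<open>1 / sqrt (4 e)\<close> becomes \<open>1 / (2 e)\<close> after
    scaling by \<open>sqrt 2\<close> and squaring, so the argument of the ceiling is at most
    \<open>e * ln n\<close>.\<close>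
  have "\<gamma> + sqrt (2 * \<nu>p / \<nu>f) \<le> sqrt 2 * (\<gamma> + sqrt (\<nu>p / \<nu>f))"
    using g pos by (simp add: distrib_left real_sqrt_mult[symmetric])
  also have "\<dots> \<le> sqrt 2 * (1 / sqrt (4 * exp 1))"
    using g by (intro mult_left_mono) auto
  finally have "(\<gamma> + sqrt (2 * \<nu>p / \<nu>f))\<^sup>2 \<le> (sqrt 2 * (1 / sqrt (4 * exp 1)))\<^sup>2"
    using g pos by (intro power_mono) auto
  also have "\<dots> = 1 / (2 * exp 1)" by (simp add: power_mult_distrib power_divide)
  finally have "?x \<le> (exp 1)\<^sup>2 * (1 / (2 * exp 1)) * (2 * ln (real n))"
    using ln_n by (intro mult_right_mono mult_left_mono) auto
  also have "\<dots> = exp 1 * ln (real n)" by (simp add: power2_eq_square)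
  also have "\<dots> \<le> 3 * ln (real n)" using ln_n exp_le by (intro mult_right_mono) auto
  finally show "real KK + 1 \<le> 3 + 3 * ln (real n)" unfolding e using x0 by linarith
qed

sublocale C: coord cc dd "sqrt \<nu>p" \<beta> ll KK
  using pos d_neg constraint \<beta> g ln_n KK_bounds by unfold_locales (auto simp: threshold_def)

lemma M_le: "C.M \<le> Mrate n"
proof -
  have "exp (ll\<^sup>2 / (1 - 5 * C.s\<^sup>2)) \<le> exp (ln (real n) / 5)"
  proof -
    have "ll\<^sup>2 / (1 - 5 * C.s\<^sup>2) = 2 * \<gamma>\<^sup>2 / (1 - 5 * C.s\<^sup>2) * ln (real n)"
      by (simp add: ll_sq)
    also have "\<dots> \<le> 1 / 5 * ln (real n)"
      unfolding C.s_sq using ln_n constraint(2) by (intro mult_right_mono) auto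
    finally show ?thesis by simp
  qed
  then show ?thesis
    unfolding C.M_def Mrate_def using KK_bounds(3) by (intro mult_mono power_mono) auto
qed

text \<open>The constraint on \<gamma> bounds \<open>ll\<^sup>2 / (1 - 5 * s\<^sup>2)\<close> by
  \<open>ln n / 5\<close>, while \<open>rr\<^sup>2 / (4 * s\<^sup>2)\<close> is at least
  \<open>ln n / 2\<close>; the difference produces the exponent \<open>- 3 / 10\<close>.\<close>

lemma bias_le:
  "\<bar>(\<integral>z. C.Tsmooth (m + sqrt \<nu>p * z) \<partial>N01) - G (cc + dd * m) \<beta>\<bar> \<le> bias_rate g n"
proof -
  have rr: "rr \<ge> 0" by (simp add: rr_def pos less_imp_le ln_n)
  have g2: "g\<^sup>2 \<le> \<gamma>\<^sup>2" using g by (intro power_mono) auto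
  have Ksq: "(real KK + 1)\<^sup>2 \<le> (3 + 3 * ln (real n))\<^sup>2"
    using KK_bounds(3) by (intro power_mono) auto
  have "\<bar>(\<integral>z. C.Tsmooth (m + sqrt \<nu>p * z) \<partial>N01) - G (cc + dd * m) \<beta>\<bar>
    \<le> exp (- 2 * (ll + rr)\<^sup>2) + ((real KK + 1)\<^sup>2 + 3) * exp (ll\<^sup>2 / (1 - 5 * C.s\<^sup>2) - rr\<^sup>2 / (4 * C.s\<^sup>2)) + 4 * exp (- ll\<^sup>2 / 16)"
    using rr KK_bounds(2) by (rule C.Tsmooth_bias)
  also have "\<dots> \<le> bias_rate g n"
    unfolding bias_rate_def
  proof (intro add_mono mult_mono Ksq order_refl)
    have "\<gamma>\<^sup>2 \<le> (\<gamma> + sqrt (2 * \<nu>p / \<nu>f))\<^sup>2" using g pos by (intro power_mono) auto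
    then have "g\<^sup>2 * (2 * ln (real n)) \<le> (ll + rr)\<^sup>2"
      unfolding ll_rr using g2 ln_n by (intro mult_right_mono) auto
    then show "exp (- 2 * (ll + rr)\<^sup>2) \<le> exp (- 4 * g\<^sup>2 * ln (real n))" by (simp add: mult_ac)
    have "g\<^sup>2 * ln (real n) \<le> \<gamma>\<^sup>2 * ln (real n)" using g2 ln_n by (intro mult_right_mono) auto
    then show "exp (- ll\<^sup>2 / 16) \<le> exp (- g\<^sup>2 * ln (real n) / 8)" by (simp add: ll_sq mult_ac)
    have "ll\<^sup>2 / (1 - 5 * C.s\<^sup>2) = 2 * \<gamma>\<^sup>2 / (1 - 5 * C.s\<^sup>2) * ln (real n)"
      by (simp add: ll_sq)
    also have "\<dots> \<le> 1 / 5 * ln (real n)"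
      unfolding C.s_sq using ln_n constraint(2) by (intro mult_right_mono) auto
    finally have 1: "ll\<^sup>2 / (1 - 5 * C.s\<^sup>2) \<le> 1 / 5 * ln (real n)" .
    have rsq: "rr\<^sup>2 = (\<nu>p / \<nu>f) * 4 * ln (real n)"
      using ln_n pos by (simp add: rr_def power_mult_distrib)
    have "4 * C.s\<^sup>2 \<le> 8 * (\<nu>p / \<nu>f)" using v_le unfolding C.s_sq by linarith
    then have "1 / 2 * (4 * C.s\<^sup>2) \<le> 4 * (\<nu>p / \<nu>f)" by simp
    then have "1 / 2 * (4 * C.s\<^sup>2) * ln (real n) \<le> 4 * (\<nu>p / \<nu>f) * ln (real n)"
      using ln_n by (intro mult_right_mono) auto
    then have 2: "1 / 2 * ln (real n) \<le> rr\<^sup>2 / (4 * C.s\<^sup>2)"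
      unfolding rsq using C.s_pos by (subst pos_le_divide_eq) (simp_all add: mult_ac)
    from 1 2 show "exp (ll\<^sup>2 / (1 - 5 * C.s\<^sup>2) - rr\<^sup>2 / (4 * C.s\<^sup>2)) \<le> exp (- 3 / 10 * ln (real n))"
      by (simp only: exp_le_cancel_iff)
  qed simp_all
  finally show ?thesis .
qed

lemma s_coef_sq: "(s_coef \<nu>p \<nu>f \<tau>)\<^sup>2 = C.s\<^sup>2"
  using pos by (simp add: s_coef_def C.s_sq power_mult_distrib)

lemma T_hat_eq: "T_hat \<nu>p \<nu>f \<beta> \<gamma> n x \<tau> = C.Tclip (real n) x"
  unfolding T_hat_def C.Tclip_def T_aux_def Let_def S_trunc_def
    S_poly_eq_poly[OF KK_bounds(1) G_0 deriv_G_0] s_coef_sq C.Spoly_def C.U_def C.V_def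
  by (intro Bochner_Integration.integral_cong refl)

definition "w = (b + h) * sqrt (\<nu>f + \<nu>p * (shrinkage \<nu>p \<tau>)\<^sup>2)"

lemma w_bounds: "0 \<le> w" "w \<le> B * sqrt (2 * F)"
  unfolding w_def shrinkage_eq using bh denom by (auto simp: mult.commute[of \<nu>p] intro!: mult_mono)

lemma coord_loss_Lipschitz: "\<bar>coord_loss \<nu>f b h \<theta> q - coord_loss \<nu>f b h \<theta> q'\<bar> \<le> B * \<bar>q - q'\<bar>"
proof -
  have "\<bar>G ((q - \<theta>) / sqrt \<nu>f) \<beta> - G ((q' - \<theta>) / sqrt \<nu>f) \<beta>\<bar> \<le> \<bar>(q - \<theta>) / sqrt \<nu>f - (q' - \<theta>) / sqrt \<nu>f\<bar>"
    by (rule G_Lipschitz[OF \<beta>])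
  also have "(q - \<theta>) / sqrt \<nu>f - (q' - \<theta>) / sqrt \<nu>f = (q - q') / sqrt \<nu>f"
    by (simp add: diff_divide_distrib)
  finally have "sqrt \<nu>f * (b + h) * \<bar>G ((q - \<theta>) / sqrt \<nu>f) \<beta> - G ((q' - \<theta>) / sqrt \<nu>f) \<beta>\<bar>
      \<le> sqrt \<nu>f * (b + h) * \<bar>(q - q') / sqrt \<nu>f\<bar>"
    using pos bh by (intro mult_left_mono) auto
  also have "\<dots> = (b + h) * \<bar>q - q'\<bar>" using pos by (simp add: abs_divide)
  also have "\<dots> \<le> B * \<bar>q - q'\<bar>" using bh by (intro mult_right_mono) auto
  finally show ?thesis
    unfolding coord_loss_def right_diff_distrib[symmetric] abs_mult using pos bh by simp
qed

definition "qshift = sqrt (\<nu>f + \<alpha> * \<nu>p) * std_normal_quantile \<beta>"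

text \<open>The origin of \<open>c_coef\<close> and \<open>d_coef\<close>. With a fixed centre the
  prediction error is Gaussian with variance \<open>\<alpha>\<^sup>2 * \<nu>p\<close>; smoothing
  adds this to \<open>\<nu>f\<close>, and \<open>cc + dd * (\<theta> - \<theta>b)\<close> is the
  mean error in units of the resulting standard deviation.\<close>

lemma coord_loss_mean:
  "has_bochner_integral N01 (\<lambda>z. coord_loss \<nu>f b h \<theta> (\<alpha> * (\<theta> + sqrt \<nu>p * z) + (1 - \<alpha>) * \<theta>b + qshift))
    (w * G (cc + dd * (\<theta> - \<theta>b)) \<beta>)"
proof -
  let ?m = "qshift - (1 - \<alpha>) * (\<theta> - \<theta>b)" and ?q = "sqrt (\<nu>f + \<alpha>\<^sup>2 * \<nu>p)"
  have e: "\<alpha> * (\<theta> + sqrt \<nu>p * z) + (1 - \<alpha>) * \<theta>b + qshift - \<theta> = ?m + (\<alpha> * sqrt \<nu>p) * z" for z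
    by (simp add: algebra_simps)
  have "has_bochner_integral N01 (\<lambda>z. (b + h) * (sqrt \<nu>f * G ((?m + (\<alpha> * sqrt \<nu>p) * z) / sqrt \<nu>f) \<beta>))
      ((b + h) * (sqrt (\<nu>f + (\<alpha> * sqrt \<nu>p)\<^sup>2) * G (?m / sqrt (\<nu>f + (\<alpha> * sqrt \<nu>p)\<^sup>2)) \<beta>))"
    using \<alpha> pos by (intro has_bochner_integral_mult_right G_smoothing) auto
  moreover have "(\<alpha> * sqrt \<nu>p)\<^sup>2 = \<alpha>\<^sup>2 * \<nu>p" using pos by (simp add: power_mult_distrib)
  moreover have "?m / ?q = cc + dd * (\<theta> - \<theta>b)"
    unfolding d_eq c_coef_def shrinkage_eq qshift_def using denom
    by (simp add: real_sqrt_divide diff_divide_distrib[of "sqrt _ * _"])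
      (simp only: minus_divide_left minus_mult_left minus_diff_eq)
  ultimately show ?thesis
    unfolding coord_loss_def e w_def shrinkage_eq by (simp add: mult_ac)
qed

end

section \<open>The residual between estimate and loss at one coordinate\<close>

context coord_setting
begin

definition "wmax = B * sqrt (2 * F)"
definition "dmax = 1 / sqrt p"
definition "Vmax = 2 * (4 * wmax * dmax + B)\<^sup>2 * F + 8 * wmax\<^sup>2 * Mrate n"

lemma wmax_nonneg: "0 \<le> wmax" "0 \<le> dmax" and w_le: "w \<le> wmax"
  using pos p w_bounds by (auto simp: wmax_def dmax_def)

lemma Mrate_nonneg: "0 \<le> Mrate n"
  by (simp add: Mrate_def)

lemma inverse_sigma_le: "1 / sqrt \<nu>p \<le> dmax"
  unfolding dmax_def using p by (intro frac_le) auto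

text \<open>With the deterministic centre \<open>\<theta>b\<close> this depends on a single
  coordinate, so residuals of different coordinates are independent. Clipping and the true centring
  are charged to \<open>resid_error\<close>.\<close>

definition "resid \<theta> \<theta>b y = w * C.Tsmooth (y - \<theta>b) - coord_loss \<nu>f b h \<theta> (\<alpha> * y + (1 - \<alpha>) * \<theta>b + qshift)"

lemma coord_loss_measurable [measurable]: "(\<lambda>q. coord_loss \<nu>f b h \<theta> q) \<in> borel_measurable borel"
  unfolding coord_loss_def by measurable

lemma resid_measurable [measurable]: "resid \<theta> \<theta>b \<in> borel_measurable borel"
  unfolding resid_def[abs_def] by measurable

lemma resid_mean: "\<bar>\<integral>z. resid \<theta> \<theta>b (\<theta> + sqrt \<nu>p * z) \<partial>N01\<bar> \<le> wmax * bias_rate g n"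
proof -
  let ?m = "\<theta> - \<theta>b"
  have e: "resid \<theta> \<theta>b (\<theta> + sqrt \<nu>p * z) = w * C.Tsmooth (?m + sqrt \<nu>p * z)
      - coord_loss \<nu>f b h \<theta> (\<alpha> * (\<theta> + sqrt \<nu>p * z) + (1 - \<alpha>) * \<theta>b + qshift)" for z
    unfolding resid_def by (simp add: algebra_simps)
  have "(\<integral>z. resid \<theta> \<theta>b (\<theta> + sqrt \<nu>p * z) \<partial>N01)
      = w * (\<integral>z. C.Tsmooth (?m + sqrt \<nu>p * z) \<partial>N01) - w * G (cc + dd * ?m) \<beta>"
    unfolding e using coord_loss_mean[of \<theta> \<theta>b] C.Tsmooth_integrable[of ?m]
    by (simp add: has_bochner_integral_iff)
  also have "\<dots> = w * ((\<integral>z. C.Tsmooth (?m + sqrt \<nu>p * z) \<partial>N01) - G (cc + dd * ?m) \<beta>)"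
    by (simp only: right_diff_distrib)
  finally have "\<bar>\<integral>z. resid \<theta> \<theta>b (\<theta> + sqrt \<nu>p * z) \<partial>N01\<bar>
      = w * \<bar>(\<integral>z. C.Tsmooth (?m + sqrt \<nu>p * z) \<partial>N01) - G (cc + dd * ?m) \<beta>\<bar>"
    using w_bounds by (simp add: abs_mult)
  also have "\<dots> \<le> wmax * bias_rate g n"
    using w_le w_bounds(1) wmax_nonneg by (intro mult_mono bias_le) auto
  finally show ?thesis .
qed

lemma square_sum_le: "\<bar>y\<bar> \<le> u * \<bar>z\<bar> + v \<Longrightarrow> y\<^sup>2 \<le> 2 * (u\<^sup>2 * z\<^sup>2) + 2 * v\<^sup>2" for y u z v :: real
proof -
  assume a: "\<bar>y\<bar> \<le> u * \<bar>z\<bar> + v"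
  have "y\<^sup>2 = \<bar>y\<bar>\<^sup>2" by simp
  also have "\<dots> \<le> (u * \<bar>z\<bar> + v)\<^sup>2" using a by (intro power_mono) auto
  also have "\<dots> \<le> 2 * ((u * \<bar>z\<bar>)\<^sup>2 + v\<^sup>2)"
    using sum_squares_bound[of "u * \<bar>z\<bar>" v] by (simp add: power2_sum)
  finally show ?thesis by (simp add: power_mult_distrib)
qed

text \<open>The subtracted centre is the value at \<open>z = 0\<close> of the Lipschitz parts, which
  may grow with \<theta>. Their deviation from it is of order \<open>|z|\<close>, and
  \<open>Tpoly\<close> has a bounded second moment by itself, so the bound is uniform in
  \<theta>.\<close>

lemma resid_second_moment:
  "(\<integral>\<^sup>+z. ennreal ((resid \<theta> \<theta>b (\<theta> + sqrt \<nu>p * z)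
      - (w * C.Tlin (\<theta> - \<theta>b) - coord_loss \<nu>f b h \<theta> (\<alpha> * \<theta> + (1 - \<alpha>) * \<theta>b + qshift)))\<^sup>2) \<partial>N01) \<le> ennreal Vmax"
proof -
  let ?a = "w * C.Tlin (\<theta> - \<theta>b) - coord_loss \<nu>f b h \<theta> (\<alpha> * \<theta> + (1 - \<alpha>) * \<theta>b + qshift)"
  let ?c = "4 * wmax * dmax + B"
  have pt: "(resid \<theta> \<theta>b (\<theta> + sqrt \<nu>p * z) - ?a)\<^sup>2
      \<le> (2 * ?c\<^sup>2 * F) * z\<^sup>2 + (4 * wmax\<^sup>2) * C.Qpoly ((\<theta> - \<theta>b) + sqrt \<nu>p * z)" for z
  proof -
    let ?y = "(\<theta> - \<theta>b) + sqrt \<nu>p * z"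
    have eq: "resid \<theta> \<theta>b (\<theta> + sqrt \<nu>p * z) - ?a = w * (C.Tlin ?y - C.Tlin (\<theta> - \<theta>b)) + w * C.Tpoly ?y
       - (coord_loss \<nu>f b h \<theta> (\<alpha> * (\<theta> + sqrt \<nu>p * z) + (1 - \<alpha>) * \<theta>b + qshift)
          - coord_loss \<nu>f b h \<theta> (\<alpha> * \<theta> + (1 - \<alpha>) * \<theta>b + qshift))"
      unfolding resid_def by (simp add: C.Tsmooth_eq algebra_simps)
    have 1: "\<bar>w * (C.Tlin ?y - C.Tlin (\<theta> - \<theta>b))\<bar> \<le> wmax * (4 * dmax * (sqrt F * \<bar>z\<bar>))"
    proof -
      have "\<bar>C.Tlin ?y - C.Tlin (\<theta> - \<theta>b)\<bar> \<le> 4 * \<bar>dd\<bar> * \<bar>?y - (\<theta> - \<theta>b)\<bar>" by (rule C.Tlin_Lipschitz)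
      also have "\<bar>?y - (\<theta> - \<theta>b)\<bar> = sqrt \<nu>p * \<bar>z\<bar>" using pos by (simp add: abs_mult)
      also have "4 * \<bar>dd\<bar> * (sqrt \<nu>p * \<bar>z\<bar>) \<le> 4 * dmax * (sqrt F * \<bar>z\<bar>)"
        using p d_abs_le \<nu> pos unfolding dmax_def by (intro mult_mono) auto
      finally have "w * \<bar>C.Tlin ?y - C.Tlin (\<theta> - \<theta>b)\<bar> \<le> wmax * (4 * dmax * (sqrt F * \<bar>z\<bar>))"
        using w_le w_bounds wmax_nonneg by (intro mult_mono) auto
      then show ?thesis using w_bounds by (simp add: abs_mult)
    qed
    have 2: "\<bar>w * C.Tpoly ?y\<bar> \<le> wmax * \<bar>C.Tpoly ?y\<bar>"
      unfolding abs_mult using w_le w_bounds by (intro mult_right_mono) auto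
    have 3: "\<bar>coord_loss \<nu>f b h \<theta> (\<alpha> * (\<theta> + sqrt \<nu>p * z) + (1 - \<alpha>) * \<theta>b + qshift)
          - coord_loss \<nu>f b h \<theta> (\<alpha> * \<theta> + (1 - \<alpha>) * \<theta>b + qshift)\<bar> \<le> B * (sqrt F * \<bar>z\<bar>)"
    proof -
      have "\<bar>coord_loss \<nu>f b h \<theta> (\<alpha> * (\<theta> + sqrt \<nu>p * z) + (1 - \<alpha>) * \<theta>b + qshift)
          - coord_loss \<nu>f b h \<theta> (\<alpha> * \<theta> + (1 - \<alpha>) * \<theta>b + qshift)\<bar>
        \<le> B * \<bar>(\<alpha> * (\<theta> + sqrt \<nu>p * z) + (1 - \<alpha>) * \<theta>b + qshift) - (\<alpha> * \<theta> + (1 - \<alpha>) * \<theta>b + qshift)\<bar>"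
        by (rule coord_loss_Lipschitz)
      also have "\<bar>(\<alpha> * (\<theta> + sqrt \<nu>p * z) + (1 - \<alpha>) * \<theta>b + qshift) - (\<alpha> * \<theta> + (1 - \<alpha>) * \<theta>b + qshift)\<bar>
          = \<alpha> * (sqrt \<nu>p * \<bar>z\<bar>)"
        using \<alpha> pos by (simp add: distrib_left abs_mult)
      also have "\<dots> \<le> 1 * (sqrt F * \<bar>z\<bar>)"
        using \<alpha> \<nu> pos by (intro mult_mono) auto
      finally show ?thesis using pos by simp
    qed
    have "\<bar>resid \<theta> \<theta>b (\<theta> + sqrt \<nu>p * z) - ?a\<bar> \<le> wmax * (4 * dmax * (sqrt F * \<bar>z\<bar>)) + wmax * \<bar>C.Tpoly ?y\<bar> + B * (sqrt F * \<bar>z\<bar>)"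
      unfolding eq using 1 2 3 by linarith
    also have "\<dots> = (?c * sqrt F) * \<bar>z\<bar> + wmax * \<bar>C.Tpoly ?y\<bar>"
      by (simp add: algebra_simps)
    finally have "(resid \<theta> \<theta>b (\<theta> + sqrt \<nu>p * z) - ?a)\<^sup>2 \<le> 2 * ((?c * sqrt F)\<^sup>2 * z\<^sup>2) + 2 * (wmax * \<bar>C.Tpoly ?y\<bar>)\<^sup>2"
      by (rule square_sum_le)
    also have "\<dots> = (2 * ?c\<^sup>2 * F) * z\<^sup>2 + (2 * wmax\<^sup>2) * (C.Tpoly ?y)\<^sup>2"
      using pos by (simp add: power_mult_distrib)
    also have "\<dots> \<le> (2 * ?c\<^sup>2 * F) * z\<^sup>2 + (2 * wmax\<^sup>2) * (2 * C.Qpoly ?y)"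
      by (intro add_left_mono mult_left_mono C.Tpoly_square_le) simp
    finally show ?thesis by simp
  qed
  have "(\<integral>\<^sup>+z. ennreal ((resid \<theta> \<theta>b (\<theta> + sqrt \<nu>p * z) - ?a)\<^sup>2) \<partial>N01)
      \<le> (\<integral>\<^sup>+z. ennreal (2 * ?c\<^sup>2 * F) * ennreal (z\<^sup>2) + ennreal (4 * wmax\<^sup>2) * ennreal (C.Qpoly ((\<theta> - \<theta>b) + sqrt \<nu>p * z)) \<partial>N01)"
  proof (intro nn_integral_mono)
    fix z
    have "ennreal ((resid \<theta> \<theta>b (\<theta> + sqrt \<nu>p * z) - ?a)\<^sup>2)
       \<le> ennreal ((2 * ?c\<^sup>2 * F) * z\<^sup>2 + (4 * wmax\<^sup>2) * C.Qpoly ((\<theta> - \<theta>b) + sqrt \<nu>p * z))"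
      by (rule ennreal_leI[OF pt])
    also have "\<dots> = ennreal ((2 * ?c\<^sup>2 * F) * z\<^sup>2) + ennreal ((4 * wmax\<^sup>2) * C.Qpoly ((\<theta> - \<theta>b) + sqrt \<nu>p * z))"
      using pos C.Qpoly_nonneg by (intro ennreal_plus) auto
    also have "\<dots> = ennreal (2 * ?c\<^sup>2 * F) * ennreal (z\<^sup>2) + ennreal (4 * wmax\<^sup>2) * ennreal (C.Qpoly ((\<theta> - \<theta>b) + sqrt \<nu>p * z))"
      by (subst (1 2) ennreal_mult'') (use C.Qpoly_nonneg in auto)
    finally show "ennreal ((resid \<theta> \<theta>b (\<theta> + sqrt \<nu>p * z) - ?a)\<^sup>2)
       \<le> ennreal (2 * ?c\<^sup>2 * F) * ennreal (z\<^sup>2) + ennreal (4 * wmax\<^sup>2) * ennreal (C.Qpoly ((\<theta> - \<theta>b) + sqrt \<nu>p * z))" .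
  qed
  also have "\<dots> = ennreal (2 * ?c\<^sup>2 * F) * (\<integral>\<^sup>+z. ennreal (z\<^sup>2) \<partial>N01)
      + ennreal (4 * wmax\<^sup>2) * (\<integral>\<^sup>+z. ennreal (C.Qpoly ((\<theta> - \<theta>b) + sqrt \<nu>p * z)) \<partial>N01)"
    by (simp add: nn_integral_add nn_integral_cmult)
  also have "\<dots> \<le> ennreal (2 * ?c\<^sup>2 * F) * 1 + ennreal (4 * wmax\<^sup>2) * ennreal (2 * C.M)"
    unfolding nn_integral_N01_square by (intro add_left_mono mult_left_mono C.Qpoly_mean) simp
  also have "\<dots> \<le> ennreal (2 * ?c\<^sup>2 * F) * 1 + ennreal (4 * wmax\<^sup>2) * ennreal (2 * Mrate n)"
    using M_le by (intro add_left_mono mult_left_mono ennreal_leI) auto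
  also have "\<dots> = ennreal (2 * ?c\<^sup>2 * F) + ennreal (4 * wmax\<^sup>2 * (2 * Mrate n))"
    using Mrate_nonneg by (subst ennreal_mult'') auto
  also have "\<dots> = ennreal Vmax"
    unfolding Vmax_def using pos Mrate_nonneg by (subst ennreal_plus[symmetric]) auto
  finally show ?thesis .
qed

text \<open>Error terms sorted by argument: \<open>\<Psi>1\<close> will be taken at \<open>x\<close>
  minus the grand mean, \<open>\<Psi>2\<close> at \<open>x - \<theta>b\<close>. The first has to be
  integrated by conditioning on the other coordinates, the second directly.\<close>

definition "\<Psi>1 a u = ennreal wmax * (C.Eclip u / ennreal (real n) + ennreal (C.Qpoly u / (2 * a)))"
definition "\<Psi>2 \<delta> a u = ennreal wmax * (C.Wpoly \<delta> u + ennreal (C.Qpoly u / (2 * a)))"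

lemma \<Psi>_measurable [measurable]: "\<Psi>1 a \<in> borel_measurable borel" "\<Psi>2 \<delta> a \<in> borel_measurable borel"
  unfolding \<Psi>1_def[abs_def] \<Psi>2_def[abs_def] by measurable

lemma Qpoly_scaled_mean:
  assumes "a > 0"
  shows "(\<integral>\<^sup>+z. ennreal (C.Qpoly (m + sqrt \<nu>p * z) / (2 * a)) \<partial>N01) \<le> ennreal (Mrate n / a)"
proof -
  have "(\<integral>\<^sup>+z. ennreal (C.Qpoly (m + sqrt \<nu>p * z) / (2 * a)) \<partial>N01)
      = (\<integral>\<^sup>+z. ennreal (1 / (2 * a)) * ennreal (C.Qpoly (m + sqrt \<nu>p * z)) \<partial>N01)"
    using assms by (intro nn_integral_cong) (simp add: ennreal_mult'[symmetric])
  also have "\<dots> = ennreal (1 / (2 * a)) * (\<integral>\<^sup>+z. ennreal (C.Qpoly (m + sqrt \<nu>p * z)) \<partial>N01)"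
    by (rule nn_integral_cmult) measurable
  also have "\<dots> \<le> ennreal (1 / (2 * a)) * ennreal (2 * Mrate n)"
    using M_le by (intro mult_left_mono order_trans[OF C.Qpoly_mean] ennreal_leI) auto
  also have "\<dots> = ennreal (Mrate n / a)"
    using assms Mrate_nonneg by (simp add: ennreal_mult'[symmetric])
  finally show ?thesis .
qed

lemma \<Psi>1_mean:
  assumes "a > 0"
  shows "(\<integral>\<^sup>+z. \<Psi>1 a (m + sqrt \<nu>p * z) \<partial>N01) \<le> ennreal (wmax * (Mrate n / real n + Mrate n / a))"
proof -
  have "(\<integral>\<^sup>+z. \<Psi>1 a (m + sqrt \<nu>p * z) \<partial>N01)
      = ennreal wmax * ((\<integral>\<^sup>+z. C.Eclip (m + sqrt \<nu>p * z) \<partial>N01) / ennreal (real n)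
         + (\<integral>\<^sup>+z. ennreal (C.Qpoly (m + sqrt \<nu>p * z) / (2 * a)) \<partial>N01))"
    unfolding \<Psi>1_def by (simp add: nn_integral_cmult nn_integral_add nn_integral_divide)
  also have "\<dots> \<le> ennreal wmax * (ennreal (Mrate n) / ennreal (real n) + ennreal (Mrate n / a))"
    using M_le by (intro mult_left_mono add_mono divide_right_mono_ennreal Qpoly_scaled_mean assms
        order_trans[OF C.Eclip_mean] ennreal_leI) auto
  also have "ennreal (Mrate n) / ennreal (real n) = ennreal (Mrate n / real n)"
    using Mrate_nonneg n by (intro divide_ennreal) auto
  also have "ennreal wmax * (ennreal (Mrate n / real n) + ennreal (Mrate n / a))
      = ennreal (wmax * (Mrate n / real n + Mrate n / a))"
    using assms Mrate_nonneg wmax_nonneg by (subst ennreal_plus[symmetric]) (auto simp: ennreal_mult')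
  finally show ?thesis .
qed

lemma \<Psi>2_mean:
  assumes "a > 0" "\<delta> > 0"
  shows "(\<integral>\<^sup>+z. \<Psi>2 \<delta> a (m + sqrt \<nu>p * z) \<partial>N01) \<le> ennreal (wmax * (8 * \<delta> * dmax * (Mrate n + 1) + Mrate n / a))"
proof -
  have "(\<integral>\<^sup>+z. \<Psi>2 \<delta> a (m + sqrt \<nu>p * z) \<partial>N01)
      = ennreal wmax * ((\<integral>\<^sup>+z. C.Wpoly \<delta> (m + sqrt \<nu>p * z) \<partial>N01)
         + (\<integral>\<^sup>+z. ennreal (C.Qpoly (m + sqrt \<nu>p * z) / (2 * a)) \<partial>N01))"
    unfolding \<Psi>2_def by (simp add: nn_integral_cmult nn_integral_add)
  also have "\<dots> \<le> ennreal wmax * (ennreal (8 * \<delta> * dmax * (Mrate n + 1)) + ennreal (Mrate n / a))"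
  proof (intro mult_left_mono add_mono Qpoly_scaled_mean assms)
    have "(\<bar>dd\<bar> + 1 / sqrt \<nu>p) * (C.M + 1) \<le> (2 * dmax) * (Mrate n + 1)"
      using d_abs_le inverse_sigma_le M_le C.M_nonneg wmax_nonneg unfolding dmax_def[symmetric] by (intro mult_mono) auto
    then have "4 * \<delta> * ((\<bar>dd\<bar> + 1 / sqrt \<nu>p) * (C.M + 1)) \<le> 4 * \<delta> * ((2 * dmax) * (Mrate n + 1))"
      using assms by (intro mult_left_mono) auto
    then show "(\<integral>\<^sup>+z. C.Wpoly \<delta> (m + sqrt \<nu>p * z) \<partial>N01) \<le> ennreal (8 * \<delta> * dmax * (Mrate n + 1))"
      using assms by (intro order_trans[OF C.Wpoly_mean] ennreal_leI) (auto simp: mult_ac)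
  qed simp
  also have "\<dots> = ennreal (wmax * (8 * \<delta> * dmax * (Mrate n + 1) + Mrate n / a))"
    using assms Mrate_nonneg wmax_nonneg by (subst ennreal_plus[symmetric]) (auto simp: ennreal_mult')
  finally show ?thesis .
qed

lemma resid_error:
  assumes pos': "a > 0" "\<delta> > 0"
  shows "ennreal \<bar>w * T_hat \<nu>p \<nu>f \<beta> \<gamma> n (x - xb) \<tau> - coord_loss \<nu>f b h \<theta> (\<alpha> * x + (1 - \<alpha>) * xb + qshift) - resid \<theta> \<theta>b x\<bar>
    \<le> \<Psi>1 a (x - xb) + \<Psi>2 \<delta> a (x - \<theta>b)
      + ennreal ((4 * wmax * dmax + B) * \<bar>xb - \<theta>b\<bar> + wmax * (2 * a / \<delta>\<^sup>2) * (xb - \<theta>b)\<^sup>2)"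
proof -
  define e where "e = xb - \<theta>b"
  let ?T = "\<bar>C.Tclip (real n) ((x - \<theta>b) - e) - C.Tsmooth (x - \<theta>b)\<bar>"
  have "\<bar>w * T_hat \<nu>p \<nu>f \<beta> \<gamma> n (x - xb) \<tau> - coord_loss \<nu>f b h \<theta> (\<alpha> * x + (1 - \<alpha>) * xb + qshift) - resid \<theta> \<theta>b x\<bar>
     = \<bar>w * (C.Tclip (real n) ((x - \<theta>b) - e) - C.Tsmooth (x - \<theta>b))
        - (coord_loss \<nu>f b h \<theta> (\<alpha> * x + (1 - \<alpha>) * xb + qshift) - coord_loss \<nu>f b h \<theta> (\<alpha> * x + (1 - \<alpha>) * \<theta>b + qshift))\<bar>"
    unfolding resid_def T_hat_eq e_def by (simp add: algebra_simps)
  also have "\<dots> \<le> \<bar>w * (C.Tclip (real n) ((x - \<theta>b) - e) - C.Tsmooth (x - \<theta>b))\<bar>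
      + \<bar>coord_loss \<nu>f b h \<theta> (\<alpha> * x + (1 - \<alpha>) * xb + qshift) - coord_loss \<nu>f b h \<theta> (\<alpha> * x + (1 - \<alpha>) * \<theta>b + qshift)\<bar>"
    by (rule abs_triangle_ineq4)
  also have "\<dots> \<le> wmax * ?T + B * \<bar>e\<bar>"
  proof (rule add_mono)
    show "\<bar>w * (C.Tclip (real n) ((x - \<theta>b) - e) - C.Tsmooth (x - \<theta>b))\<bar> \<le> wmax * ?T"
      unfolding abs_mult using w_le w_bounds by (intro mult_right_mono) auto
    have "\<bar>coord_loss \<nu>f b h \<theta> (\<alpha> * x + (1 - \<alpha>) * xb + qshift) - coord_loss \<nu>f b h \<theta> (\<alpha> * x + (1 - \<alpha>) * \<theta>b + qshift)\<bar>
        \<le> B * \<bar>(\<alpha> * x + (1 - \<alpha>) * xb + qshift) - (\<alpha> * x + (1 - \<alpha>) * \<theta>b + qshift)\<bar>"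
      by (rule coord_loss_Lipschitz)
    also have "(\<alpha> * x + (1 - \<alpha>) * xb + qshift) - (\<alpha> * x + (1 - \<alpha>) * \<theta>b + qshift) = (1 - \<alpha>) * e"
      by (simp add: e_def algebra_simps)
    also have "B * \<bar>(1 - \<alpha>) * e\<bar> \<le> B * (1 * \<bar>e\<bar>)"
      unfolding abs_mult using \<alpha> pos by (intro mult_left_mono mult_right_mono) auto
    finally show "\<bar>coord_loss \<nu>f b h \<theta> (\<alpha> * x + (1 - \<alpha>) * xb + qshift) - coord_loss \<nu>f b h \<theta> (\<alpha> * x + (1 - \<alpha>) * \<theta>b + qshift)\<bar> \<le> B * \<bar>e\<bar>"
      by simp
  qed
  finally have "ennreal \<bar>w * T_hat \<nu>p \<nu>f \<beta> \<gamma> n (x - xb) \<tau> - coord_loss \<nu>f b h \<theta> (\<alpha> * x + (1 - \<alpha>) * xb + qshift) - resid \<theta> \<theta>b x\<bar>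
      \<le> ennreal (wmax * ?T + B * \<bar>e\<bar>)" by (rule ennreal_leI)
  also have "\<dots> = ennreal wmax * ennreal ?T + ennreal (B * \<bar>e\<bar>)"
    using wmax_nonneg pos by (subst ennreal_plus) (simp_all add: ennreal_mult')
  also have "\<dots> \<le> ennreal wmax * (C.Eclip ((x - \<theta>b) - e) / ennreal (real n) + ennreal (4 * \<bar>dd\<bar> * \<bar>e\<bar>) + C.Wpoly \<delta> (x - \<theta>b)
    + ennreal (2 * a * e\<^sup>2 / \<delta>\<^sup>2) + ennreal (C.Qpoly ((x - \<theta>b) - e) / (2 * a)) + ennreal (C.Qpoly (x - \<theta>b) / (2 * a))) + ennreal (B * \<bar>e\<bar>)"
    using pos' n by (intro add_right_mono mult_left_mono C.Tclip_shift) auto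
  also have "\<dots> = \<Psi>1 a (x - xb) + \<Psi>2 \<delta> a (x - \<theta>b)
      + (ennreal wmax * (ennreal (4 * \<bar>dd\<bar> * \<bar>e\<bar>) + ennreal (2 * a * e\<^sup>2 / \<delta>\<^sup>2)) + ennreal (B * \<bar>e\<bar>))"
  proof -
    have r: "c * (u1 + u2 + u3 + u4 + u5 + u6) + u7 = c * (u1 + u5) + c * (u3 + u6) + (c * (u2 + u4) + u7)"
      for c u1 u2 u3 u4 u5 u6 u7 :: ennreal by (simp add: distrib_left ac_simps)
    have x: "(x - \<theta>b) - e = x - xb" by (simp add: e_def)
    show ?thesis unfolding \<Psi>1_def \<Psi>2_def x by (rule r)
  qed
  also have "ennreal wmax * (ennreal (4 * \<bar>dd\<bar> * \<bar>e\<bar>) + ennreal (2 * a * e\<^sup>2 / \<delta>\<^sup>2)) + ennreal (B * \<bar>e\<bar>)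
      = ennreal (wmax * (4 * \<bar>dd\<bar> * \<bar>e\<bar> + 2 * a * e\<^sup>2 / \<delta>\<^sup>2) + B * \<bar>e\<bar>)"
  proof -
    have nn: "0 \<le> 4 * \<bar>dd\<bar> * \<bar>e\<bar>" "0 \<le> 2 * a * e\<^sup>2 / \<delta>\<^sup>2" "0 \<le> B * \<bar>e\<bar>" using pos pos' by auto
    have "ennreal (wmax * (4 * \<bar>dd\<bar> * \<bar>e\<bar> + 2 * a * e\<^sup>2 / \<delta>\<^sup>2) + B * \<bar>e\<bar>)
       = ennreal (wmax * (4 * \<bar>dd\<bar> * \<bar>e\<bar> + 2 * a * e\<^sup>2 / \<delta>\<^sup>2)) + ennreal (B * \<bar>e\<bar>)"
      by (intro ennreal_plus mult_nonneg_nonneg add_nonneg_nonneg nn wmax_nonneg)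
    also have "ennreal (wmax * (4 * \<bar>dd\<bar> * \<bar>e\<bar> + 2 * a * e\<^sup>2 / \<delta>\<^sup>2)) = ennreal wmax * ennreal (4 * \<bar>dd\<bar> * \<bar>e\<bar> + 2 * a * e\<^sup>2 / \<delta>\<^sup>2)"
      by (rule ennreal_mult'[OF wmax_nonneg(1)])
    also have "ennreal (4 * \<bar>dd\<bar> * \<bar>e\<bar> + 2 * a * e\<^sup>2 / \<delta>\<^sup>2) = ennreal (4 * \<bar>dd\<bar> * \<bar>e\<bar>) + ennreal (2 * a * e\<^sup>2 / \<delta>\<^sup>2)"
      by (rule ennreal_plus[OF nn(1,2)])
    finally show ?thesis by (rule sym)
  qed
  also have "\<Psi>1 a (x - xb) + \<Psi>2 \<delta> a (x - \<theta>b) + ennreal (wmax * (4 * \<bar>dd\<bar> * \<bar>e\<bar> + 2 * a * e\<^sup>2 / \<delta>\<^sup>2) + B * \<bar>e\<bar>)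
    \<le> \<Psi>1 a (x - xb) + \<Psi>2 \<delta> a (x - \<theta>b) + ennreal ((4 * wmax * dmax + B) * \<bar>e\<bar> + wmax * (2 * a / \<delta>\<^sup>2) * e\<^sup>2)"
  proof (intro add_left_mono ennreal_leI)
    have "wmax * (4 * \<bar>dd\<bar> * \<bar>e\<bar>) \<le> wmax * (4 * dmax * \<bar>e\<bar>)"
      using wmax_nonneg d_abs_le unfolding dmax_def[symmetric] by (intro mult_left_mono mult_right_mono) auto
    then show "wmax * (4 * \<bar>dd\<bar> * \<bar>e\<bar> + 2 * a * e\<^sup>2 / \<delta>\<^sup>2) + B * \<bar>e\<bar>
        \<le> (4 * wmax * dmax + B) * \<bar>e\<bar> + wmax * (2 * a / \<delta>\<^sup>2) * e\<^sup>2"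
      by (simp add: algebra_simps)
  qed
  finally show ?thesis unfolding e_def .
qed

end

section \<open>The error of the risk estimate\<close>

text \<open>The interface between one coordinate and the average. A tuple of residual, centre and
  two majorants is described by numeric bounds common to all coordinates, so that such tuples can be
  chosen coordinate by coordinate.\<close>

definition cell_ok where
  "cell_ok \<nu>p \<nu>f b h \<gamma> n \<tau> \<theta> \<theta>b wm lm vm bm p1 p2 c2 q \<longleftrightarrow> (case q of (Y, c, \<Psi>1, \<Psi>2) \<Rightarrow>
    Y \<in> borel_measurable borel \<and> \<Psi>1 \<in> borel_measurable borel \<and> \<Psi>2 \<in> borel_measurable borel \<and>
    \<bar>\<integral>z. Y (\<theta> + sqrt \<nu>p * z) \<partial>N01\<bar> \<le> bm \<and>
    (\<integral>\<^sup>+z. ennreal ((Y (\<theta> + sqrt \<nu>p * z) - c)\<^sup>2) \<partial>N01) \<le> ennreal vm \<and>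
    (\<forall>m. (\<integral>\<^sup>+z. \<Psi>1 (m + sqrt \<nu>p * z) \<partial>N01) \<le> ennreal p1) \<and>
    (\<forall>m. (\<integral>\<^sup>+z. \<Psi>2 (m + sqrt \<nu>p * z) \<partial>N01) \<le> ennreal p2) \<and>
    (\<forall>x xb. ennreal \<bar>(b + h) * sqrt (\<nu>f + \<nu>p * (shrinkage \<nu>p \<tau>)\<^sup>2) * T_hat \<nu>p \<nu>f (btilde b h) \<gamma> n (x - xb) \<tau>
        - coord_loss \<nu>f b h \<theta> (shrinkage \<nu>p \<tau> * x + (1 - shrinkage \<nu>p \<tau>) * xb
            + sqrt (\<nu>f + shrinkage \<nu>p \<tau> * \<nu>p) * std_normal_quantile (btilde b h)) - Y x\<bar>
      \<le> \<Psi>1 (x - xb) + \<Psi>2 (x - \<theta>b) + ennreal (lm * \<bar>xb - \<theta>b\<bar> + c2 * (xb - \<theta>b)\<^sup>2)))"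

lemma (in coord_setting) cell_ok_ex:
  assumes "a > 0" "\<delta> > 0"
  shows "\<exists>q. cell_ok \<nu>p \<nu>f b h \<gamma> n \<tau> \<theta> \<theta>b wmax (4 * wmax * dmax + B) Vmax (wmax * bias_rate g n)
    (wmax * (Mrate n / real n + Mrate n / a)) (wmax * (8 * \<delta> * dmax * (Mrate n + 1) + Mrate n / a)) (wmax * (2 * a / \<delta>\<^sup>2)) q"
proof (rule exI[of _ "(resid \<theta> \<theta>b, w * C.Tlin (\<theta> - \<theta>b) - coord_loss \<nu>f b h \<theta> (\<alpha> * \<theta> + (1 - \<alpha>) * \<theta>b + qshift), \<Psi>1 a, \<Psi>2 \<delta> a)"],
    unfold cell_ok_def prod.case, intro conjI allI)
  show "\<bar>\<integral>z. resid \<theta> \<theta>b (\<theta> + sqrt \<nu>p * z) \<partial>N01\<bar> \<le> wmax * bias_rate g n" by (rule resid_mean)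
  show "(\<integral>\<^sup>+z. ennreal ((resid \<theta> \<theta>b (\<theta> + sqrt \<nu>p * z)
      - (w * C.Tlin (\<theta> - \<theta>b) - coord_loss \<nu>f b h \<theta> (\<alpha> * \<theta> + (1 - \<alpha>) * \<theta>b + qshift)))\<^sup>2) \<partial>N01) \<le> ennreal Vmax"
    by (rule resid_second_moment)
  fix x xb
  show "ennreal \<bar>(b + h) * sqrt (\<nu>f + \<nu>p * (shrinkage \<nu>p \<tau>)\<^sup>2) * T_hat \<nu>p \<nu>f (btilde b h) \<gamma> n (x - xb) \<tau>
        - coord_loss \<nu>f b h \<theta> (shrinkage \<nu>p \<tau> * x + (1 - shrinkage \<nu>p \<tau>) * xb
            + sqrt (\<nu>f + shrinkage \<nu>p \<tau> * \<nu>p) * std_normal_quantile (btilde b h)) - resid \<theta> \<theta>b x\<bar>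
      \<le> \<Psi>1 a (x - xb) + \<Psi>2 \<delta> a (x - \<theta>b) + ennreal ((4 * wmax * dmax + B) * \<bar>xb - \<theta>b\<bar> + wmax * (2 * a / \<delta>\<^sup>2) * (xb - \<theta>b)\<^sup>2)"
    using resid_error[OF assms, of x xb \<theta> \<theta>b] by (simp only: w_def shrinkage_eq qshift_def)
qed (use \<Psi>1_mean[OF assms(1)] \<Psi>2_mean[OF assms] in auto)

definition total_rate where
  "total_rate F \<eta> wm lm vm bm p1 p2 c2 n = 2 * p1 + p2 + (lm * \<eta> + \<eta> + bm) + (lm / \<eta> + c2) * (F / real n) + vm / (\<eta> * real n)"

text \<open>Passes from second moments to first moments pointwise, with slack \<eta>, in place of
  Cauchy-Schwarz for integrals.\<close>

lemma le_scaled_square: "\<eta> > 0 \<Longrightarrow> \<bar>u\<bar> \<le> \<eta> + u\<^sup>2 / \<eta>" for u \<eta> :: real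
proof -
  assume \<eta>: "\<eta> > 0"
  have "\<bar>u / \<eta>\<bar> \<le> 1 + (u / \<eta>)\<^sup>2" by (rule abs_le_one_plus_square)
  then have "\<eta> * \<bar>u / \<eta>\<bar> \<le> \<eta> * (1 + (u / \<eta>)\<^sup>2)" using \<eta> by (intro mult_left_mono) auto
  then show ?thesis using \<eta> by (simp add: abs_divide power_divide power2_eq_square distrib_left)
qed

lemma abs_sum3_div:
  fixes A S C N :: real
  assumes N: "N > 0" and A: "\<bar>A\<bar> \<le> A'" and C: "\<bar>C\<bar> \<le> C'"
  shows "\<bar>(A + S + C) / N\<bar> \<le> A' / N + \<bar>S / N\<bar> + C' / N"
proof -
  have "\<bar>A + S + C\<bar> \<le> A' + \<bar>S\<bar> + C'" using A C by linarith
  then have "\<bar>A + S + C\<bar> / N \<le> (A' + \<bar>S\<bar> + C') / N" using N by (intro divide_right_mono) auto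
  moreover have "\<bar>(A + S + C) / N\<bar> = \<bar>A + S + C\<bar> / N" "\<bar>S / N\<bar> = \<bar>S\<bar> / N"
    by (simp_all only: abs_divide abs_of_pos[OF N])
  ultimately show ?thesis by (simp only: add_divide_distrib[of "A' + \<bar>S\<bar>"] add_divide_distrib[of A'])
qed

text \<open>Pointwise, the error is at most the averaged majorants plus multiples of the squared
  deviation of the grand mean and of the squared centred residual sum. The means of these two
  squares are at most \<open>F / n\<close> and \<open>n * vm\<close>.\<close>

lemma ARE_error_general:
  fixes \<theta> \<nu>p \<nu>f b h \<gamma> :: "nat \<Rightarrow> real" and n :: nat
  defines "\<theta>b \<equiv> grand_mean n \<theta>"
  assumes n: "n \<ge> 2" and F: "\<And>i. i \<in> {1..n} \<Longrightarrow> \<nu>p i \<le> F \<and> \<nu>p i \<ge> 0" and \<eta>: "\<eta> > 0"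
    and nonneg: "0 \<le> lm" "0 \<le> vm" "0 \<le> bm" "0 \<le> p1" "0 \<le> p2" "0 \<le> c2"
    and ok: "\<And>i. i \<in> {1..n} \<Longrightarrow> \<exists>q. cell_ok (\<nu>p i) (\<nu>f i) (b i) (h i) (\<gamma> i) n \<tau> (\<theta> i) \<theta>b wm lm vm bm p1 p2 c2 q"
  shows "(\<integral>\<^sup>+x. ennreal \<bar>ARE \<nu>p \<nu>f b h \<gamma> n \<tau> x - loss \<nu>f b h n \<theta> (predictor \<nu>p \<nu>f b h n \<tau> x)\<bar> \<partial>gauss_vec n \<theta> (\<lambda>i. sqrt (\<nu>p i)))
    \<le> ennreal (total_rate F \<eta> wm lm vm bm p1 p2 c2 n)"
proof -
  let ?P = "gauss_vec n \<theta> (\<lambda>i. sqrt (\<nu>p i))"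
  interpret P: prob_space ?P by (rule prob_space_gauss_vec)
  obtain q where q: "\<And>i. i \<in> {1..n} \<Longrightarrow> cell_ok (\<nu>p i) (\<nu>f i) (b i) (h i) (\<gamma> i) n \<tau> (\<theta> i) \<theta>b wm lm vm bm p1 p2 c2 (q i)"
    using bchoice[of "{1..n}" "\<lambda>i q. cell_ok (\<nu>p i) (\<nu>f i) (b i) (h i) (\<gamma> i) n \<tau> (\<theta> i) \<theta>b wm lm vm bm p1 p2 c2 q"] ok by blast
  \<comment> \<open>Zero outside \<open>{1..n}\<close>, so that measurability holds for every
    index.\<close>
  define Y c \<Psi>1 \<Psi>2 where "Y = (\<lambda>i. if i \<in> {1..n} then fst (q i) else (\<lambda>_. 0))" and "c = (\<lambda>i. fst (snd (q i)))"
    and "\<Psi>1 = (\<lambda>i. if i \<in> {1..n} then fst (snd (snd (q i))) else (\<lambda>_. 0))"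
    and "\<Psi>2 = (\<lambda>i. if i \<in> {1..n} then snd (snd (snd (q i))) else (\<lambda>_. 0))"
  define m where "m = (\<lambda>i. \<integral>z. Y i (\<theta> i + sqrt (\<nu>p i) * z) \<partial>N01)"
  have q': "cell_ok (\<nu>p i) (\<nu>f i) (b i) (h i) (\<gamma> i) n \<tau> (\<theta> i) \<theta>b wm lm vm bm p1 p2 c2 (Y i, c i, \<Psi>1 i, \<Psi>2 i)"
    if "i \<in> {1..n}" for i
    using q[OF that] that by (simp add: Y_def c_def \<Psi>1_def \<Psi>2_def)
  have meas[measurable]: "Y i \<in> borel_measurable borel" "\<Psi>1 i \<in> borel_measurable borel" "\<Psi>2 i \<in> borel_measurable borel" for i
    using q'[of i] by (cases "i \<in> {1..n}"; simp add: cell_ok_def; simp add: Y_def \<Psi>1_def \<Psi>2_def)+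
  have mi: "\<bar>m i\<bar> \<le> bm" if "i \<in> {1..n}" for i
    using q'[OF that] by (simp add: cell_ok_def m_def)
  define e where "e = (\<lambda>x. grand_mean n x - \<theta>b)"
  define S where "S = (\<lambda>x. \<Sum>i=1..n. Y i (x i) - m i)"
  have [measurable]: "e \<in> borel_measurable ?P" "S \<in> borel_measurable ?P"
    unfolding e_def S_def by measurable
  have [measurable]: "grand_mean n \<in> borel_measurable ?P" by measurable
  let ?r = "\<lambda>x i. (b i + h i) * sqrt (\<nu>f i + \<nu>p i * (shrinkage (\<nu>p i) \<tau>)\<^sup>2) * T_hat (\<nu>p i) (\<nu>f i) (btilde (b i) (h i)) (\<gamma> i) n (x i - grand_mean n x) \<tau>
        - coord_loss (\<nu>f i) (b i) (h i) (\<theta> i) (predictor \<nu>p \<nu>f b h n \<tau> x i)"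
  have cell: "ennreal \<bar>?r x i - Y i (x i)\<bar> \<le> \<Psi>1 i (x i - grand_mean n x) + \<Psi>2 i (x i - \<theta>b) + ennreal (lm * \<bar>e x\<bar> + c2 * (e x)\<^sup>2)"
    if "i \<in> {1..n}" for x i
    using q'[OF that] unfolding cell_ok_def prod.case predictor_def e_def by blast
  have nr: "real n > 0" using n by simp
  have pt: "ennreal \<bar>ARE \<nu>p \<nu>f b h \<gamma> n \<tau> x - loss \<nu>f b h n \<theta> (predictor \<nu>p \<nu>f b h n \<tau> x)\<bar>
    \<le> (\<Sum>i=1..n. ennreal (1 / real n) * (\<Psi>1 i (x i - grand_mean n x) + \<Psi>2 i (x i - \<theta>b)))
       + (ennreal (lm * \<eta> + \<eta> + bm) + ennreal (lm / \<eta> + c2) * ennreal ((e x)\<^sup>2) + ennreal (1 / (\<eta> * (real n)\<^sup>2)) * ennreal ((S x)\<^sup>2))" for x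
  proof -
    let ?D = "\<bar>ARE \<nu>p \<nu>f b h \<gamma> n \<tau> x - loss \<nu>f b h n \<theta> (predictor \<nu>p \<nu>f b h n \<tau> x)\<bar>"
    have "ARE \<nu>p \<nu>f b h \<gamma> n \<tau> x - loss \<nu>f b h n \<theta> (predictor \<nu>p \<nu>f b h n \<tau> x) = (\<Sum>i=1..n. ?r x i) / real n"
      unfolding ARE_def loss_def by (simp add: sum_subtractf diff_divide_distrib)
    moreover have "(\<Sum>i=1..n. ?r x i) = (\<Sum>i=1..n. ?r x i - Y i (x i)) + S x + (\<Sum>i=1..n. m i)"
      unfolding S_def by (simp add: sum_subtractf)
    moreover have "\<bar>((\<Sum>i=1..n. ?r x i - Y i (x i)) + S x + (\<Sum>i=1..n. m i)) / real n\<bar>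
        \<le> (\<Sum>i=1..n. \<bar>?r x i - Y i (x i)\<bar>) / real n + \<bar>S x / real n\<bar> + (\<Sum>i=1..n. \<bar>m i\<bar>) / real n"
      by (rule abs_sum3_div[OF nr sum_abs sum_abs])
    ultimately have tri: "?D \<le> (\<Sum>i=1..n. \<bar>?r x i - Y i (x i)\<bar>) / real n + \<bar>S x / real n\<bar> + (\<Sum>i=1..n. \<bar>m i\<bar>) / real n"
      by (simp only:)
    have m_le: "(\<Sum>i=1..n. \<bar>m i\<bar>) / real n \<le> bm"
    proof -
      have "(\<Sum>i=1..n. \<bar>m i\<bar>) \<le> of_nat (card {1..n}) * bm" by (rule sum_bounded_above) (rule mi)
      then have "(\<Sum>i=1..n. \<bar>m i\<bar>) \<le> bm * real n" by (simp add: mult.commute)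
      then show ?thesis by (simp only: pos_divide_le_eq[OF nr])
    qed
    have S_le: "\<bar>S x / real n\<bar> \<le> \<eta> + (S x / real n)\<^sup>2 / \<eta>"
      using \<eta> by (rule le_scaled_square)
    have "?D \<le> (\<Sum>i=1..n. \<bar>?r x i - Y i (x i)\<bar>) / real n + (\<eta> + (S x / real n)\<^sup>2 / \<eta>) + bm"
      by (rule order_trans[OF tri add_mono[OF add_mono[OF order_refl S_le] m_le]])
    moreover have "(S x / real n)\<^sup>2 / \<eta> = 1 / (\<eta> * (real n)\<^sup>2) * (S x)\<^sup>2"
      by (simp add: power_divide)
    moreover have "(\<Sum>i=1..n. \<bar>?r x i - Y i (x i)\<bar>) / real n = (\<Sum>i=1..n. 1 / real n * \<bar>?r x i - Y i (x i)\<bar>)"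
      by (simp add: sum_divide_distrib)
    ultimately have real: "?D \<le> (\<Sum>i=1..n. 1 / real n * \<bar>?r x i - Y i (x i)\<bar>) + (\<eta> + bm + 1 / (\<eta> * (real n)\<^sup>2) * (S x)\<^sup>2)"
      by (simp only: add_ac)
    have "ennreal \<bar>ARE \<nu>p \<nu>f b h \<gamma> n \<tau> x - loss \<nu>f b h n \<theta> (predictor \<nu>p \<nu>f b h n \<tau> x)\<bar>
        \<le> ennreal ((\<Sum>i=1..n. 1 / real n * \<bar>?r x i - Y i (x i)\<bar>) + (\<eta> + bm + 1 / (\<eta> * (real n)\<^sup>2) * (S x)\<^sup>2))"
      by (rule ennreal_leI[OF real])
    also have "\<dots> = (\<Sum>i=1..n. ennreal (1 / real n * \<bar>?r x i - Y i (x i)\<bar>)) + ennreal (\<eta> + bm + 1 / (\<eta> * (real n)\<^sup>2) * (S x)\<^sup>2)"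
      using \<eta> nonneg by (subst ennreal_plus) (simp_all add: sum_nonneg sum_ennreal)
    also have "(\<Sum>i=1..n. ennreal (1 / real n * \<bar>?r x i - Y i (x i)\<bar>)) = (\<Sum>i=1..n. ennreal (1 / real n) * ennreal \<bar>?r x i - Y i (x i)\<bar>)"
      by (intro sum.cong refl ennreal_mult') simp
    also have "\<dots> \<le> (\<Sum>i=1..n. ennreal (1 / real n) * (\<Psi>1 i (x i - grand_mean n x) + \<Psi>2 i (x i - \<theta>b) + ennreal (lm * \<bar>e x\<bar> + c2 * (e x)\<^sup>2)))"
      by (intro sum_mono mult_left_mono cell) auto
    also have "\<dots> = (\<Sum>i=1..n. ennreal (1 / real n) * (\<Psi>1 i (x i - grand_mean n x) + \<Psi>2 i (x i - \<theta>b))) + ennreal (lm * \<bar>e x\<bar> + c2 * (e x)\<^sup>2)"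
    proof -
      have "(\<Sum>i=1..n. ennreal (1 / real n) * ennreal (lm * \<bar>e x\<bar> + c2 * (e x)\<^sup>2)) = ennreal (real n) * (ennreal (1 / real n) * ennreal (lm * \<bar>e x\<bar> + c2 * (e x)\<^sup>2))"
        by (simp add: ennreal_of_nat_eq_real_of_nat)
      also have "\<dots> = ennreal (lm * \<bar>e x\<bar> + c2 * (e x)\<^sup>2)"
        using nr by (simp add: mult.assoc[symmetric] ennreal_mult'[symmetric])
      finally show ?thesis unfolding distrib_left[of "ennreal (1 / real n)" "_ + _"] sum.distrib by simp
    qed
    also have "\<dots> + ennreal (\<eta> + bm + 1 / (\<eta> * (real n)\<^sup>2) * (S x)\<^sup>2)
       \<le> (\<Sum>i=1..n. ennreal (1 / real n) * (\<Psi>1 i (x i - grand_mean n x) + \<Psi>2 i (x i - \<theta>b)))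
       + (ennreal (lm * \<eta> + \<eta> + bm) + ennreal (lm / \<eta> + c2) * ennreal ((e x)\<^sup>2) + ennreal (1 / (\<eta> * (real n)\<^sup>2)) * ennreal ((S x)\<^sup>2))"
      unfolding add.assoc
    proof (rule add_left_mono)
      have "lm * \<bar>e x\<bar> \<le> lm * (\<eta> + (e x)\<^sup>2 / \<eta>)"
        using nonneg by (intro mult_left_mono le_scaled_square \<eta>)
      then have "(lm * \<bar>e x\<bar> + c2 * (e x)\<^sup>2) + (\<eta> + bm + 1 / (\<eta> * (real n)\<^sup>2) * (S x)\<^sup>2)
         \<le> (lm * \<eta> + \<eta> + bm) + ((lm / \<eta> + c2) * (e x)\<^sup>2 + 1 / (\<eta> * (real n)\<^sup>2) * (S x)\<^sup>2)"
        by (simp add: distrib_left distrib_right)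
      from ennreal_leI[OF this]
      have "ennreal (lm * \<bar>e x\<bar> + c2 * (e x)\<^sup>2) + ennreal (\<eta> + bm + 1 / (\<eta> * (real n)\<^sup>2) * (S x)\<^sup>2)
          \<le> ennreal (lm * \<eta> + \<eta> + bm) + (ennreal ((lm / \<eta> + c2) * (e x)\<^sup>2) + ennreal (1 / (\<eta> * (real n)\<^sup>2) * (S x)\<^sup>2))"
        using nonneg \<eta> by (subst (asm) (1 2) ennreal_plus) (simp_all only: mult_nonneg_nonneg divide_nonneg_nonneg add_nonneg_nonneg zero_le_power2 abs_ge_zero less_imp_le zero_le_one of_nat_0_le_iff ennreal_plus)
      also have "ennreal ((lm / \<eta> + c2) * (e x)\<^sup>2) = ennreal (lm / \<eta> + c2) * ennreal ((e x)\<^sup>2)"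
        by (rule ennreal_mult'') simp
      also have "ennreal (1 / (\<eta> * (real n)\<^sup>2) * (S x)\<^sup>2) = ennreal (1 / (\<eta> * (real n)\<^sup>2)) * ennreal ((S x)\<^sup>2)"
        by (rule ennreal_mult'') simp
      finally show "ennreal (lm * \<bar>e x\<bar> + c2 * (e x)\<^sup>2) + ennreal (\<eta> + (bm + 1 / (\<eta> * (real n)\<^sup>2) * (S x)\<^sup>2))
          \<le> ennreal (lm * \<eta> + (\<eta> + bm)) + (ennreal (lm / \<eta> + c2) * ennreal ((e x)\<^sup>2) + ennreal (1 / (\<eta> * (real n)\<^sup>2)) * ennreal ((S x)\<^sup>2))"
        by (simp only: add.assoc)
    qed
    finally show ?thesis by (simp add: add_right_mono)
  qed
  have "(\<integral>\<^sup>+x. ennreal \<bar>ARE \<nu>p \<nu>f b h \<gamma> n \<tau> x - loss \<nu>f b h n \<theta> (predictor \<nu>p \<nu>f b h n \<tau> x)\<bar> \<partial>?P)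
    \<le> (\<integral>\<^sup>+x. (\<Sum>i=1..n. ennreal (1 / real n) * (\<Psi>1 i (x i - grand_mean n x) + \<Psi>2 i (x i - \<theta>b)))
       + (ennreal (lm * \<eta> + \<eta> + bm) + ennreal (lm / \<eta> + c2) * ennreal ((e x)\<^sup>2) + ennreal (1 / (\<eta> * (real n)\<^sup>2)) * ennreal ((S x)\<^sup>2)) \<partial>?P)"
    by (intro nn_integral_mono pt)
  also have "\<dots> = (\<Sum>i=1..n. ennreal (1 / real n) * ((\<integral>\<^sup>+x. \<Psi>1 i (x i - grand_mean n x) \<partial>?P) + (\<integral>\<^sup>+x. \<Psi>2 i (x i - \<theta>b) \<partial>?P)))
       + (ennreal (lm * \<eta> + \<eta> + bm) + ennreal (lm / \<eta> + c2) * (\<integral>\<^sup>+x. ennreal ((e x)\<^sup>2) \<partial>?P)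
          + ennreal (1 / (\<eta> * (real n)\<^sup>2)) * (\<integral>\<^sup>+x. ennreal ((S x)\<^sup>2) \<partial>?P))"
  proof -
    have 1: "(\<integral>\<^sup>+x. (\<Sum>i=1..n. ennreal (1 / real n) * (\<Psi>1 i (x i - grand_mean n x) + \<Psi>2 i (x i - \<theta>b))) \<partial>?P)
        = (\<Sum>i=1..n. ennreal (1 / real n) * ((\<integral>\<^sup>+x. \<Psi>1 i (x i - grand_mean n x) \<partial>?P) + (\<integral>\<^sup>+x. \<Psi>2 i (x i - \<theta>b) \<partial>?P)))"
      by (subst nn_integral_sum, measurable, intro sum.cong refl, subst nn_integral_cmult, measurable, subst nn_integral_add, measurable)
    show ?thesis
      by (subst nn_integral_add, measurable, subst 1)
        (simp add: nn_integral_add nn_integral_cmult P.emeasure_space_1)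
  qed
  also have "\<dots> \<le> (\<Sum>i=1..n. ennreal (1 / real n) * (2 * ennreal p1 + ennreal p2))
       + (ennreal (lm * \<eta> + \<eta> + bm) + ennreal (lm / \<eta> + c2) * ennreal (F / real n)
          + ennreal (1 / (\<eta> * (real n)\<^sup>2)) * ennreal (real n * vm))"
  proof (intro add_mono sum_mono mult_left_mono order_refl)
    fix i assume i: "i \<in> {1..n}"
    show "(\<integral>\<^sup>+x. \<Psi>1 i (x i - grand_mean n x) \<partial>?P) \<le> 2 * ennreal p1"
      using q'[OF i] by (intro gauss_vec_centered n i) (auto simp: cell_ok_def)
    have "(\<integral>\<^sup>+x. \<Psi>2 i (x i - \<theta>b) \<partial>?P) = (\<integral>\<^sup>+z. \<Psi>2 i ((\<theta> i - \<theta>b) + sqrt (\<nu>p i) * z) \<partial>N01)"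
      using i by (subst nn_integral_gauss_vec_coord) (auto simp: algebra_simps)
    also have "\<dots> \<le> ennreal p2" using q'[OF i] by (simp add: cell_ok_def)
    finally show "(\<integral>\<^sup>+x. \<Psi>2 i (x i - \<theta>b) \<partial>?P) \<le> ennreal p2" .
  next
    show "(\<integral>\<^sup>+x. ennreal ((e x)\<^sup>2) \<partial>?P) \<le> ennreal (F / real n)"
      unfolding e_def \<theta>b_def using n F by (intro grand_mean_deviation) auto
    show "(\<integral>\<^sup>+x. ennreal ((S x)\<^sup>2) \<partial>?P) \<le> ennreal (real n * vm)"
      unfolding S_def m_def using q'
      by (intro gauss_vec_sum_second_moment[where a=c]) (auto simp: cell_ok_def nonneg)
  qed simp_all
  also have "\<dots> = ennreal (total_rate F \<eta> wm lm vm bm p1 p2 c2 n)"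
  proof -
    have F0: "F \<ge> 0" using F[of 1] n by auto
    have "(\<Sum>i=1..n. ennreal (1 / real n) * (2 * ennreal p1 + ennreal p2)) = ennreal (2 * p1 + p2)"
    proof -
      have "2 * ennreal p1 + ennreal p2 = ennreal (2 * p1 + p2)"
        using nonneg by (subst ennreal_plus) (auto simp: ennreal_mult')
      then have "(\<Sum>i=1..n. ennreal (1 / real n) * (2 * ennreal p1 + ennreal p2)) = ennreal (real n) * (ennreal (1 / real n) * ennreal (2 * p1 + p2))"
        by (simp add: ennreal_of_nat_eq_real_of_nat)
      also have "\<dots> = ennreal (2 * p1 + p2)"
        using nr by (simp add: mult.assoc[symmetric] ennreal_mult'[symmetric])
      finally show ?thesis .
    qed
    moreover have "ennreal (lm / \<eta> + c2) * ennreal (F / real n) = ennreal ((lm / \<eta> + c2) * (F / real n))"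
      using F0 by (intro ennreal_mult''[symmetric]) simp
    moreover have "ennreal (1 / (\<eta> * (real n)\<^sup>2)) * ennreal (real n * vm) = ennreal (vm / (\<eta> * real n))"
      using nonneg nr by (subst ennreal_mult''[symmetric]) (auto simp: power2_eq_square)
    moreover have nn: "0 \<le> 2 * p1 + p2" "0 \<le> lm * \<eta> + \<eta> + bm" "0 \<le> (lm / \<eta> + c2) * (F / real n)" "0 \<le> vm / (\<eta> * real n)"
      using nonneg \<eta> F0 by auto
    ultimately show ?thesis
      unfolding total_rate_def by (simp only: ennreal_plus[symmetric] add_nonneg_nonneg add.assoc)
  qed
  finally show ?thesis .
qed

text \<open>Here the free parameters are fixed: window width and slack are both \<open>n\<close> to
  the \<open>-3/10\<close>, Young's parameter is the inverse. Up to logarithms, the terms caused by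
  the shift are then of order \<open>n\<close> to the \<open>-1/10\<close>.\<close>

definition err_rate :: "real \<Rightarrow> real \<Rightarrow> real \<Rightarrow> real \<Rightarrow> nat \<Rightarrow> real" where
  "err_rate p F B g n = (let wm = B * sqrt (2 * F); dm = 1 / sqrt p; \<delta> = exp (- 3 / 10 * ln (real n)); a = exp (3 / 10 * ln (real n)) in
     total_rate F \<delta> wm (4 * wm * dm + B) (2 * (4 * wm * dm + B)\<^sup>2 * F + 8 * wm\<^sup>2 * Mrate n) (wm * bias_rate g n)
       (wm * (Mrate n / real n + Mrate n / a)) (wm * (8 * \<delta> * dm * (Mrate n + 1) + Mrate n / a)) (wm * (2 * a / \<delta>\<^sup>2)) n)"

lemma ARE_error:
  assumes n: "n \<ge> 3" and par: "\<And>i. i \<in> {1..n} \<Longrightarrow> coord_setting (\<nu>p i) (\<nu>f i) (b i) (h i) (\<gamma> i) p F B g t n"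
  shows "(\<integral>\<^sup>+x. ennreal \<bar>ARE \<nu>p \<nu>f b h \<gamma> n (ennreal t) x - loss \<nu>f b h n \<theta> (predictor \<nu>p \<nu>f b h n (ennreal t) x)\<bar>
      \<partial>gauss_vec n \<theta> (\<lambda>i. sqrt (\<nu>p i))) \<le> ennreal (err_rate p F B g n)"
proof -
  have p1: "coord_setting (\<nu>p 1) (\<nu>f 1) (b 1) (h 1) (\<gamma> 1) p F B g t n" using n by (intro par) auto
  note wd = coord_setting.wmax_def[OF p1] coord_setting.dmax_def[OF p1] coord_setting.Vmax_def[OF p1]
  have nn: "0 \<le> B * sqrt (2 * F)" "0 \<le> 1 / sqrt p" "0 < B" "0 < F"
    using coord_setting.wmax_nonneg[OF p1] coord_setting.pos[OF p1] unfolding wd by auto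
  show ?thesis
    unfolding err_rate_def Let_def
  proof (rule ARE_error_general)
    fix i assume i: "i \<in> {1..n}"
    interpret coord_setting "\<nu>p i" "\<nu>f i" "b i" "h i" "\<gamma> i" p F B g t n by (rule par[OF i])
    show "\<nu>p i \<le> F \<and> \<nu>p i \<ge> 0" using pos \<nu> by auto
    show "\<exists>q. cell_ok (\<nu>p i) (\<nu>f i) (b i) (h i) (\<gamma> i) n (ennreal t) (\<theta> i) (grand_mean n \<theta>) (B * sqrt (2 * F)) (4 * (B * sqrt (2 * F)) * (1 / sqrt p) + B)
       (2 * (4 * (B * sqrt (2 * F)) * (1 / sqrt p) + B)\<^sup>2 * F + 8 * (B * sqrt (2 * F))\<^sup>2 * Mrate n) (B * sqrt (2 * F) * bias_rate g n)
       (B * sqrt (2 * F) * (Mrate n / real n + Mrate n / exp (3 / 10 * ln (real n))))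
       (B * sqrt (2 * F) * (8 * exp (- 3 / 10 * ln (real n)) * (1 / sqrt p) * (Mrate n + 1) + Mrate n / exp (3 / 10 * ln (real n))))
       (B * sqrt (2 * F) * (2 * exp (3 / 10 * ln (real n)) / (exp (- 3 / 10 * ln (real n)))\<^sup>2)) q"
      using cell_ok_ex[of "exp (3 / 10 * ln (real n))" "exp (- 3 / 10 * ln (real n))" "\<theta> i" "grand_mean n \<theta>"]
      unfolding wmax_def dmax_def Vmax_def by simp
  qed (use n nn in \<open>auto simp: Mrate_def bias_rate_def intro!: add_nonneg_nonneg mult_nonneg_nonneg divide_nonneg_nonneg\<close>)
qed

section \<open>Discretization\<close>

lemma shrinkage_bounds:
  assumes "\<nu> > 0"
  shows "0 \<le> shrinkage \<nu> \<tau>" "shrinkage \<nu> \<tau> \<le> 1"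
  using assms by (auto simp: shrinkage_def divide_le_eq_1 add_nonneg_pos)

text \<open>\<open>shrinkage 1 \<tau>\<close> is the grid coordinate \<open>\<tau> / (\<tau> + 1)\<close>, extended continuously to \<open>\<tau> = \<infinity>\<close>.\<close>

lemma shrinkage_via_unit:
  assumes "\<nu> > 0"
  shows "shrinkage \<nu> \<tau> = shrinkage 1 \<tau> / (shrinkage 1 \<tau> + \<nu> * (1 - shrinkage 1 \<tau>))"
    and "0 \<le> shrinkage 1 \<tau>" "shrinkage 1 \<tau> \<le> 1"
proof -
  let ?t = "enn2real \<tau>"
  have t: "?t \<ge> 0" by simp
  show "0 \<le> shrinkage 1 \<tau>" "shrinkage 1 \<tau> \<le> 1" by (rule shrinkage_bounds; simp)+
  show "shrinkage \<nu> \<tau> = shrinkage 1 \<tau> / (shrinkage 1 \<tau> + \<nu> * (1 - shrinkage 1 \<tau>))"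
  proof (cases "\<tau> = \<infinity>")
    case False
    have e: "?t / (?t + 1) + \<nu> * (1 - ?t / (?t + 1)) = (?t + \<nu>) / (?t + 1)"
    proof -
      have "?t + 1 > 0" using t by (rule add_nonneg_pos) simp
      then have "1 - ?t / (?t + 1) = 1 / (?t + 1)" by (simp add: divide_simps)
      then show ?thesis by (simp add: add_divide_distrib)
    qed
    have ne: "?t + 1 \<noteq> 0" using add_nonneg_pos[OF t zero_less_one] by linarith
    have "x / y / ((x + \<nu>) / y) = x / (x + \<nu>)" if "y \<noteq> 0" for x y :: real
      using that by simp
    from this[OF ne] have r: "(?t / (?t + 1)) / ((?t + \<nu>) / (?t + 1)) = ?t / (?t + \<nu>)" .
    have s: "shrinkage y \<tau> = ?t / (?t + y)" for y
      using False by (simp add: shrinkage_def)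
    show ?thesis unfolding s e by (rule r[symmetric])
  qed (simp add: shrinkage_def)
qed

text \<open>In the coordinate \<open>u\<close> the denominator \<open>u + \<nu> * (1 - u)\<close> is
  a convex combination of \<open>1\<close> and \<nu>, hence at least \<open>p\<close>. The
  difference of the two fractions has numerator \<open>\<nu> * (u - u')\<close>.\<close>

lemma shrinkage_Lipschitz:
  assumes p: "0 < p" "p \<le> 1" "p \<le> \<nu>" and F: "\<nu> \<le> F"
  shows "\<bar>shrinkage \<nu> \<tau> - shrinkage \<nu> \<tau>'\<bar> \<le> F / p\<^sup>2 * \<bar>shrinkage 1 \<tau> - shrinkage 1 \<tau>'\<bar>"
proof -
  define u u' where "u = shrinkage 1 \<tau>" and "u' = shrinkage 1 \<tau>'"
  have \<nu>: "\<nu> > 0" using p by simp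
  have u: "0 \<le> u" "u \<le> 1" "0 \<le> u'" "u' \<le> 1"
    using shrinkage_via_unit[OF \<nu>] by (auto simp: u_def u'_def)
  have den: "p \<le> y + \<nu> * (1 - y)" if "0 \<le> y" "y \<le> 1" for y
  proof -
    have "p * y + p * (1 - y) \<le> 1 * y + \<nu> * (1 - y)" using that p by (intro add_mono mult_right_mono) auto
    then show ?thesis by (simp add: algebra_simps)
  qed
  define d d' where "d = u + \<nu> * (1 - u)" and "d' = u' + \<nu> * (1 - u')"
  have d: "p \<le> d" "p \<le> d'" using den u by (auto simp: d_def d'_def)
  have "shrinkage \<nu> \<tau> - shrinkage \<nu> \<tau>' = u / d - u' / d'"
    unfolding shrinkage_via_unit(1)[OF \<nu>] u_def u'_def d_def d'_def ..
  also have "\<dots> = \<nu> * (u - u') / (d * d')"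
    using d p by (simp add: divide_simps) (simp add: d_def d'_def algebra_simps)
  finally have "\<bar>shrinkage \<nu> \<tau> - shrinkage \<nu> \<tau>'\<bar> = \<nu> * \<bar>u - u'\<bar> / (d * d')"
    using d p \<nu> by (simp add: abs_mult abs_divide)
  also have "\<dots> \<le> F * \<bar>u - u'\<bar> / (p * p)"
    using d p F \<nu> by (intro frac_le mult_mono) auto
  finally show ?thesis by (simp add: u_def u'_def power2_eq_square)
qed

definition disc_const :: "real \<Rightarrow> real \<Rightarrow> real \<Rightarrow> real" where
  "disc_const p F B = B * (F / p\<^sup>2)"

lemma loss_discretization:
  fixes x :: "nat \<Rightarrow> real"
  assumes n: "n \<ge> 1" and p: "0 < p" "p \<le> 1" and q: "0 \<le> q" and B: "0 \<le> B"
    and par: "\<And>i. i \<in> {1..n} \<Longrightarrow> p \<le> \<nu>p i \<and> \<nu>p i \<le> F \<and> p \<le> \<nu>f i \<and> 0 < b i \<and> 0 < h i \<and> b i + h i \<le> B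
      \<and> \<bar>std_normal_quantile (btilde (b i) (h i))\<bar> \<le> q"
  shows "\<bar>loss \<nu>f b h n \<theta> (predictor \<nu>p \<nu>f b h n \<tau> x) - loss \<nu>f b h n \<theta> (predictor \<nu>p \<nu>f b h n \<tau>' x)\<bar>
    \<le> disc_const p F B * \<bar>shrinkage 1 \<tau> - shrinkage 1 \<tau>'\<bar> * (2 * ((\<Sum>i=1..n. \<bar>x i\<bar>) / real n) + F * q / sqrt p)"
proof -
  let ?u = "\<bar>shrinkage 1 \<tau> - shrinkage 1 \<tau>'\<bar>"
  let ?a = "\<bar>grand_mean n x\<bar>"
  have coord: "\<bar>coord_loss (\<nu>f i) (b i) (h i) (\<theta> i) (predictor \<nu>p \<nu>f b h n \<tau> x i) - coord_loss (\<nu>f i) (b i) (h i) (\<theta> i) (predictor \<nu>p \<nu>f b h n \<tau>' x i)\<bar>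
     \<le> B * (F / p\<^sup>2 * ?u * (\<bar>x i\<bar> + ?a + F * q / sqrt p))" if i: "i \<in> {1..n}" for i
  proof -
    define s s' where "s = shrinkage (\<nu>p i) \<tau>" and "s' = shrinkage (\<nu>p i) \<tau>'"
    have P: "p \<le> \<nu>p i" "\<nu>p i \<le> F" "p \<le> \<nu>f i" "0 < b i" "0 < h i" "b i + h i \<le> B" "\<bar>std_normal_quantile (btilde (b i) (h i))\<bar> \<le> q"
      using par[OF i] by auto
    have pos: "\<nu>p i > 0" "\<nu>f i > 0" using P p by auto
    have s01: "0 \<le> s" "0 \<le> s'" using shrinkage_bounds[OF pos(1)] by (auto simp: s_def s'_def)
    have ss: "\<bar>s - s'\<bar> \<le> F / p\<^sup>2 * ?u"
      unfolding s_def s'_def using p P by (intro shrinkage_Lipschitz) auto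
    have sq: "\<bar>sqrt (\<nu>f i + s * \<nu>p i) - sqrt (\<nu>f i + s' * \<nu>p i)\<bar> \<le> \<bar>s - s'\<bar> * (F / sqrt p)"
    proof -
      let ?A = "\<nu>f i + s * \<nu>p i" and ?B = "\<nu>f i + s' * \<nu>p i"
      have AB: "p \<le> ?A" "0 \<le> ?B" using P pos s01 by (auto intro: add_increasing2)
      have sA: "sqrt p \<le> sqrt ?A" "0 \<le> sqrt ?B" "0 < sqrt p" using AB p by auto
      \<comment> \<open>Multiplication by the conjugate, which is at least
        \<open>sqrt p\<close>.\<close>
      have "(sqrt ?A - sqrt ?B) * (sqrt ?A + sqrt ?B) = (s - s') * \<nu>p i"
      proof -
        have "(sqrt ?A - sqrt ?B) * (sqrt ?A + sqrt ?B) = (sqrt ?A)\<^sup>2 - (sqrt ?B)\<^sup>2"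
          by (simp add: power2_eq_square algebra_simps)
        also have "\<dots> = ?A - ?B" using AB p by (subst (1 2) real_sqrt_pow2) auto
        finally show ?thesis by (simp add: algebra_simps)
      qed
      then have "\<bar>sqrt ?A - sqrt ?B\<bar> * (sqrt ?A + sqrt ?B) = \<bar>s - s'\<bar> * \<nu>p i"
        using sA pos by (metis abs_mult abs_of_nonneg abs_of_pos add_nonneg_nonneg less_imp_le order_trans)
      moreover have "\<bar>sqrt ?A - sqrt ?B\<bar> * sqrt p \<le> \<bar>sqrt ?A - sqrt ?B\<bar> * (sqrt ?A + sqrt ?B)"
      proof (rule mult_left_mono)
        show "sqrt p \<le> sqrt ?A + sqrt ?B" using sA by linarith
      qed simp
      moreover have "\<bar>s - s'\<bar> * \<nu>p i \<le> \<bar>s - s'\<bar> * F" using P by (intro mult_left_mono) auto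
      ultimately have "\<bar>sqrt ?A - sqrt ?B\<bar> * sqrt p \<le> \<bar>s - s'\<bar> * F" by linarith
      then show ?thesis using sA by (simp add: field_simps)
    qed
    have "\<bar>predictor \<nu>p \<nu>f b h n \<tau> x i - predictor \<nu>p \<nu>f b h n \<tau>' x i\<bar>
        = \<bar>(s - s') * x i + - ((s - s') * grand_mean n x) + (sqrt (\<nu>f i + s * \<nu>p i) - sqrt (\<nu>f i + s' * \<nu>p i)) * std_normal_quantile (btilde (b i) (h i))\<bar>"
      unfolding predictor_def s_def s'_def by (simp add: algebra_simps)
    also have "\<dots> \<le> \<bar>s - s'\<bar> * \<bar>x i\<bar> + \<bar>s - s'\<bar> * ?a + \<bar>sqrt (\<nu>f i + s * \<nu>p i) - sqrt (\<nu>f i + s' * \<nu>p i)\<bar> * \<bar>std_normal_quantile (btilde (b i) (h i))\<bar>"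
      by (intro order_trans[OF abs_triangle_ineq] add_mono) (simp_all add: abs_mult)
    also have "\<dots> \<le> \<bar>s - s'\<bar> * \<bar>x i\<bar> + \<bar>s - s'\<bar> * ?a + \<bar>s - s'\<bar> * (F / sqrt p) * q"
      using sq P pos p by (intro add_left_mono mult_mono) auto
    also have "\<dots> = \<bar>s - s'\<bar> * (\<bar>x i\<bar> + ?a + F * q / sqrt p)" by (simp add: algebra_simps)
    also have "\<dots> \<le> F / p\<^sup>2 * ?u * (\<bar>x i\<bar> + ?a + F * q / sqrt p)"
      using ss P p q by (intro mult_right_mono) auto
    finally have diff: "\<bar>predictor \<nu>p \<nu>f b h n \<tau> x i - predictor \<nu>p \<nu>f b h n \<tau>' x i\<bar> \<le> F / p\<^sup>2 * ?u * (\<bar>x i\<bar> + ?a + F * q / sqrt p)" .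
    let ?y = "predictor \<nu>p \<nu>f b h n \<tau> x i" and ?y' = "predictor \<nu>p \<nu>f b h n \<tau>' x i"
    have "\<bar>G ((?y - \<theta> i) / sqrt (\<nu>f i)) (btilde (b i) (h i)) - G ((?y' - \<theta> i) / sqrt (\<nu>f i)) (btilde (b i) (h i))\<bar>
        \<le> \<bar>(?y - \<theta> i) / sqrt (\<nu>f i) - (?y' - \<theta> i) / sqrt (\<nu>f i)\<bar>"
      using P by (intro G_Lipschitz) (auto simp: btilde_def)
    also have "\<dots> = \<bar>?y - ?y'\<bar> / sqrt (\<nu>f i)"
      using pos by (simp add: diff_divide_distrib[symmetric] abs_divide)
    finally have "sqrt (\<nu>f i) * (b i + h i) * \<bar>G ((?y - \<theta> i) / sqrt (\<nu>f i)) (btilde (b i) (h i)) - G ((?y' - \<theta> i) / sqrt (\<nu>f i)) (btilde (b i) (h i))\<bar>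
        \<le> sqrt (\<nu>f i) * (b i + h i) * (\<bar>?y - ?y'\<bar> / sqrt (\<nu>f i))"
      using P pos by (intro mult_left_mono) auto
    also have "\<dots> = (b i + h i) * \<bar>?y - ?y'\<bar>" using pos by simp
    also have "\<dots> \<le> B * (F / p\<^sup>2 * ?u * (\<bar>x i\<bar> + ?a + F * q / sqrt p))"
      using P diff B by (intro mult_mono) auto
    finally show ?thesis
      unfolding coord_loss_def right_diff_distrib[symmetric] abs_mult using pos P by simp
  qed
  have nr: "real n > 0" using n by simp
  have K0: "0 \<le> disc_const p F B * ?u"
    using p B par[of 1] n by (auto simp: disc_const_def)
  have gm: "?a \<le> (\<Sum>i=1..n. \<bar>x i\<bar>) / real n"
    unfolding grand_mean_def abs_divide using sum_abs[of x "{1..n}"] nr by (simp add: divide_right_mono)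
  have "\<bar>loss \<nu>f b h n \<theta> (predictor \<nu>p \<nu>f b h n \<tau> x) - loss \<nu>f b h n \<theta> (predictor \<nu>p \<nu>f b h n \<tau>' x)\<bar>
     \<le> (\<Sum>i=1..n. B * (F / p\<^sup>2 * ?u * (\<bar>x i\<bar> + ?a + F * q / sqrt p))) / real n"
    unfolding loss_def diff_divide_distrib[symmetric] sum_subtractf[symmetric] abs_divide
    using nr by (simp only: abs_of_pos) (intro divide_right_mono order_trans[OF sum_abs] sum_mono coord, simp_all)
  also have "\<dots> = disc_const p F B * ?u * ((\<Sum>i=1..n. \<bar>x i\<bar> + (?a + F * q / sqrt p)) / real n)"
    by (simp add: disc_const_def sum_distrib_left sum_divide_distrib mult_ac add_ac)
  also have "(\<Sum>i=1..n. \<bar>x i\<bar> + (?a + F * q / sqrt p)) / real n = (\<Sum>i=1..n. \<bar>x i\<bar>) / real n + (?a + F * q / sqrt p)"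
    using nr by (simp add: sum.distrib add_divide_distrib)
  also have "disc_const p F B * ?u * ((\<Sum>i=1..n. \<bar>x i\<bar>) / real n + (?a + F * q / sqrt p))
      \<le> disc_const p F B * ?u * (2 * ((\<Sum>i=1..n. \<bar>x i\<bar>) / real n) + F * q / sqrt p)"
    using gm K0 by (intro mult_left_mono) auto
  finally show ?thesis .
qed

section \<open>Measurability of the estimate and decay of the error rates\<close>

lemma (in coord) Tclip_measurable [measurable]: "Tclip N \<in> borel_measurable borel"
  unfolding Tclip_def[abs_def] U_def V_def sgn_if by measurable

text \<open>The rate is a fixed combination of elementary sequences, each a negative power of
  \<open>n\<close> up to powers of \<open>ln n\<close>; they are treated one by one, with the
  exponent \<open>g\<^sup>2\<close> of the bias left symbolic.\<close>

lemma rate_lim: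
  assumes "W > 0" "D > 0" "L > 0" "F > 0" "g > (0::real)"
  shows "(\<lambda>n. ln (real n) * total_rate F (exp (- 3 / 10 * ln (real n))) W L (2 * L\<^sup>2 * F + 8 * W\<^sup>2 * Mrate n) (W * bias_rate g n)
       (W * (Mrate n / real n + Mrate n / exp (3 / 10 * ln (real n))))
       (W * (8 * exp (- 3 / 10 * ln (real n)) * D * (Mrate n + 1) + Mrate n / exp (3 / 10 * ln (real n))))
       (W * (2 * exp (3 / 10 * ln (real n)) / (exp (- 3 / 10 * ln (real n)))\<^sup>2)) n) \<longlonglongrightarrow> 0"
proof -
  have e1: "(\<lambda>n. ln (real n) * (Mrate n / real n)) \<longlonglongrightarrow> 0" unfolding Mrate_def by real_asymp
  have e2: "(\<lambda>n. ln (real n) * (Mrate n / exp (3 / 10 * ln (real n)))) \<longlonglongrightarrow> 0" unfolding Mrate_def by real_asymp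
  have e3: "(\<lambda>n. ln (real n) * (exp (- 3 / 10 * ln (real n)) * (Mrate n + 1))) \<longlonglongrightarrow> 0" unfolding Mrate_def by real_asymp
  have e4: "(\<lambda>n. ln (real n) * exp (- 3 / 10 * ln (real n))) \<longlonglongrightarrow> 0" by real_asymp
  have e5: "(\<lambda>n. ln (real n) * bias_rate g n) \<longlonglongrightarrow> 0"
  proof -
    have g2: "g\<^sup>2 > 0" using assms by simp
    define k where "k = g\<^sup>2"
    have k: "k > 0" using g2 by (simp add: k_def)
    have 1: "(\<lambda>n. ln (real n) * exp (- 4 * k * ln (real n))) \<longlonglongrightarrow> 0" using k by real_asymp
    have 2: "(\<lambda>n. ln (real n) * exp (- k * ln (real n) / 8)) \<longlonglongrightarrow> 0" using k by real_asymp
    have 3: "(\<lambda>n. ln (real n) * (((3 + 3 * ln (real n))\<^sup>2 + 3) * exp (- 3 / 10 * ln (real n)))) \<longlonglongrightarrow> 0" by real_asymp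
    have "(\<lambda>n. ln (real n) * exp (- 4 * k * ln (real n)) + ln (real n) * (((3 + 3 * ln (real n))\<^sup>2 + 3) * exp (- 3 / 10 * ln (real n)))
        + 4 * (ln (real n) * exp (- k * ln (real n) / 8))) \<longlonglongrightarrow> 0 + 0 + 4 * 0"
      by (intro tendsto_intros 1 2 3)
    then show ?thesis unfolding bias_rate_def k_def[symmetric] by (simp add: algebra_simps)
  qed
  have e6: "(\<lambda>n. ln (real n) * (1 / (exp (- 3 / 10 * ln (real n)) * real n))) \<longlonglongrightarrow> 0" by real_asymp
  have e7: "(\<lambda>n. ln (real n) * (Mrate n / (exp (- 3 / 10 * ln (real n)) * real n))) \<longlonglongrightarrow> 0" unfolding Mrate_def by real_asymp
  have e8: "(\<lambda>n. ln (real n) * ((exp (3 / 10 * ln (real n)) / (exp (- 3 / 10 * ln (real n)))\<^sup>2) / real n)) \<longlonglongrightarrow> 0" by real_asymp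
  have "(\<lambda>n. 2 * W * (ln (real n) * (Mrate n / real n)) + 3 * W * (ln (real n) * (Mrate n / exp (3 / 10 * ln (real n))))
      + 8 * W * D * (ln (real n) * (exp (- 3 / 10 * ln (real n)) * (Mrate n + 1)))
      + (L + 1) * (ln (real n) * exp (- 3 / 10 * ln (real n))) + W * (ln (real n) * bias_rate g n)
      + (L * F + 2 * L\<^sup>2 * F) * (ln (real n) * (1 / (exp (- 3 / 10 * ln (real n)) * real n)))
      + 8 * W\<^sup>2 * (ln (real n) * (Mrate n / (exp (- 3 / 10 * ln (real n)) * real n)))
      + 2 * W * F * (ln (real n) * ((exp (3 / 10 * ln (real n)) / (exp (- 3 / 10 * ln (real n)))\<^sup>2) / real n)))
    \<longlonglongrightarrow> 2 * W * 0 + 3 * W * 0 + 8 * W * D * 0 + (L + 1) * 0 + W * 0 + (L * F + 2 * L\<^sup>2 * F) * 0 + 8 * W\<^sup>2 * 0 + 2 * W * F * 0"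
    by (intro tendsto_add tendsto_mult_left e1 e2 e3 e4 e5 e6 e7 e8)
  \<comment> \<open>The regrouping as an identity in abstract letters: \<open>l\<close> is
    \<open>ln n\<close>, \<open>d\<close> and \<open>a\<close> are the two powers of
    \<open>n\<close>, \<open>M\<close> and \<open>bb\<close> stand for \<open>Mrate\<close> and
    \<open>bias_rate\<close>.\<close>
  moreover have "2 * W * (l * (M / N)) + 3 * W * (l * (M / a)) + 8 * W * D * (l * (d * (M + 1))) + (L + 1) * (l * d) + W * (l * bb)
      + (L * F + 2 * L\<^sup>2 * F) * (l * (1 / (d * N))) + 8 * W\<^sup>2 * (l * (M / (d * N))) + 2 * W * F * (l * ((a / d\<^sup>2) / N))
    = l * (2 * (W * (M / N + M / a)) + W * (8 * d * D * (M + 1) + M / a) + (L * d + d + W * bb)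
      + (L / d + W * (2 * a / d\<^sup>2)) * (F / N) + (2 * L\<^sup>2 * F + 8 * W\<^sup>2 * M) / (d * N))" for l M N a d bb :: real
    by (simp add: algebra_simps add_divide_distrib)
  ultimately show ?thesis
    unfolding total_rate_def by (simp only: mult_zero_right add_0_right)
qed

lemma err_rate_lim:
  assumes "p > 0" "F > 0" "B > 0" "g > (0::real)"
  shows "(\<lambda>n. ln (real n) * err_rate p F B g n) \<longlonglongrightarrow> 0"
  unfolding err_rate_def Let_def using assms by (intro rate_lim) (auto intro: add_nonneg_pos)

section \<open>The grid\<close>

definition grid_points :: "real \<Rightarrow> nat" where
  "grid_points \<delta> = nat \<lceil>1 / \<delta>\<rceil>"

definition grid_value :: "real \<Rightarrow> nat \<Rightarrow> real" where
  "grid_value \<delta> j = ((real j - 1) * \<delta>) / (1 - (real j - 1) * \<delta>)"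

lemma grid_points_bounds:
  assumes "\<delta> > 0"
  shows "1 / \<delta> \<le> real (grid_points \<delta>)" "real (grid_points \<delta>) < 1 / \<delta> + 1" "1 \<le> grid_points \<delta>"
proof -
  have c: "0 < \<lceil>1 / \<delta>\<rceil>" using assms by (simp add: zero_less_ceiling)
  then have r: "real (grid_points \<delta>) = of_int \<lceil>1 / \<delta>\<rceil>" by (simp add: grid_points_def)
  show "1 / \<delta> \<le> real (grid_points \<delta>)" "real (grid_points \<delta>) < 1 / \<delta> + 1"
    unfolding r by linarith+
  show "1 \<le> grid_points \<delta>" using c unfolding grid_points_def by linarith
qed

text \<open>The count is below \<open>1 / \<delta> + 1\<close>, so the last coordinate stays below
  \<open>1\<close> and every grid point is finite.\<close>

lemma grid_coordinate_bounds:
  assumes "\<delta> > 0" "j \<in> {1..grid_points \<delta>}"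
  shows "0 \<le> (real j - 1) * \<delta>" "(real j - 1) * \<delta> < 1"
proof -
  show "0 \<le> (real j - 1) * \<delta>" using assms by simp
  have "real j \<le> real (grid_points \<delta>)" using assms by simp
  also have "\<dots> < 1 / \<delta> + 1" by (rule grid_points_bounds) fact
  finally have "(real j - 1) * \<delta> < (1 / \<delta>) * \<delta>" using assms(1) by (intro mult_strict_right_mono) auto
  then show "(real j - 1) * \<delta> < 1" using assms(1) by simp
qed

lemma grid_value_nonneg: "\<delta> > 0 \<Longrightarrow> j \<in> {1..grid_points \<delta>} \<Longrightarrow> 0 \<le> grid_value \<delta> j"
  unfolding grid_value_def using grid_coordinate_bounds[of \<delta> j] by (intro divide_nonneg_nonneg) auto

lemma unit_fraction:
  fixes t u :: real
  assumes "t \<ge> 0" "u < 1"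
  shows "t / (t + 1) = u \<longleftrightarrow> t = u / (1 - u)"
proof -
  have "t + 1 \<noteq> 0" "1 - u \<noteq> 0" using assms by auto
  then show ?thesis by (auto simp: divide_simps algebra_simps)
qed

lemma grid_eq:
  assumes "grid_step C1 C2 C3 C4 n > 0"
  shows "grid C1 C2 C3 C4 n = (\<lambda>j. ennreal (grid_value (grid_step C1 C2 C3 C4 n) j)) ` {1..grid_points (grid_step C1 C2 C3 C4 n)}"
proof -
  let ?\<delta> = "grid_step C1 C2 C3 C4 n"
  have e: "t / (t + 1) = (real j - 1) * ?\<delta> \<longleftrightarrow> t = grid_value ?\<delta> j" if "t \<ge> 0" "j \<in> {1..grid_points ?\<delta>}" for t j
    unfolding grid_value_def using that grid_coordinate_bounds[OF assms that(2)] by (intro unit_fraction) auto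
  show ?thesis
    unfolding grid_def grid_points_def[symmetric]
  proof (intro set_eqI iffI)
    fix \<tau> assume "\<tau> \<in> {ennreal t |t. t \<ge> 0 \<and> (\<exists>j\<in>{1..grid_points ?\<delta>}. t / (t + 1) = (real j - 1) * ?\<delta>)}"
    then show "\<tau> \<in> (\<lambda>j. ennreal (grid_value ?\<delta> j)) ` {1..grid_points ?\<delta>}" using e by blast
  next
    fix \<tau> assume "\<tau> \<in> (\<lambda>j. ennreal (grid_value ?\<delta> j)) ` {1..grid_points ?\<delta>}"
    then obtain j where j: "j \<in> {1..grid_points ?\<delta>}" "\<tau> = ennreal (grid_value ?\<delta> j)" by blast
    then show "\<tau> \<in> {ennreal t |t. t \<ge> 0 \<and> (\<exists>j\<in>{1..grid_points ?\<delta>}. t / (t + 1) = (real j - 1) * ?\<delta>)}"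
      using e[OF grid_value_nonneg[OF assms j(1)] j(1)] grid_value_nonneg[OF assms j(1)] by blast
  qed
qed

lemma shrinkage_1_grid_value:
  assumes "\<delta> > 0" "j \<in> {1..grid_points \<delta>}"
  shows "shrinkage 1 (ennreal (grid_value \<delta> j)) = (real j - 1) * \<delta>"
proof -
  have "grid_value \<delta> j / (grid_value \<delta> j + 1) = (real j - 1) * \<delta>"
    using unit_fraction[OF grid_value_nonneg[OF assms] grid_coordinate_bounds(2)[OF assms]] by (simp add: grid_value_def)
  then show ?thesis using grid_value_nonneg[OF assms] by (simp add: shrinkage_def)
qed

text \<open>Rounding the coordinate of \<tau> down to a multiple of \<delta> finds the grid point;
  \<open>\<tau> = \<infinity>\<close> has coordinate \<open>1\<close> and is included.\<close>

lemma grid_dense: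
  assumes \<delta>: "\<delta> > 0"
  obtains j where "j \<in> {1..grid_points \<delta>}" "\<bar>shrinkage 1 (ennreal (grid_value \<delta> j)) - shrinkage 1 \<tau>\<bar> \<le> \<delta>"
proof -
  define u where "u = shrinkage 1 \<tau>"
  have u: "0 \<le> u" "u \<le> 1" using shrinkage_bounds[of 1 \<tau>] by (auto simp: u_def)
  define m where "m = grid_points \<delta>"
  define k where "k = nat \<lfloor>u / \<delta>\<rfloor>"
  have m: "1 / \<delta> \<le> real m" "m \<ge> 1"
    unfolding m_def by (rule grid_points_bounds[OF \<delta>])+
  have k: "real k \<le> u / \<delta>" "u / \<delta> < real k + 1"
  proof -
    have "0 \<le> \<lfloor>u / \<delta>\<rfloor>" using u \<delta> by simp
    then have "real k = of_int \<lfloor>u / \<delta>\<rfloor>" by (simp add: k_def)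
    then show "real k \<le> u / \<delta>" "u / \<delta> < real k + 1" by linarith+
  qed
  show ?thesis
  proof (cases "k < m")
    case True
    have j: "k + 1 \<in> {1..grid_points \<delta>}" using True by (simp add: m_def[symmetric])
    have "real k * \<delta> \<le> u" "u \<le> (real k + 1) * \<delta>" using k \<delta> by (auto simp: field_simps)
    then have "\<bar>real k * \<delta> - u\<bar> \<le> \<delta>" by (simp add: algebra_simps abs_le_iff)
    then show ?thesis using that[OF j] shrinkage_1_grid_value[OF \<delta> j] by (simp add: u_def)
  next
    \<comment> \<open>Occurs only at \<open>u = 1\<close> with \<open>1 / \<delta>\<close> an
      integer: rounding down would give \<open>1\<close> itself, and the last grid point, one step
      below, is used instead.\<close>
    case False
    have j: "m \<in> {1..grid_points \<delta>}" using m by (simp add: m_def)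
    have "1 \<le> real m * \<delta>" using m \<delta> by (simp add: field_simps)
    moreover have "real m * \<delta> \<le> real k * \<delta>" using False \<delta> by simp
    moreover have "real k * \<delta> \<le> u" using k \<delta> by (simp add: field_simps)
    ultimately have "u = 1" "1 \<le> real m * \<delta>" using u by auto
    then have "\<bar>(real m - 1) * \<delta> - u\<bar> \<le> \<delta>"
      using grid_coordinate_bounds[OF \<delta> j] by (simp add: algebra_simps abs_le_iff)
    then show ?thesis using that[OF j] shrinkage_1_grid_value[OF \<delta> j] by (simp add: u_def)
  qed
qed

text \<open>The inverse step is of order \<open>ln (ln n)\<close>: slow enough for summing errors
  over the grid, yet unbounded, so that the grid becomes dense.\<close>

lemma grid_step_asymptotics:
  assumes C: "C1 > 0" "C2 > 0" "C3 > 0" "C4 > 0"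
  shows "eventually (\<lambda>n. grid_step C1 C2 C3 C4 n > 0) sequentially"
    and "grid_step C1 C2 C3 C4 \<longlonglongrightarrow> 0"
    and "eventually (\<lambda>n. real (grid_points (grid_step C1 C2 C3 C4 n)) \<le> ln (real n)) sequentially"
proof -
  define f where "f = std_normal_density 0"
  have f: "f > 0" using std_normal_density_0_le by (simp add: f_def)
  have a: "eventually (\<lambda>n. a_seq n > 0) sequentially" unfolding a_seq_def by real_asymp
  show pos: "eventually (\<lambda>n. grid_step C1 C2 C3 C4 n > 0) sequentially"
    using a by eventually_elim (use C f in \<open>simp add: grid_step_def f_def[symmetric] add_pos_pos\<close>)
  show "grid_step C1 C2 C3 C4 \<longlonglongrightarrow> 0"
    unfolding grid_step_def[abs_def] f_def[symmetric] a_seq_def using C f by real_asymp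
  have "eventually (\<lambda>n. 2 * C1 * C2 * (2 * f + C3 + sqrt (ln (ln (real n))) * C4 + ln (ln (real n))) + 1 \<le> ln (real n)) sequentially"
    using C f by real_asymp
  with pos show "eventually (\<lambda>n. real (grid_points (grid_step C1 C2 C3 C4 n)) \<le> ln (real n)) sequentially"
  proof eventually_elim
    case (elim n)
    have "1 / grid_step C1 C2 C3 C4 n = 2 * C1 * C2 * (2 * f + C3 + sqrt (ln (ln (real n))) * C4 + ln (ln (real n)))"
      by (simp only: grid_step_def a_seq_def f_def) (simp only: inverse_eq_divide divide_divide_eq_right mult_1_left div_by_1)
    moreover have "real (grid_points (grid_step C1 C2 C3 C4 n)) \<le> 1 / grid_step C1 C2 C3 C4 n + 1"
      using grid_points_bounds(2)[OF elim(1)] by simp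
    ultimately show ?case using elim(2) by linarith
  qed
qed

section \<open>The oracle inequality for one sample size\<close>

text \<open>The hypotheses at one sample size, reduced to numeric constants; the asymptotic
  assumptions serve to supply these constants independently of \<open>n\<close>.\<close>

locale shrinkage_model =
  fixes \<theta> \<nu>p \<nu>f b h \<gamma> :: "nat \<Rightarrow> real" and p F B g q A :: real and n :: nat
  assumes n: "n \<ge> 3" and p: "0 < p" "p \<le> 1" and g: "0 < g"
    and variances: "\<And>i. i \<in> {1..n} \<Longrightarrow> p \<le> \<nu>p i \<and> \<nu>p i \<le> \<nu>f i \<and> \<nu>f i \<le> F"
    and costs: "\<And>i. i \<in> {1..n} \<Longrightarrow> 0 < b i \<and> 0 < h i \<and> b i + h i \<le> B"
    and quantiles: "\<And>i. i \<in> {1..n} \<Longrightarrow> \<bar>std_normal_quantile (btilde (b i) (h i))\<bar> \<le> q"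
    and thresholds: "\<And>i. i \<in> {1..n} \<Longrightarrow> g \<le> \<gamma> i \<and> \<gamma> i + sqrt (\<nu>p i / \<nu>f i) < 1 / sqrt (4 * exp 1)"
    and means: "(\<Sum>i=1..n. \<bar>\<theta> i\<bar>) / real n \<le> A"
begin

abbreviation "L \<tau> x \<equiv> loss \<nu>f b h n \<theta> (predictor \<nu>p \<nu>f b h n \<tau> x)"
abbreviation "E \<tau> x \<equiv> ARE \<nu>p \<nu>f b h \<gamma> n \<tau> x"
abbreviation "P \<equiv> gauss_vec n \<theta> (\<lambda>i. sqrt (\<nu>p i))"
abbreviation "mean_abs x \<equiv> (\<Sum>i=1..n. \<bar>x i\<bar>) / real n"

lemma sets_P: "sets P = sets (data_space n)"
  unfolding data_space_def by (rule sets_gauss_vec)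

lemma params_coord: "i \<in> {1..n} \<Longrightarrow> t \<ge> 0 \<Longrightarrow> coord_setting (\<nu>p i) (\<nu>f i) (b i) (h i) (\<gamma> i) p F B g t n"
  using n p g variances costs thresholds by unfold_locales auto

lemma constants_nonneg: "0 < F" "0 < B" "0 \<le> q"
proof -
  have 1: "1 \<in> {1..n}" using n by simp
  show "0 < F" "0 < B" using variances[OF 1] costs[OF 1] p by linarith+
  show "0 \<le> q" using quantiles[OF 1] by linarith
qed

lemma mean_abs_nonneg: "0 \<le> mean_abs x"
  by (intro divide_nonneg_nonneg sum_nonneg) auto

lemma disc_const_nonneg: "0 \<le> disc_const p F B"
  using constants_nonneg p by (simp add: disc_const_def)

lemma L_discretization:
  "\<bar>L \<tau> x - L \<tau>' x\<bar> \<le> disc_const p F B * \<bar>shrinkage 1 \<tau> - shrinkage 1 \<tau>'\<bar> * (2 * mean_abs x + F * q / sqrt p)"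
proof (rule loss_discretization)
  fix i assume i: "i \<in> {1..n}"
  show "p \<le> \<nu>p i \<and> \<nu>p i \<le> F \<and> p \<le> \<nu>f i \<and> 0 < b i \<and> 0 < h i \<and> b i + h i \<le> B
      \<and> \<bar>std_normal_quantile (btilde (b i) (h i))\<bar> \<le> q"
    using variances[OF i] costs[OF i] quantiles[OF i] by auto
qed (use n p constants_nonneg in auto)

lemma ARE_measurable:
  assumes "t \<ge> 0"
  shows "E (ennreal t) \<in> borel_measurable P"
proof -
  have [measurable]: "(\<lambda>y. T_hat (\<nu>p i) (\<nu>f i) (btilde (b i) (h i)) (\<gamma> i) n y (ennreal t)) \<in> borel_measurable borel" if "i \<in> {1..n}" for i
  proof -
    interpret coord_setting "\<nu>p i" "\<nu>f i" "b i" "h i" "\<gamma> i" p F B g t n using that assms by (rule params_coord)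
    show ?thesis unfolding T_hat_eq by measurable
  qed
  show ?thesis unfolding ARE_def[abs_def] by measurable
qed

lemma shrinkage_measurable [measurable]: "shrinkage \<nu> \<in> borel_measurable borel"
  unfolding shrinkage_def[abs_def] by measurable

lemma coord_loss_measurable [measurable]: "(\<lambda>y. coord_loss \<nu> b' h' \<theta>' y) \<in> borel_measurable borel"
  unfolding coord_loss_def by measurable

lemma L_measurable:
  assumes [measurable]: "\<tau> \<in> borel_measurable P"
  shows "(\<lambda>x. L (\<tau> x) x) \<in> borel_measurable P"
  unfolding loss_def predictor_def by measurable

lemma mean_abs_integral: "(\<integral>\<^sup>+x. ennreal (mean_abs x) \<partial>P) \<le> ennreal (A + 2 * sqrt F)"
proof -
  have z: "\<bar>z\<bar> \<le> 1 + z\<^sup>2" for z :: real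
  proof -
    have "0 \<le> (\<bar>z\<bar> - 1)\<^sup>2" by simp
    then have "2 * \<bar>z\<bar> \<le> 1 + z\<^sup>2" by (simp add: power2_diff)
    then show ?thesis using abs_ge_zero[of z] by linarith
  qed
  have c: "(\<integral>\<^sup>+x. ennreal \<bar>x i\<bar> \<partial>P) \<le> ennreal (\<bar>\<theta> i\<bar> + 2 * sqrt F)" if i: "i \<in> {1..n}" for i
  proof -
    have s: "sqrt (\<nu>p i) \<le> sqrt F" "0 \<le> sqrt (\<nu>p i)" using variances[OF i] p by auto
    have "(\<integral>\<^sup>+x. ennreal \<bar>x i\<bar> \<partial>P) = (\<integral>\<^sup>+z. ennreal \<bar>\<theta> i + sqrt (\<nu>p i) * z\<bar> \<partial>N01)"
      using nn_integral_gauss_vec_coord[of "\<lambda>y. ennreal \<bar>y\<bar>" i n \<theta> "\<lambda>i. sqrt (\<nu>p i)"] i by simp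
    also have "\<dots> \<le> (\<integral>\<^sup>+z. (ennreal (\<bar>\<theta> i\<bar> + sqrt F) + ennreal (sqrt F) * ennreal (z\<^sup>2)) \<partial>N01)"
    proof (rule nn_integral_mono)
      fix z :: real
      have "\<bar>\<theta> i + sqrt (\<nu>p i) * z\<bar> \<le> \<bar>\<theta> i\<bar> + \<bar>sqrt (\<nu>p i) * z\<bar>" by (rule abs_triangle_ineq)
      moreover have "\<bar>sqrt (\<nu>p i) * z\<bar> \<le> sqrt F * (1 + z\<^sup>2)"
        unfolding abs_mult using s z[of z] by (intro mult_mono) auto
      ultimately have "\<bar>\<theta> i + sqrt (\<nu>p i) * z\<bar> \<le> (\<bar>\<theta> i\<bar> + sqrt F) + sqrt F * z\<^sup>2" by (simp add: algebra_simps)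
      then have "ennreal \<bar>\<theta> i + sqrt (\<nu>p i) * z\<bar> \<le> ennreal ((\<bar>\<theta> i\<bar> + sqrt F) + sqrt F * z\<^sup>2)" by (rule ennreal_leI)
      also have "\<dots> = ennreal (\<bar>\<theta> i\<bar> + sqrt F) + ennreal (sqrt F) * ennreal (z\<^sup>2)"
        using constants_nonneg by (simp add: ennreal_plus ennreal_mult)
      finally show "ennreal \<bar>\<theta> i + sqrt (\<nu>p i) * z\<bar> \<le> ennreal (\<bar>\<theta> i\<bar> + sqrt F) + ennreal (sqrt F) * ennreal (z\<^sup>2)" .
    qed
    also have "\<dots> = ennreal (\<bar>\<theta> i\<bar> + sqrt F) + ennreal (sqrt F)"
      by (simp add: nn_integral_add nn_integral_cmult nn_integral_N01_square N01.emeasure_space_1[simplified])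
    also have "\<dots> = ennreal (\<bar>\<theta> i\<bar> + 2 * sqrt F)"
      using constants_nonneg by (simp flip: ennreal_plus)
    finally show ?thesis .
  qed
  have "(\<integral>\<^sup>+x. ennreal (mean_abs x) \<partial>P) = (\<integral>\<^sup>+x. ennreal (1 / real n) * (\<Sum>i=1..n. ennreal \<bar>x i\<bar>) \<partial>P)"
  proof (rule nn_integral_cong)
    fix x
    have "(\<Sum>i=1..n. ennreal \<bar>x i\<bar>) = ennreal (\<Sum>i=1..n. \<bar>x i\<bar>)" by (rule sum_ennreal) auto
    then show "ennreal (mean_abs x) = ennreal (1 / real n) * (\<Sum>i=1..n. ennreal \<bar>x i\<bar>)"
      by (simp add: ennreal_mult[symmetric] sum_nonneg)
  qed
  also have "\<dots> = ennreal (1 / real n) * (\<Sum>i=1..n. \<integral>\<^sup>+x. ennreal \<bar>x i\<bar> \<partial>P)"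
    by (subst nn_integral_cmult, measurable) (subst nn_integral_sum, auto)
  also have "\<dots> \<le> ennreal (1 / real n) * (\<Sum>i=1..n. ennreal (\<bar>\<theta> i\<bar> + 2 * sqrt F))"
    by (intro mult_left_mono sum_mono c) auto
  also have "(\<Sum>i=1..n. ennreal (\<bar>\<theta> i\<bar> + 2 * sqrt F)) = ennreal (\<Sum>i=1..n. \<bar>\<theta> i\<bar> + 2 * sqrt F)"
    using constants_nonneg by (intro sum_ennreal) auto
  also have "ennreal (1 / real n) * \<dots> = ennreal ((\<Sum>i=1..n. \<bar>\<theta> i\<bar>) / real n + 2 * sqrt F)"
    using constants_nonneg n by (subst ennreal_mult[symmetric]) (auto simp: sum_nonneg sum.distrib add_divide_distrib simp del: ennreal_plus)
  also have "\<dots> \<le> ennreal (A + 2 * sqrt F)" using means by (intro ennreal_leI) auto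
  finally show ?thesis .
qed

lemma mean_abs_integrable: "integrable P mean_abs"
  using mean_abs_integral mean_abs_nonneg by (intro integrableI_nonneg) (auto intro: le_less_trans)

text \<open>Comparison with \<open>\<tau> = \<infinity>\<close>, where the prediction is the
  coordinate plus a constant; any other hyperparameter is at distance at most \<open>1\<close> in
  \<open>u\<close>. Uniformity in \<tau> gives integrability for data-dependent choices.\<close>

lemma L_bound: "\<exists>K K'. \<forall>\<tau> x. \<bar>L \<tau> x\<bar> \<le> K + K' * mean_abs x"
proof -
  let ?c = "\<lambda>i. sqrt (\<nu>f i + \<nu>p i) * std_normal_quantile (btilde (b i) (h i))"
  let ?l = "\<lambda>i. coord_loss (\<nu>f i) (b i) (h i) (\<theta> i)"
  define K where "K = (\<Sum>i=1..n. \<bar>?l i (?c i)\<bar>) / real n"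
  have inf: "\<bar>L \<infinity> x\<bar> \<le> K + B * mean_abs x" for x
  proof -
    have l: "\<bar>?l i (x i + ?c i)\<bar> \<le> \<bar>?l i (?c i)\<bar> + B * \<bar>x i\<bar>" if i: "i \<in> {1..n}" for i
    proof -
      interpret coord_setting "\<nu>p i" "\<nu>f i" "b i" "h i" "\<gamma> i" p F B g 0 n using i by (rule params_coord) simp
      show ?thesis using coord_loss_Lipschitz[of "\<theta> i" "x i + ?c i" "?c i"] by simp
    qed
    have "\<bar>L \<infinity> x\<bar> = \<bar>\<Sum>i=1..n. ?l i (x i + ?c i)\<bar> / real n"
      by (simp add: loss_def predictor_def shrinkage_def)
    also have "\<dots> \<le> (\<Sum>i=1..n. \<bar>?l i (?c i)\<bar> + B * \<bar>x i\<bar>) / real n"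
      by (intro divide_right_mono order_trans[OF sum_abs sum_mono] l) auto
    also have "\<dots> = K + B * mean_abs x" by (simp add: K_def sum.distrib add_divide_distrib sum_distrib_left)
    finally show ?thesis .
  qed
  have "\<bar>L \<tau> x\<bar> \<le> (K + disc_const p F B * (F * q / sqrt p)) + (B + 2 * disc_const p F B) * mean_abs x" for \<tau> x
  proof -
    have s: "\<bar>shrinkage 1 \<tau> - shrinkage 1 \<infinity>\<bar> \<le> 1"
      using shrinkage_bounds[of 1 \<tau>] shrinkage_bounds[of 1 \<infinity>] by auto
    have nn: "0 \<le> 2 * mean_abs x + F * q / sqrt p"
      using mean_abs_nonneg[of x] constants_nonneg p by (intro add_nonneg_nonneg) auto
    have "\<bar>L \<tau> x - L \<infinity> x\<bar> \<le> disc_const p F B * \<bar>shrinkage 1 \<tau> - shrinkage 1 \<infinity>\<bar> * (2 * mean_abs x + F * q / sqrt p)"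
      by (rule L_discretization)
    also have "\<dots> \<le> disc_const p F B * 1 * (2 * mean_abs x + F * q / sqrt p)"
      using s disc_const_nonneg nn by (intro mult_right_mono mult_left_mono) auto
    finally have "\<bar>L \<tau> x - L \<infinity> x\<bar> \<le> disc_const p F B * (F * q / sqrt p) + 2 * disc_const p F B * mean_abs x"
      by (simp add: algebra_simps)
    then have "\<bar>L \<tau> x\<bar> \<le> (disc_const p F B * (F * q / sqrt p) + 2 * disc_const p F B * mean_abs x) + (K + B * mean_abs x)"
      using inf[of x] by linarith
    then show ?thesis by (simp add: algebra_simps add_divide_distrib)
  qed
  then show ?thesis by blast
qed

lemma L_integrable:
  assumes "\<tau> \<in> borel_measurable P"
  shows "integrable P (\<lambda>x. L (\<tau> x) x)"
proof -
  obtain K K' where K: "\<And>\<tau> x. \<bar>L \<tau> x\<bar> \<le> K + K' * mean_abs x" using L_bound by blast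
  interpret prob_space P by (rule prob_space_gauss_vec)
  have "integrable P (\<lambda>x. K + K' * mean_abs x)" by (intro Bochner_Integration.integrable_add integrable_mult_right mean_abs_integrable) simp
  then show ?thesis
    by (rule Bochner_Integration.integrable_bound) (use K L_measurable[OF assms] in \<open>auto intro: order_trans[OF _ abs_ge_self]\<close>)
qed

text \<open>Both the minimizer and the grid point next to \<open>\<tau>'\<close> may depend on the
  data. Bounding their two errors by the sum over the whole grid leaves only fixed hyperparameters
  to be averaged.\<close>

lemma oracle_gap_pointwise:
  fixes \<delta> :: real
  assumes \<delta>: "\<delta> > 0" and m: "m = grid_points \<delta>"
    and min: "is_arg_min (\<lambda>\<tau>. E \<tau> x) (\<lambda>\<tau>. \<tau> \<in> (\<lambda>j. ennreal (grid_value \<delta> j)) ` {1..m}) \<tau>"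
  shows "L \<tau> x - L \<tau>' x \<le> 2 * (\<Sum>j=1..m. \<bar>E (ennreal (grid_value \<delta> j)) x - L (ennreal (grid_value \<delta> j)) x\<bar>)
    + disc_const p F B * \<delta> * (2 * mean_abs x + F * q / sqrt p)"
proof -
  define t where "t j = ennreal (grid_value \<delta> j)" for j
  define S where "S = (\<Sum>j=1..m. \<bar>E (t j) x - L (t j) x\<bar>)"
  have le: "\<bar>E (t j) x - L (t j) x\<bar> \<le> S" if "j \<in> {1..m}" for j
    unfolding S_def using that by (intro member_le_sum) auto
  obtain k where k: "k \<in> {1..m}" "\<tau> = t k" using min by (auto simp: is_arg_min_def t_def)
  obtain j where j: "j \<in> {1..m}" "\<bar>shrinkage 1 (t j) - shrinkage 1 \<tau>'\<bar> \<le> \<delta>"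
    using grid_dense[OF \<delta>, of \<tau>'] unfolding m t_def by blast
  have opt: "E (t k) x \<le> E (t j) x" using min j(1) k(2) by (auto simp: is_arg_min_def t_def not_less)
  have nn: "0 \<le> 2 * mean_abs x + F * q / sqrt p"
    using mean_abs_nonneg[of x] constants_nonneg p by (intro add_nonneg_nonneg) auto
  have "L (t j) x - L \<tau>' x \<le> disc_const p F B * \<bar>shrinkage 1 (t j) - shrinkage 1 \<tau>'\<bar> * (2 * mean_abs x + F * q / sqrt p)"
    using L_discretization[of "t j" x \<tau>'] by linarith
  also have "\<dots> \<le> disc_const p F B * \<delta> * (2 * mean_abs x + F * q / sqrt p)"
    using j(2) disc_const_nonneg nn by (intro mult_right_mono mult_left_mono) auto
  finally have "L (t j) x - L \<tau>' x \<le> disc_const p F B * \<delta> * (2 * mean_abs x + F * q / sqrt p)" .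
  then show ?thesis using le[OF j(1)] le[OF k(1)] opt unfolding k(2) S_def t_def by linarith
qed

definition gap_rate :: "real \<Rightarrow> real" where
  "gap_rate \<delta> = 2 * (real (grid_points \<delta>) * err_rate p F B g n) + disc_const p F B * \<delta> * (2 * (A + 2 * sqrt F) + F * q / sqrt p)"

text \<open>The regret is nonnegative because \<open>\<tau>'\<close> is at least as good as \<tau>;
  hence its Bochner integral equals the nonnegative integral, for which the pointwise bound is
  averaged term by term.\<close>

lemma oracle_gap:
  fixes \<delta> :: real
  assumes \<delta>: "\<delta> > 0" and e: "0 \<le> err_rate p F B g n" and A: "0 \<le> A"
    and meas: "\<tau> \<in> borel_measurable P" "\<tau>' \<in> borel_measurable P"
    and min: "\<And>x. x \<in> space P \<Longrightarrow> is_arg_min (\<lambda>\<tau>. E \<tau> x) (\<lambda>\<tau>. \<tau> \<in> (\<lambda>j. ennreal (grid_value \<delta> j)) ` {1..grid_points \<delta>}) (\<tau> x)"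
    and min': "\<And>x. x \<in> space P \<Longrightarrow> L (\<tau>' x) x \<le> L (\<tau> x) x"
  shows "(\<integral>x. L (\<tau> x) x - L (\<tau>' x) x \<partial>P) \<le> gap_rate \<delta>"
proof -
  define m where "m = grid_points \<delta>"
  define t where "t j = ennreal (grid_value \<delta> j)" for j
  define D where "D x = L (\<tau> x) x - L (\<tau>' x) x" for x
  define c where "c = disc_const p F B * \<delta>"
  have c: "0 \<le> c" using disc_const_nonneg \<delta> by (simp add: c_def)
  have k: "0 \<le> F * q / sqrt p" using constants_nonneg p by auto
  have Dint: "integrable P D" unfolding D_def by (intro Bochner_Integration.integrable_diff L_integrable meas)
  have Dnn: "0 \<le> D x" if "x \<in> space P" for x using min'[OF that] by (simp add: D_def)
  interpret prob_space P by (rule prob_space_gauss_vec)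
  have em [measurable]: "(\<lambda>x. E (t j) x - L (t j) x) \<in> borel_measurable P" if "j \<in> {1..m}" for j
  proof -
    have "0 \<le> grid_value \<delta> j" using that \<delta> unfolding m_def by (intro grid_value_nonneg)
    then show ?thesis unfolding t_def by (intro borel_measurable_diff ARE_measurable L_measurable) auto
  qed
  have sums: "(\<integral>\<^sup>+x. (\<Sum>j=1..m. ennreal \<bar>E (t j) x - L (t j) x\<bar>) \<partial>P) = (\<Sum>j=1..m. \<integral>\<^sup>+x. ennreal \<bar>E (t j) x - L (t j) x\<bar> \<partial>P)"
    using em by (intro nn_integral_sum) measurable
  have "(\<integral>\<^sup>+x. ennreal (D x) \<partial>P) \<le> (\<integral>\<^sup>+x. (2 * (\<Sum>j=1..m. ennreal \<bar>E (t j) x - L (t j) x\<bar>)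
      + (ennreal (2 * c) * ennreal (mean_abs x) + ennreal (c * (F * q / sqrt p)))) \<partial>P)"
  proof (rule nn_integral_mono)
    fix x assume x: "x \<in> space P"
    define S where "S = (\<Sum>j=1..m. \<bar>E (t j) x - L (t j) x\<bar>)"
    have S: "0 \<le> S" unfolding S_def by (intro sum_nonneg) auto
    have "D x \<le> 2 * S + c * (2 * mean_abs x + F * q / sqrt p)"
      unfolding D_def S_def t_def c_def m_def by (intro oracle_gap_pointwise \<delta> refl min x)
    then have "ennreal (D x) \<le> ennreal (2 * S + (2 * c * mean_abs x + c * (F * q / sqrt p)))"
      by (intro ennreal_leI) (simp add: algebra_simps)
    also have "\<dots> = ennreal (2 * S) + (ennreal (2 * c * mean_abs x) + ennreal (c * (F * q / sqrt p)))"
      using mult_nonneg_nonneg[OF c k] mult_nonneg_nonneg[OF c mean_abs_nonneg[of x]] S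
      by (subst ennreal_plus, simp, simp, subst ennreal_plus) auto
    also have "ennreal (2 * S) = 2 * (\<Sum>j=1..m. ennreal \<bar>E (t j) x - L (t j) x\<bar>)"
      using S by (simp add: ennreal_mult sum_ennreal S_def)
    also have "ennreal (2 * c * mean_abs x) = ennreal (2 * c) * ennreal (mean_abs x)"
      using c mean_abs_nonneg[of x] by (intro ennreal_mult) auto
    finally show "ennreal (D x) \<le> 2 * (\<Sum>j=1..m. ennreal \<bar>E (t j) x - L (t j) x\<bar>)
      + (ennreal (2 * c) * ennreal (mean_abs x) + ennreal (c * (F * q / sqrt p)))" .
  qed
  also have "\<dots> = 2 * (\<Sum>j=1..m. \<integral>\<^sup>+x. ennreal \<bar>E (t j) x - L (t j) x\<bar> \<partial>P)
      + (ennreal (2 * c) * (\<integral>\<^sup>+x. ennreal (mean_abs x) \<partial>P) + ennreal (c * (F * q / sqrt p)))"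
    by (simp add: nn_integral_add nn_integral_cmult sums emeasure_space_1 del: sum_ennreal One_nat_def)
  also have "\<dots> \<le> 2 * (\<Sum>j=1..m. ennreal (err_rate p F B g n))
      + (ennreal (2 * c) * ennreal (A + 2 * sqrt F) + ennreal (c * (F * q / sqrt p)))"
  proof (intro add_mono mult_left_mono sum_mono mean_abs_integral order_refl)
    fix j assume "j \<in> {1..m}"
    then have "0 \<le> grid_value \<delta> j" using \<delta> unfolding m_def by (intro grid_value_nonneg)
    then show "(\<integral>\<^sup>+x. ennreal \<bar>E (t j) x - L (t j) x\<bar> \<partial>P) \<le> ennreal (err_rate p F B g n)"
      unfolding t_def using n by (intro ARE_error params_coord) auto
  qed auto
  also have "\<dots> = ennreal (2 * (real m * err_rate p F B g n)) + (ennreal (2 * c * (A + 2 * sqrt F)) + ennreal (c * (F * q / sqrt p)))"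
    using e c A constants_nonneg by (simp add: ennreal_mult ennreal_of_nat_eq_real_of_nat)
  also have "\<dots> = ennreal (gap_rate \<delta>)"
  proof -
    have "0 \<le> 2 * (real m * err_rate p F B g n)" "0 \<le> 2 * c * (A + 2 * sqrt F)" "0 \<le> c * (F * q / sqrt p)"
      using e c A constants_nonneg mult_nonneg_nonneg[OF c k] by simp_all
    then show ?thesis by (simp add: gap_rate_def m_def c_def algebra_simps flip: ennreal_plus)
  qed
  finally have "(\<integral>\<^sup>+x. ennreal (D x) \<partial>P) \<le> ennreal (gap_rate \<delta>)" .
  moreover have "(\<integral>\<^sup>+x. ennreal (D x) \<partial>P) = ennreal (\<integral>x. D x \<partial>P)"
    using Dint Dnn by (intro nn_integral_eq_integral AE_I2)
  ultimately have "ennreal (\<integral>x. D x \<partial>P) \<le> ennreal (gap_rate \<delta>)" by simp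
  moreover have "0 \<le> gap_rate \<delta>"
    unfolding gap_rate_def using e A k constants_nonneg disc_const_nonneg \<delta> by (intro add_nonneg_nonneg mult_nonneg_nonneg) auto
  ultimately show ?thesis by (simp add: D_def)
qed

end

lemma err_rate_nonneg:
  assumes "n \<ge> 3" "p > 0" "F > 0" "B > 0"
  shows "0 \<le> err_rate p F B g n"
proof -
  have n: "0 \<le> ln (real n)" "0 < real n" using assms(1) by (auto intro!: ln_ge_zero)
  have "0 \<le> Mrate n" "0 \<le> bias_rate g n" using n by (simp_all add: Mrate_def bias_rate_def add_nonneg_nonneg)
  then show ?thesis
    unfolding err_rate_def Let_def total_rate_def
    by (intro add_nonneg_nonneg mult_nonneg_nonneg divide_nonneg_nonneg) (use assms n in auto)
qed

section \<open>The joint law of the data\<close>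

lemma distr_data_vec:
  assumes "prob_space M" and n: "n \<ge> 1" and \<sigma>: "\<And>i. i \<in> {1..n} \<Longrightarrow> \<sigma> i > 0"
    and indep: "prob_space.indep_vars M (\<lambda>_. borel) X {1..n}"
    and normal: "\<And>i. i \<in> {1..n} \<Longrightarrow> distributed M lborel (X i) (normal_density (\<theta> i) (\<sigma> i))"
  shows "data_vec n X \<in> measurable M (data_space n)"
    and "distr M (data_space n) (data_vec n X) = gauss_vec n \<theta> \<sigma>"
proof -
  interpret prob_space M by fact
  have X: "X i \<in> borel_measurable M" if "i \<in> {1..n}" for i
    using distributed_measurable[OF normal[OF that]] by simp
  show "data_vec n X \<in> measurable M (data_space n)"
    unfolding data_vec_def[abs_def] data_space_def by (intro measurable_restrict X)
  have d: "distr M borel (X i) = normal_law (\<theta> i) (\<sigma> i)" if "i \<in> {1..n}" for i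
  proof -
    have "distr M borel (X i) = distr M lborel (X i)" by (rule distr_cong) auto
    also have "\<dots> = density lborel (normal_density (\<theta> i) (\<sigma> i))"
      by (rule distributed_distr_eq_density[OF normal[OF that]])
    also have "\<dots> = normal_law (\<theta> i) (\<sigma> i)" unfolding normal_law_def by (rule normal_as_affine[OF \<sigma>[OF that]])
    finally show ?thesis .
  qed
  have "distr M (data_space n) (data_vec n X) = (\<Pi>\<^sub>M i\<in>{1..n}. distr M borel (X i))"
    unfolding data_vec_def[abs_def] data_space_def
    using indep by (subst (asm) indep_vars_iff_distr_eq_PiM') (use n X in auto)
  also have "\<dots> = gauss_vec n \<theta> \<sigma>" unfolding gauss_vec_def by (intro PiM_cong refl d)
  finally show "distr M (data_space n) (data_vec n X) = gauss_vec n \<theta> \<sigma>" .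
qed

section \<open>Passing to the limit\<close>

text \<open>The sequence \<open>c\<close> is the oracle loss, a lower bound for every competitor. A
  bound on the mean of \<open>a - c\<close> thus serves for comparisons with the oracle and with
  arbitrary estimators alike.\<close>

definition regret_bound ::
  "(nat \<Rightarrow> 'a measure) \<Rightarrow> (nat \<Rightarrow> 'a \<Rightarrow> real) \<Rightarrow> (nat \<Rightarrow> 'a \<Rightarrow> real) \<Rightarrow> (nat \<Rightarrow> real) \<Rightarrow> nat \<Rightarrow> bool" where
  "regret_bound M a c r n \<longleftrightarrow> prob_space (M n) \<and> integrable (M n) (a n) \<and> integrable (M n) (c n)
     \<and> (\<forall>\<omega>\<in>space (M n). c n \<omega> \<le> a n \<omega>) \<and> (\<integral>\<omega>. a n \<omega> - c n \<omega> \<partial>M n) \<le> r n"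

lemma regret_expectation:
  assumes ev: "eventually (regret_bound M a c r) sequentially" and r: "r \<longlonglongrightarrow> 0"
  shows "(\<lambda>n. (\<integral>\<omega>. a n \<omega> \<partial>M n) - (\<integral>\<omega>. c n \<omega> \<partial>M n)) \<longlonglongrightarrow> 0"
proof (rule tendsto_sandwich[OF _ _ tendsto_const r])
  show "\<forall>\<^sub>F n in sequentially. 0 \<le> (\<integral>\<omega>. a n \<omega> \<partial>M n) - (\<integral>\<omega>. c n \<omega> \<partial>M n)"
    using ev by eventually_elim (auto simp: regret_bound_def intro!: integral_mono)
  show "\<forall>\<^sub>F n in sequentially. (\<integral>\<omega>. a n \<omega> \<partial>M n) - (\<integral>\<omega>. c n \<omega> \<partial>M n) \<le> r n"
    using ev by eventually_elim (auto simp: regret_bound_def)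
qed

text \<open>Since \<open>c \<le> e\<close>, the event lies in the event that \<open>a - c\<close> is
  at least \<epsilon>, to which Markov's inequality applies.\<close>

lemma regret_probability:
  fixes e :: "nat \<Rightarrow> 'a \<Rightarrow> real"
  assumes ev: "eventually (regret_bound M a c r) sequentially" and r: "r \<longlonglongrightarrow> 0" and "\<epsilon> > 0"
    and ce: "eventually (\<lambda>n. \<forall>\<omega>\<in>space (M n). c n \<omega> \<le> e n \<omega>) sequentially"
  shows "(\<lambda>n. measure (M n) {\<omega> \<in> space (M n). a n \<omega> \<ge> e n \<omega> + \<epsilon>}) \<longlonglongrightarrow> 0"
proof (rule tendsto_sandwich[OF _ _ tendsto_const])
  show "\<forall>\<^sub>F n in sequentially. 0 \<le> measure (M n) {\<omega> \<in> space (M n). a n \<omega> \<ge> e n \<omega> + \<epsilon>}" by simp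
  show "(\<lambda>n. r n / \<epsilon>) \<longlonglongrightarrow> 0" using tendsto_divide[OF r tendsto_const[of \<epsilon>]] \<open>\<epsilon> > 0\<close> by simp
  show "\<forall>\<^sub>F n in sequentially. measure (M n) {\<omega> \<in> space (M n). a n \<omega> \<ge> e n \<omega> + \<epsilon>} \<le> r n / \<epsilon>"
    using ev ce
  proof eventually_elim
    case (elim n)
    interpret prob_space "M n" using elim by (simp add: regret_bound_def)
    have int: "integrable (M n) (\<lambda>\<omega>. a n \<omega> - c n \<omega>)" using elim by (simp add: regret_bound_def)
    have [measurable]: "a n \<in> borel_measurable (M n)" "c n \<in> borel_measurable (M n)" using elim by (auto simp: regret_bound_def)
    have "measure (M n) {\<omega> \<in> space (M n). a n \<omega> \<ge> e n \<omega> + \<epsilon>} \<le> measure (M n) {\<omega> \<in> space (M n). \<epsilon> \<le> a n \<omega> - c n \<omega>}"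
      using elim by (intro finite_measure_mono) (force, measurable)
    also have "\<dots> \<le> (\<integral>\<omega>. a n \<omega> - c n \<omega> \<partial>M n) / \<epsilon>"
      using elim \<open>\<epsilon> > 0\<close> by (intro integral_Markov_inequality_measure[OF int, where A = "{}"]) (auto simp: regret_bound_def)
    also have "\<dots> \<le> r n / \<epsilon>" using elim \<open>\<epsilon> > 0\<close> by (intro divide_right_mono) (auto simp: regret_bound_def)
    finally show ?case .
  qed
qed

lemma regret_limsup:
  fixes e :: "nat \<Rightarrow> 'a \<Rightarrow> real"
  assumes ev: "eventually (regret_bound M a c r) sequentially" and r: "r \<longlonglongrightarrow> 0"
    and ce: "eventually (\<lambda>n. integrable (M n) (e n) \<and> (\<forall>\<omega>\<in>space (M n). c n \<omega> \<le> e n \<omega>)) sequentially"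
  shows "limsup (\<lambda>n. ereal ((\<integral>\<omega>. a n \<omega> \<partial>M n) - (\<integral>\<omega>. e n \<omega> \<partial>M n))) \<le> 0"
proof -
  have "limsup (\<lambda>n. ereal ((\<integral>\<omega>. a n \<omega> \<partial>M n) - (\<integral>\<omega>. e n \<omega> \<partial>M n))) \<le> limsup (\<lambda>n. ereal (r n))"
  proof (rule Limsup_mono, use ev ce in eventually_elim)
    case (elim n)
    have "(\<integral>\<omega>. c n \<omega> \<partial>M n) \<le> (\<integral>\<omega>. e n \<omega> \<partial>M n)" using elim by (intro integral_mono) (auto simp: regret_bound_def)
    then show ?case using elim by (auto simp: regret_bound_def)
  qed
  also have "\<dots> = 0"
    using r by (intro lim_imp_Limsup) (simp_all add: zero_ereal_def)
  finally show ?thesis .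
qed

text \<open>A strict inequality in \<open>ereal\<close> leaves room for a real number in between,
  which bounds all terms at once.\<close>

lemma SUP_ereal_lessE:
  fixes f :: "nat \<Rightarrow> real"
  assumes "(SUP i\<in>{1..}. ereal (f i)) < c"
  obtains u where "ereal u < c" "\<And>i. i \<ge> 1 \<Longrightarrow> f i \<le> u"
proof -
  obtain u where u: "(SUP i\<in>{1..}. ereal (f i)) < ereal u" "ereal u < c" using ereal_dense2[OF assms] by blast
  have "f i \<le> u" if "i \<ge> 1" for i
    using that SUP_upper[of i "{1..}" "\<lambda>i. ereal (f i)"] u(1) by (auto dest: le_less_trans)
  then show ?thesis using u(2) that by blast
qed

lemma INF_ereal_greaterE:
  fixes f :: "nat \<Rightarrow> real"
  assumes "c < (INF i\<in>{1..}. ereal (f i))"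
  obtains l where "c < ereal l" "\<And>i. i \<ge> 1 \<Longrightarrow> l \<le> f i"
proof -
  obtain l where l: "c < ereal l" "ereal l < (INF i\<in>{1..}. ereal (f i))" using ereal_dense2[OF assms] by blast
  have "l \<le> f i" if "i \<ge> 1" for i
    using that INF_lower[of i "{1..}" "\<lambda>i. ereal (f i)"] l(2) by (auto dest: less_le_trans)
  then show ?thesis using l(1) that by blast
qed

text \<open>The number of grid points is absorbed by the factor \<open>ln n\<close> in
  \<open>err_rate_lim\<close>; the discretization term vanishes with the step.\<close>

lemma gap_rate_lim:
  assumes C: "C1 > 0" "C2 > 0" "C3 > 0" "C4 > 0" and pos: "p > 0" "F > 0" "B > 0" "g > 0"
  shows "(\<lambda>n. 2 * (real (grid_points (grid_step C1 C2 C3 C4 n)) * err_rate p F B g n)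
    + disc_const p F B * grid_step C1 C2 C3 C4 n * k) \<longlonglongrightarrow> 0"
proof -
  note step = grid_step_asymptotics[OF C]
  have "(\<lambda>n. real (grid_points (grid_step C1 C2 C3 C4 n)) * err_rate p F B g n) \<longlonglongrightarrow> 0"
  proof (rule tendsto_sandwich[OF _ _ tendsto_const err_rate_lim[OF pos]])
    show "\<forall>\<^sub>F n in sequentially. 0 \<le> real (grid_points (grid_step C1 C2 C3 C4 n)) * err_rate p F B g n"
      using eventually_ge_at_top[of 3] by eventually_elim (use pos in \<open>intro mult_nonneg_nonneg err_rate_nonneg; simp\<close>)
    show "\<forall>\<^sub>F n in sequentially. real (grid_points (grid_step C1 C2 C3 C4 n)) * err_rate p F B g n \<le> ln (real n) * err_rate p F B g n"
      using eventually_ge_at_top[of 3] step(3) by eventually_elim (use pos in \<open>intro mult_right_mono err_rate_nonneg; simp\<close>)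
  qed
  from tendsto_add[OF tendsto_mult_left[OF this, of 2] tendsto_mult_right[OF tendsto_mult_left[OF step(2), of "disc_const p F B"], of k]]
  show ?thesis by simp
qed

section \<open>The limits of regret in probability and in mean\<close>

theorem theorem1p9:
  fixes \<theta> \<nu>p \<nu>f b h \<gamma> :: "nat \<Rightarrow> real"
    and C1 C2 C3 C4 :: real
    and M :: "nat \<Rightarrow> 'a measure"
    and X :: "nat \<Rightarrow> nat \<Rightarrow> 'a \<Rightarrow> real"
    and \<tau>_ARE \<tau>_GOR :: "nat \<Rightarrow> (nat \<Rightarrow> real) \<Rightarrow> ennreal"
  assumes pos: "\<And>i. i \<ge> 1 \<Longrightarrow> \<nu>p i > 0 \<and> \<nu>f i > 0 \<and> b i > 0 \<and> h i > 0"
    and A1: "assm_A1 b h"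
    and A2: "assm_A2 \<theta>"
    and A3: "assm_A3 \<nu>p \<nu>f"
    and gamma: "\<And>i. i \<ge> 1 \<Longrightarrow> 0 < \<gamma> i \<and> \<gamma> i < 1 / sqrt (4 * exp 1) - sqrt (\<nu>p i / \<nu>f i)"
    and gamma_inf: "0 < (INF i\<in>{1..}. ereal (\<gamma> i))"
    and constants: "grid_constants \<nu>p \<nu>f b h \<theta> C1 C2 C3 C4"
    and prob: "\<And>n. n \<ge> 3 \<Longrightarrow> prob_space (M n)"
    and indep: "\<And>n. n \<ge> 3 \<Longrightarrow> prob_space.indep_vars (M n) (\<lambda>_. borel) (X n) {1..n}"
    and normal: "\<And>n i. n \<ge> 3 \<Longrightarrow> i \<in> {1..n} \<Longrightarrow>
      distributed (M n) lborel (X n i) (normal_density (\<theta> i) (sqrt (\<nu>p i)))"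
    and ARE_meas: "\<And>n. n \<ge> 3 \<Longrightarrow> \<tau>_ARE n \<in> borel_measurable (data_space n)"
    and ARE_min: "\<And>n x. n \<ge> 3 \<Longrightarrow> x \<in> space (data_space n) \<Longrightarrow>
      is_arg_min (\<lambda>\<tau>. ARE \<nu>p \<nu>f b h \<gamma> n \<tau> x) (\<lambda>\<tau>. \<tau> \<in> grid C1 C2 C3 C4 n) (\<tau>_ARE n x)"
    and GOR_meas: "\<And>n. n \<ge> 3 \<Longrightarrow> \<tau>_GOR n \<in> borel_measurable (data_space n)"
    and GOR_min: "\<And>n x. n \<ge> 3 \<Longrightarrow> x \<in> space (data_space n) \<Longrightarrow>
      is_arg_min (\<lambda>\<tau>. loss \<nu>f b h n \<theta> (predictor \<nu>p \<nu>f b h n \<tau> x)) (\<lambda>\<tau>. \<tau> \<in> {0..\<infinity>}) (\<tau>_GOR n x)"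
  shows
    "(\<forall>\<epsilon>>0. (\<lambda>n. measure (M n) {\<omega> \<in> space (M n).
        let x = data_vec n (X n) \<omega> in
          loss \<nu>f b h n \<theta> (predictor \<nu>p \<nu>f b h n (\<tau>_ARE n x) x)
            \<ge> loss \<nu>f b h n \<theta> (predictor \<nu>p \<nu>f b h n (\<tau>_GOR n x) x) + \<epsilon>})
        \<longlonglongrightarrow> 0)
     \<and> (\<lambda>n. risk (M n) (X n) \<nu>f b h n \<theta> (\<lambda>x. predictor \<nu>p \<nu>f b h n (\<tau>_ARE n x) x)
          - (\<integral>\<omega>. (let x = data_vec n (X n) \<omega> in
               loss \<nu>f b h n \<theta> (predictor \<nu>p \<nu>f b h n (\<tau>_GOR n x) x)) \<partial>M n))
        \<longlonglongrightarrow> 0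
     \<and> (\<forall>\<tau>_hat :: nat \<Rightarrow> (nat \<Rightarrow> real) \<Rightarrow> ennreal.
          (\<forall>n\<ge>3. \<tau>_hat n \<in> borel_measurable (data_space n)) \<longrightarrow>
            (\<forall>\<epsilon>>0. (\<lambda>n. measure (M n) {\<omega> \<in> space (M n).
              let x = data_vec n (X n) \<omega> in
                loss \<nu>f b h n \<theta> (predictor \<nu>p \<nu>f b h n (\<tau>_ARE n x) x)
                  \<ge> loss \<nu>f b h n \<theta> (predictor \<nu>p \<nu>f b h n (\<tau>_hat n x) x) + \<epsilon>})
              \<longlonglongrightarrow> 0)
            \<and> limsup (\<lambda>n. ereal (
                risk (M n) (X n) \<nu>f b h n \<theta> (\<lambda>x. predictor \<nu>p \<nu>f b h n (\<tau>_ARE n x) x)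
                - risk (M n) (X n) \<nu>f b h n \<theta> (\<lambda>x. predictor \<nu>p \<nu>f b h n (\<tau>_hat n x) x))) \<le> 0)"
proof -
  define La where "La n \<omega> = loss \<nu>f b h n \<theta> (predictor \<nu>p \<nu>f b h n (\<tau>_ARE n (data_vec n (X n) \<omega>)) (data_vec n (X n) \<omega>))" for n \<omega>
  define Lg where "Lg n \<omega> = loss \<nu>f b h n \<theta> (predictor \<nu>p \<nu>f b h n (\<tau>_GOR n (data_vec n (X n) \<omega>)) (data_vec n (X n) \<omega>))" for n \<omega>
  have a1: "0 < (INF i\<in>{1..}. ereal (btilde (b i) (h i)))" "(SUP i\<in>{1..}. ereal (btilde (b i) (h i))) < 1"
      "(SUP i\<in>{1..}. ereal (b i + h i)) < \<infinity>"
    and a3: "(SUP i\<in>{1..}. ereal (\<nu>f i)) < \<infinity>" "0 < (INF i\<in>{1..}. ereal (\<nu>p i))"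
    using A1 A3 by (simp_all only: assm_A1_def assm_A3_def)
  obtain l where l: "0 < l" "\<And>i. i \<ge> 1 \<Longrightarrow> l \<le> btilde (b i) (h i)"
    using INF_ereal_greaterE[OF a1(1)] by (auto simp: zero_ereal_def)
  obtain u where u: "u < 1" "\<And>i. i \<ge> 1 \<Longrightarrow> btilde (b i) (h i) \<le> u"
    using SUP_ereal_lessE[OF a1(2)] by (auto simp: one_ereal_def)
  obtain B where B: "\<And>i. i \<ge> 1 \<Longrightarrow> b i + h i \<le> B"
    using SUP_ereal_lessE[OF a1(3)] by auto
  obtain q where q: "\<And>\<beta>. l \<le> \<beta> \<Longrightarrow> \<beta> \<le> u \<Longrightarrow> \<bar>std_normal_quantile \<beta>\<bar> \<le> q"
    using std_normal_quantile_bounded[OF l(1) u(1)] by blast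
  obtain F where F: "\<And>i. i \<ge> 1 \<Longrightarrow> \<nu>f i \<le> F"
    using SUP_ereal_lessE[OF a3(1)] by auto
  obtain p0 where p0: "0 < p0" "\<And>i. i \<ge> 1 \<Longrightarrow> p0 \<le> \<nu>p i"
    using INF_ereal_greaterE[OF a3(2)] by (auto simp: zero_ereal_def)
  obtain g where g: "0 < g" "\<And>i. i \<ge> 1 \<Longrightarrow> g \<le> \<gamma> i"
    using INF_ereal_greaterE[OF gamma_inf] by (auto simp: zero_ereal_def)
  obtain A0 where A0: "limsup (\<lambda>n. ereal ((\<Sum>i=1..n. \<bar>\<theta> i\<bar>) / real n)) < ereal A0"
    using A2 ereal_dense2 unfolding assm_A2_def by blast
  \<comment> \<open>Capped at \<open>1\<close>, because on the scale of \<open>u\<close> the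
    denominators interpolate between \<open>1\<close> and \<open>\<nu>p i\<close>.\<close>
  define p where "p = min 1 p0"
  \<comment> \<open>The maximum supplies the condition \<open>0 \<le> A\<close> of
    \<open>oracle_gap\<close> directly.\<close>
  define A where "A = max 0 A0"
  have C: "C1 > 0" "C2 > 0" "C3 > 0" "C4 > 0" using constants by (auto simp: grid_constants_def)
  have pp: "0 < p" "p \<le> 1" using p0 by (auto simp: p_def)
  have FB: "0 < F" "0 < B" using F[of 1] pos[of 1] B[of 1] by auto
  \<comment> \<open>Positivity of \<gamma> together with its upper bound forces
    \<open>sqrt (\<nu>p i / \<nu>f i) < 1\<close>.\<close>
  have \<nu>: "\<nu>p i \<le> \<nu>f i" if i: "i \<ge> 1" for i
  proof -
    have "1 < sqrt (4 * exp (1::real))" using exp_ge_add_one_self[of "1::real"] by (intro real_less_rsqrt) simp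
    then have "1 / sqrt (4 * exp (1::real)) < 1" by simp
    then have "sqrt (\<nu>p i / \<nu>f i) < 1" using gamma[OF i] by linarith
    then show ?thesis using pos[OF i] by (simp add: divide_simps)
  qed
  let ?\<delta> = "grid_step C1 C2 C3 C4"
  define r where "r n = 2 * (real (grid_points (?\<delta> n)) * err_rate p F B g n)
    + disc_const p F B * ?\<delta> n * (2 * (A + 2 * sqrt F) + F * q / sqrt p)" for n
  have r: "r \<longlonglongrightarrow> 0" unfolding r_def by (intro gap_rate_lim C pp FB g)
  have good: "eventually (\<lambda>n. n \<ge> 3 \<and> ?\<delta> n > 0 \<and> shrinkage_model \<theta> \<nu>p \<nu>f b h \<gamma> p F B g q A n) sequentially"
    using eventually_ge_at_top[of 3] grid_step_asymptotics(1)[OF C] Limsup_lessD[OF A0]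
  proof eventually_elim
    case (elim n)
    have "shrinkage_model \<theta> \<nu>p \<nu>f b h \<gamma> p F B g q A n"
    proof
      fix i assume "i \<in> {1..n}"
      then have i: "i \<ge> 1" by simp
      show "p \<le> \<nu>p i \<and> \<nu>p i \<le> \<nu>f i \<and> \<nu>f i \<le> F" using p0(2)[OF i] \<nu>[OF i] F[OF i] by (simp add: p_def)
      show "0 < b i \<and> 0 < h i \<and> b i + h i \<le> B" using pos[OF i] B[OF i] by simp
      show "\<bar>std_normal_quantile (btilde (b i) (h i))\<bar> \<le> q" using q l(2)[OF i] u(2)[OF i] by simp
      show "g \<le> \<gamma> i \<and> \<gamma> i + sqrt (\<nu>p i / \<nu>f i) < 1 / sqrt (4 * exp 1)" using g(2)[OF i] gamma[OF i] by simp
    qed (use elim pp g in \<open>auto simp: A_def\<close>)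
    then show ?case using elim by simp
  qed
  have law: "data_vec n (X n) \<in> measurable (M n) (data_space n)"
    "distr (M n) (data_space n) (data_vec n (X n)) = gauss_vec n \<theta> (\<lambda>i. sqrt (\<nu>p i))" if n: "n \<ge> 3" for n
  proof -
    have \<sigma>: "sqrt (\<nu>p i) > 0" if "i \<in> {1..n}" for i using that pos by simp
    have "1 \<le> n" using n by simp
    note data = distr_data_vec[OF prob[OF n] this \<sigma> indep[OF n] normal[OF n]]
    show "data_vec n (X n) \<in> measurable (M n) (data_space n)" by (rule data(1))
    show "distr (M n) (data_space n) (data_vec n (X n)) = gauss_vec n \<theta> (\<lambda>i. sqrt (\<nu>p i))" by (rule data(2))
  qed
  have loss_int: "integrable (M n) (\<lambda>\<omega>. loss \<nu>f b h n \<theta> (predictor \<nu>p \<nu>f b h n (\<tau> (data_vec n (X n) \<omega>)) (data_vec n (X n) \<omega>)))"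
    if n: "n \<ge> 3" and model: "shrinkage_model \<theta> \<nu>p \<nu>f b h \<gamma> p F B g q A n" and \<tau>: "\<tau> \<in> borel_measurable (data_space n)" for n \<tau>
  proof -
    interpret shrinkage_model \<theta> \<nu>p \<nu>f b h \<gamma> p F B g q A n by fact
    have \<tau>': "\<tau> \<in> borel_measurable P" using \<tau> by (simp cong: measurable_cong_sets[OF sets_P refl])
    have "integrable (distr (M n) (data_space n) (data_vec n (X n))) (\<lambda>x. L (\<tau> x) x)"
      unfolding law(2)[OF n] by (rule L_integrable[OF \<tau>'])
    then show ?thesis by (rule integrable_distr[OF law(1)[OF n]])
  qed
  \<comment> \<open>The oracle minimizes for each data vector separately, so it also beats every
    data-dependent choice.\<close>
  have GOR_le: "Lg n \<omega> \<le> loss \<nu>f b h n \<theta> (predictor \<nu>p \<nu>f b h n (\<tau> (data_vec n (X n) \<omega>)) (data_vec n (X n) \<omega>))"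
    if n: "n \<ge> 3" and \<omega>: "\<omega> \<in> space (M n)" for n \<omega> \<tau>
    using GOR_min[OF n measurable_space[OF law(1)[OF n] \<omega>]] by (auto simp: is_arg_min_def Lg_def not_less)
  have bound: "eventually (regret_bound M La Lg r) sequentially"
    using good
  proof eventually_elim
    case (elim n)
    then have n: "n \<ge> 3" and model: "shrinkage_model \<theta> \<nu>p \<nu>f b h \<gamma> p F B g q A n" by auto
    interpret shrinkage_model \<theta> \<nu>p \<nu>f b h \<gamma> p F B g q A n by fact
    let ?D = "distr (M n) (data_space n) (data_vec n (X n))"
    have m: "\<tau>_ARE n \<in> borel_measurable P" "\<tau>_GOR n \<in> borel_measurable P"
      using ARE_meas[OF n] GOR_meas[OF n] by (simp_all cong: measurable_cong_sets[OF sets_P refl])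
    have s: "x \<in> space P \<longleftrightarrow> x \<in> space (data_space n)" for x using sets_eq_imp_space_eq[OF sets_P] by simp
    have "(\<integral>\<omega>. La n \<omega> - Lg n \<omega> \<partial>M n) = (\<integral>x. L (\<tau>_ARE n x) x - L (\<tau>_GOR n x) x \<partial>?D)"
      unfolding La_def Lg_def
    proof (rule integral_distr[OF law(1)[OF n], symmetric])
      show "(\<lambda>x. L (\<tau>_ARE n x) x - L (\<tau>_GOR n x) x) \<in> borel_measurable (data_space n)"
        using borel_measurable_diff[OF L_measurable[OF m(1)] L_measurable[OF m(2)]]
        by (simp cong: measurable_cong_sets[OF sets_P refl])
    qed
    also have "\<dots> \<le> gap_rate (?\<delta> n)"
      unfolding law(2)[OF n]
    proof (rule oracle_gap[OF _ _ _ m])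
      show "?\<delta> n > 0" using elim by simp
      show "0 \<le> err_rate p F B g n" using n pp FB by (intro err_rate_nonneg)
      show "0 \<le> A" by (simp add: A_def)
      fix x assume x: "x \<in> space P"
      show "is_arg_min (\<lambda>\<tau>. E \<tau> x) (\<lambda>\<tau>. \<tau> \<in> (\<lambda>j. ennreal (grid_value (?\<delta> n) j)) ` {1..grid_points (?\<delta> n)}) (\<tau>_ARE n x)"
        using ARE_min[OF n] x grid_eq[of C1 C2 C3 C4 n] elim by (simp add: s)
      show "L (\<tau>_GOR n x) x \<le> L (\<tau>_ARE n x) x"
        using GOR_min[OF n] x by (auto simp: s is_arg_min_def not_less)
    qed
    also have "gap_rate (?\<delta> n) = r n" by (simp add: gap_rate_def r_def)
    finally show ?case
      unfolding regret_bound_def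
      using loss_int[OF n model] ARE_meas[OF n] GOR_meas[OF n] prob[OF n] GOR_le[OF n, of _ "\<tau>_ARE n"]
      by (auto simp: La_def[abs_def] Lg_def[abs_def])
  qed
  have hat: "(\<forall>\<epsilon>>0. (\<lambda>n. measure (M n) {\<omega> \<in> space (M n). La n \<omega> \<ge>
          loss \<nu>f b h n \<theta> (predictor \<nu>p \<nu>f b h n (\<tau> n (data_vec n (X n) \<omega>)) (data_vec n (X n) \<omega>)) + \<epsilon>}) \<longlonglongrightarrow> 0)
      \<and> limsup (\<lambda>n. ereal ((\<integral>\<omega>. La n \<omega> \<partial>M n)
          - (\<integral>\<omega>. loss \<nu>f b h n \<theta> (predictor \<nu>p \<nu>f b h n (\<tau> n (data_vec n (X n) \<omega>)) (data_vec n (X n) \<omega>)) \<partial>M n))) \<le> 0"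
    if \<tau>: "\<forall>n\<ge>3. \<tau> n \<in> borel_measurable (data_space n)" for \<tau> :: "nat \<Rightarrow> (nat \<Rightarrow> real) \<Rightarrow> ennreal"
  proof (intro conjI allI impI)
    have e: "eventually (\<lambda>n. integrable (M n) (\<lambda>\<omega>. loss \<nu>f b h n \<theta> (predictor \<nu>p \<nu>f b h n (\<tau> n (data_vec n (X n) \<omega>)) (data_vec n (X n) \<omega>)))
        \<and> (\<forall>\<omega>\<in>space (M n). Lg n \<omega> \<le> loss \<nu>f b h n \<theta> (predictor \<nu>p \<nu>f b h n (\<tau> n (data_vec n (X n) \<omega>)) (data_vec n (X n) \<omega>)))) sequentially"
      using good by eventually_elim (use loss_int GOR_le \<tau> in blast)
    show "limsup (\<lambda>n. ereal ((\<integral>\<omega>. La n \<omega> \<partial>M n)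
          - (\<integral>\<omega>. loss \<nu>f b h n \<theta> (predictor \<nu>p \<nu>f b h n (\<tau> n (data_vec n (X n) \<omega>)) (data_vec n (X n) \<omega>)) \<partial>M n))) \<le> 0"
      by (rule regret_limsup[OF bound r e])
    fix \<epsilon> :: real assume \<epsilon>: "\<epsilon> > 0"
    show "(\<lambda>n. measure (M n) {\<omega> \<in> space (M n). La n \<omega> \<ge>
          loss \<nu>f b h n \<theta> (predictor \<nu>p \<nu>f b h n (\<tau> n (data_vec n (X n) \<omega>)) (data_vec n (X n) \<omega>)) + \<epsilon>}) \<longlonglongrightarrow> 0"
      by (rule regret_probability[OF bound r \<epsilon>]) (use e in \<open>auto elim: eventually_mono\<close>)
  qed
  \<comment> \<open>The oracle is itself an admissible competitor, so the comparison with it is an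
    instance of \<open>hat\<close>.\<close>
  have I: "\<forall>\<epsilon>>0. (\<lambda>n. measure (M n) {\<omega> \<in> space (M n). La n \<omega> \<ge> Lg n \<omega> + \<epsilon>}) \<longlonglongrightarrow> 0"
    using hat[of \<tau>_GOR] GOR_meas by (simp add: Lg_def)
  show ?thesis
    using I regret_expectation[OF bound r] hat unfolding risk_def Let_def La_def Lg_def by blast
qed

end
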